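(* Let $\tau$ be a bi-infinite linear trajectory on $S_O$ in direction $\theta$ whose cutting sequence $w=c(\tau)$ is non-periodic. Let $s_0,s_1,\dots$ be the normalized cutting sequence $\bar c(r_\theta)$, and for $k\ge1$ put $\nu(k)=\nu_{s_0}^{-1}\gamma\,\nu_{s_1}^{-1}\gamma\cdots\nu_{s_{k-1}}^{-1}\gamma$, and let $\Psi_{\nu(k)}:S_O\to S_O$ be the affine automorphism with derivative $\nu(k)$. Let $w_k$ be the $k$-th sequence produced from $w$ by the combinatorial renormalization ($w_0=w$, $w_{j+1}=n(w_j)'$). Then $w_k$ is the cutting sequence of the same trajectory $\tau$ with respect to the sides of the affine octagon $\Psi_{\nu(k)}O$, with the labeling induced by $\Psi_{\nu(k)}$.
   Context: Octagon surface. $O\subset\mathbb{R}^2$ is a regular octagon with two horizontal sides, and $S_O$ is the translation surface obtained by gluing opposite parallel sides of $O$ by translations; it has one singular point (the image of the vertices). Each pair of opposite sides gets one letter of $\{A,B,C,D\}$: $A$ for the horizontal sides and then $B,C,D$ for the successive sides met going clockwise around $O$ from the top side. A linear trajectory in direction $\theta$ is a straight line path in $S_O$ making angle $\theta$ with the horizontal; bi-infinite means it never hits the singular point. Its cutting sequence $c(\tau)\in\{A,B,C,D\}^{\mathbb{Z}}$ is the sequence of labels of the sides of $O$ it crosses. Directions are considered in $\mathbb{RP}^1$, $\theta\in[0,\pi)$. Combinatorial renormalization. $\overline\Sigma_j$ is the sector of directions with angle in $[j\pi/8,(j+1)\pi/8]$, $0\le j\le7$. The diagram $\mathscr{D}_j$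 is the directed graph on $\{A,B,C,D\}$ whose edges are the ordered pairs of consecutive letters that can occur in cutting sequences of trajectories with direction in $\overline\Sigma_j$. A word is admissible in diagram $j$ if all its pairs of consecutive letters are edges of $\mathscr{D}_j$. Permutations of the letters: $\pi_0=\mathrm{Id}$, $\pi_1=(AD)(BC)$, $\pi_2=(ABCD)$, $\pi_3=(AC)$, $\pi_4=(AC)(BD)$, $\pi_5=(AB)(CD)$, $\pi_6=(ADCB)$, $\pi_7=(BD)$; $\pi\cdot w$ is the word obtained by applying $\pi$ to each letter of $w$. If $w$ is admissible in a unique diagram $\mathscr{D}_j$, its normal form is $n(w)=\pi_j\cdot w$. A letter is sandwiched if preceded and followed by the same letter; the derived sequence $w'$ keeps only the sandwiched letters of $w$. For a non-periodic cutting sequence $w$ the recursion $w_0=w$, $w_{j+1}=n(w_j)'$ is well defined for all $j$ (each $w_j$ is admissible in a unique diagram). Affine automorphisms. An affine automorphism of $S_O$ is a homeomorphism of $S_O$ preserving the singular set, which is a diffeomorphism with constant derivative (in $GL(2,\mathbb{R})$, determinant $\pm1$) off the singular set; orientation-reversing maps are allowed. The Veech group $V(S_O)$ is the group of derivatives, and an affine automorphism is uniquely determined by its derivative. The following matrices lie in $V(S_O)$: $$\gamma=\begin{pmatrix}-1&2(1+\sqrt2)\\0&1\end{pmatrix},\quad \nu_0=\begin{pmatrix}1&0\\0&1\end{pmatrix},\ \nu_1=\tfrac1{\sqrt2}\begin{pmatrix}1&1\\1&-1\end{pmatrix},\ \nu_2=\tfrac1{\sqrt2}\begin{pmatrix}1&1\\-1&1\end{pmatrix},\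 \nu_3=\begin{pmatrix}0&1\\1&0\end{pmatrix},$$ $$\nu_4=\begin{pmatrix}0&1\\-1&0\end{pmatrix},\ \nu_5=\tfrac1{\sqrt2}\begin{pmatrix}-1&1\\1&1\end{pmatrix},\ \nu_6=\tfrac1{\sqrt2}\begin{pmatrix}-1&1\\-1&-1\end{pmatrix},\ \nu_7=\begin{pmatrix}-1&0\\0&1\end{pmatrix}.$$ Induced labeling. $\Psi_\nu O\subset S_O$ is the image of $O\subset S_O$; the image under $\Psi_\nu$ of a side of $O$ labeled $L$ is labeled $L$. The cutting sequence of $\tau$ with respect to the sides of $\Psi_\nu O$ is the sequence of labels of the sides of $\Psi_\nu O$ crossed by $\tau$. Hyperbolic side. The Teichmüller disk of $S_O$ is identified with the upper half-plane $\mathbb{H}$. A matrix $\nu=\begin{pmatrix}a&b\\c&d\end{pmatrix}$ of determinant $\pm1$ acts on the right on $\mathbb{H}$ by $z\nu=\frac{az+c}{bz+d}$ if $\det\nu=1$, and $z\nu=\frac{a\bar z+c}{b\bar z+d}$ if $\det\nu=-1$. $V_P\subset PGL(2,\mathbb{R})$ is the image of $V(S_O)$; it is generated by $\alpha=\begin{pmatrix}1&0\\0&-1\end{pmatrix}$, $\beta=\nu_1$ and $\gamma$, i.e. by reflections in the sides of the hyperbolic triangle with vertices $\sqrt{-1},0,1-\sqrt2$, which is a strict fundamental domain. $E_0$ is the geodesic with endpoints $0$ and $1-\sqrt2$, $E_i=E_0\nu_i$, $\mathscr{O}$ is the ideal octagon containing $\sqrt{-1}$ bounded by $E_0,\dots,E_7$;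 its images under $V_P$ are the tiles of the ideal octagon tessellation. $r_\theta$ is the geodesic ray from $\sqrt{-1}$ to $-\tan\theta\in\partial\mathbb{H}$. Its normalized cutting sequence $\bar c(r_\theta)$ is: $\bar c(r_\theta)_0=k\in\{0,\dots,7\}$ if $r_\theta$ leaves $\mathscr{O}$ through $E_k$; for $l\ge1$, if $\mathscr{O}'$ is the $l$-th tile entered by $r_\theta$ after leaving $\mathscr{O}$, with entering side $E'$ and exiting side $E''$, and $\nu'\in V_P$ is the unique element whose right action sends $\mathscr{O}'$ to $\mathscr{O}$ and $E'$ to $E_0$, then $\bar c(r_\theta)_l$ is the $k\in\{1,\dots,7\}$ with $E''\nu'=E_k$. (When $c(\tau)$ is non-periodic, $\bar c(r_\theta)$ is infinite.) *)

theory Defs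
  imports "HOL-Analysis.Analysis" "HOL-Combinatorics.Cycles"
begin

section \<open>The octagon surface\<close>

datatype letter = A | B | C | D

definition mat2 :: "real \<Rightarrow> real \<Rightarrow> real \<Rightarrow> real \<Rightarrow> real^2^2" where
  "mat2 a b c d = vector [vector [a, b], vector [c, d]]"

text \<open>The octagon has centre 0 and circumradius 1.  Vertices and sides are numbered clockwise with
  period 8: side 0 is the top side, and side \<open>i\<close> has outer normal at angle \<open>\<pi>/2 - i\<pi>/4\<close>.\<close>

definition oct_vertex :: "nat \<Rightarrow> real^2" where
  "oct_vertex i = vector [cos (5 * pi / 8 - real i * pi / 4), sin (5 * pi / 8 - real i * pi / 4)]"

definition octagon :: "(real^2) set" where
  "octagon = convex hull (range oct_vertex)"

definition oct_side :: "nat \<Rightarrow> (real^2) set" where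
  "oct_side i = closed_segment (oct_vertex i) (oct_vertex (Suc i))"

definition oct_label :: "nat \<Rightarrow> letter" where
  "oct_label i = [A, B, C, D] ! (i mod 4)"

text \<open>The translation taking side \<open>i\<close> to the opposite side \<open>i + 4\<close>; it sends the vertices
  \<open>i\<close> and \<open>i + 1\<close> to the vertices \<open>i + 5\<close> and \<open>i + 4\<close>.\<close>

definition glue_vec :: "nat \<Rightarrow> real^2" where
  "glue_vec i = oct_vertex (i + 5) - oct_vertex i"

definition glue_step :: "((real^2) \<times> (real^2)) set" where
  "glue_step = {(p, p + glue_vec i) | p i. p \<in> oct_side i}"

definition glue :: "((real^2) \<times> (real^2)) set" where
  "glue = glue_step\<^sup>* \<inter> (octagon \<times> octagon)"

type_synonym surface_point = "(real^2) set"

definition octagon_surface :: "surface_point set" where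
  "octagon_surface = octagon // glue"

text \<open>The quotient topology; the preimage of a set \<open>U\<close> of classes in the octagon is \<open>\<Union>U\<close>.\<close>

definition surface_topology :: "surface_point topology" where
  "surface_topology =
     topology (\<lambda>U. U \<subseteq> octagon_surface \<and> openin (top_of_set octagon) (\<Union>U))"

definition singular_point :: surface_point where
  "singular_point = glue `` {oct_vertex 0}"

definition surface_side :: "letter \<Rightarrow> surface_point set" where
  "surface_side L = {x \<in> octagon_surface. \<exists>i. oct_label i = L \<and> x \<inter> oct_side i \<noteq> {}}"

text \<open>The translation structure.  For \<open>x\<close> off the singular point and \<open>v\<close> near 0 this set is again
  a gluing class (a point on a side is represented both by \<open>p\<close> and by its translate \<open>p'\<close> on the
  opposite side, and those of \<open>p + v\<close>, \<open>p' + v\<close> that lie in the octagon form one class), and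
  \<open>v \<mapsto> surface_plus x v\<close> is the inverse of a translation chart around \<open>x\<close>.  It is only used
  for \<open>v\<close> near 0.\<close>

definition surface_plus :: "surface_point \<Rightarrow> real^2 \<Rightarrow> surface_point" where
  "surface_plus x v = (\<lambda>p. p + v) ` x \<inter> octagon"


section \<open>Trajectories and cutting sequences\<close>

text \<open>Bi-infinite trajectories are parametrised by \<open>\<real>\<close> with constant non-zero velocity; \<open>c\<close> may be
  negative because directions live in \<open>\<real>P\<^sup>1\<close>.\<close>

definition linear_trajectory :: "real \<Rightarrow> (real \<Rightarrow> surface_point) \<Rightarrow> bool" where
  "linear_trajectory \<theta> \<tau> \<longleftrightarrow>
     (\<forall>t. \<tau> t \<in> octagon_surface - {singular_point}) \<and>
     (\<exists>c. c \<noteq> 0 \<and> (\<forall>t. \<forall>\<^sub>F h in nhds 0.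
        \<tau> (t + h) = surface_plus (\<tau> t) ((c * h) *\<^sub>R vector [cos \<theta>, sin \<theta>])))"

text \<open>\<open>w\<close> is the cutting sequence of \<open>\<tau>\<close> with respect to the sides of the image of the octagon under
  \<open>\<Psi>\<close>, labelled through \<open>\<Psi>\<close>: \<open>t\<close> enumerates the crossing times in increasing order.  The indexing
  of \<open>w\<close> by \<open>\<int>\<close> is determined up to a shift, so the predicate is invariant under shifts of \<open>w\<close>.
  A bi-infinite trajectory cannot run along a side, as the ends of sides are singular.\<close>

definition cutting_sequence ::
  "(surface_point \<Rightarrow> surface_point) \<Rightarrow> (real \<Rightarrow> surface_point) \<Rightarrow> (int \<Rightarrow> letter) \<Rightarrow> bool" where
  "cutting_sequence \<Psi> \<tau> w \<longleftrightarrow>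
     (\<exists>t :: int \<Rightarrow> real. strict_mono t \<and>
        range t = {u. \<exists>L. \<tau> u \<in> \<Psi> ` surface_side L} \<and>
        (\<forall>i. \<tau> (t i) \<in> \<Psi> ` surface_side (w i)))"

definition periodic_word :: "(int \<Rightarrow> 'a) \<Rightarrow> bool" where
  "periodic_word w \<longleftrightarrow> (\<exists>p>0. \<forall>i. w (i + p) = w i)"


section \<open>Combinatorial renormalization\<close>

definition sector :: "nat \<Rightarrow> real set" where
  "sector j = {real j * pi / 8 .. real (j + 1) * pi / 8}"

definition diagram :: "nat \<Rightarrow> (letter \<times> letter) set" where
  "diagram j = {(w i, w (i + 1)) | w i. \<exists>\<theta>\<in>sector j. \<exists>\<tau>.
     linear_trajectory \<theta> \<tau> \<and> cutting_sequence id \<tau> w}"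

definition admissible :: "nat \<Rightarrow> (int \<Rightarrow> letter) \<Rightarrow> bool" where
  "admissible j w \<longleftrightarrow> (\<forall>i. (w i, w (i + 1)) \<in> diagram j)"

definition letter_perm :: "nat \<Rightarrow> letter \<Rightarrow> letter" where
  "letter_perm j =
     [id,
      cycle_of_list [A, D] \<circ> cycle_of_list [B, C],
      cycle_of_list [A, B, C, D],
      cycle_of_list [A, C],
      cycle_of_list [A, C] \<circ> cycle_of_list [B, D],
      cycle_of_list [A, B] \<circ> cycle_of_list [C, D],
      cycle_of_list [A, D, C, B],
      cycle_of_list [B, D]] ! j"

definition normal_form :: "(int \<Rightarrow> letter) \<Rightarrow> int \<Rightarrow> letter" where
  "normal_form w = letter_perm (THE j. j < 8 \<and> admissible j w) \<circ> w"

definition sandwiched :: "(int \<Rightarrow> 'a) \<Rightarrow> int \<Rightarrow> bool" where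
  "sandwiched w i \<longleftrightarrow> w (i - 1) = w (i + 1)"

text \<open>The increasing enumeration of the sandwiched positions by \<open>\<int>\<close> (when it exists) is unique up
  to a shift, so the derived sequence is well defined as a bi-infinite word up to shift.\<close>

definition derived :: "(int \<Rightarrow> 'a) \<Rightarrow> int \<Rightarrow> 'a" where
  "derived w = w \<circ> (SOME e :: int \<Rightarrow> int. strict_mono e \<and> range e = {i. sandwiched w i})"

fun renormalized :: "nat \<Rightarrow> (int \<Rightarrow> letter) \<Rightarrow> int \<Rightarrow> letter" where
  "renormalized 0 w = w"
| "renormalized (Suc k) w = derived (normal_form (renormalized k w))"


section \<open>Affine automorphisms and the Veech group\<close>

text \<open>\<open>F\<close> is the expression of \<open>\<Psi>\<close> in the translation charts centred at \<open>x\<close> and \<open>\<Psi> x\<close>.  Values of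
  \<open>\<Psi>\<close> off the surface are irrelevant.\<close>

definition affine_automorphism :: "(surface_point \<Rightarrow> surface_point) \<Rightarrow> real^2^2 \<Rightarrow> bool" where
  "affine_automorphism \<Psi> M \<longleftrightarrow>
     homeomorphic_map surface_topology surface_topology \<Psi> \<and>
     \<Psi> singular_point = singular_point \<and>
     \<bar>det M\<bar> = 1 \<and>
     (\<forall>x \<in> octagon_surface - {singular_point}.
        \<exists>F. F 0 = 0 \<and> (F has_derivative (\<lambda>v. M *v v)) (at 0) \<and>
          (\<forall>\<^sub>F v in nhds 0. \<Psi> (surface_plus x v) = surface_plus (\<Psi> x) (F v)))"

definition veech_group :: "(real^2^2) set" where
  "veech_group = {M. \<exists>\<Psi>. affine_automorphism \<Psi> M}"

definition gamma :: "real^2^2" where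
  "gamma = mat2 (-1) (2 * (1 + sqrt 2)) 0 1"

definition nu :: "nat \<Rightarrow> real^2^2" where
  "nu j =
     [mat2 1 0 0 1,
      (1 / sqrt 2) *\<^sub>R mat2 1 1 1 (-1),
      (1 / sqrt 2) *\<^sub>R mat2 1 1 (-1) 1,
      mat2 0 1 1 0,
      mat2 0 1 (-1) 0,
      (1 / sqrt 2) *\<^sub>R mat2 (-1) 1 1 1,
      (1 / sqrt 2) *\<^sub>R mat2 (-1) 1 (-1) (-1),
      mat2 (-1) 0 0 1] ! j"

fun nu_prod :: "(nat \<Rightarrow> nat) \<Rightarrow> nat \<Rightarrow> real^2^2" where
  "nu_prod s 0 = mat 1"
| "nu_prod s (Suc k) = nu_prod s k ** (matrix_inv (nu (s k)) ** gamma)"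


section \<open>The ideal octagon tessellation\<close>

definition upper_half_plane :: "complex set" where
  "upper_half_plane = {z. Im z > 0}"

text \<open>The right action on the upper half-plane, for matrices of determinant \<open>\<plusminus>1\<close>.  It factors
  through \<open>PGL(2,\<real>)\<close>, so the image of the Veech group there is represented below by the
  Veech group itself.\<close>

definition act :: "complex \<Rightarrow> real^2^2 \<Rightarrow> complex" where
  "act z M = (let z' = (if det M > 0 then z else cnj z) in
     (of_real (M $ 1 $ 1) * z' + of_real (M $ 2 $ 1)) /
     (of_real (M $ 1 $ 2) * z' + of_real (M $ 2 $ 2)))"

definition act_set :: "complex set \<Rightarrow> real^2^2 \<Rightarrow> complex set" where
  "act_set S M = (\<lambda>z. act z M) ` S"

definition geodesic :: "real \<Rightarrow> real \<Rightarrow> complex set" where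
  "geodesic a b =
     {z \<in> upper_half_plane. cmod (z - of_real ((a + b) / 2)) = \<bar>b - a\<bar> / 2}"

definition edge :: "nat \<Rightarrow> complex set" where
  "edge i = act_set (geodesic 0 (1 - sqrt 2)) (nu i)"

text \<open>The closed half-plane bounded by \<open>edge i\<close> that contains \<open>\<i>\<close>: the outside of the half-circle
  \<open>edge 0\<close>, moved by \<open>nu i\<close>, which fixes \<open>\<i>\<close>.\<close>

definition edge_half_plane :: "nat \<Rightarrow> complex set" where
  "edge_half_plane i = act_set
     {z \<in> upper_half_plane. cmod (z - of_real ((1 - sqrt 2) / 2)) \<ge> (sqrt 2 - 1) / 2} (nu i)"

definition ideal_octagon :: "complex set" where
  "ideal_octagon = (\<Inter>i<8. edge_half_plane i)"

definition tiles :: "complex set set" where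
  "tiles = {act_set ideal_octagon M | M. M \<in> veech_group}"

definition tile_sides :: "complex set \<Rightarrow> complex set set" where
  "tile_sides P =
     {act_set (edge i) M | i M. i < 8 \<and> M \<in> veech_group \<and> act_set ideal_octagon M = P}"

text \<open>The geodesic ray from \<open>\<i>\<close> to \<open>- tan \<theta>\<close>, with unit speed: the vertical ray
  from \<open>\<i>\<close> to \<open>\<infinity>\<close> moved by the rotation about \<open>\<i>\<close> that takes \<open>\<infinity>\<close> to \<open>- tan \<theta>\<close>
  (which is \<open>\<infinity>\<close> if \<open>\<theta> = \<pi>/2\<close>).\<close>

definition ray :: "real \<Rightarrow> real \<Rightarrow> complex" where
  "ray \<theta> t = act (\<i> * of_real (exp t)) (mat2 (sin \<theta>) (- cos \<theta>) (cos \<theta>) (sin \<theta>))"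

text \<open>\<open>P 0, P 1, \<dots>\<close> are the tiles met by the ray in order, starting from the ideal octagon; it
  passes from \<open>P l\<close> to \<open>P (l + 1)\<close> at time \<open>T l\<close> through their common side \<open>E l\<close>.\<close>

definition normalized_cutting_sequence :: "real \<Rightarrow> (nat \<Rightarrow> nat) \<Rightarrow> bool" where
  "normalized_cutting_sequence \<theta> s \<longleftrightarrow>
     (\<exists>(T :: nat \<Rightarrow> real) P E.
        0 < T 0 \<and> strict_mono T \<and>
        P 0 = ideal_octagon \<and> (\<forall>l. P l \<in> tiles) \<and> (\<forall>l. P (Suc l) \<noteq> P l) \<and>
        (\<forall>l. E l \<in> tile_sides (P l) \<inter> tile_sides (P (Suc l)) \<and> ray \<theta> (T l) \<in> E l) \<and>
        (\<forall>t\<in>{0..T 0}. ray \<theta> t \<in> P 0) \<and>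
        (\<forall>l. \<forall>t\<in>{T l..T (Suc l)}. ray \<theta> t \<in> P (Suc l)) \<and>
        s 0 \<in> {0..7} \<and> E 0 = edge (s 0) \<and>
        (\<forall>l. s (Suc l) \<in> {1..7} \<and>
           (\<exists>M\<in>veech_group. act_set (P (Suc l)) M = ideal_octagon \<and>
              act_set (E l) M = edge 0 \<and> act_set (E (Suc l)) M = edge (s (Suc l)))))"


section \<open>Basic facts\<close>

lemma oct_vertex_4: "oct_vertex (i + 4) = - oct_vertex i"
proof -
  have "cos (5 * pi / 8 - real (i + 4) * pi / 4) = cos ((5 * pi / 8 - real i * pi / 4) - pi)"
    and "sin (5 * pi / 8 - real (i + 4) * pi / 4) = sin ((5 * pi / 8 - real i * pi / 4) - pi)"
    by (simp_all add: field_simps)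
  then show ?thesis
    by (simp only: oct_vertex_def vec_eq_iff forall_2 cos_minus_pi sin_minus_pi
        vector_uminus_component vector_2)
qed

lemma oct_side_glue: "p \<in> oct_side i \<Longrightarrow> p + glue_vec i \<in> oct_side (i + 4)"
proof -
  assume "p \<in> oct_side i"
  then have "glue_vec i + p \<in> closed_segment (glue_vec i + oct_vertex i)
      (glue_vec i + oct_vertex (Suc i))"
    by (simp add: oct_side_def closed_segment_translation_eq)
  moreover have "glue_vec i + oct_vertex (Suc i) = oct_vertex (i + 4)"
    using oct_vertex_4[of "Suc i"] oct_vertex_4[of i] by (simp add: glue_vec_def add.commute)
  ultimately show ?thesis
    by (simp add: oct_side_def glue_vec_def closed_segment_commute add.commute)
qed

lemma glue_vec_4: "glue_vec (i + 4) = - glue_vec i"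
  using oct_vertex_4[of "i + 5"] oct_vertex_4[of i]
  by (simp add: glue_vec_def add.commute add.left_commute)

lemma sym_glue_step: "sym glue_step"
proof (rule symI)
  fix p q assume "(p, q) \<in> glue_step"
  then obtain i where i: "p \<in> oct_side i" "q = p + glue_vec i"
    by (auto simp: glue_step_def)
  then have "q \<in> oct_side (i + 4)" "p = q + glue_vec (i + 4)"
    using oct_side_glue glue_vec_4 by auto
  then show "(q, p) \<in> glue_step"
    unfolding glue_step_def by blast
qed

lemma equiv_glue: "equiv octagon glue"
proof (rule equivI)
  show "glue \<subseteq> octagon \<times> octagon" by (simp add: glue_def)
  show "refl_on octagon glue" by (auto simp: refl_on_def glue_def)
  show "sym glue"
    using sym_rtrancl[OF sym_glue_step] by (auto simp: sym_def glue_def)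
  show "trans glue"
    unfolding trans_def glue_def by (blast intro: rtrancl_trans)
qed

lemma openin_surface_topology:
  "openin surface_topology U \<longleftrightarrow>
     U \<subseteq> octagon_surface \<and> openin (top_of_set octagon) (\<Union>U)"
proof -
  have int: "\<Union>(S \<inter> T) = \<Union>S \<inter> \<Union>T" if "S \<subseteq> octagon_surface" "T \<subseteq> octagon_surface" for S T
    using that quotient_disj[OF equiv_glue] unfolding octagon_surface_def by blast
  have un: "\<Union>(\<Union>K) = \<Union>(Union ` K)" for K :: "surface_point set set" by blast
  have "istopology (\<lambda>U. U \<subseteq> octagon_surface \<and> openin (top_of_set octagon) (\<Union>U))"
    unfolding istopology_def
  proof (intro conjI allI impI)
    fix S T
    assume "S \<subseteq> octagon_surface \<and> openin (top_of_set octagon) (\<Union> S)"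
      and "T \<subseteq> octagon_surface \<and> openin (top_of_set octagon) (\<Union> T)"
    then show "S \<inter> T \<subseteq> octagon_surface" "openin (top_of_set octagon) (\<Union> (S \<inter> T))"
      by (auto simp: int intro: openin_Int simp del: openin_subtopology)
  next
    fix K assume K: "\<forall>S\<in>K. S \<subseteq> octagon_surface \<and> openin (top_of_set octagon) (\<Union> S)"
    then show "\<Union>K \<subseteq> octagon_surface" by blast
    show "openin (top_of_set octagon) (\<Union>(\<Union>K))"
      unfolding un using K by blast
  qed
  then show ?thesis
    by (simp add: surface_topology_def topology_inverse')
qed

lemma topspace_surface_topology: "topspace surface_topology = octagon_surface"
proof -
  have "openin surface_topology octagon_surface"
    using Union_quotient[OF equiv_glue] openin_topspace[of "top_of_set octagon"]
    by (simp add: openin_surface_topology octagon_surface_def)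
  then show ?thesis
    by (meson openin_surface_topology openin_subset openin_topspace subset_antisym)
qed

lemma quotient_map_octagon:
  "quotient_map (top_of_set octagon) surface_topology (\<lambda>p. glue `` {p})"
proof -
  have "(\<lambda>p. glue `` {p}) ` octagon = octagon_surface"
    by (auto simp: octagon_surface_def quotient_def)
  moreover have "{p \<in> octagon. glue `` {p} \<in> U} = \<Union>U" if U: "U \<subseteq> octagon_surface" for U
  proof (intro subset_antisym subsetI)
    fix p assume "p \<in> {p \<in> octagon. glue `` {p} \<in> U}"
    then show "p \<in> \<Union>U" using equiv_class_self[OF equiv_glue] by blast
  next
    fix p assume "p \<in> \<Union>U"
    then obtain x where x: "x \<in> U" "p \<in> x" "x \<in> octagon // glue"
      using U by (auto simp: octagon_surface_def)
    then have "glue `` {p} = x"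
      by (metis Image_singleton_iff equiv_class_eq_iff equiv_glue quotientE)
    moreover have "p \<in> octagon"
      using x Union_quotient[OF equiv_glue] by blast
    ultimately show "p \<in> {p \<in> octagon. glue `` {p} \<in> U}" using x by simp
  qed
  ultimately show ?thesis
    by (simp add: quotient_map_def topspace_surface_topology openin_surface_topology)
qed

lemma ray_0: "ray \<theta> 0 = \<i>"
proof -
  have d: "sin \<theta> * sin \<theta> + cos \<theta> * cos \<theta> = 1" by (metis power2_eq_square sin_cos_squared_add)
  have "complex_of_real (sin \<theta>) - of_real (cos \<theta>) * \<i> \<noteq> 0"
    using d by (auto simp: complex_eq_iff)
  with d show ?thesis
    by (simp add: ray_def act_def mat2_def det_2 Let_def divide_eq_eq algebra_simps)
qed

lemma ray_tendsto:
  assumes "cos \<theta> \<noteq> 0"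
  shows "(ray \<theta> \<longlongrightarrow> of_real (- tan \<theta>)) at_top"
proof -
  have d: "sin \<theta> * sin \<theta> + cos \<theta> * cos \<theta> = 1" by (metis power2_eq_square sin_cos_squared_add)
  have e: "((\<lambda>t::real. complex_of_real (exp (- t))) \<longlongrightarrow> of_real 0) at_top"
    by (intro tendsto_of_real filterlim_compose[OF exp_at_bot filterlim_uminus_at_bot_at_top])
  have eq: "ray \<theta> t = (of_real (sin \<theta>) * \<i> + of_real (cos \<theta>) * of_real (exp (- t))) /
      (of_real (- cos \<theta>) * \<i> + of_real (sin \<theta>) * of_real (exp (- t)))" for t
  proof -
    have x: "complex_of_real (exp t) * of_real (exp (- t)) = 1"
      by (simp flip: of_real_mult exp_add)
    have "ray \<theta> t = (of_real (sin \<theta>) * (\<i> * of_real (exp t)) + of_real (cos \<theta>)) /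
        (of_real (- cos \<theta>) * (\<i> * of_real (exp t)) + of_real (sin \<theta>))"
      using d by (simp add: ray_def act_def mat2_def det_2 Let_def)
    also have "\<dots> = ((of_real (sin \<theta>) * (\<i> * of_real (exp t)) + of_real (cos \<theta>)) * of_real (exp (- t))) /
        ((of_real (- cos \<theta>) * (\<i> * of_real (exp t)) + of_real (sin \<theta>)) * of_real (exp (- t)))"
      by simp
    finally show ?thesis
      by (simp only: distrib_right mult.assoc x mult_1_right)
  qed
  have "((\<lambda>t. (of_real (sin \<theta>) * \<i> + of_real (cos \<theta>) * complex_of_real (exp (- t))) /
      (of_real (- cos \<theta>) * \<i> + of_real (sin \<theta>) * of_real (exp (- t)))) \<longlongrightarrow>
      (of_real (sin \<theta>) * \<i> + of_real (cos \<theta>) * of_real 0) /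
      (of_real (- cos \<theta>) * \<i> + of_real (sin \<theta>) * of_real 0)) at_top"
    by (intro tendsto_intros e) (use assms in simp)
  then show ?thesis
    using assms by (simp add: eq[abs_def] tan_def)
qed

end

theory Submission
  imports Defs
begin

text \<open>
  One step of the renormalization is a statement about a single affine map.  Let \<open>f\<close> be a trajectory whose
  direction lies strictly inside the first sector.  The surface is the union of two horizontal cylinders, \<open>Inner\<close>
  (heights between \<open>- hs\<close> and \<open>hs\<close>) and \<open>Outer\<close> (the upper and lower trapezoids of the octagon, glued along
  the slanted sides), and \<open>f\<close> climbs through one after the other.  An affine map \<open>\<Phi>\<close> with derivative
  \<open>gamma\<close> maps each cylinder to itself by a reflection followed by a shear that moves the upper boundary past
  two sides (\<open>gamma_cylinder\<close>).  If \<open>f\<close> crosses the sides number \<open>a + 1, \<dots>, b\<close> of a cylinder, then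
  \<open>\<Phi> \<circ> f\<close> crosses the mirror images of the sides \<open>a + 1, \<dots>, b - 2\<close>, or that of
  side \<open>a\<close> in the opposite sense if \<open>b = a + 1\<close>; a look at the ends of the passage
  shows that the sandwiched letters of \<open>f\<close> in this passage are exactly as many, with the same labels in the same
  order.  Hence the derived word is the cutting sequence of \<open>\<Phi> \<circ> f\<close> (\<open>sector0_derived\<close>), and the cutting
  sequence of \<open>f\<close> with respect to the octagon \<open>\<Phi>\<^sup>-\<^sup>1 O\<close>.

  The normal form prepares this step.  The symmetry \<open>nu s\<close> of the octagon takes the sector number \<open>s\<close> to the
  first one and acts on labels by \<open>letter_perm s\<close>.  That the diagram is unique needs an argument, as a word could
  a priori lie in two diagrams (\<open>unique_diagram\<close>).  Then, after normalization, it either has period two, or it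
  has no two consecutive letters \<open>C\<close>.  The height of a chord of the trajectory, measured across its direction,
  changes by a constant depending on the label of the side crossed.  In the first case the heights drift to
  infinity.  In the second case the chords from \<open>D\<close> to \<open>B\<close> are moved by a rotation of a circle, and the
  orbit avoids an interval; so the rotation is rational and the trajectory is periodic, or the interval is empty,
  with the same conclusion (\<open>no_CC_periodic\<close>).

  It remains to see which symmetry is used in step \<open>k\<close>, that is, that \<open>nu (s k) * nu(k)\<^sup>-\<^sup>1\<close> takes the direction
  of the trajectory into the first sector.  The sides of the tessellation are zero sets of products of two
  linear forms, evaluated in a Hermitian way (\<open>form\<close>).  Along the geodesic ray such a function has the
  shape \<open>exp (2 t) X + Y\<close>, so leaving a tile through a side determines the sign of \<open>X\<close>, and this sign says that
  the direction lies in the sector belonging to the side (\<open>sign_change\<close>).  The matrices which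
  bring the tiles back to the ideal octagon agree with \<open>nu_prod s k\<close> up to sign, because an element of the Veech
  group that stabilises \<open>edge 0\<close> is one of \<open>\<plusminus> 1, \<plusminus> gamma\<close> (\<open>edge_0_stabiliser\<close>).  This
  last fact is again flat geometry: closed horizontal trajectories have only two possible lengths,
  so an affine map preserving the horizontal direction cannot stretch it (\<open>horizontal_scaling\<close>), and the
  direction \<open>(sr, 1)\<close> of the other end of \<open>edge 0\<close> has closed trajectories with a different ratio of
  lengths (\<open>no_swap\<close>).  Comparing two consecutive tiles also shows that an affine map with derivative \<open>gamma\<close>
  exists (\<open>tile_transition\<close>).  The induction over the steps is \<open>renormalized_cutting\<close>.
\<close>

section \<open>Coordinates of the octagon\<close>

text \<open>Half the length of a side, the inradius, and their ratio \<open>sr = ir / hs\<close>: the first sector is bounded by the lines of slope \<open>0\<close> and \<open>1 / sr\<close>.\<close>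

definition hs :: real where "hs = sin (pi / 8)"
definition ir :: real where "ir = cos (pi / 8)"
definition sr :: real where "sr = 1 + sqrt 2"

abbreviation pt :: "real \<Rightarrow> real \<Rightarrow> real^2" where "pt x y \<equiv> vector [x, y]"

lemma pt_simps [simp]:
  "pt a b + pt c d = pt (a + c) (b + d)" "pt a b - pt c d = pt (a - c) (b - d)"
  "- pt a b = pt (- a) (- b)" "k *\<^sub>R pt a b = pt (k * a) (k * b)"
  "pt a b = pt c d \<longleftrightarrow> a = c \<and> b = d" "pt a b \<bullet> pt c d = a * c + b * d"
  by (auto simp: vec_eq_iff forall_2 inner_vec_def sum_2)

lemma pt_collapse: "pt (p $ 1) (p $ 2) = p" by (simp add: vec_eq_iff forall_2)

lemma pt_cases: obtains x y where "p = pt x y" by (metis pt_collapse)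

lemma hs_pos: "hs > 0" unfolding hs_def by (rule sin_gt_zero) auto

lemma sr_sq: "sr * sr = 2 * sr + 1" by (simp add: sr_def algebra_simps)

lemma sr_bounds: "2 * sr > 4" "2 * sr < 5"
proof -
  have "sqrt 2 > 1" by simp
  moreover have "sqrt 2 < 3/2" by (rule real_less_lsqrt) (auto simp: power2_eq_square)
  ultimately show "2 * sr > 4" "2 * sr < 5" by (auto simp: sr_def)
qed

lemma sr_hs: "sr * hs = ir"
proof -
  have c: "ir > 0" unfolding ir_def by (rule cos_gt_zero) auto
  have "sin (pi/4) = 2 * hs * ir" using sin_double[of "pi/8"] by (simp add: hs_def ir_def)
  moreover have "cos (pi/4) = ir\<^sup>2 - hs\<^sup>2" using cos_double[of "pi/8"] by (simp add: hs_def ir_def)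
  ultimately have *: "ir * ir - hs * hs = 2 * hs * ir" by (simp add: sin_45 cos_45 power2_eq_square)
  have "(sr * hs - ir) * ((sr - 2) * hs + ir) = (sr * sr - 2 * sr) * (hs * hs) - (ir * ir - 2 * hs * ir)"
    by (simp add: algebra_simps)
  also have "\<dots> = 0" using * by (simp add: sr_sq)
  finally have "(sr * hs - ir) * ((sr - 2) * hs + ir) = 0" .
  moreover have "(sr - 2) * hs + ir > 0"
    using c hs_pos sr_bounds by (intro add_pos_pos mult_pos_pos) auto
  ultimately show ?thesis by simp
qed

lemma sr_ir: "sr * ir = 2 * ir + hs"
proof -
  have "sr * ir = (sr * sr) * hs" by (simp add: sr_hs[symmetric])
  then show ?thesis unfolding sr_sq by (simp add: algebra_simps sr_hs[symmetric])
qed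

lemma ir_bounds: "2 * hs < ir" "2 * ir < 5 * hs"
  using sr_bounds hs_pos mult_strict_right_mono[of 2 sr hs] mult_strict_right_mono[of "2 * sr" 5 hs]
  by (simp_all add: sr_hs[symmetric])

lemma ir_pos: "ir > 0" using ir_bounds hs_pos by simp

lemma ir_sq: "ir * ir = 2 * (ir * hs) + hs * hs"
proof -
  have "ir * ir = (sr * ir) * hs" by (simp add: sr_hs[symmetric])
  then show ?thesis unfolding sr_ir by (simp add: algebra_simps)
qed

lemma sqrt2_ir: "sqrt 2 * ir = ir + hs" using sr_ir by (simp add: sr_def algebra_simps)

lemma oct_vertex_8: "oct_vertex (i + 8) = oct_vertex i"
  using oct_vertex_4[of i] oct_vertex_4[of "i + 4"] by (simp add: add.assoc)

lemma oct_vertex_mod: "oct_vertex (i mod 8) = oct_vertex i"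
proof -
  have "oct_vertex (k + 8 * m) = oct_vertex k" for k m
  proof (induction m)
    case (Suc m)
    then show ?case using oct_vertex_8[of "k + 8 * m"] by (simp add: algebra_simps)
  qed simp
  from this[of "i mod 8" "i div 8"] show ?thesis by simp
qed

lemma oct_vertex_values:
  "oct_vertex 0 = pt (- hs) ir" "oct_vertex 1 = pt hs ir" "oct_vertex 2 = pt ir hs"
  "oct_vertex 3 = pt ir (- hs)" "oct_vertex 4 = pt hs (- ir)" "oct_vertex 5 = pt (- hs) (- ir)"
  "oct_vertex 6 = pt (- ir) (- hs)" "oct_vertex 7 = pt (- ir) hs" "oct_vertex 8 = pt (- hs) ir"
proof -
  have 0: "5 * pi / 8 = pi/8 + pi/2" and 1: "5 * pi / 8 - pi/4 = pi/2 - pi/8"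
    and 2: "5 * pi / 8 - 2 * pi/4 = pi/8" and 3: "5 * pi / 8 - 3 * pi/4 = - (pi/8)" by simp_all
  have c: "cos (pi/2 - pi/8) = hs" "sin (pi/2 - pi/8) = ir"
    unfolding hs_def ir_def by (simp_all only: cos_diff sin_diff cos_pi_half sin_pi_half mult_zero_left mult_1 add_0 diff_zero)
  have d: "cos (pi/8 + pi/2) = - hs" "sin (pi/8 + pi/2) = ir"
    unfolding hs_def ir_def by (simp_all only: cos_add sin_add cos_pi_half sin_pi_half mult_zero_right mult_1_right add_0 diff_0 add_0_right)
  show v0: "oct_vertex 0 = pt (- hs) ir" unfolding oct_vertex_def using d by (simp only: of_nat_0 mult_zero_left div_0 diff_zero 0)
  show v1: "oct_vertex 1 = pt hs ir" unfolding oct_vertex_def using c by (simp only: of_nat_1 mult_1 1)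
  show v2: "oct_vertex 2 = pt ir hs" unfolding oct_vertex_def hs_def ir_def by (simp only: of_nat_numeral 2)
  show v3: "oct_vertex 3 = pt ir (- hs)" unfolding oct_vertex_def hs_def ir_def by (simp only: of_nat_numeral 3 cos_minus sin_minus)
  show "oct_vertex 4 = pt hs (- ir)" "oct_vertex 5 = pt (- hs) (- ir)"
  "oct_vertex 6 = pt (- ir) (- hs)" "oct_vertex 7 = pt (- ir) hs" "oct_vertex 8 = pt (- hs) ir"
    using oct_vertex_4[of 0] oct_vertex_4[of 1] oct_vertex_4[of 2] oct_vertex_4[of 3] oct_vertex_8[of 0]
    unfolding v0 v1 v2 v3 by (simp_all add: v0)
qed

text \<open>The midpoint of side \<open>i\<close> is \<open>ir\<close> times the outer unit normal of that side, so it serves both for the half-plane bounded by the side and for the gluing, which translates by \<open>- 2 * mid i\<close>.\<close>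

definition mid :: "nat \<Rightarrow> real^2" where
  "mid i = (1/2) *\<^sub>R (oct_vertex i + oct_vertex (Suc i))"

text \<open>The slanted sides lie on the lines \<open>x \<plusminus> y = \<plusminus> ll\<close>, and \<open>ll = sqrt 2 * ir\<close>.\<close>

abbreviation ll :: real where "ll \<equiv> hs + ir"

lemma glue_vec_mid: "glue_vec i = - 2 *\<^sub>R mid i"
  using oct_vertex_4[of "Suc i"] by (simp add: glue_vec_def mid_def scaleR_add_right add.commute)

lemma mid_4: "mid (i + 4) = - mid i"
  using oct_vertex_4[of "Suc i"] oct_vertex_4[of i] by (simp add: mid_def algebra_simps)

lemma mid_mod: "mid (i mod 8) = mid i"
  by (metis mid_def oct_vertex_mod mod_Suc_eq)

lemma mid_values:
  "mid 0 = pt 0 ir" "mid 1 = pt (ll/2) (ll/2)" "mid 2 = pt ir 0" "mid 3 = pt (ll/2) (-ll/2)"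
  "mid 4 = pt 0 (-ir)" "mid 5 = pt (-ll/2) (-ll/2)" "mid 6 = pt (-ir) 0" "mid 7 = pt (-ll/2) (ll/2)"
  unfolding mid_def by (simp_all add: oct_vertex_values eval_nat_numeral(3)[symmetric] numeral_2_eq_2[symmetric] Suc_1 flip: numeral_eq_Suc One_nat_def)

lemma less_8: "(i::nat) < 8 \<Longrightarrow> i = 0 \<or> i = 1 \<or> i = 2 \<or> i = 3 \<or> i = 4 \<or> i = 5 \<or> i = 6 \<or> i = 7" by auto

lemma mid_vertex:
  assumes "i < 8" "j < 8"
  shows "mid j \<bullet> oct_vertex i \<le> ir * ir \<and> (mid j \<bullet> oct_vertex i = ir * ir \<longleftrightarrow> j = i \<or> i = (j + 1) mod 8)"
proof -
  have e: "ll / 2 * hs = (hs * hs + ir * hs) / 2" "ll / 2 * ir = (3 * (ir * hs) + hs * hs) / 2"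
    "- ll / 2 * hs = - (hs * hs + ir * hs) / 2" "- ll / 2 * ir = - (3 * (ir * hs) + hs * hs) / 2"
    by (simp_all add: algebra_simps ir_sq)
  have m: "pt a b \<bullet> pt c d = a * c + b * d" for a b c d :: real by simp
  obtain u v where uv: "ir * hs = u" "hs * hs = v" "hs * ir = u" and p: "u > 0" "v > 0"
    using hs_pos ir_pos by (simp add: mult.commute)
  show ?thesis
    using less_8[OF assms(1)] less_8[OF assms(2)] p
    apply (elim disjE)
    apply (simp_all only: oct_vertex_values mid_values m e mult_minus_right mult_zero_left ir_sq mult_minus_left uv)
    apply (simp_all add: field_simps)
    done
qed

section \<open>The octagon as an intersection of half-planes\<close>

lemma vertex_mid: "mid j \<bullet> oct_vertex i \<le> ir * ir"
  using mid_vertex[of "i mod 8" "j mod 8"] by (simp add: mid_mod oct_vertex_mod)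

lemma mid_le: "p \<in> octagon \<Longrightarrow> mid j \<bullet> p \<le> ir * ir"
proof -
  have "octagon \<subseteq> {p. mid j \<bullet> p \<le> ir * ir}"
    unfolding octagon_def by (rule hull_minimal) (auto simp: vertex_mid convex_halfspace_le)
  then show "p \<in> octagon \<Longrightarrow> mid j \<bullet> p \<le> ir * ir" by blast
qed

lemma all8: "(\<forall>i<8. P i) \<longleftrightarrow> P 0 \<and> P 1 \<and> P 2 \<and> P 3 \<and> P 4 \<and> P 5 \<and> P 6 \<and> P (7::nat)"
  using less_8 by auto

lemma mid_le_iff:
  "mid 0 \<bullet> pt x y \<le> ir * ir \<longleftrightarrow> y \<le> ir" "mid 1 \<bullet> pt x y \<le> ir * ir \<longleftrightarrow> x + y \<le> ll"
  "mid 2 \<bullet> pt x y \<le> ir * ir \<longleftrightarrow> x \<le> ir" "mid 3 \<bullet> pt x y \<le> ir * ir \<longleftrightarrow> x - y \<le> ll"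
  "mid 4 \<bullet> pt x y \<le> ir * ir \<longleftrightarrow> - ir \<le> y" "mid 5 \<bullet> pt x y \<le> ir * ir \<longleftrightarrow> - ll \<le> x + y"
  "mid 6 \<bullet> pt x y \<le> ir * ir \<longleftrightarrow> - ir \<le> x" "mid 7 \<bullet> pt x y \<le> ir * ir \<longleftrightarrow> - ll \<le> x - y"
  "mid 0 \<bullet> pt x y = ir * ir \<longleftrightarrow> y = ir" "mid 1 \<bullet> pt x y = ir * ir \<longleftrightarrow> x + y = ll"
  "mid 2 \<bullet> pt x y = ir * ir \<longleftrightarrow> x = ir" "mid 3 \<bullet> pt x y = ir * ir \<longleftrightarrow> x - y = ll"
  "mid 4 \<bullet> pt x y = ir * ir \<longleftrightarrow> y = - ir" "mid 5 \<bullet> pt x y = ir * ir \<longleftrightarrow> x + y = - ll"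
  "mid 6 \<bullet> pt x y = ir * ir \<longleftrightarrow> x = - ir" "mid 7 \<bullet> pt x y = ir * ir \<longleftrightarrow> x - y = - ll"
proof -
  have l: "ll > 0" "ll \<noteq> 0" and r: "ir > 0" using hs_pos ir_pos by auto
  have q: "ir * ir = ll / 2 * ll" by (simp add: algebra_simps ir_sq)
  have s: "ll / 2 * x + ll / 2 * y = ll / 2 * (x + y)" "ll / 2 * x + - ll / 2 * y = ll / 2 * (x - y)"
    "- ll / 2 * x + - ll / 2 * y = ll / 2 * (- (x + y))" "- ll / 2 * x + ll / 2 * y = ll / 2 * (- (x - y))"
    by (simp_all add: field_simps)
  have c: "ll / 2 * a \<le> ll / 2 * b \<longleftrightarrow> a \<le> b" "ll / 2 * a = ll / 2 * b \<longleftrightarrow> a = b" for a b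
    using l by (simp_all add: mult_le_cancel_left_pos del: distrib_right)
  show "mid 1 \<bullet> pt x y \<le> ir * ir \<longleftrightarrow> x + y \<le> ll" "mid 3 \<bullet> pt x y \<le> ir * ir \<longleftrightarrow> x - y \<le> ll"
   "mid 5 \<bullet> pt x y \<le> ir * ir \<longleftrightarrow> - ll \<le> x + y" "mid 7 \<bullet> pt x y \<le> ir * ir \<longleftrightarrow> - ll \<le> x - y"
   "mid 1 \<bullet> pt x y = ir * ir \<longleftrightarrow> x + y = ll" "mid 3 \<bullet> pt x y = ir * ir \<longleftrightarrow> x - y = ll"
   "mid 5 \<bullet> pt x y = ir * ir \<longleftrightarrow> x + y = - ll" "mid 7 \<bullet> pt x y = ir * ir \<longleftrightarrow> x - y = - ll"
    unfolding mid_values pt_simps q s c by linarith+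
  show "mid 0 \<bullet> pt x y \<le> ir * ir \<longleftrightarrow> y \<le> ir" "mid 2 \<bullet> pt x y \<le> ir * ir \<longleftrightarrow> x \<le> ir"
    "mid 4 \<bullet> pt x y \<le> ir * ir \<longleftrightarrow> - ir \<le> y" "mid 6 \<bullet> pt x y \<le> ir * ir \<longleftrightarrow> - ir \<le> x"
    "mid 0 \<bullet> pt x y = ir * ir \<longleftrightarrow> y = ir" "mid 2 \<bullet> pt x y = ir * ir \<longleftrightarrow> x = ir"
    "mid 4 \<bullet> pt x y = ir * ir \<longleftrightarrow> y = - ir" "mid 6 \<bullet> pt x y = ir * ir \<longleftrightarrow> x = - ir"
    unfolding mid_values pt_simps using r mult_le_cancel_left_pos[OF r, of "- y" ir] mult_le_cancel_left_pos[OF r, of "- x" ir]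
      mult_left_cancel[of ir "- y" ir] mult_left_cancel[of ir "- x" ir]
    by (auto simp: mult_le_cancel_left_pos)
qed

lemma octagon_vertex: "oct_vertex i \<in> octagon"
  unfolding octagon_def by (simp add: hull_inc)

lemma convex_octagon: "convex octagon" by (simp add: octagon_def)

lemma octagon_horizontal:
  assumes "pt a y \<in> octagon" "pt b y \<in> octagon" "a \<le> x" "x \<le> b" shows "pt x y \<in> octagon"
proof (cases "a = b")
  case False
  then have d: "b - a > 0" using assms by simp
  let ?u = "(x - a) / (b - a)"
  have "(1 - ?u) *\<^sub>R pt a y + ?u *\<^sub>R pt b y \<in> octagon"
    using assms d by (intro convexD[OF convex_octagon]) auto
  moreover have "(1 - ?u) * a + ?u * b = a + ?u * (b - a)" by (simp only: left_diff_distrib right_diff_distrib mult_1)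
  then have "(1 - ?u) * a + ?u * b = x" using d by simp
  moreover have "(1 - ?u) * y + ?u * y = y" by (simp add: algebra_simps)
  ultimately show ?thesis by simp
qed (use assms in auto)

lemma interp: "a \<noteq> b \<Longrightarrow> (y::real) = (1 - (y - a) / (b - a)) * a + (y - a) / (b - a) * b"
proof -
  assume "a \<noteq> b"
  then have "(y - a) / (b - a) * (b - a) = y - a" by simp
  then show ?thesis by (simp only: left_diff_distrib right_diff_distrib mult_1)
qed

lemma octagon_comb:
  assumes "pt a b \<in> octagon" "pt c d \<in> octagon" "0 \<le> u" "u \<le> 1" "x = (1 - u) * a + u * c" "y = (1 - u) * b + u * d"
  shows "pt x y \<in> octagon"
proof -
  have "(1 - u) *\<^sub>R pt a b + u *\<^sub>R pt c d \<in> octagon"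
    using assms by (intro convexD[OF convex_octagon]) auto
  then show ?thesis using assms by simp
qed

text \<open>The vertices satisfy the inequalities.  Conversely, a point that satisfies them lies on a horizontal chord whose ends are on sides of the octagon, hence are convex combinations of vertices.\<close>

lemma octagon_iff: "p \<in> octagon \<longleftrightarrow> (\<forall>i<8. mid i \<bullet> p \<le> ir * ir)"
proof
  assume A: "\<forall>i<8. mid i \<bullet> p \<le> ir * ir"
  obtain x y where p: "p = pt x y" by (rule pt_cases)
  have B: "y \<le> ir" "x + y \<le> ll" "x \<le> ir" "x - y \<le> ll" "-ir \<le> y" "-ll \<le> x + y" "-ir \<le> x" "-ll \<le> x - y"
    using A unfolding all8 p mid_le_iff by auto
  note V = octagon_vertex[of 0] octagon_vertex[of 1] octagon_vertex[of 2] octagon_vertex[of 3]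
    octagon_vertex[of 4] octagon_vertex[of 5] octagon_vertex[of 6] octagon_vertex[of 7]
  note V = V[unfolded oct_vertex_values]
  have d: "ir - hs > 0" using ir_bounds hs_pos by simp
  note h = hs_pos
  show "p \<in> octagon"
  proof (cases "y \<le> hs \<and> - hs \<le> y")
    case True
    define u where "u = (hs - y) / (2 * hs)"
    have u: "0 \<le> u" "u \<le> 1" "y = (1 - u) * hs + u * (- hs)" using True h by (auto simp: field_simps u_def)
    have "pt ir y \<in> octagon" by (rule octagon_comb[OF V(3) V(4) u(1,2) _ u(3)]) (simp add: algebra_simps)
    moreover have "pt (-ir) y \<in> octagon" by (rule octagon_comb[OF V(8) V(7) u(1,2) _ u(3)]) (simp add: algebra_simps)
    ultimately show ?thesis unfolding p using octagon_horizontal[of "-ir" y "ir" x] B by simp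
  next
    case False
    show ?thesis
    proof (cases "y > hs")
      case True
      define u where "u = (y - hs) / (ir - hs)"
      have u: "0 \<le> u" "u \<le> 1" "y = (1 - u) * hs + u * ir" using True d B interp[of hs ir y] by (auto simp: u_def)
      have "pt (ll - y) y \<in> octagon" by (rule octagon_comb[OF V(3) V(2) u(1,2) _ u(3)]) (use u(3) in \<open>simp add: algebra_simps\<close>)
      moreover have "pt (y - ll) y \<in> octagon" by (rule octagon_comb[OF V(8) V(1) u(1,2) _ u(3)]) (use u(3) in \<open>simp add: algebra_simps\<close>)
      ultimately show ?thesis unfolding p using octagon_horizontal[of "y - ll" y "ll - y" x] B by simp
    next
      case n: False
      with False have y: "y < - hs" by auto
      define u where "u = (- y - hs) / (ir - hs)"
      have e: "u * (ir - hs) = - y - hs" using d by (simp add: u_def)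
      have u: "0 \<le> u" "u \<le> 1" using y d B by (auto simp: u_def)
      have u: "0 \<le> u" "u \<le> 1" "y = (1 - u) * (- hs) + u * (- ir)" using u e by (simp_all add: algebra_simps)
      have "pt (ll + y) y \<in> octagon" by (rule octagon_comb[OF V(4) V(5) u(1,2) _ u(3)]) (use u(3) in \<open>simp add: algebra_simps\<close>)
      moreover have "pt (- ll - y) y \<in> octagon" by (rule octagon_comb[OF V(7) V(6) u(1,2) _ u(3)]) (use u(3) in \<open>simp add: algebra_simps\<close>)
      ultimately show ?thesis unfolding p using octagon_horizontal[of "- ll - y" y "ll + y" x] B by simp
    qed
  qed
qed (simp add: mid_le)

lemma octagon_pt:
  "pt x y \<in> octagon \<longleftrightarrow> y \<le> ir \<and> x + y \<le> ll \<and> x \<le> ir \<and> x - y \<le> ll \<and>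
     - ir \<le> y \<and> - ll \<le> x + y \<and> - ir \<le> x \<and> - ll \<le> x - y"
  unfolding octagon_iff all8 mid_le_iff by auto

section \<open>Gluing classes\<close>

definition oct_int :: "real^2 \<Rightarrow> bool" where
  "oct_int p \<longleftrightarrow> (\<forall>j<8. mid j \<bullet> p < ir * ir)"

definition edge_pt :: "nat \<Rightarrow> real^2 \<Rightarrow> bool" where
  "edge_pt i p \<longleftrightarrow> mid i \<bullet> p = ir * ir \<and> (\<forall>j<8. j \<noteq> i mod 8 \<longrightarrow> mid j \<bullet> p < ir * ir)"

lemma oct_int_octagon: "oct_int p \<Longrightarrow> p \<in> octagon"
  by (auto simp: oct_int_def octagon_iff less_imp_le)

lemma edge_pt_octagon: "edge_pt i p \<Longrightarrow> p \<in> octagon"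
  unfolding edge_pt_def octagon_iff by (metis less_imp_le mid_mod order_refl)

lemma oct_int_pt:
  "oct_int (pt x y) \<longleftrightarrow> y < ir \<and> x + y < ll \<and> x < ir \<and> x - y < ll \<and>
     - ir < y \<and> - ll < x + y \<and> - ir < x \<and> - ll < x - y"
proof -
  have *: "a < b \<longleftrightarrow> a \<le> b \<and> a \<noteq> b" for a b :: real by auto
  show ?thesis unfolding oct_int_def all8 *[of "mid _ \<bullet> _"] mid_le_iff by (intro iffI conjI; elim conjE; linarith)
qed

lemma oct_side_mod: "oct_side (i mod 8) = oct_side i"
  unfolding oct_side_def by (metis oct_vertex_mod mod_Suc_eq)

lemma segment_x:
  assumes "a \<noteq> c" "0 \<le> (x - a) / (c - a)" "(x - a) / (c - a) \<le> 1" "(x - a) / (c - a) * (d - b) = y - b"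
  shows "pt x y \<in> closed_segment (pt a b) (pt c d)"
proof -
  let ?u = "(x - a) / (c - a)"
  have "(1 - ?u) * b + ?u * d = b + ?u * (d - b)" by (simp only: left_diff_distrib right_diff_distrib mult_1)
  then have "y = (1 - ?u) * b + ?u * d" using assms(4) by simp
  then have "pt x y = (1 - ?u) *\<^sub>R pt a b + ?u *\<^sub>R pt c d" using interp[OF assms(1), of x] by simp
  then show ?thesis unfolding in_segment using assms(2,3) by blast
qed

lemma segment_u:
  "0 \<le> u \<Longrightarrow> u \<le> 1 \<Longrightarrow> x = (1 - u) * a + u * c \<Longrightarrow> y = (1 - u) * b + u * d \<Longrightarrow>
    pt x y \<in> closed_segment (pt a b) (pt c d)"
  unfolding in_segment by (intro exI[of _ u]) simp

lemma segment_y: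
  assumes "b \<noteq> d" "0 \<le> (y - b) / (d - b)" "(y - b) / (d - b) \<le> 1"
  shows "pt a y \<in> closed_segment (pt a b) (pt a d)"
proof -
  let ?u = "(y - b) / (d - b)"
  have "(1 - ?u) * a + ?u * a = a" by (simp only: left_diff_distrib mult_1)
  then have "pt a y = (1 - ?u) *\<^sub>R pt a b + ?u *\<^sub>R pt a d" using interp[OF assms(1), of y] by simp
  then show ?thesis unfolding in_segment using assms(2,3) by blast
qed

lemma vertex_on_side: "mid i \<bullet> oct_vertex i = ir * ir" "mid i \<bullet> oct_vertex (Suc i) = ir * ir"
proof -
  show "mid i \<bullet> oct_vertex i = ir * ir"
    using mid_vertex[of "i mod 8" "i mod 8"] by (simp add: mid_mod oct_vertex_mod)
  show "mid i \<bullet> oct_vertex (Suc i) = ir * ir"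
    using mid_vertex[of "Suc i mod 8" "i mod 8"] by (simp add: mid_mod oct_vertex_mod mod_Suc_eq)
qed

lemma oct_side_values:
  "oct_side 0 = closed_segment (pt (- hs) ir) (pt hs ir)"
  "oct_side 1 = closed_segment (pt hs ir) (pt ir hs)"
  "oct_side 2 = closed_segment (pt ir hs) (pt ir (- hs))"
  "oct_side 3 = closed_segment (pt ir (- hs)) (pt hs (- ir))"
  "oct_side 4 = closed_segment (pt hs (- ir)) (pt (- hs) (- ir))"
  "oct_side 5 = closed_segment (pt (- hs) (- ir)) (pt (- ir) (- hs))"
  "oct_side 6 = closed_segment (pt (- ir) (- hs)) (pt (- ir) hs)"
  "oct_side 7 = closed_segment (pt (- ir) hs) (pt (- hs) ir)"
proof -
  have "Suc 0 = 1" "Suc 1 = 2" "Suc 2 = 3" "Suc 3 = 4" "Suc 4 = 5" "Suc 5 = 6" "Suc 6 = 7" "Suc 7 = 8" by simp_all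
  note S = this
  show "oct_side 0 = closed_segment (pt (- hs) ir) (pt hs ir)" "oct_side 1 = closed_segment (pt hs ir) (pt ir hs)" "oct_side 2 = closed_segment (pt ir hs) (pt ir (- hs))" "oct_side 3 = closed_segment (pt ir (- hs)) (pt hs (- ir))" "oct_side 4 = closed_segment (pt hs (- ir)) (pt (- hs) (- ir))" "oct_side 5 = closed_segment (pt (- hs) (- ir)) (pt (- ir) (- hs))" "oct_side 6 = closed_segment (pt (- ir) (- hs)) (pt (- ir) hs)" "oct_side 7 = closed_segment (pt (- ir) hs) (pt (- hs) ir)"
    unfolding oct_side_def by (simp_all only: S oct_vertex_values)
qed

lemma oct_side_iff: "p \<in> oct_side i \<longleftrightarrow> p \<in> octagon \<and> mid i \<bullet> p = ir * ir"
proof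
  assume "p \<in> oct_side i"
  then obtain u where u: "0 \<le> u" "u \<le> 1" "p = (1 - u) *\<^sub>R oct_vertex i + u *\<^sub>R oct_vertex (Suc i)"
    unfolding oct_side_def in_segment by blast
  have "p \<in> octagon" unfolding u(3) using u octagon_vertex by (intro convexD[OF convex_octagon]) auto
  moreover have "mid i \<bullet> p = ir * ir"
    unfolding u(3) inner_add_right inner_scaleR_right vertex_on_side by (simp add: algebra_simps)
  ultimately show "p \<in> octagon \<and> mid i \<bullet> p = ir * ir" by blast
next
  assume A: "p \<in> octagon \<and> mid i \<bullet> p = ir * ir"
  obtain x y where p: "p = pt x y" by (rule pt_cases)
  have d: "ir - hs > 0" using ir_bounds hs_pos by simp
  have B: "y \<le> ir" "x + y \<le> ll" "x \<le> ir" "x - y \<le> ll" "-ir \<le> y" "-ll \<le> x + y" "-ir \<le> x" "-ll \<le> x - y"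
    using A unfolding p octagon_pt by auto
  have i: "i mod 8 < 8" by simp
  have A0: "mid (i mod 8) \<bullet> pt x y = ir * ir" using A p by (simp add: mid_mod)
  have "pt x y \<in> oct_side (i mod 8)"
    using less_8[OF i]
  proof (elim disjE)
    assume k: "i mod 8 = 0"
    from A0 have e: "y = ir" unfolding k mid_le_iff by linarith
    show ?thesis unfolding k oct_side_values e using B[unfolded e] hs_pos d
      by (intro segment_x) (auto simp: field_simps)
  next
    assume k: "i mod 8 = 1"
    from A0 have e: "y = ll - x" unfolding k mid_le_iff by linarith
    define u where "u = (x - hs) / (ir - hs)"
    have "u * (ir - hs) = x - hs" "0 \<le> u" "u \<le> 1" using d B[unfolded e] by (auto simp: u_def)
    then show ?thesis unfolding k oct_side_values e by (intro segment_u[of u]) (simp_all add: algebra_simps)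
  next
    assume k: "i mod 8 = 2"
    from A0 have e: "x = ir" unfolding k mid_le_iff by linarith
    show ?thesis unfolding k oct_side_values e using B[unfolded e] hs_pos d
      by (intro segment_y) (auto simp: field_simps)
  next
    assume k: "i mod 8 = 3"
    from A0 have e: "y = x - ll" unfolding k mid_le_iff by linarith
    define u where "u = (ir - x) / (ir - hs)"
    have "u * (ir - hs) = ir - x" "0 \<le> u" "u \<le> 1" using d B[unfolded e] by (auto simp: u_def)
    then show ?thesis unfolding k oct_side_values e by (intro segment_u[of u]) (simp_all add: algebra_simps)
  next
    assume k: "i mod 8 = 4"
    from A0 have e: "y = - ir" unfolding k mid_le_iff by linarith
    show ?thesis unfolding k oct_side_values e using B[unfolded e] hs_pos d
      by (intro segment_x) (auto simp: field_simps)
  next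
    assume k: "i mod 8 = 5"
    from A0 have e: "y = - ll - x" unfolding k mid_le_iff by linarith
    define u where "u = (- hs - x) / (ir - hs)"
    have "u * (ir - hs) = - hs - x" "0 \<le> u" "u \<le> 1" using d B[unfolded e] by (auto simp: u_def)
    then show ?thesis unfolding k oct_side_values e by (intro segment_u[of u]) (simp_all add: algebra_simps)
  next
    assume k: "i mod 8 = 6"
    from A0 have e: "x = - ir" unfolding k mid_le_iff by linarith
    show ?thesis unfolding k oct_side_values e using B[unfolded e] hs_pos d
      by (intro segment_y) (auto simp: field_simps)
  next
    assume k: "i mod 8 = 7"
    from A0 have e: "y = ll + x" unfolding k mid_le_iff by linarith
    define u where "u = (x + ir) / (ir - hs)"
    have "u * (ir - hs) = x + ir" "0 \<le> u" "u \<le> 1" using d B[unfolded e] by (auto simp: u_def)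
    then show ?thesis unfolding k oct_side_values e by (intro segment_u[of u]) (simp_all add: algebra_simps)
  qed
  then show "p \<in> oct_side i" by (simp add: oct_side_mod p)
qed

lemma octagon_cases:
  assumes "p \<in> octagon"
  obtains "oct_int p" | i where "i < 8" "edge_pt i p" | i where "i < 8" "p = oct_vertex i"
proof (cases "oct_int p")
  case False
  then obtain i where i: "i < 8" "mid i \<bullet> p = ir * ir"
    using assms by (force simp: oct_int_def octagon_iff)
  then have "p \<in> oct_side i" using assms oct_side_iff by simp
  then obtain u where u: "0 \<le> u" "u \<le> 1" "p = (1 - u) *\<^sub>R oct_vertex i + u *\<^sub>R oct_vertex (Suc i)"
    unfolding oct_side_def in_segment by blast
  consider "u = 0" | "u = 1" | "0 < u" "u < 1" using u by linarith
  then show ?thesis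
  proof cases
    case 1 then show ?thesis using u that(3) i by simp
  next
    case 2 then show ?thesis using u that(3)[of "Suc i mod 8"] i by (simp add: oct_vertex_mod)
  next
    case 3
    have "mid j \<bullet> p < ir * ir" if j: "j < 8" "j \<noteq> i mod 8" for j
    proof -
      have "\<not> (mid j \<bullet> oct_vertex i = ir * ir \<and> mid j \<bullet> oct_vertex (Suc i) = ir * ir)"
      proof -
        have "mid j \<bullet> oct_vertex i = ir * ir \<longleftrightarrow> i = (j + 1) mod 8"
          using mid_vertex[OF i(1) j(1)] j i by auto
        moreover have "mid j \<bullet> oct_vertex (Suc i) = ir * ir \<longleftrightarrow> j = Suc i mod 8 \<or> Suc i mod 8 = (j + 1) mod 8"
          using mid_vertex[of "Suc i mod 8" j] j by (simp add: oct_vertex_mod)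
        ultimately show ?thesis using j i less_8[OF i(1)] less_8[OF j(1)] by (elim disjE; simp)
      qed
      then have l: "mid j \<bullet> oct_vertex i < ir * ir \<or> mid j \<bullet> oct_vertex (Suc i) < ir * ir"
        using vertex_mid[of j i] vertex_mid[of j "Suc i"] by linarith
      have "(1 - u) * (mid j \<bullet> oct_vertex i) \<le> (1 - u) * (ir * ir)" "u * (mid j \<bullet> oct_vertex (Suc i)) \<le> u * (ir * ir)"
        using 3 vertex_mid by (auto intro!: mult_left_mono)
      moreover have "(1 - u) * (mid j \<bullet> oct_vertex i) < (1 - u) * (ir * ir) \<or> u * (mid j \<bullet> oct_vertex (Suc i)) < u * (ir * ir)"
        using 3 l by (auto simp: mult_less_cancel_left_pos)
      ultimately have "(1 - u) * (mid j \<bullet> oct_vertex i) + u * (mid j \<bullet> oct_vertex (Suc i)) < (1 - u) * (ir * ir) + u * (ir * ir)"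
        by linarith
      also have "\<dots> = ir * ir" by (simp add: algebra_simps)
      finally show ?thesis unfolding u(3) by (simp add: inner_add_right)
    qed
    then show ?thesis using that(2)[of i] i by (simp add: edge_pt_def)
  qed
qed (use that in blast)

lemma mid_norm: "mid i \<bullet> mid i = ir * ir"
proof -
  have "mid i \<bullet> mid i = (1/2) * (mid i \<bullet> oct_vertex i + mid i \<bullet> oct_vertex (Suc i))"
    by (subst (2) mid_def) (simp add: inner_add_right)
  then show ?thesis by (simp add: vertex_on_side)
qed

lemma mid_inner_less: assumes "i < 8" "j < 8" "i \<noteq> j" shows "mid j \<bullet> mid i < ir * ir"
proof -
  have "mid j \<bullet> mid i \<le> ir * ir" using vertex_mid[of j i] vertex_mid[of j "Suc i"]
    by (simp add: mid_def[of i] inner_add_right)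
  moreover have "mid j \<bullet> mid i \<noteq> ir * ir"
  proof
    assume "mid j \<bullet> mid i = ir * ir"
    then have "(mid j - mid i) \<bullet> (mid j - mid i) = 0"
      by (simp add: inner_diff_left inner_diff_right mid_norm inner_commute)
    then have "mid j = mid i" by simp
    then have "mid j \<bullet> oct_vertex i = ir * ir" "mid j \<bullet> oct_vertex (Suc i mod 8) = ir * ir"
      by (simp_all add: vertex_on_side oct_vertex_mod)
    then have "j = i \<or> i = (j + 1) mod 8" "j = Suc i mod 8 \<or> Suc i mod 8 = (j + 1) mod 8"
      using mid_vertex[of i j] mid_vertex[of "Suc i mod 8" j] assms by simp_all
    moreover have "\<forall>i<8. \<forall>j<8. i \<noteq> j \<longrightarrow> \<not> ((j = i \<or> i = (j + 1) mod 8) \<and> (j = Suc i mod 8 \<or> Suc i mod 8 = (j + 1) mod 8))"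
      unfolding all8 by simp
    ultimately show False using assms by blast
  qed
  ultimately show ?thesis by simp
qed

lemma edge_pt_unique: "edge_pt i p \<Longrightarrow> mid j \<bullet> p = ir * ir \<Longrightarrow> j mod 8 = i mod 8"
proof (rule ccontr)
  assume e: "edge_pt i p" "mid j \<bullet> p = ir * ir" and "j mod 8 \<noteq> i mod 8"
  then have "mid (j mod 8) \<bullet> p < ir * ir" by (simp add: edge_pt_def)
  then show False using e by (simp add: mid_mod)
qed

lemma edge_pt_mod: "edge_pt (i mod 8) p = edge_pt i p"
  by (simp add: edge_pt_def mid_mod)

lemma vertex_not_edge: "\<not> edge_pt i (oct_vertex k)"
proof
  assume e: "edge_pt i (oct_vertex k)"
  have "oct_vertex (Suc (k + 7)) = oct_vertex k" using oct_vertex_8[of k] by (simp add: add.commute)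
  then have "mid (k + 7) \<bullet> oct_vertex k = ir * ir" using vertex_on_side(2)[of "k + 7"] by simp
  then have "k mod 8 = i mod 8" "(k + 7) mod 8 = i mod 8"
    using e vertex_on_side(1)[of k] edge_pt_unique by blast+
  then show False using mod_eq_dvd_iff_nat[of k "k + 7" 8] by simp
qed

lemma side_cases:
  assumes "p \<in> octagon" "mid i \<bullet> p = ir * ir"
  obtains "edge_pt i p" | "p = oct_vertex i" | "p = oct_vertex (Suc i)"
  using assms(1)
proof (cases rule: octagon_cases)
  case 1
  moreover have "mid (i mod 8) \<bullet> p = ir * ir" using assms by (simp add: mid_mod)
  ultimately show ?thesis unfolding oct_int_def by (metis less_irrefl mod_less_divisor zero_less_numeral)
next
  case (2 k)
  then have "i mod 8 = k mod 8" using edge_pt_unique assms by blast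
  then show ?thesis using that(1) 2 edge_pt_mod by metis
next
  case (3 k)
  have "mid (i mod 8) \<bullet> oct_vertex k = ir * ir" using assms 3 by (simp add: mid_mod)
  then have "i mod 8 = k \<or> k = (i mod 8 + 1) mod 8" using mid_vertex[of k "i mod 8"] 3 by simp
  then have "oct_vertex k = oct_vertex i \<or> oct_vertex k = oct_vertex (Suc i)"
    using oct_vertex_mod[of i] oct_vertex_mod[of "Suc i"] by (auto simp: mod_simps)
  then show ?thesis using that 3 by blast
qed

lemma edge_pt_opposite: assumes "edge_pt i p" shows "edge_pt (i + 4) (p - 2 *\<^sub>R mid i)"
proof -
  have 1: "mid i \<bullet> p = ir * ir" using assms by (simp add: edge_pt_def)
  have p: "p \<in> octagon" using assms edge_pt_octagon by blast
  have side: "p - 2 *\<^sub>R mid i \<in> oct_side (i + 4)"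
    using oct_side_glue[of p i] 1 p by (simp add: oct_side_iff glue_vec_mid)
  have "p = oct_vertex (Suc i)" if "p - 2 *\<^sub>R mid i = oct_vertex (i + 4)"
    using that oct_vertex_4[of i] by (simp add: mid_def algebra_simps)
  moreover have "p = oct_vertex i" if "p - 2 *\<^sub>R mid i = oct_vertex (Suc (i + 4))"
    using that oct_vertex_4[of "Suc i"] by (simp add: mid_def algebra_simps)
  moreover have "p - 2 *\<^sub>R mid i \<in> octagon" "mid (i + 4) \<bullet> (p - 2 *\<^sub>R mid i) = ir * ir"
    using side by (auto simp: oct_side_iff)
  ultimately show ?thesis using vertex_not_edge assms by (metis side_cases)
qed

lemma edge_pt_inner: "edge_pt i p \<Longrightarrow> \<not> oct_int p"
  unfolding oct_int_def edge_pt_def by (metis less_irrefl mid_mod mod_less_divisor zero_less_numeral)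

lemma glue_closed:
  assumes K: "\<And>p q. p \<in> K \<Longrightarrow> (p, q) \<in> glue_step \<Longrightarrow> q \<in> K"
    and "\<And>q. q \<in> K \<Longrightarrow> q \<in> octagon \<and> (p, q) \<in> glue_step\<^sup>*" "p \<in> K"
  shows "glue `` {p} = K"
proof -
  have "q \<in> K" if "(p, q) \<in> glue_step\<^sup>*" for q
    using that by induction (use assms in auto)
  then show ?thesis using assms by (auto simp: glue_def)
qed

lemma glue_step_iff: "(p, q) \<in> glue_step \<longleftrightarrow> (\<exists>i. p \<in> octagon \<and> mid i \<bullet> p = ir * ir \<and> q = p - 2 *\<^sub>R mid i)"
  by (auto simp: glue_step_def oct_side_iff glue_vec_mid)

lemma class_int: "oct_int p \<Longrightarrow> glue `` {p} = {p}"
  by (rule glue_closed) (auto simp: glue_step_iff oct_int_octagon oct_int_def,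
    metis less_irrefl mid_mod mod_less_divisor zero_less_numeral)

lemma mid_eq: "i mod 8 = j mod 8 \<Longrightarrow> mid i = mid j" by (metis mid_mod)

lemma class_edge: "edge_pt i p \<Longrightarrow> glue `` {p} = {p, p - 2 *\<^sub>R mid i}"
proof (rule glue_closed)
  assume e: "edge_pt i p"
  have o: "edge_pt (i + 4) (p - 2 *\<^sub>R mid i)" by (rule edge_pt_opposite[OF e])
  fix a b assume ab: "a \<in> {p, p - 2 *\<^sub>R mid i}" "(a, b) \<in> glue_step"
  then obtain j where j: "mid j \<bullet> a = ir * ir" "b = a - 2 *\<^sub>R mid j" by (auto simp: glue_step_iff)
  show "b \<in> {p, p - 2 *\<^sub>R mid i}"
  proof (cases "a = p")
    case True
    then have "mid j = mid i" using j edge_pt_unique[OF e] mid_eq by blast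
    then show ?thesis using j True by simp
  next
    case False
    then have a: "a = p - 2 *\<^sub>R mid i" using ab by simp
    then have "mid j = mid (i + 4)" using j edge_pt_unique[OF o] mid_eq by blast
    then show ?thesis using j a by (simp add: mid_4)
  qed
next
  assume e: "edge_pt i p"
  fix q assume "q \<in> {p, p - 2 *\<^sub>R mid i}"
  moreover have "(p, p - 2 *\<^sub>R mid i) \<in> glue_step"
    using e edge_pt_octagon by (auto simp: glue_step_iff edge_pt_def)
  ultimately show "q \<in> octagon \<and> (p, q) \<in> glue_step\<^sup>*"
    using e edge_pt_octagon edge_pt_opposite[OF e] by auto
qed simp

lemma glue_step_vertex: "(oct_vertex i, oct_vertex (i + 5)) \<in> glue_step" "(oct_vertex (Suc i), oct_vertex (i + 4)) \<in> glue_step"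
proof -
  have "oct_vertex (i + 5) = oct_vertex i - 2 *\<^sub>R mid i"
    using oct_vertex_4[of "Suc i"] by (simp add: mid_def scaleR_add_right algebra_simps)
  then show "(oct_vertex i, oct_vertex (i + 5)) \<in> glue_step"
    unfolding glue_step_iff using octagon_vertex vertex_on_side by blast
  have "oct_vertex (i + 4) = oct_vertex (Suc i) - 2 *\<^sub>R mid i"
    using oct_vertex_4[of i] by (simp add: mid_def scaleR_add_right algebra_simps)
  then show "(oct_vertex (Suc i), oct_vertex (i + 4)) \<in> glue_step"
    unfolding glue_step_iff using octagon_vertex vertex_on_side by blast
qed

text \<open>The gluings of the two sides at vertex \<open>i\<close> take it to the vertices \<open>i + 5\<close> and \<open>i + 3\<close>; as \<open>5\<close> is invertible modulo \<open>8\<close>, all vertices are glued together.\<close>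

lemma singular_point_eq: "singular_point = range oct_vertex"
  unfolding singular_point_def
proof (rule glue_closed)
  fix p q assume "p \<in> range oct_vertex" "(p, q) \<in> glue_step"
  then obtain k i where k: "p = oct_vertex k" and i: "mid i \<bullet> p = ir * ir" "q = p - 2 *\<^sub>R mid i" "p \<in> octagon"
    by (auto simp: glue_step_iff)
  from i(3,1) show "q \<in> range oct_vertex"
  proof (cases rule: side_cases)
    case 1 then show ?thesis using vertex_not_edge k by blast
  next
    case 2 then have "q = oct_vertex (i + 5)" using i oct_vertex_4[of "Suc i"] by (simp add: mid_def scaleR_add_right algebra_simps)
    then show ?thesis by blast
  next
    case 3 then have "q = oct_vertex (i + 4)" using i oct_vertex_4[of "i"] by (simp add: mid_def scaleR_add_right algebra_simps)
    then show ?thesis by blast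
  qed
next
  have s: "(oct_vertex 0, oct_vertex (5 * n)) \<in> glue_step\<^sup>*" for n
  proof (induction n)
    case (Suc n)
    then show ?case using glue_step_vertex(1)[of "5 * n"] by (simp add: algebra_simps rtrancl.rtrancl_into_rtrancl)
  qed simp
  fix q assume "q \<in> range oct_vertex"
  then obtain k where q: "q = oct_vertex k" by blast
  have "5 * (5 * k) = k + 8 * (3 * k)" by simp
  then have "(5 * (5 * k)) mod 8 = k mod 8" by (simp only: mod_mult_self2)
  then have "oct_vertex (5 * (5 * k)) = oct_vertex k" by (metis oct_vertex_mod)
  then show "q \<in> octagon \<and> (oct_vertex 0, q) \<in> glue_step\<^sup>*"
    using s[of "5 * k"] q octagon_vertex by auto
qed simp

abbreviation regular :: "surface_point set" where "regular \<equiv> octagon_surface - {singular_point}"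

lemma surfaceI: "p \<in> octagon \<Longrightarrow> glue `` {p} \<in> octagon_surface"
  by (auto simp: octagon_surface_def quotient_def)

lemma surface_class: "x \<in> octagon_surface \<Longrightarrow> p \<in> x \<Longrightarrow> x = glue `` {p} \<and> p \<in> octagon"
proof -
  assume "x \<in> octagon_surface" "p \<in> x"
  then obtain q where "x = glue `` {q}" "(q, p) \<in> glue" unfolding octagon_surface_def by (auto elim!: quotientE)
  then show ?thesis using equiv_class_eq[OF equiv_glue] by (auto simp: glue_def)
qed

lemma surface_nonempty: "x \<in> octagon_surface \<Longrightarrow> \<exists>p. p \<in> x"
  unfolding octagon_surface_def using equiv_class_self[OF equiv_glue] by (auto elim!: quotientE)

lemma surface_eqI: "x \<in> octagon_surface \<Longrightarrow> y \<in> octagon_surface \<Longrightarrow> p \<in> x \<Longrightarrow> p \<in> y \<Longrightarrow> x = y"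
  using surface_class by metis

lemma singular_surface: "singular_point \<in> octagon_surface"
  unfolding singular_point_def using surfaceI octagon_vertex by blast

lemma int_regular: "oct_int p \<Longrightarrow> {p} \<in> regular"
proof -
  assume p: "oct_int p"
  then have "{p} \<in> octagon_surface" using surfaceI[OF oct_int_octagon[OF p]] class_int by simp
  moreover have "p \<notin> range oct_vertex" using p vertex_on_side(1)
    unfolding oct_int_def by (metis less_irrefl mid_mod mod_less_divisor rangeE zero_less_numeral)
  ultimately show ?thesis unfolding singular_point_eq by auto
qed

lemma edge_regular: "edge_pt i p \<Longrightarrow> {p, p - 2 *\<^sub>R mid i} \<in> regular"
  using surfaceI[OF edge_pt_octagon] class_edge vertex_not_edge unfolding singular_point_eq
  by (metis DiffI insertI1 rangeE singletonD)

lemma regular_cases: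
  assumes "x \<in> regular" "p \<in> x"
  obtains "oct_int p" "x = {p}" | i where "i < 8" "edge_pt i p" "x = {p, p - 2 *\<^sub>R mid i}"
proof -
  have x: "x = glue `` {p}" "p \<in> octagon" using surface_class assms by auto
  from x(2) show ?thesis
  proof (cases rule: octagon_cases)
    case (3 k)
    then have "p \<in> singular_point" by (simp add: singular_point_eq)
    then show ?thesis using assms surface_eqI singular_surface by blast
  qed (use that x class_int class_edge in auto)
qed

lemma regular_finite: "x \<in> octagon_surface \<Longrightarrow> finite x"
proof (cases "x = singular_point")
  case True
  have "range oct_vertex = oct_vertex ` {..<8}"
  proof safe
    fix i show "oct_vertex i \<in> oct_vertex ` {..<8}"
      using oct_vertex_mod[of i, symmetric] by (intro image_eqI[of _ _ "i mod 8"]) auto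
  qed auto
  then show ?thesis using True by (simp add: singular_point_eq)
next
  case False
  assume "x \<in> octagon_surface"
  then show ?thesis using False surface_nonempty regular_cases
    by (metis DiffI finite.emptyI finite_insert singletonD)
qed

section \<open>Straight paths\<close>

lemma small_scale:
  fixes P :: "real^2 \<Rightarrow> bool"
  assumes "\<forall>\<^sub>F v in nhds 0. P v" shows "\<forall>\<^sub>F u in nhds 0. P (u *\<^sub>R v)"
proof -
  have "((\<lambda>u::real. u *\<^sub>R v) \<longlongrightarrow> 0 *\<^sub>R v) (nhds 0)"
    by (intro tendsto_intros filterlim_ident)
  then have "filterlim (\<lambda>u::real. u *\<^sub>R v) (nhds 0) (nhds 0)" by simp
  from eventually_compose_filterlim[OF assms this] show ?thesis .
qed

lemma small_ball:
  fixes P :: "'a::real_normed_vector \<Rightarrow> bool"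
  shows "(\<forall>\<^sub>F v in nhds 0. P v) \<longleftrightarrow> (\<exists>e>0. \<forall>v. norm v < e \<longrightarrow> P v)"
  by (simp add: eventually_nhds_metric dist_norm)

lemma closed_octagon: "closed octagon"
proof -
  have "octagon = (\<Inter>i\<in>{..<8}. {p. mid i \<bullet> p \<le> ir * ir})" by (auto simp: octagon_iff)
  moreover have "closed (\<Inter>i\<in>{..<8}. {p. mid i \<bullet> p \<le> ir * ir})" by (intro closed_INT ballI closed_halfspace_le)
  ultimately show ?thesis by simp
qed

lemma bounded_octagon: "p \<in> octagon \<Longrightarrow> norm p \<le> 2"
proof -
  assume "p \<in> octagon"
  then have "pt (p $ 1) (p $ 2) \<in> octagon" by (simp add: pt_collapse)
  then have "\<bar>p $ 1\<bar> \<le> ir" "\<bar>p $ 2\<bar> \<le> ir" by (auto simp: octagon_pt)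
  moreover have "ir \<le> 1" by (simp add: ir_def)
  ultimately have "\<bar>p $ 1\<bar> + \<bar>p $ 2\<bar> \<le> 2" by linarith
  then show ?thesis using norm_le_l1_cart[of p] by (simp add: sum_2)
qed

lemma near_octagon:
  assumes "finite X"
  shows "\<forall>\<^sub>F v in nhds 0. \<forall>p\<in>X. p + v \<in> octagon \<longrightarrow> p \<in> octagon"
proof -
  have "\<forall>\<^sub>F v in nhds 0. p + v \<in> octagon \<longrightarrow> p \<in> octagon" for p
  proof (cases "p \<in> octagon")
    case False
    have "open (- octagon)" using closed_octagon by (simp add: open_Compl)
    then obtain e where e: "e > 0" "\<forall>y. dist y p < e \<longrightarrow> y \<in> - octagon"
      using False by (meson ComplI open_dist)
    then show ?thesis unfolding small_ball by (intro exI[of _ e]) (auto simp: dist_norm)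
  qed simp
  then show ?thesis using assms by (simp add: eventually_ball_finite)
qed

lemma finite_separated:
  fixes X :: "'a::real_normed_vector set"
  assumes "finite X" shows "\<exists>d>0. \<forall>p\<in>X. \<forall>q\<in>X. norm (p - q) < d \<longrightarrow> p = q"
proof -
  have "\<exists>d>0. \<forall>q\<in>X. q \<noteq> p \<longrightarrow> d \<le> dist p q" for p
    using finite_set_avoid[OF assms, of p] by blast
  then obtain d where d: "\<And>p. d p > 0" "\<And>p q. q \<in> X \<Longrightarrow> q \<noteq> p \<Longrightarrow> d p \<le> dist p q" by metis
  show ?thesis
  proof (cases "X = {}")
    case False
    let ?d = "Min (d ` X)"
    have "?d > 0" using False assms d by simp
    moreover have "p = q" if "p \<in> X" "q \<in> X" "norm (p - q) < ?d" for p q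
    proof (rule ccontr)
      assume "p \<noteq> q"
      then have "d p \<le> dist p q" using d that by metis
      moreover have "?d \<le> d p" using assms that by simp
      ultimately show False using that by (simp add: dist_norm)
    qed
    ultimately show ?thesis by blast
  qed (auto intro: exI[of _ 1])
qed

lemma plus_plus:
  assumes "finite x"
  shows "\<forall>\<^sub>F u in nhds 0. surface_plus (surface_plus x v) u = surface_plus x (v + u)"
proof -
  have "finite ((\<lambda>p. p + v) ` x)" using assms by simp
  from near_octagon[OF this] show ?thesis
  proof eventually_elim
    case (elim u)
    then show ?case by (auto simp: surface_plus_def image_iff add.assoc)
  qed
qed

lemma oct_int_open: "oct_int p \<Longrightarrow> \<forall>\<^sub>F v in nhds 0. oct_int (p + v)"
proof -
  assume p: "oct_int p"
  have "open {p. mid i \<bullet> p < ir * ir}" for i by (rule open_halfspace_lt)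
  then have "open (\<Inter>i\<in>{..<8}. {p. mid i \<bullet> p < ir * ir})" by blast
  moreover have "(\<Inter>i\<in>{..<8}. {p. mid i \<bullet> p < ir * ir}) = {p. oct_int p}" by (auto simp: oct_int_def)
  ultimately have "open {p. oct_int p}" by simp
  then obtain e where "e > 0" "\<forall>y. dist y p < e \<longrightarrow> oct_int y" using p by (force simp: open_dist)
  then show ?thesis unfolding small_ball by (intro exI[of _ e]) (auto simp: dist_norm)
qed

lemma mid_i_less: "mid j \<bullet> p < c \<Longrightarrow> \<forall>\<^sub>F v in nhds 0. mid j \<bullet> (p + v) < c"
proof -
  assume a: "mid j \<bullet> p < c"
  have "open {p. mid j \<bullet> p < c}" by (rule open_halfspace_lt)
  then obtain e where "e > 0" "\<forall>y. dist y p < e \<longrightarrow> mid j \<bullet> y < c" using a by (force simp: open_dist)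
  then show ?thesis unfolding small_ball by (intro exI[of _ e]) (auto simp: dist_norm)
qed

text \<open>For a point inside a side only the inequality of this side matters for small displacements.\<close>

lemma edge_near:
  assumes "edge_pt i p"
  shows "\<forall>\<^sub>F v in nhds 0. (mid i \<bullet> v < 0 \<longrightarrow> oct_int (p + v)) \<and> (mid i \<bullet> v = 0 \<longrightarrow> edge_pt i (p + v)) \<and>
     (mid i \<bullet> v > 0 \<longrightarrow> p + v \<notin> octagon)"
proof -
  have "\<forall>\<^sub>F v in nhds 0. \<forall>j\<in>{..<8} - {i mod 8}. mid j \<bullet> (p + v) < ir * ir"
    using assms by (intro eventually_ball_finite ballI mid_i_less) (auto simp: edge_pt_def)
  then show ?thesis
  proof eventually_elim
    case (elim v)
    have m: "mid i \<bullet> (p + v) = ir * ir + mid i \<bullet> v" using assms by (simp add: edge_pt_def inner_add_right)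
    have "p + v \<notin> octagon" if "mid i \<bullet> v > 0" using mid_le[of "p + v" i] m that by auto
    moreover have "edge_pt i (p + v)" if "mid i \<bullet> v = 0" using m that elim by (auto simp: edge_pt_def)
    moreover have "oct_int (p + v)" if "mid i \<bullet> v < 0"
      unfolding oct_int_def using elim m that mid_mod[of i] by (metis Diff_iff add_less_same_cancel1 insertE lessThan_iff empty_iff)
    ultimately show ?case by blast
  qed
qed

lemma regular_plus:
  assumes "x \<in> regular" shows "\<forall>\<^sub>F v in nhds 0. surface_plus x v \<in> regular"
proof -
  obtain p where p: "p \<in> x" using assms surface_nonempty by auto
  from assms p show ?thesis
  proof (cases rule: regular_cases)
    case 1
    then have "\<forall>\<^sub>F v in nhds 0. oct_int (p + v)" using oct_int_open by blast
    then show ?thesis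
    proof eventually_elim
      case (elim v)
      then have "surface_plus x v = {p + v}" using 1 oct_int_octagon by (auto simp: surface_plus_def)
      then show ?case using int_regular elim by simp
    qed
  next
    case (2 i)
    let ?q = "p - 2 *\<^sub>R mid i"
    have q: "edge_pt (i + 4) ?q" using edge_pt_opposite 2 by blast
    from edge_near[OF 2(2)] edge_near[OF q] show ?thesis
    proof eventually_elim
      case (elim v)
      have x: "surface_plus x v = {p + v, ?q + v} \<inter> octagon" using 2 by (auto simp: surface_plus_def)
      consider "mid i \<bullet> v < 0" | "mid i \<bullet> v = 0" | "mid i \<bullet> v > 0" by linarith
      then show ?case
      proof cases
        case 1
        then have "surface_plus x v = {p + v}" "oct_int (p + v)"
          using elim unfolding x mid_4 using oct_int_octagon by auto
        then show ?thesis using int_regular by simp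
      next
        case 2
        then have "surface_plus x v = {p + v, p + v - 2 *\<^sub>R mid i}" "edge_pt i (p + v)"
          using elim edge_pt_octagon unfolding x mid_4 by (auto simp: algebra_simps)
        then show ?thesis using edge_regular by simp
      next
        case 3
        then have "surface_plus x v = {?q + v}" "oct_int (?q + v)"
          using elim unfolding x mid_4 using oct_int_octagon by auto
        then show ?thesis using int_regular by simp
      qed
    qed
  qed
qed

text \<open>Besides whole trajectories, paths over intervals are needed, to follow a line up to the singular point.\<close>

definition straight :: "real set \<Rightarrow> real^2 \<Rightarrow> (real \<Rightarrow> surface_point) \<Rightarrow> bool" where
  "straight I v f \<longleftrightarrow> (\<forall>t\<in>I. f t \<in> octagon_surface \<and> (\<forall>\<^sub>F u in nhds 0. f (t + u) = surface_plus (f t) (u *\<^sub>R v)))"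

definition traj :: "real^2 \<Rightarrow> (real \<Rightarrow> surface_point) \<Rightarrow> bool" where
  "traj v f \<longleftrightarrow> (\<forall>t. f t \<in> regular) \<and> straight UNIV v f"

lemma linear_trajectory_iff:
  "linear_trajectory \<theta> \<tau> \<longleftrightarrow> (\<exists>c. c \<noteq> 0 \<and> traj (c *\<^sub>R pt (cos \<theta>) (sin \<theta>)) \<tau>)"
proof -
  have e: "(c * u) *\<^sub>R p = u *\<^sub>R (c *\<^sub>R p)" for c u and p :: "real^2" by simp
  have "straight UNIV v \<tau> \<longleftrightarrow> (\<forall>t. \<forall>\<^sub>F u in nhds 0. \<tau> (t + u) = surface_plus (\<tau> t) (u *\<^sub>R v))"
    if "\<forall>t. \<tau> t \<in> regular" for v using that by (simp add: straight_def)
  then have "traj v \<tau> \<longleftrightarrow> (\<forall>t. \<tau> t \<in> regular) \<and> (\<forall>t. \<forall>\<^sub>F u in nhds 0. \<tau> (t + u) = surface_plus (\<tau> t) (u *\<^sub>R v))" for v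
    by (cases "\<forall>t. \<tau> t \<in> regular") (auto simp only: traj_def)
  then show ?thesis unfolding linear_trajectory_def e by auto
qed

lemma trajD: "traj v f \<Longrightarrow> \<forall>\<^sub>F u in nhds 0. f (t + u) = surface_plus (f t) (u *\<^sub>R v)"
  by (simp add: traj_def straight_def)

lemma trajI:
  "(\<And>t. f t \<in> regular) \<Longrightarrow> (\<And>t. \<forall>\<^sub>F u in nhds 0. f (t + u) = surface_plus (f t) (u *\<^sub>R v)) \<Longrightarrow> traj v f"
  by (simp add: traj_def straight_def)

lemma straight_subset: "straight I v f \<Longrightarrow> J \<subseteq> I \<Longrightarrow> straight J v f" by (auto simp: straight_def)

lemma straight_regular: "traj v f \<Longrightarrow> f t \<in> regular" by (simp add: traj_def)

lemma traj_straight: "traj v f \<Longrightarrow> straight I v f" by (auto simp: traj_def straight_def)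

lemma ev_nhds_0_nonzero:
  fixes P :: "real \<Rightarrow> bool"
  assumes "\<forall>\<^sub>F u in nhds 0. P u" shows "\<exists>e>0. \<forall>u. \<bar>u\<bar> < e \<longrightarrow> P u"
  using assms unfolding small_ball by simp

text \<open>The times at which two paths agree form an open set by the local law, and so do the times at which they differ, since the class \<open>f r\<close> can be recovered from any point of \<open>f s\<close> for \<open>s\<close> near \<open>r\<close>.  The interval is connected.\<close>

lemma straight_unique:
  assumes f: "straight {a<..<b} v f" and g: "straight {a<..<b} v g"
    and c: "c \<in> {a<..<b}" "f c = g c" and t: "t \<in> {a<..<b}"
  shows "f t = g t"
proof (rule ccontr)
  assume ne: "f t \<noteq> g t"
  let ?E = "{s \<in> {a<..<b}. f s = g s}" and ?N = "{s \<in> {a<..<b}. f s \<noteq> g s}"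
  have local: "\<exists>e>0. \<forall>s. \<bar>s - r\<bar> < e \<longrightarrow> (s \<in> {a<..<b} \<and> (f s = g s \<longleftrightarrow> f r = g r))" if r: "r \<in> {a<..<b}" for r
  proof -
    have "\<forall>\<^sub>F u in nhds 0. f (r + u) = surface_plus (f r) (u *\<^sub>R v)" using f r by (auto simp: straight_def)
    from ev_nhds_0_nonzero[OF this] obtain e1 where e1: "e1 > 0" "\<And>u. \<bar>u\<bar> < e1 \<Longrightarrow> f (r + u) = surface_plus (f r) (u *\<^sub>R v)" by blast
    have "\<forall>\<^sub>F u in nhds 0. g (r + u) = surface_plus (g r) (u *\<^sub>R v)" using g r by (auto simp: straight_def)
    from ev_nhds_0_nonzero[OF this] obtain e2 where e2: "e2 > 0" "\<And>u. \<bar>u\<bar> < e2 \<Longrightarrow> g (r + u) = surface_plus (g r) (u *\<^sub>R v)" by blast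
    define e where "e = min (min e1 e2) (min (r - a) (b - r))"
    have "s \<in> {a<..<b} \<and> (f s = g s \<longleftrightarrow> f r = g r)" if s: "\<bar>s - r\<bar> < e" for s
    proof -
      have se: "\<bar>s - r\<bar> < e1" "\<bar>s - r\<bar> < e2" "\<bar>s - r\<bar> < r - a" "\<bar>s - r\<bar> < b - r" using s by (auto simp: e_def)
      have sab: "s \<in> {a<..<b}" using se by auto
      have fs: "f s = surface_plus (f r) ((s - r) *\<^sub>R v)" "g s = surface_plus (g r) ((s - r) *\<^sub>R v)"
        using e1(2)[of "s - r"] e2(2)[of "s - r"] se by auto
      moreover have "f r = g r" if eq: "f s = g s"
      proof -
        have "f s \<in> octagon_surface" using f sab by (simp add: straight_def)
        then obtain q where q: "q \<in> f s" using surface_nonempty by blast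
        then have "q \<in> surface_plus (f r) ((s - r) *\<^sub>R v)" "q \<in> surface_plus (g r) ((s - r) *\<^sub>R v)"
          using fs eq by simp_all
        then have "q - (s - r) *\<^sub>R v \<in> f r" "q - (s - r) *\<^sub>R v \<in> g r"
          by (auto simp: surface_plus_def)
        moreover have "f r \<in> octagon_surface" "g r \<in> octagon_surface" using f g r by (auto simp: straight_def)
        ultimately show ?thesis using surface_eqI by blast
      qed
      ultimately show ?thesis using sab by metis
    qed
    moreover have "e > 0" using e1(1) e2(1) r by (auto simp: e_def)
    ultimately show ?thesis by blast
  qed
  have "\<exists>e>0. \<forall>s. \<bar>s - r\<bar> < e \<longrightarrow> s \<in> ?E" if "r \<in> ?E" for r
  proof -
    have "r \<in> {a<..<b}" using that by simp
    from local[OF this] obtain e where "e > 0" "\<forall>s. \<bar>s - r\<bar> < e \<longrightarrow> (s \<in> {a<..<b} \<and> (f s = g s \<longleftrightarrow> f r = g r))" by blast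
    then show ?thesis using that by (metis (mono_tags, lifting) mem_Collect_eq)
  qed
  then have oE: "open ?E" by (simp only: open_dist dist_real_def) simp
  have "\<exists>e>0. \<forall>s. \<bar>s - r\<bar> < e \<longrightarrow> s \<in> ?N" if "r \<in> ?N" for r
  proof -
    have "r \<in> {a<..<b}" using that by simp
    from local[OF this] obtain e where "e > 0" "\<forall>s. \<bar>s - r\<bar> < e \<longrightarrow> (s \<in> {a<..<b} \<and> (f s = g s \<longleftrightarrow> f r = g r))" by blast
    then show ?thesis using that by (metis (mono_tags, lifting) mem_Collect_eq)
  qed
  then have oN: "open ?N" by (simp only: open_dist dist_real_def) simp
  note oE oN
  moreover have "connected {a<..<b}" by simp
  moreover have "?E \<inter> ?N \<inter> {a<..<b} = {}" "{a<..<b} \<subseteq> ?E \<union> ?N" by auto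
  ultimately have "?E \<inter> {a<..<b} = {} \<or> ?N \<inter> {a<..<b} = {}" unfolding connected_def by blast
  then show False using c t ne by auto
qed

lemma traj_unique: "traj v f \<Longrightarrow> traj v g \<Longrightarrow> f c = g c \<Longrightarrow> f t = g t"
  using straight_unique[of "min c t - 1" "max c t + 1" v f g c t] traj_straight by (simp add: min_def max_def)

lemma traj_shift: "traj v f \<Longrightarrow> traj v (\<lambda>t. f (t + P))"
proof -
  assume f: "traj v f"
  show ?thesis
  proof (rule trajI)
    show "f (t + P) \<in> regular" for t using f by (simp add: traj_def)
    show "\<forall>\<^sub>F u in nhds 0. f (t + u + P) = surface_plus (f (t + P)) (u *\<^sub>R v)" for t
      using trajD[OF f, of "t + P"] by (simp add: add.commute add.left_commute)
  qed
qed

lemma traj_reverse: "traj v f \<Longrightarrow> traj (- v) (\<lambda>t. f (- t))"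
proof -
  assume f: "traj v f"
  have "\<forall>\<^sub>F u in nhds 0. f (- (t + u)) = surface_plus (f (- t)) (u *\<^sub>R - v)" for t
  proof -
    have "\<forall>\<^sub>F u in nhds 0. f (- t + u) = surface_plus (f (- t)) (u *\<^sub>R v)" by (rule trajD[OF f])
    from ev_nhds_0_nonzero[OF this] obtain e where e: "e > 0" "\<And>u. \<bar>u\<bar> < e \<Longrightarrow> f (- t + u) = surface_plus (f (-t)) (u *\<^sub>R v)" by blast
    have "f (- (t + u)) = surface_plus (f (- t)) (u *\<^sub>R - v)" if "\<bar>u\<bar> < e" for u
      using e(2)[of "- u"] that by simp
    then show ?thesis unfolding small_ball using e(1) by (intro exI[of _ e]) simp
  qed
  then show ?thesis using f by (auto simp: traj_def straight_def)
qed

section \<open>Developing paths\<close>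

text \<open>The translates of \<open>P\<close> by \<open>\<Lambda>\<close> that lie in the octagon.  If \<open>\<Lambda>\<close> consists of translations that unfold part of the surface into the plane, this is the class of the point of the surface over \<open>P\<close>, and moving \<open>P\<close> along a line gives a straight path.\<close>

definition dev :: "(real^2) set \<Rightarrow> real^2 \<Rightarrow> surface_point" where
  "dev \<Lambda> P = (\<lambda>q. P + q) ` \<Lambda> \<inter> octagon"

definition loc_finite :: "(real^2) set \<Rightarrow> bool" where
  "loc_finite \<Lambda> \<longleftrightarrow> (\<forall>R. finite {q \<in> \<Lambda>. norm q \<le> R})"

lemma finite_loc_finite: "finite \<Lambda> \<Longrightarrow> loc_finite \<Lambda>" by (simp add: loc_finite_def)

lemma dev_plus:
  assumes "loc_finite \<Lambda>" shows "\<forall>\<^sub>F v in nhds 0. dev \<Lambda> (P + v) = surface_plus (dev \<Lambda> P) v"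
proof -
  let ?F = "{q \<in> \<Lambda>. norm q \<le> 3 + norm P}"
  have "finite ((\<lambda>q. P + q) ` ?F)" using assms by (auto simp: loc_finite_def)
  from near_octagon[OF this]
  have "\<forall>\<^sub>F v in nhds 0. \<forall>q\<in>?F. P + q + v \<in> octagon \<longrightarrow> P + q \<in> octagon" by simp
  moreover have "\<forall>\<^sub>F v in nhds (0::real^2). norm v < 1" unfolding small_ball by (intro exI[of _ 1]) auto
  ultimately show ?thesis
  proof eventually_elim
    case (elim v)
    have "P + q \<in> octagon" if "q \<in> \<Lambda>" "P + q + v \<in> octagon" for q
    proof -
      have "q = (P + q + v) - (P + v)" by simp
      then have "norm q \<le> norm (P + q + v) + norm (P + v)" by (metis norm_triangle_ineq4)
      also have "\<dots> \<le> 2 + (norm P + 1)" using bounded_octagon[OF that(2)] elim norm_triangle_ineq[of P v] by linarith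
      finally have "q \<in> ?F" using that by simp
      then show ?thesis using elim that by blast
    qed
    then have "dev \<Lambda> (P + v) \<subseteq> surface_plus (dev \<Lambda> P) v"
    proof -
      assume A: "\<And>q. q \<in> \<Lambda> \<Longrightarrow> P + q + v \<in> octagon \<Longrightarrow> P + q \<in> octagon"
      show ?thesis
      proof
        fix x assume "x \<in> dev \<Lambda> (P + v)"
        then obtain q where q: "q \<in> \<Lambda>" "x = P + q + v" "x \<in> octagon" by (auto simp: dev_def algebra_simps)
        then have "P + q \<in> dev \<Lambda> P" using A by (auto simp: dev_def)
        then show "x \<in> surface_plus (dev \<Lambda> P) v" using q by (auto simp: surface_plus_def)
      qed
    qed
    moreover have "surface_plus (dev \<Lambda> P) v \<subseteq> dev \<Lambda> (P + v)"
    proof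
      fix x assume "x \<in> surface_plus (dev \<Lambda> P) v"
      then obtain q where q: "q \<in> \<Lambda>" "x = P + q + v" "x \<in> octagon" by (auto simp: surface_plus_def dev_def)
      then have "x = P + v + q" by (simp add: algebra_simps)
      then show "x \<in> dev \<Lambda> (P + v)" using q by (auto simp: dev_def)
    qed
    ultimately show ?case by blast
  qed
qed

lemma dev_straight:
  assumes "loc_finite \<Lambda>" "\<And>t. t \<in> I \<Longrightarrow> dev \<Lambda> (P + t *\<^sub>R v) \<in> octagon_surface"
  shows "straight I v (\<lambda>t. dev \<Lambda> (P + t *\<^sub>R v))"
  unfolding straight_def
proof safe
  fix t assume "t \<in> I"
  then show "dev \<Lambda> (P + t *\<^sub>R v) \<in> octagon_surface" by (rule assms)
  show "\<forall>\<^sub>F u in nhds 0. dev \<Lambda> (P + (t + u) *\<^sub>R v) = surface_plus (dev \<Lambda> (P + t *\<^sub>R v)) (u *\<^sub>R v)"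
    using small_scale[OF dev_plus[OF assms(1)], of "P + t *\<^sub>R v" v] by (simp add: algebra_simps)
qed

text \<open>Inside the interval this is uniqueness of straight paths.  The ends are allowed to be over the singular point, where
  the developed path is no longer a point of the surface; there comparing both paths
  with a nearby time inside the interval shows that \<open>f\<close> still meets it.\<close>

lemma dev_path:
  assumes L: "loc_finite \<Lambda>" and f: "straight {a..b} v f"
    and d: "\<And>t. t \<in> {a<..<b} \<Longrightarrow> dev \<Lambda> (P + t *\<^sub>R v) \<in> octagon_surface"
    and c: "c \<in> {a<..<b}" "f c \<inter> dev \<Lambda> (P + c *\<^sub>R v) \<noteq> {}"
  shows "\<And>t. t \<in> {a<..<b} \<Longrightarrow> f t = dev \<Lambda> (P + t *\<^sub>R v)"
    and "f a \<inter> dev \<Lambda> (P + a *\<^sub>R v) \<noteq> {}" "f b \<inter> dev \<Lambda> (P + b *\<^sub>R v) \<noteq> {}"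
proof -
  have fc: "f c = dev \<Lambda> (P + c *\<^sub>R v)"
  proof -
    have "f c \<in> octagon_surface" using c f by (auto simp: straight_def)
    then show ?thesis using c(2) d[OF c(1)] surface_eqI by blast
  qed
  show eq: "f t = dev \<Lambda> (P + t *\<^sub>R v)" if "t \<in> {a<..<b}" for t
    by (rule straight_unique[OF straight_subset[OF f] dev_straight[OF L] c(1) fc that]) (use d in auto)
  have ab: "a < b" using c by auto
  have ends: "f e \<inter> dev \<Lambda> (P + e *\<^sub>R v) \<noteq> {}" if e: "e \<in> {a, b}" for e
  proof -
    have "\<forall>\<^sub>F u in nhds 0. f (e + u) = surface_plus (f e) (u *\<^sub>R v)" using f e ab by (auto simp: straight_def)
    moreover have "\<forall>\<^sub>F u in nhds 0. dev \<Lambda> (P + e *\<^sub>R v + u *\<^sub>R v) = surface_plus (dev \<Lambda> (P + e *\<^sub>R v)) (u *\<^sub>R v)"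
      by (rule small_scale[OF dev_plus[OF L]])
    ultimately have "\<forall>\<^sub>F u in nhds 0. f (e + u) = surface_plus (f e) (u *\<^sub>R v) \<and>
       dev \<Lambda> (P + (e + u) *\<^sub>R v) = surface_plus (dev \<Lambda> (P + e *\<^sub>R v)) (u *\<^sub>R v)"
      by eventually_elim (simp add: algebra_simps)
    from ev_nhds_0_nonzero[OF this] obtain r where r: "r > 0" "\<And>u. \<bar>u\<bar> < r \<Longrightarrow> f (e + u) = surface_plus (f e) (u *\<^sub>R v) \<and>
       dev \<Lambda> (P + (e + u) *\<^sub>R v) = surface_plus (dev \<Lambda> (P + e *\<^sub>R v)) (u *\<^sub>R v)" by blast
    define u where "u = (if e = a then min (r/2) ((b - a)/2) else - min (r/2) ((b - a)/2))"
    have u: "\<bar>u\<bar> < r" "e + u \<in> {a<..<b}" using r(1) ab e by (auto simp: u_def min_def field_simps)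
    have "f (e + u) \<in> octagon_surface" using f u(2) by (auto simp: straight_def)
    then obtain q where q: "q \<in> f (e + u)" using surface_nonempty by blast
    then have "q \<in> surface_plus (f e) (u *\<^sub>R v)" "q \<in> surface_plus (dev \<Lambda> (P + e *\<^sub>R v)) (u *\<^sub>R v)"
      using r(2)[OF u(1)] eq[OF u(2)] by auto
    then have "q - u *\<^sub>R v \<in> f e \<inter> dev \<Lambda> (P + e *\<^sub>R v)" by (auto simp: surface_plus_def)
    then show ?thesis by blast
  qed
  show "f a \<inter> dev \<Lambda> (P + a *\<^sub>R v) \<noteq> {}" "f b \<inter> dev \<Lambda> (P + b *\<^sub>R v) \<noteq> {}" using ends by blast+
qed

section \<open>Locally affine maps\<close>

text \<open>Everything that is used of an affine automorphism: it is a bijection that fixes the singular point and is linear in translation charts.\<close>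

definition aff :: "(surface_point \<Rightarrow> surface_point) \<Rightarrow> real^2^2 \<Rightarrow> bool" where
  "aff \<Psi> M \<longleftrightarrow> bij_betw \<Psi> octagon_surface octagon_surface \<and> \<Psi> singular_point = singular_point \<and>
     (\<forall>x\<in>regular. \<forall>\<^sub>F v in nhds 0. \<Psi> (surface_plus x v) = surface_plus (\<Psi> x) (M *v v))"

lemma isCont_nhds: "isCont G z \<Longrightarrow> filterlim G (nhds (G z)) (nhds z)"
  unfolding isCont_def tendsto_at_iff_tendsto_nhds .

lemma small_linear:
  fixes P :: "real^2 \<Rightarrow> bool" and M :: "real^2^2"
  assumes "\<forall>\<^sub>F v in nhds 0. P v" shows "\<forall>\<^sub>F v in nhds 0. P (M *v v)"
proof -
  have "isCont (\<lambda>v. M *v v) 0" by (rule linear_continuous_at) (simp add: linear_linear)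
  from isCont_nhds[OF this] have "filterlim (\<lambda>v. M *v v) (nhds 0) (nhds 0)" by simp
  from eventually_compose_filterlim[OF assms this] show ?thesis .
qed

lemma affD:
  assumes "aff \<Psi> M"
  shows "x \<in> octagon_surface \<Longrightarrow> \<Psi> x \<in> octagon_surface" "\<Psi> singular_point = singular_point"
    "x \<in> octagon_surface \<Longrightarrow> y \<in> octagon_surface \<Longrightarrow> \<Psi> x = \<Psi> y \<Longrightarrow> x = y"
    "x \<in> regular \<Longrightarrow> \<forall>\<^sub>F v in nhds 0. \<Psi> (surface_plus x v) = surface_plus (\<Psi> x) (M *v v)"
    "y \<in> octagon_surface \<Longrightarrow> \<exists>x\<in>octagon_surface. y = \<Psi> x"
proof -
  have b: "bij_betw \<Psi> octagon_surface octagon_surface" using assms by (simp add: aff_def)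
  show "x \<in> octagon_surface \<Longrightarrow> \<Psi> x \<in> octagon_surface" by (rule bij_betw_apply[OF b])
  show "\<Psi> singular_point = singular_point" using assms by (simp add: aff_def)
  show "x \<in> octagon_surface \<Longrightarrow> y \<in> octagon_surface \<Longrightarrow> \<Psi> x = \<Psi> y \<Longrightarrow> x = y"
    using bij_betw_imp_inj_on[OF b] by (simp add: inj_on_eq_iff)
  show "x \<in> regular \<Longrightarrow> \<forall>\<^sub>F v in nhds 0. \<Psi> (surface_plus x v) = surface_plus (\<Psi> x) (M *v v)"
    using assms by (simp add: aff_def)
  show "y \<in> octagon_surface \<Longrightarrow> \<exists>x\<in>octagon_surface. y = \<Psi> x"
    using bij_betw_imp_surj_on[OF b] by blast
qed

lemma aff_regular: "aff \<Psi> M \<Longrightarrow> x \<in> regular \<Longrightarrow> \<Psi> x \<in> regular"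
  using affD(1,2,3) singular_surface by (metis Diff_iff insertCI singletonD)

lemma aff_straight:
  assumes "aff \<Psi> M" "straight I v f" "\<And>t. t \<in> I \<Longrightarrow> f t \<in> regular"
  shows "straight I (M *v v) (\<Psi> \<circ> f)"
  unfolding straight_def
proof safe
  fix t assume t: "t \<in> I"
  show "(\<Psi> \<circ> f) t \<in> octagon_surface" using assms(3)[OF t] affD(1)[OF assms(1)] by simp
  have "\<forall>\<^sub>F u in nhds 0. \<Psi> (surface_plus (f t) (u *\<^sub>R v)) = surface_plus (\<Psi> (f t)) (M *v (u *\<^sub>R v))"
    by (rule small_scale[OF affD(4)[OF assms(1) assms(3)[OF t]]])
  moreover have "\<forall>\<^sub>F u in nhds 0. f (t + u) = surface_plus (f t) (u *\<^sub>R v)" using assms(2) t by (simp add: straight_def)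
  ultimately show "\<forall>\<^sub>F u in nhds 0. (\<Psi> \<circ> f) (t + u) = surface_plus ((\<Psi> \<circ> f) t) (u *\<^sub>R (M *v v))"
    by eventually_elim (simp add: matrix_vector_mult_scaleR)
qed

lemma aff_traj: "aff \<Psi> M \<Longrightarrow> traj v f \<Longrightarrow> traj (M *v v) (\<Psi> \<circ> f)"
  using aff_straight[of \<Psi> M UNIV v f] aff_regular by (simp add: traj_def)

lemma aff_comp:
  assumes "aff \<Psi> M" "aff \<Phi> N" shows "aff (\<Psi> \<circ> \<Phi>) (M ** N)"
  unfolding aff_def
proof (intro conjI ballI)
  show "bij_betw (\<Psi> \<circ> \<Phi>) octagon_surface octagon_surface" using assms by (auto simp: aff_def intro: bij_betw_trans)
  show "(\<Psi> \<circ> \<Phi>) singular_point = singular_point" using assms by (simp add: aff_def)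
  fix x assume x: "x \<in> regular"
  from affD(4)[OF assms(2) x] small_linear[OF affD(4)[OF assms(1) aff_regular[OF assms(2) x]], of N]
  show "\<forall>\<^sub>F v in nhds 0. (\<Psi> \<circ> \<Phi>) (surface_plus x v) = surface_plus ((\<Psi> \<circ> \<Phi>) x) ((M ** N) *v v)"
    by eventually_elim (simp add: matrix_vector_mul_assoc)
qed

lemma aff_inverse:
  assumes a: "aff \<Psi> M" and MN: "M ** N = mat 1"
  shows "aff (inv_into octagon_surface \<Psi>) N"
  unfolding aff_def
proof (intro conjI ballI)
  let ?I = "inv_into octagon_surface \<Psi>"
  have b: "bij_betw \<Psi> octagon_surface octagon_surface" using a by (simp add: aff_def)
  have inv: "?I (\<Psi> z) = z" if "z \<in> octagon_surface" for z using b that by (simp add: bij_betw_inv_into_left)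
  show bI: "bij_betw ?I octagon_surface octagon_surface" using b by (rule bij_betw_inv_into)
  show s: "?I singular_point = singular_point" using inv[OF singular_surface] affD(2)[OF a] by simp
  fix x assume x: "x \<in> regular"
  then obtain y where y: "y \<in> octagon_surface" "x = \<Psi> y" using affD(5)[OF a] by blast
  then have yr: "y \<in> regular" using x affD(2)[OF a] by auto
  from small_linear[OF affD(4)[OF a yr], of N] small_linear[OF regular_plus[OF yr], of N]
  show "\<forall>\<^sub>F v in nhds 0. ?I (surface_plus x v) = surface_plus (?I x) (N *v v)"
  proof eventually_elim
    case (elim v)
    have "M *v (N *v v) = v" by (simp add: matrix_vector_mul_assoc MN)
    then have "\<Psi> (surface_plus y (N *v v)) = surface_plus x v" using elim y by simp
    then show ?case using inv[of "surface_plus y (N *v v)"] elim inv[OF y(1)] y(2) by simp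
  qed
qed

text \<open>The representatives of a class keep their distance, so a small displacement can be read off from the displaced class.\<close>

lemma surface_plus_inj:
  assumes "\<forall>p\<in>x. \<forall>q\<in>x. norm (p - q) < 2 * d \<longrightarrow> p = q" "norm a < d" "norm b < d"
    and "surface_plus x a = surface_plus x b" "surface_plus x a \<in> octagon_surface"
  shows "a = b"
proof -
  obtain z where z: "z \<in> surface_plus x a" using assms(5) surface_nonempty by blast
  then have "z \<in> surface_plus x b" using assms(4) by simp
  then obtain p q where pq: "p \<in> x" "q \<in> x" "z = p + a" "z = q + b" using z by (auto simp: surface_plus_def)
  have "p - q = (p + a) - (q + b) + (b - a)" by simp
  also have "\<dots> = b - a" unfolding pq(3)[symmetric] pq(4)[symmetric] by simp
  finally have "p - q = b - a" .
  then have "norm (p - q) < 2 * d" using norm_triangle_ineq4[of b a] assms(2,3) by simp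
  then have "p = q" using assms(1) pq by blast
  then show ?thesis using pq by simp
qed

text \<open>The chart expression of an affine automorphism is only assumed to be differentiable at the centre of the chart.
  Moving the centre shows that its derivative is the same matrix at all nearby points, so it is linear near 0.\<close>

lemma affine_automorphism_aff:
  assumes A: "affine_automorphism \<Psi> M" shows "aff \<Psi> M"
proof -
  have hom: "homeomorphic_map surface_topology surface_topology \<Psi>" and sing: "\<Psi> singular_point = singular_point"
    using A by (auto simp: affine_automorphism_def)
  have loc: "\<exists>F. F 0 = 0 \<and> (F has_derivative (\<lambda>v. M *v v)) (at 0) \<and>
      (\<forall>\<^sub>F v in nhds 0. \<Psi> (surface_plus x v) = surface_plus (\<Psi> x) (F v))" if "x \<in> regular" for x
    using A that unfolding affine_automorphism_def by blast
  have bij: "bij_betw \<Psi> octagon_surface octagon_surface"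
    using homeomorphic_imp_injective_map[OF hom] homeomorphic_imp_surjective_map[OF hom]
    by (simp add: bij_betw_def topspace_surface_topology)
  have reg: "\<Psi> x \<in> regular" if "x \<in> regular" for x
  proof -
    have "\<Psi> x \<in> octagon_surface" using bij that by (auto simp: bij_betw_def)
    moreover have "\<Psi> x \<noteq> singular_point"
      using that sing bij singular_surface unfolding bij_betw_def inj_on_def by (metis DiffD1 DiffD2 singletonI)
    ultimately show ?thesis by simp
  qed
  have "\<forall>\<^sub>F v in nhds 0. \<Psi> (surface_plus x v) = surface_plus (\<Psi> x) (M *v v)" if x: "x \<in> regular" for x
  proof -
    obtain F where F: "F 0 = 0" "(F has_derivative (\<lambda>v. M *v v)) (at 0)"
      "\<forall>\<^sub>F v in nhds 0. \<Psi> (surface_plus x v) = surface_plus (\<Psi> x) (F v)" using loc[OF x] by blast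
    have fx: "finite x" "finite (\<Psi> x)" using x reg[OF x] regular_finite by auto
    obtain d where d: "d > 0" "\<forall>p\<in>\<Psi> x. \<forall>q\<in>\<Psi> x. norm (p - q) < d \<longrightarrow> p = q" using finite_separated[OF fx(2)] by blast
    have tend: "\<forall>\<^sub>F u in nhds 0. norm (G u) < e" if "G 0 = 0" "(G has_derivative (\<lambda>v. M *v v)) (at 0)" "e > 0" for G :: "real^2 \<Rightarrow> real^2" and e :: real
    proof -
      have "isCont G 0" using that(2) has_derivative_continuous by blast
      then have "(G \<longlongrightarrow> 0) (nhds 0)" using that(1) isCont_nhds by metis
      then have "\<forall>\<^sub>F u in nhds 0. dist (G u) 0 < e" using that(3) by (rule tendstoD)
      then show ?thesis by simp
    qed
    have "\<forall>\<^sub>F v in nhds 0. \<Psi> (surface_plus x v) = surface_plus (\<Psi> x) (F v) \<and> surface_plus x v \<in> regular \<and> norm (F v) < d / 2"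
      using F(3) regular_plus[OF x] tend[OF F(1,2), of "d/2"] d(1) by (simp add: eventually_conj_iff)
    then obtain e where e: "e > 0" and E: "\<And>v. norm v < e \<Longrightarrow> \<Psi> (surface_plus x v) = surface_plus (\<Psi> x) (F v)"
      "\<And>v. norm v < e \<Longrightarrow> surface_plus x v \<in> regular" "\<And>v. norm v < e \<Longrightarrow> norm (F v) < d / 2"
      unfolding small_ball by blast
    have der: "(F has_derivative (\<lambda>v. M *v v)) (at v)" if v: "norm v < e" for v
    proof -
      obtain G where G: "G 0 = 0" "(G has_derivative (\<lambda>v. M *v v)) (at 0)"
        "\<forall>\<^sub>F u in nhds 0. \<Psi> (surface_plus (surface_plus x v) u) = surface_plus (\<Psi> (surface_plus x v)) (G u)"
        using loc[OF E(2)[OF v]] by blast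
      have Glim: "filterlim G (nhds 0) (nhds 0)"
        using isCont_nhds[OF has_derivative_continuous[OF G(2)]] G(1) by simp
      have 1: "\<forall>\<^sub>F u in nhds 0. surface_plus (surface_plus (\<Psi> x) (F v)) (G u) = surface_plus (\<Psi> x) (F v + G u)"
        using eventually_compose_filterlim[OF plus_plus[OF fx(2), of "F v"] Glim] .
      have 2: "\<forall>\<^sub>F u in nhds 0. norm (G u) < d / 2 - norm (F v)" by (rule tend[OF G(1,2)]) (use E(3)[OF v] in simp)
      have 3: "\<forall>\<^sub>F u in nhds 0. norm (v + u) < e"
        unfolding small_ball
        by (intro exI[of _ "e - norm v"]) (use v in \<open>auto intro: le_less_trans[OF norm_triangle_ineq]\<close>)
      have "\<forall>\<^sub>F u in nhds 0. F (v + u) = F v + G u"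
        using G(3) plus_plus[OF fx(1), of v] 1 2 3
      proof eventually_elim
        case (elim u)
        have eq: "surface_plus (\<Psi> x) (F (v + u)) = surface_plus (\<Psi> x) (F v + G u)"
          using elim E(1)[of "v + u"] E(1)[OF v] by simp
        show ?case
        proof (rule surface_plus_inj[OF _ _ _ eq])
          show "\<forall>p\<in>\<Psi> x. \<forall>q\<in>\<Psi> x. norm (p - q) < 2 * (d/2) \<longrightarrow> p = q" using d by simp
          show "norm (F (v + u)) < d / 2" using E(3) elim by blast
          show "norm (F v + G u) < d / 2" using norm_triangle_ineq[of "F v" "G u"] elim by linarith
          show "surface_plus (\<Psi> x) (F (v + u)) \<in> octagon_surface"
            using E(1)[of "v + u"] E(2)[of "v + u"] reg elim by (metis DiffD1)
        qed
      qed
      then have ev: "\<forall>\<^sub>F z in nhds v. F z = F v + G (z - v)"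
      proof -
        assume "\<forall>\<^sub>F u in nhds 0. F (v + u) = F v + G u"
        then obtain r where "r > 0" "\<And>u. norm u < r \<Longrightarrow> F (v + u) = F v + G u" unfolding small_ball by blast
        then show ?thesis unfolding eventually_nhds_metric dist_norm
          by (intro exI[of _ r]) (metis add.commute diff_add_cancel)
      qed
      have "((\<lambda>z. F v + G (z - v)) has_derivative (\<lambda>w. M *v w)) (at v)"
      proof -
        have "((\<lambda>z. z - v) has_derivative (\<lambda>w. w)) (at v)" by (auto intro!: derivative_eq_intros)
        moreover have "(G has_derivative (\<lambda>w. M *v w)) (at (v - v))" using G(2) by simp
        ultimately have "(G \<circ> (\<lambda>z. z - v) has_derivative (\<lambda>w. M *v w) \<circ> (\<lambda>w. w)) (at v)"
          by (rule diff_chain_at)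
        then show ?thesis by (auto intro!: derivative_eq_intros simp: o_def)
      qed
      moreover have "\<forall>\<^sub>F z in at v. F v + G (z - v) = F z"
        unfolding eventually_at_filter using ev by eventually_elim simp
      moreover have "F v + G (v - v) = F v" using G(1) by simp
      ultimately show ?thesis by (rule has_derivative_transform_eventually) simp
    qed
    have lin: "F v = M *v v" if v: "norm v < e" for v
    proof -
      have z: "((\<lambda>w. F w - M *v w) has_derivative (\<lambda>w. 0)) (at w within ball 0 e)" if "w \<in> ball 0 e" for w
      proof -
        have "((\<lambda>w. F w - M *v w) has_derivative (\<lambda>w. M *v w - M *v w)) (at w)"
          by (intro has_derivative_diff der) (use that in \<open>auto intro: linear_imp_has_derivative simp: dist_norm\<close>)
        then show ?thesis by (auto intro: has_derivative_at_withinI)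
      qed
      have "\<exists>c. \<forall>w\<in>ball 0 e. F w - M *v w = c"
        by (rule has_derivative_zero_constant[OF convex_ball z])
      then obtain c where c: "\<And>w. norm w < e \<Longrightarrow> F w - M *v w = c" by auto
      have "c = 0" using c[of 0] e F(1) by simp
      then show ?thesis using c[OF v] by simp
    qed
    show ?thesis unfolding small_ball by (intro exI[of _ e]) (use e E(1) lin in auto)
  qed
  then show ?thesis using bij sing by (simp add: aff_def)
qed

section \<open>Symmetries of the octagon\<close>

definition sym_map :: "real^2^2 \<Rightarrow> surface_point \<Rightarrow> surface_point" where
  "sym_map M x = (\<lambda>p. M *v p) ` x"

text \<open>An orthogonal matrix that permutes the midpoints of the sides acts on the whole gluing pattern.\<close>

definition octagon_symmetry :: "real^2^2 \<Rightarrow> bool" where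
  "octagon_symmetry M \<longleftrightarrow> orthogonal_matrix M \<and> (\<forall>i<8. \<exists>j<8. M *v mid i = mid j)"

lemma sym_inner: "octagon_symmetry M \<Longrightarrow> (M *v p) \<bullet> (M *v q) = p \<bullet> q"
proof -
  assume "octagon_symmetry M"
  then have "orthogonal_transformation (\<lambda>p. M *v p)"
    by (simp add: orthogonal_transformation_matrix octagon_symmetry_def)
  then show ?thesis by (simp add: orthogonal_transformation_def)
qed

lemma mid_inj: "inj_on mid {..<8}"
proof (rule inj_onI)
  fix i j :: nat assume "i \<in> {..<8}" "j \<in> {..<8}" "mid i = mid j"
  then show "i = j" using mid_inner_less[of i j] mid_norm[of i] by fastforce
qed

lemma sym_surj: assumes "octagon_symmetry M" "i < 8" shows "\<exists>j<8. M *v mid j = mid i"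
proof -
  have "inj_on (\<lambda>p. M *v p) (mid ` {..<8})"
  proof (rule inj_onI)
    fix p q assume "M *v p = M *v q"
    then have "(M *v (p - q)) \<bullet> (M *v (p - q)) = 0" by (simp add: matrix_vector_mult_diff_distrib)
    then show "p = q" using sym_inner[OF assms(1)] by simp
  qed
  moreover have "(\<lambda>p. M *v p) ` mid ` {..<8} \<subseteq> mid ` {..<8}"
    using assms(1) by (force simp: octagon_symmetry_def)
  ultimately have "(\<lambda>p. M *v p) ` mid ` {..<8} = mid ` {..<8}" by (intro endo_inj_surj) auto
  moreover have "mid i \<in> mid ` {..<8}" using assms(2) by simp
  ultimately have "mid i \<in> (\<lambda>p. M *v p) ` mid ` {..<8}" by simp
  then show ?thesis by auto
qed

lemma sym_transpose: "octagon_symmetry M \<Longrightarrow> octagon_symmetry (transpose M)"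
proof -
  assume M: "octagon_symmetry M"
  have o: "transpose M ** M = mat 1" using M by (simp add: octagon_symmetry_def orthogonal_matrix)
  have "\<exists>j<8. transpose M *v mid i = mid j" if i: "i < 8" for i
  proof -
    obtain j where j: "j < 8" "M *v mid j = mid i" using sym_surj[OF M i] by blast
    have "transpose M *v (M *v mid j) = mid j" by (simp add: matrix_vector_mul_assoc o del: transpose_matrix_vector)
    then show ?thesis using j(1) unfolding j(2) by blast
  qed
  then show ?thesis using M by (simp add: octagon_symmetry_def orthogonal_matrix_transpose del: transpose_matrix_vector)
qed

lemma sym_cancel: "octagon_symmetry M \<Longrightarrow> transpose M *v (M *v p) = p" "octagon_symmetry M \<Longrightarrow> M *v (transpose M *v p) = p"
  by (simp_all add: octagon_symmetry_def orthogonal_matrix_def matrix_vector_mul_assoc del: transpose_matrix_vector)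

lemma sym_octagon: "octagon_symmetry M \<Longrightarrow> p \<in> octagon \<Longrightarrow> M *v p \<in> octagon"
  unfolding octagon_iff by (metis sym_inner sym_surj)

lemma sym_octagon_iff: "octagon_symmetry M \<Longrightarrow> M *v p \<in> octagon \<longleftrightarrow> p \<in> octagon"
  using sym_octagon[of M p] sym_octagon[OF sym_transpose, of M "M *v p"] sym_cancel(1)[of M p] by auto

lemma sym_glue_step: "octagon_symmetry M \<Longrightarrow> (p, q) \<in> glue_step \<Longrightarrow> (M *v p, M *v q) \<in> glue_step"
proof -
  assume M: "octagon_symmetry M" and "(p, q) \<in> glue_step"
  then obtain i where i: "p \<in> octagon" "mid i \<bullet> p = ir * ir" "q = p - 2 *\<^sub>R mid i" by (auto simp: glue_step_iff)
  have "i mod 8 < 8" by simp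
  then obtain j where j: "M *v mid (i mod 8) = mid j" using M unfolding octagon_symmetry_def by blast
  then have "M *v mid i = mid j" by (simp add: mid_mod)
  then have "mid j \<bullet> (M *v p) = ir * ir" "M *v q = M *v p - 2 *\<^sub>R mid j"
    using sym_inner[OF M, of "mid i" p] i by (simp_all add: matrix_vector_mult_diff_distrib matrix_vector_mult_scaleR)
  then show ?thesis using sym_octagon[OF M] i by (auto simp: glue_step_iff)
qed

lemma sym_glue: assumes M: "octagon_symmetry M" and "(p, q) \<in> glue" shows "(M *v p, M *v q) \<in> glue"
proof -
  have "(p, q) \<in> glue_step\<^sup>*" "p \<in> octagon" "q \<in> octagon" using assms by (auto simp: glue_def)
  from this(1) have "(M *v p, M *v q) \<in> glue_step\<^sup>*"
    by induction (use sym_glue_step[OF M] in \<open>auto intro: rtrancl_into_rtrancl\<close>)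
  then show ?thesis using sym_octagon[OF M] \<open>p \<in> octagon\<close> \<open>q \<in> octagon\<close> by (simp add: glue_def)
qed

lemma sym_class: assumes M: "octagon_symmetry M" shows "sym_map M (glue `` {p}) = glue `` {M *v p}"
proof safe
  fix q assume "q \<in> sym_map M (glue `` {p})"
  then show "(M *v p, q) \<in> glue" using sym_glue[OF M] by (auto simp: sym_map_def)
next
  fix q assume "(M *v p, q) \<in> glue"
  then have "(p, transpose M *v q) \<in> glue" using sym_glue[OF sym_transpose[OF M]] sym_cancel[OF M] by metis
  then show "q \<in> sym_map M (glue `` {p})" unfolding sym_map_def
    by (intro image_eqI[of _ _ "transpose M *v q"]) (simp_all add: sym_cancel[OF M] del: transpose_matrix_vector)
qed

lemma sym_surface: "octagon_symmetry M \<Longrightarrow> x \<in> octagon_surface \<Longrightarrow> sym_map M x \<in> octagon_surface"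
  using surface_nonempty surface_class sym_class surfaceI sym_octagon by metis

lemma sym_plus:
  assumes "octagon_symmetry M" shows "sym_map M (surface_plus x v) = surface_plus (sym_map M x) (M *v v)"
proof -
  have "M *v p + M *v v = M *v (p + v)" for p by (simp add: matrix_vector_right_distrib)
  then show ?thesis unfolding sym_map_def surface_plus_def using sym_octagon_iff[OF assms] by (auto simp: image_iff)
qed

lemma sym_singular: assumes M: "octagon_symmetry M" shows "sym_map M singular_point = singular_point"
proof (rule ccontr)
  assume ne: "sym_map M singular_point \<noteq> singular_point"
  have reg: "sym_map M singular_point \<in> regular" using sym_surface[OF M singular_surface] ne by simp
  have v: "M *v oct_vertex 0 \<in> sym_map M singular_point" by (auto simp: sym_map_def singular_point_eq)
  have e: "\<exists>j<8. M *v mid i = mid j \<and> mid j \<bullet> (M *v oct_vertex 0) = ir * ir" if "i < 8" "mid i \<bullet> oct_vertex 0 = ir * ir" for i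
    using M that sym_inner[OF M] unfolding octagon_symmetry_def by metis
  obtain a where a: "a < 8" "M *v mid 0 = mid a" "mid a \<bullet> (M *v oct_vertex 0) = ir * ir"
    using e[of 0] vertex_on_side(1)[of 0] by auto
  obtain b where b: "b < 8" "M *v mid 7 = mid b" "mid b \<bullet> (M *v oct_vertex 0) = ir * ir"
    using e[of 7] mid_vertex[of 0 7] by auto
  have "mid 0 = mid 7" if "a = b" using a(2) b(2) that sym_cancel(1)[OF M] by metis
  moreover have "mid 0 \<noteq> mid 7" using inj_onD[OF mid_inj, of 0 7] by auto
  ultimately have "a \<noteq> b" by blast
  from reg v show False
  proof (cases rule: regular_cases)
    case 1 then show ?thesis using a by (auto simp: oct_int_def)
  next
    case (2 i)
    have "a mod 8 = i mod 8" "b mod 8 = i mod 8" using edge_pt_unique[OF 2(2)] a(3) b(3) by blast+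
    then show ?thesis using a(1) b(1) \<open>a \<noteq> b\<close> by simp
  qed
qed

lemma sym_aff: assumes M: "octagon_symmetry M" shows "aff (sym_map M) M"
  unfolding aff_def
proof (intro conjI ballI)
  have c: "sym_map (transpose M) (sym_map M x) = x" "sym_map M (sym_map (transpose M) x) = x" for x
    by (simp_all add: sym_map_def image_image sym_cancel[OF M] del: transpose_matrix_vector)
  show "bij_betw (sym_map M) octagon_surface octagon_surface"
    by (rule bij_betw_byWitness[of _ "sym_map (transpose M)"])
       (use c sym_surface[OF M] sym_surface[OF sym_transpose[OF M]] in auto)
qed (use sym_singular[OF M] sym_plus[OF M] in auto)

section \<open>The matrices \<open>nu j\<close>\<close>

lemma mat2_nth [simp]: "mat2 a b c d $ 1 $ 1 = a" "mat2 a b c d $ 1 $ 2 = b" "mat2 a b c d $ 2 $ 1 = c" "mat2 a b c d $ 2 $ 2 = d"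
  by (simp_all add: mat2_def)

lemma mat2_eq_iff: "M = N \<longleftrightarrow> M $ 1 $ 1 = N $ 1 $ 1 \<and> M $ 1 $ 2 = N $ 1 $ 2 \<and> M $ 2 $ 1 = N $ 2 $ 1 \<and> M $ 2 $ 2 = (N $ 2 $ 2 :: real)"
  for M N :: "real^2^2" by (auto simp: vec_eq_iff forall_2)

lemma mat2_vec: "mat2 a b c d *v pt x y = pt (a * x + b * y) (c * x + d * y)"
  by (simp add: vec_eq_iff forall_2 matrix_vector_mult_def sum_2 mat2_def)

lemma mat2_mult: "mat2 a b c d ** mat2 a' b' c' d' = mat2 (a * a' + b * c') (a * b' + b * d') (c * a' + d * c') (c * b' + d * d')"
  by (simp add: mat2_eq_iff matrix_matrix_mult_def sum_2)

lemma mat2_scale: "k *\<^sub>R mat2 a b c d = mat2 (k * a) (k * b) (k * c) (k * d)"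
  by (simp add: mat2_eq_iff)

lemma mat2_transpose: "transpose (mat2 a b c d) = mat2 a c b d"
  by (simp add: mat2_eq_iff transpose_def)

lemma mat2_1: "mat 1 = mat2 1 0 0 1" "mat2 a b c d = mat 1 \<longleftrightarrow> a = 1 \<and> b = 0 \<and> c = 0 \<and> d = 1"
  by (auto simp: mat2_eq_iff mat_def)

lemma mat2_det: "det (mat2 a b c d) = a * d - b * c" by (simp add: det_2)

lemma mat2_uminus: "- mat2 a b c d = mat2 (-a) (-b) (-c) (-d)" by (simp add: mat2_eq_iff)

lemma mat2_cases: obtains a b c d where "M = mat2 a b c d"
  using that[of "M $ 1 $ 1" "M $ 1 $ 2" "M $ 2 $ 1" "M $ 2 $ 2"] by (simp add: mat2_eq_iff)

abbreviation is2 :: real where "is2 \<equiv> 1 / sqrt 2"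

lemma nu_values:
  "nu 0 = mat2 1 0 0 1" "nu 1 = mat2 is2 is2 is2 (- is2)" "nu 2 = mat2 is2 is2 (- is2) is2"
  "nu 3 = mat2 0 1 1 0" "nu 4 = mat2 0 1 (-1) 0" "nu 5 = mat2 (- is2) is2 is2 is2"
  "nu 6 = mat2 (- is2) is2 (- is2) (- is2)" "nu 7 = mat2 (-1) 0 0 1"
  by (simp_all add: nu_def mat2_scale)

lemma is2: "is2 * is2 = 1/2" "is2 * ll = ir" "is2 * ir = ll / 2" "is2 * (ll / 2) = ir / 2" "is2 * (- ll / 2) = - ir / 2"
proof -
  show "is2 * is2 = 1/2" by simp
  show a: "is2 * ll = ir" using sqrt2_ir by (simp add: field_simps)
  have "sqrt 2 * (sqrt 2 * ir) = sqrt 2 * ll" using sqrt2_ir by (simp add: algebra_simps)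
  then have "2 * ir = sqrt 2 * ll" by (simp flip: mult.assoc)
  then show "is2 * ir = ll / 2" by (simp add: field_simps)
  have "s * (ll / 2) = ir / 2" "s * (- ll / 2) = - ir / 2" if "s * ll = ir" for s using that by linarith+
  from this[OF a] show "is2 * (ll / 2) = ir / 2" "is2 * (- ll / 2) = - ir / 2" .
qed

lemma nu_orthogonal: assumes "j < 8" shows "orthogonal_matrix (nu j)"
  using less_8[OF assms]
  by (elim disjE; simp add: orthogonal_matrix_def nu_values nu_values(2)[unfolded One_nat_def] mat2_transpose mat2_mult mat2_1)

text \<open>The permutation of the sides induced by \<open>nu j\<close>: a clockwise rotation by \<open>j / 2\<close> sides if \<open>j\<close> is even, a reflection if \<open>j\<close> is odd.\<close>

definition nu_index :: "nat \<Rightarrow> nat \<Rightarrow> nat" where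
  "nu_index j i = (if even j then (i + j div 2) mod 8 else (12 - (j + 1) div 2 - i) mod 8)"

lemma nu_mid: assumes "j < 8" "i < 8" shows "nu j *v mid i = mid (nu_index j i)"
proof -
  define s where s: "s = is2"
  have a: "s * ir = ll / 2" "s * (ll / 2) = ir / 2" unfolding s by (rule is2)+
  have e: "s * ir = ll / 2" "s * (ll / 2) = ir / 2" "s * (- ll / 2) = - ir / 2" "- s * (ll / 2) = - ir / 2" "- s * (- ll / 2) = ir / 2"
      "s * - ir = - ll / 2" "- s * ir = - ll / 2" "- s * - ir = ll / 2"
    using a by linarith+
  show ?thesis
    using less_8[OF assms(1)] less_8[OF assms(2)]
    apply (elim disjE)
    apply (simp_all only: nu_values mid_values mat2_vec nu_index_def s[symmetric] e)
    apply (simp_all add: mid_values mid_values(2)[unfolded One_nat_def] mid_values(3)[unfolded numeral_2_eq_2])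
    done
qed

lemma letter_perm_cycles:
  "letter_perm 0 = id" "letter_perm 1 = cycle_of_list [A, D] \<circ> cycle_of_list [B, C]"
  "letter_perm 2 = cycle_of_list [A, B, C, D]" "letter_perm 3 = cycle_of_list [A, C]"
  "letter_perm 4 = cycle_of_list [A, C] \<circ> cycle_of_list [B, D]"
  "letter_perm 5 = cycle_of_list [A, B] \<circ> cycle_of_list [C, D]"
  "letter_perm 6 = cycle_of_list [A, D, C, B]" "letter_perm 7 = cycle_of_list [B, D]"
  unfolding letter_perm_def by (simp_all del: cycle_of_list.simps)

lemma cycle_values:
  "cycle_of_list [a, b] x = Transposition.transpose a b x"
  "cycle_of_list [a, b, c, d] x = Transposition.transpose a b (Transposition.transpose b c (Transposition.transpose c d x))"
  by simp_all

lemma letter_perm_values: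
  "letter_perm 0 A = A" "letter_perm 0 B = B" "letter_perm 0 C = C" "letter_perm 0 D = D"
  "letter_perm 1 A = D" "letter_perm 1 B = C" "letter_perm 1 C = B" "letter_perm 1 D = A"
  "letter_perm 2 A = B" "letter_perm 2 B = C" "letter_perm 2 C = D" "letter_perm 2 D = A"
  "letter_perm 3 A = C" "letter_perm 3 B = B" "letter_perm 3 C = A" "letter_perm 3 D = D"
  "letter_perm 4 A = C" "letter_perm 4 B = D" "letter_perm 4 C = A" "letter_perm 4 D = B"
  "letter_perm 5 A = B" "letter_perm 5 B = A" "letter_perm 5 C = D" "letter_perm 5 D = C"
  "letter_perm 6 A = D" "letter_perm 6 B = A" "letter_perm 6 C = B" "letter_perm 6 D = C"
  "letter_perm 7 A = A" "letter_perm 7 B = D" "letter_perm 7 C = C" "letter_perm 7 D = B"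
  by (simp_all only: letter_perm_cycles id_apply o_apply cycle_values Transposition.transpose_def letter.distinct if_True if_False refl)

lemma oct_label_mod: "oct_label (i mod 8) = oct_label i"
proof -
  have "i mod 8 mod 4 = i mod 4" by (rule mod_mod_cancel) simp
  then show ?thesis by (simp add: oct_label_def)
qed

lemma oct_label_4: "oct_label (i + 4) = oct_label i" by (simp add: oct_label_def)

lemma oct_label_values:
  "oct_label 0 = A" "oct_label 1 = B" "oct_label 2 = C" "oct_label 3 = D" "oct_label 4 = A" "oct_label 5 = B"
  "oct_label 6 = C" "oct_label 7 = D" by (simp_all add: oct_label_def)

lemma nu_label: assumes "j < 8" "i < 8" shows "oct_label (nu_index j i) = letter_perm j (oct_label i)"
  using less_8[OF assms(1)] less_8[OF assms(2)]
  apply (elim disjE)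
  apply (simp_all only: oct_label_values letter_perm_values)
  apply (simp_all add: nu_index_def oct_label_def)
  done

lemma nu_symmetry: "j < 8 \<Longrightarrow> octagon_symmetry (nu j)"
  unfolding octagon_symmetry_def using nu_orthogonal nu_mid
  by (metis mod_less_divisor nu_index_def zero_less_numeral)

lemma minus_vec: "- mat 1 *v p = - (p :: real^2)"
  by (rule pt_cases[of p]) (simp add: mat2_1 mat2_uminus mat2_vec)

lemma minus_symmetry: "octagon_symmetry (- mat 1)"
  unfolding octagon_symmetry_def
proof (intro conjI allI impI)
  show "orthogonal_matrix (- mat 1 :: real^2^2)"
    by (simp add: orthogonal_matrix_def mat2_1 mat2_uminus mat2_transpose mat2_mult)
  fix i :: nat assume "i < 8"
  have "- mat 1 *v mid i = mid ((i + 4) mod 8)" by (simp add: mid_mod mid_4 minus_vec)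
  then show "\<exists>j<8. - mat 1 *v mid i = mid j" by (metis mod_less_divisor zero_less_numeral)
qed

text \<open>For even \<open>j\<close> the matrix \<open>nu j\<close> is a rotation, for odd \<open>j\<close> a reflection; in both cases it takes the sector number \<open>j\<close> to the first one.\<close>

lemma nu_direction:
  assumes "j < 8"
  shows "nu j *v pt (cos x) (sin x) = (let y = (if even j then x - j * pi / 8 else (j + 1) * pi / 8 - x) in pt (cos y) (sin y))"
proof -
  have q: "sqrt 2 / 2 = is2" by (simp add: field_simps)
  have v: "cos (pi/4) = is2" "sin (pi/4) = is2" by (simp_all add: cos_45 sin_45 q)
  have w: "cos (3 * pi/4) = - is2" "sin (3 * pi/4) = is2"
  proof -
    have p: "3 * pi/4 = pi - pi/4" by simp
    show "cos (3 * pi/4) = - is2" "sin (3 * pi/4) = is2" unfolding p cos_pi_minus sin_pi_minus v by (rule refl)+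
  qed
  have e: "2 * pi / 8 = pi / 4" "4 * pi / 8 = pi / 2" "6 * pi / 8 = 3 * pi / 4" "8 * pi / 8 = pi" by simp_all
  show ?thesis
    using less_8[OF assms]
    apply (elim disjE)
    apply (simp_all only: nu_values mat2_vec Let_def)
    apply (simp_all add: e cos_diff sin_diff v w)
    done
qed

section \<open>Sides and cutting sequences\<close>

lemma surface_side_iff:
  "x \<in> octagon_surface \<Longrightarrow> x \<in> surface_side L \<longleftrightarrow> (\<exists>p\<in>x. \<exists>i<8. oct_label i = L \<and> mid i \<bullet> p = ir * ir)"
proof -
  assume x: "x \<in> octagon_surface"
  have "(\<exists>i. oct_label i = L \<and> x \<inter> oct_side i \<noteq> {}) \<longleftrightarrow> (\<exists>i<8. oct_label i = L \<and> x \<inter> oct_side i \<noteq> {})"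
  proof
    assume "\<exists>i. oct_label i = L \<and> x \<inter> oct_side i \<noteq> {}"
    then obtain i where "oct_label i = L \<and> x \<inter> oct_side i \<noteq> {}" by blast
    then show "\<exists>i<8. oct_label i = L \<and> x \<inter> oct_side i \<noteq> {}"
      by (intro exI[of _ "i mod 8"]) (simp add: oct_label_mod oct_side_mod)
  qed blast
  also have "\<dots> \<longleftrightarrow> (\<exists>p\<in>x. \<exists>i<8. oct_label i = L \<and> mid i \<bullet> p = ir * ir)"
  proof -
    have "x \<subseteq> octagon" using surface_class[OF x] by blast
    then have "x \<inter> oct_side i \<noteq> {} \<longleftrightarrow> (\<exists>p\<in>x. mid i \<bullet> p = ir * ir)" for i
      unfolding disjoint_iff using oct_side_iff by blast
    then show ?thesis by auto
  qed
  finally show ?thesis using x by (simp add: surface_side_def)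
qed

lemma side_surface: "surface_side L \<subseteq> octagon_surface" by (auto simp: surface_side_def)

lemma regular_side:
  assumes "x \<in> regular" "p \<in> x" "x \<in> surface_side L"
  obtains i where "i < 8" "edge_pt i p" "oct_label i = L" "x = {p, p - 2 *\<^sub>R mid i}"
proof -
  have xs: "x \<in> octagon_surface" using assms by simp
  obtain q k where q: "q \<in> x" "k < 8" "oct_label k = L" "mid k \<bullet> q = ir * ir"
    using assms(3) unfolding surface_side_iff[OF xs] by blast
  from assms(1,2) show ?thesis
  proof (cases rule: regular_cases)
    case 1
    then show ?thesis using q by (auto simp: oct_int_def)
  next
    case (2 i)
    have "oct_label i = L"
    proof (cases "q = p")
      case True
      then have "k mod 8 = i mod 8" using edge_pt_unique[OF 2(2)] q by blast
      then show ?thesis using q 2 by simp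
    next
      case False
      then have "k mod 8 = (i + 4) mod 8" using edge_pt_unique[OF edge_pt_opposite[OF 2(2)]] q 2 by blast
      then show ?thesis using q oct_label_4 oct_label_mod by metis
    qed
    then show ?thesis using that 2 by blast
  qed
qed

lemma edge_side: "edge_pt i p \<Longrightarrow> {p, p - 2 *\<^sub>R mid i} \<in> surface_side (oct_label i)"
proof -
  assume e: "edge_pt i p"
  have x: "{p, p - 2 *\<^sub>R mid i} \<in> octagon_surface" using edge_regular[OF e] by simp
  show ?thesis unfolding surface_side_iff[OF x] using e
    by (intro bexI[of _ p] exI[of _ "i mod 8"]) (auto simp: edge_pt_def mid_mod oct_label_mod)
qed

lemma int_side: "oct_int p \<Longrightarrow> {p} \<notin> surface_side L"
  using int_regular[of p] regular_side[of "{p}" p L] edge_pt_inner by blast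

lemma side_unique: "x \<in> regular \<Longrightarrow> x \<in> surface_side L \<Longrightarrow> x \<in> surface_side L' \<Longrightarrow> L = L'"
proof -
  assume x: "x \<in> regular" "x \<in> surface_side L" "x \<in> surface_side L'"
  obtain p where p: "p \<in> x" using x surface_nonempty by blast
  obtain i where i: "i < 8" "edge_pt i p" "oct_label i = L" using regular_side[OF x(1) p x(2)] by blast
  obtain k where k: "k < 8" "edge_pt k p" "oct_label k = L'" using regular_side[OF x(1) p x(3)] by blast
  have "i mod 8 = k mod 8" using i(2) edge_pt_unique[OF k(2)] by (simp add: edge_pt_def)
  then show ?thesis using i k by simp
qed

lemma sym_side:
  assumes M: "octagon_symmetry M" and x: "x \<in> octagon_surface"
    and l: "\<And>i j. i < 8 \<Longrightarrow> j < 8 \<Longrightarrow> M *v mid i = mid j \<Longrightarrow> oct_label j = f (oct_label i)"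
  shows "sym_map M x \<in> surface_side L' \<longleftrightarrow> (\<exists>L. L' = f L \<and> x \<in> surface_side L)"
proof
  assume "sym_map M x \<in> surface_side L'"
  then obtain p j where p: "p \<in> x" "j < 8" "oct_label j = L'" "mid j \<bullet> (M *v p) = ir * ir"
    unfolding surface_side_iff[OF sym_surface[OF M x]] by (auto simp: sym_map_def)
  obtain i where i: "i < 8" "M *v mid i = mid j" using sym_surj[OF M p(2)] by blast
  then have "mid i \<bullet> p = ir * ir" using p(4) sym_inner[OF M, of "mid i" p] by simp
  then have "x \<in> surface_side (oct_label i)" unfolding surface_side_iff[OF x] using p i by blast
  then show "\<exists>L. L' = f L \<and> x \<in> surface_side L" using l i p by blast
next
  assume "\<exists>L. L' = f L \<and> x \<in> surface_side L"
  then obtain p i where p: "p \<in> x" "i < 8" "L' = f (oct_label i)" "mid i \<bullet> p = ir * ir"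
    unfolding surface_side_iff[OF x] by blast
  obtain j where j: "j < 8" "M *v mid i = mid j" using M p unfolding octagon_symmetry_def by blast
  then have "mid j \<bullet> (M *v p) = ir * ir" using p(4) sym_inner[OF M, of "mid i" p] by simp
  then show "sym_map M x \<in> surface_side L'" unfolding surface_side_iff[OF sym_surface[OF M x]]
    using p j l by (auto simp: sym_map_def)
qed

lemma cutting_id:
  "cutting_sequence id \<tau> w \<longleftrightarrow> (\<exists>t :: int \<Rightarrow> real. strict_mono t \<and>
     range t = {u. \<exists>L. \<tau> u \<in> surface_side L} \<and> (\<forall>i. \<tau> (t i) \<in> surface_side (w i)))"
  by (simp add: cutting_sequence_def)

lemma sym_cutting:
  assumes M: "octagon_symmetry M" and t: "\<And>t. \<tau> t \<in> octagon_surface"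
    and l: "\<And>i j. i < 8 \<Longrightarrow> j < 8 \<Longrightarrow> M *v mid i = mid j \<Longrightarrow> oct_label j = f (oct_label i)"
    and c: "cutting_sequence id \<tau> w"
  shows "cutting_sequence id (sym_map M \<circ> \<tau>) (f \<circ> w)"
proof -
  have "(sym_map M \<circ> \<tau>) u \<in> surface_side L' \<longleftrightarrow> (\<exists>L. L' = f L \<and> \<tau> u \<in> surface_side L)" for u L'
    unfolding o_apply by (rule sym_side[where f = f, OF M t l])
  note e = this
  obtain t :: "int \<Rightarrow> real" where t: "strict_mono t" "range t = {u. \<exists>L. \<tau> u \<in> surface_side L}" "\<forall>i. \<tau> (t i) \<in> surface_side (w i)"
    using c unfolding cutting_id by blast
  show ?thesis unfolding cutting_id e by (intro exI[of _ t]) (use t in auto)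
qed

lemma nu_cutting:
  assumes "j < 8" "\<And>t. \<tau> t \<in> octagon_surface" "cutting_sequence id \<tau> w"
  shows "cutting_sequence id (sym_map (nu j) \<circ> \<tau>) (letter_perm j \<circ> w)"
proof (rule sym_cutting[OF nu_symmetry[OF assms(1)] assms(2) _ assms(3)])
  fix i k :: nat assume i: "i < 8" "k < 8" "nu j *v mid i = mid k"
  then have "mid (nu_index j i) = mid k" using nu_mid assms by simp
  moreover have "nu_index j i < 8" by (simp add: nu_index_def)
  ultimately have "nu_index j i = k" using inj_onD[OF mid_inj, of "nu_index j i" k] i by simp
  then show "oct_label k = letter_perm j (oct_label i)" using nu_label assms i by blast
qed

lemma minus_cutting:
  assumes "\<And>t. \<tau> t \<in> octagon_surface" "cutting_sequence id \<tau> w"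
  shows "cutting_sequence id (sym_map (- mat 1) \<circ> \<tau>) w"
proof -
  have "cutting_sequence id (sym_map (- mat 1) \<circ> \<tau>) ((\<lambda>L. L) \<circ> w)"
  proof (rule sym_cutting[OF minus_symmetry assms(1) _ assms(2)])
    fix i k :: nat assume i: "i < 8" "k < 8" "- mat 1 *v mid i = mid k"
    have "- mat 1 *v mid i = mid ((i + 4) mod 8)" by (simp add: mid_mod mid_4 minus_vec)
    then have m: "mid ((i + 4) mod 8) = mid k" using i(3) by simp
    have "(i + 4) mod 8 = k" by (rule inj_onD[OF mid_inj m]) (use i in simp_all)
    then show "oct_label k = oct_label i" using oct_label_4[of i] oct_label_mod[of "i + 4"] by simp
  qed
  then show ?thesis by (simp add: comp_def)
qed

lemma aff_cutting:
  assumes a: "aff \<Psi> M" and t: "\<And>t. \<tau> t \<in> octagon_surface"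
  shows "cutting_sequence \<Psi> \<tau> w \<longleftrightarrow> cutting_sequence id (inv_into octagon_surface \<Psi> \<circ> \<tau>) w"
proof -
  have b: "bij_betw \<Psi> octagon_surface octagon_surface" using a by (simp add: aff_def)
  have "\<tau> u \<in> \<Psi> ` surface_side L \<longleftrightarrow> inv_into octagon_surface \<Psi> (\<tau> u) \<in> surface_side L" for u L
  proof
    assume "\<tau> u \<in> \<Psi> ` surface_side L"
    then obtain x where x: "x \<in> surface_side L" "\<tau> u = \<Psi> x" by blast
    then have "x \<in> octagon_surface" using side_surface by blast
    then show "inv_into octagon_surface \<Psi> (\<tau> u) \<in> surface_side L"
      using bij_betw_inv_into_left[OF b, of x] x by simp
  next
    assume i: "inv_into octagon_surface \<Psi> (\<tau> u) \<in> surface_side L"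
    have "\<Psi> (inv_into octagon_surface \<Psi> (\<tau> u)) = \<tau> u" using b t by (simp add: bij_betw_inv_into_right)
    then show "\<tau> u \<in> \<Psi> ` surface_side L" using i by (metis imageI)
  qed
  then show ?thesis by (simp add: cutting_sequence_def)
qed

section \<open>Chords of the octagon\<close>

lemma mid_less_iff:
  "mid 0 \<bullet> pt x y < ir * ir \<longleftrightarrow> y < ir" "mid 1 \<bullet> pt x y < ir * ir \<longleftrightarrow> x + y < ll"
  "mid 2 \<bullet> pt x y < ir * ir \<longleftrightarrow> x < ir" "mid 3 \<bullet> pt x y < ir * ir \<longleftrightarrow> x - y < ll"
  "mid 4 \<bullet> pt x y < ir * ir \<longleftrightarrow> - ir < y" "mid 5 \<bullet> pt x y < ir * ir \<longleftrightarrow> - ll < x + y"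
  "mid 6 \<bullet> pt x y < ir * ir \<longleftrightarrow> - ir < x" "mid 7 \<bullet> pt x y < ir * ir \<longleftrightarrow> - ll < x - y"
  by (simp_all only: less_le mid_le_iff) auto

lemma edge_coords:
  "edge_pt 0 (pt x y) \<Longrightarrow> y = ir \<and> - hs < x \<and> x < hs" "edge_pt 1 (pt x y) \<Longrightarrow> x + y = ll \<and> hs < x \<and> x < ir"
  "edge_pt 2 (pt x y) \<Longrightarrow> x = ir \<and> - hs < y \<and> y < hs" "edge_pt 3 (pt x y) \<Longrightarrow> x - y = ll \<and> hs < x \<and> x < ir"
  "edge_pt 4 (pt x y) \<Longrightarrow> y = - ir \<and> - hs < x \<and> x < hs" "edge_pt 5 (pt x y) \<Longrightarrow> x + y = - ll \<and> - ir < x \<and> x < - hs"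
  "edge_pt 6 (pt x y) \<Longrightarrow> x = - ir \<and> - hs < y \<and> y < hs" "edge_pt 7 (pt x y) \<Longrightarrow> x - y = - ll \<and> - ir < x \<and> x < - hs"
  unfolding edge_pt_def all8 by (simp_all add: mid_less_iff mid_le_iff mid_less_iff(2)[unfolded One_nat_def] mid_le_iff(10)[unfolded One_nat_def])

lemma oct_int_regular_nonside:
  assumes "x \<in> regular" "\<And>L. x \<notin> surface_side L" "p \<in> x" shows "oct_int p \<and> x = {p}"
  using assms(1,3) by (cases rule: regular_cases) (use assms edge_side in auto)

lemma dev_0: "dev {0} P = {P} \<inter> octagon" by (simp add: dev_def)

text \<open>Until the next crossing of a side the path stays in the interior of the octagon, where it is an ordinary line.\<close>

lemma inside_forward:
  assumes f: "traj v f" and c: "f m = {c}" "oct_int c" and n: "\<And>u L. m < u \<Longrightarrow> u < b \<Longrightarrow> f u \<notin> surface_side L"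
    and s: "m \<le> s" "s < b"
  shows "f s = {c + (s - m) *\<^sub>R v} \<and> oct_int (c + (s - m) *\<^sub>R v)"
proof -
  let ?g = "\<lambda>u. c - m *\<^sub>R v + u *\<^sub>R v"
  have g: "?g u = c + (u - m) *\<^sub>R v" for u by (simp add: algebra_simps)
  have open_int: "open {p. oct_int p}"
  proof -
    have "{p. oct_int p} = (\<Inter>i\<in>{..<8}. {p. mid i \<bullet> p < ir * ir})" by (auto simp: oct_int_def)
    then show ?thesis by (auto intro!: open_INT open_halfspace_lt)
  qed
  have cont: "continuous_on UNIV ?g" by (intro continuous_intros)
  have openI: "open {u. oct_int (?g u)}" using open_vimage[OF open_int cont] by (simp add: vimage_def)
  obtain e where e: "e > 0" "\<And>u. \<bar>u - m\<bar> < e \<Longrightarrow> oct_int (?g u)"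
  proof -
    have "m \<in> {u. oct_int (?g u)}" using c(2) by (simp add: g)
    then have "\<exists>e>0. \<forall>u. \<bar>u - m\<bar> < e \<longrightarrow> u \<in> {u. oct_int (?g u)}"
      using openI[unfolded open_dist dist_real_def] by (rule bspec[rotated])
    then show ?thesis using that by auto
  qed
  have dint: "dev {0} (?g u) \<in> octagon_surface" "dev {0} (?g u) = {?g u}" if "oct_int (?g u)" for u
    using that int_regular[OF that] oct_int_octagon[OF that] by (auto simp: dev_0)
  have all: "oct_int (?g u)" if u: "m \<le> u" "u < b" for u
  proof (rule ccontr)
    assume not: "\<not> oct_int (?g u)"
    let ?B = "{m..u} \<inter> - {u. oct_int (?g u)}"
    have "closed ?B" using openI by (intro closed_Int) auto
    then have "compact ?B" by (metis compact_Int_closed compact_Icc closed_Compl openI)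
    moreover have "?B \<noteq> {}" using not u by auto
    ultimately obtain r where r: "r \<in> ?B" "\<And>x. x \<in> ?B \<Longrightarrow> r \<le> x" using compact_attains_inf[of ?B] by blast
    have rm: "r > m" using r(1) c(2) by (cases "r = m") (auto simp: g)
    have int: "oct_int (?g x)" if x: "x \<in> {m - e/2<..<r}" for x
    proof (cases "x < m")
      case True then show ?thesis using e x by auto
    next
      case False
      then show ?thesis using r(2)[of x] r(1) x by auto
    qed
    have m: "m \<in> {m - e/2<..<r}" using e rm by auto
    have "f m \<inter> dev {0} (?g m) \<noteq> {}" using c dint(2)[of m] by (simp add: g)
    then have "f r \<inter> dev {0} (?g r) \<noteq> {}"
      using dev_path(3)[OF finite_loc_finite traj_straight[OF f] _ m, of "{0}" "c - m *\<^sub>R v"] dint(1) int by blast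
    then have gr: "?g r \<in> f r" by (auto simp: dev_0)
    have "oct_int (?g r)"
      using oct_int_regular_nonside[OF straight_regular[OF f] _ gr] n rm r(1) u by auto
    then show False using r(1) by blast
  qed
  obtain b' where b': "s < b'" "b' < b" using s dense by blast
  have int: "oct_int (?g x)" if x: "x \<in> {m - e/2<..<b'}" for x
    using x e all[of x] b' by (cases "x < m") auto
  have m: "m \<in> {m - e/2<..<b'}" using e b' s by auto
  have "f m \<inter> dev {0} (?g m) \<noteq> {}" using c dint(2)[of m] by (simp add: g)
  then have "f s = dev {0} (?g s)"
    using dev_path(1)[OF finite_loc_finite traj_straight[OF f] _ m, of "{0}" "c - m *\<^sub>R v" s] dint(1) int s b' e by auto
  then show ?thesis using dint(2)[of s] all[OF s] by (simp add: g)
qed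

lemma chord:
  assumes f: "traj v f" and ab: "a < b" and n: "\<And>u L. a < u \<Longrightarrow> u < b \<Longrightarrow> f u \<notin> surface_side L"
  obtains p where "p \<in> f a" "p + (b - a) *\<^sub>R v \<in> f b" "\<And>s. 0 < s \<Longrightarrow> s < b - a \<Longrightarrow> oct_int (p + s *\<^sub>R v) \<and> f (a + s) = {p + s *\<^sub>R v}"
proof -
  let ?m = "(a + b) / 2"
  have m: "a < ?m" "?m < b" using ab by auto
  obtain c where c: "c \<in> f ?m" using straight_regular[OF f] surface_nonempty by blast
  have ci: "oct_int c" "f ?m = {c}" using oct_int_regular_nonside[OF straight_regular[OF f] _ c] n m by auto
  have fwd: "f s = {c + (s - ?m) *\<^sub>R v} \<and> oct_int (c + (s - ?m) *\<^sub>R v)" if "?m \<le> s" "s < b" for s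
    by (rule inside_forward[OF f ci(2,1) _ that]) (use n m in auto)
  have bwd: "f s = {c + (s - ?m) *\<^sub>R v} \<and> oct_int (c + (s - ?m) *\<^sub>R v)" if "a < s" "s \<le> ?m" for s
  proof -
    have "f (- (- s)) = {c + (- s - (- ?m)) *\<^sub>R - v} \<and> oct_int (c + (- s - (- ?m)) *\<^sub>R - v)"
    proof (rule inside_forward[OF traj_reverse[OF f], of "- ?m" c "- a" "- s"])
      fix u L assume "- ?m < u" "u < - a"
      then have "a < - u" "- u < b" using m by linarith+
      then show "f (- u) \<notin> surface_side L" by (rule n)
    qed (use ci that in auto)
    then show ?thesis by (simp add: algebra_simps)
  qed
  let ?p = "c + (a - ?m) *\<^sub>R v"
  have all: "oct_int (?p + s *\<^sub>R v) \<and> f (a + s) = {?p + s *\<^sub>R v}" if "0 < s" "s < b - a" for s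
  proof -
    have e: "?p + s *\<^sub>R v = c + (a + s - ?m) *\<^sub>R v" by (simp add: algebra_simps)
    have "a < a + s" "a + s < b" using that by auto
    then have "f (a + s) = {c + (a + s - ?m) *\<^sub>R v} \<and> oct_int (c + (a + s - ?m) *\<^sub>R v)"
      using fwd bwd linear by blast
    then show ?thesis unfolding e by blast
  qed
  have g: "c - ?m *\<^sub>R v + u *\<^sub>R v = ?p + (u - a) *\<^sub>R v" for u by (simp add: algebra_simps)
  have cl: "dev {0} (c - ?m *\<^sub>R v + t *\<^sub>R v) \<in> octagon_surface" if t: "t \<in> {a<..<b}" for t
  proof -
    have "oct_int (?p + (t - a) *\<^sub>R v)" using all[of "t - a"] t by auto
    then show ?thesis unfolding g dev_0 using int_regular oct_int_octagon by auto
  qed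
  have mm: "?m \<in> {a<..<b}" using m by auto
  have meet: "f ?m \<inter> dev {0} (c - ?m *\<^sub>R v + ?m *\<^sub>R v) \<noteq> {}" using ci oct_int_octagon by (simp add: dev_0)
  note ends = dev_path(2,3)[OF finite_loc_finite[of "{0}"] traj_straight[OF f] cl mm meet]
  from ends(1) have 1: "?p \<in> f a" unfolding g dev_0 by auto
  from ends(2) have 2: "?p + (b - a) *\<^sub>R v \<in> f b" unfolding g dev_0 by auto
  show thesis using that[OF 1 2 all] by blast
qed

text \<open>The chord number \<open>i\<close> enters through side \<open>a i\<close> at \<open>P i\<close> and leaves through side \<open>b i\<close>.\<close>

lemma cutting_chords:
  assumes f: "traj v f" and w: "cutting_sequence id f w"
  obtains t P a b where "strict_mono (t :: int \<Rightarrow> real)" "range t = {u. \<exists>L. f u \<in> surface_side L}"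
    "\<And>i. f (t i) \<in> surface_side (w i)"
    "\<And>i. P i \<in> f (t i) \<and> a i < 8 \<and> edge_pt (a i) (P i) \<and> mid (a i) \<bullet> v < 0 \<and> oct_label (a i) = w i"
    "\<And>i. b i < 8 \<and> edge_pt (b i) (P i + (t (i + 1) - t i) *\<^sub>R v) \<and> mid (b i) \<bullet> v > 0 \<and> oct_label (b i) = w (i + 1)"
    "\<And>i. P (i + 1) = P i + (t (i + 1) - t i) *\<^sub>R v - 2 *\<^sub>R mid (b i)"
proof -
  obtain t :: "int \<Rightarrow> real" where t: "strict_mono t" "range t = {u. \<exists>L. f u \<in> surface_side L}" "\<forall>i. f (t i) \<in> surface_side (w i)"
    using w unfolding cutting_id by blast
  have non: "f u \<notin> surface_side L" if "t i < u" "u < t (i + 1)" for u i L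
  proof
    assume "f u \<in> surface_side L"
    then obtain k where k: "u = t k" using t(2) by blast
    then have "i < k" "k < i + 1" using that t(1) by (auto simp: strict_mono_less)
    then show False by simp
  qed
  have lt: "t i < t (i + 1)" for i using t(1) by (simp add: strict_mono_less)
  have "\<exists>p a b. p \<in> f (t i) \<and> (p + (t (i + 1) - t i) *\<^sub>R v \<in> f (t (i + 1))) \<and>
      (a < 8 \<and> edge_pt a p \<and> mid a \<bullet> v < 0 \<and> oct_label a = w i) \<and>
      (b < 8 \<and> edge_pt b (p + (t (i + 1) - t i) *\<^sub>R v) \<and> mid b \<bullet> v > 0 \<and> oct_label b = w (i + 1)) \<and>
      f (t (i + 1)) = {p + (t (i + 1) - t i) *\<^sub>R v, p + (t (i + 1) - t i) *\<^sub>R v - 2 *\<^sub>R mid b}" for i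
  proof -
    obtain p where p: "p \<in> f (t i)" "p + (t (i + 1) - t i) *\<^sub>R v \<in> f (t (i + 1))"
      "\<And>s. 0 < s \<Longrightarrow> s < t (i + 1) - t i \<Longrightarrow> oct_int (p + s *\<^sub>R v)"
    proof -
      have n: "\<And>u L. t i < u \<Longrightarrow> u < t (i + 1) \<Longrightarrow> f u \<notin> surface_side L" using non by blast
      show ?thesis by (rule chord[OF f lt[of i] n]) (use that in blast)+
    qed
    obtain a where a: "a < 8" "edge_pt a p" "oct_label a = w i"
      using regular_side[OF straight_regular[OF f] p(1)] t(3) by blast
    obtain b where b: "b < 8" "edge_pt b (p + (t (i + 1) - t i) *\<^sub>R v)" "oct_label b = w (i + 1)"
       "f (t (i + 1)) = {p + (t (i + 1) - t i) *\<^sub>R v, p + (t (i + 1) - t i) *\<^sub>R v - 2 *\<^sub>R mid b}"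
      using regular_side[OF straight_regular[OF f] p(2)] t(3) by blast
    define d where "d = (t (i + 1) - t i) / 2"
    have d: "d > 0" "d < t (i + 1) - t i" "t (i + 1) - t i = 2 * d" using lt[of i] by (auto simp: d_def)
    have i: "oct_int (p + d *\<^sub>R v)" using p(3) d by blast
    have "mid a \<bullet> (p + d *\<^sub>R v) < ir * ir" "mid b \<bullet> (p + d *\<^sub>R v) < ir * ir" using i a b by (auto simp: oct_int_def)
    moreover have "mid a \<bullet> p = ir * ir" "mid b \<bullet> (p + (2 * d) *\<^sub>R v) = ir * ir" using a b unfolding d by (auto simp: edge_pt_def)
    ultimately have "d * (mid a \<bullet> v) < 0" "d * (mid b \<bullet> v) > 0" by (auto simp: inner_add_right)
    then have "mid a \<bullet> v < 0" "mid b \<bullet> v > 0" using d by (auto simp: mult_less_0_iff zero_less_mult_iff)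
    then show ?thesis using p a b by blast
  qed
  then obtain P a b where P: "\<And>i. P i \<in> f (t i) \<and> (P i + (t (i + 1) - t i) *\<^sub>R v \<in> f (t (i + 1))) \<and>
      (a i < 8 \<and> edge_pt (a i) (P i) \<and> mid (a i) \<bullet> v < 0 \<and> oct_label (a i) = w i) \<and>
      (b i < 8 \<and> edge_pt (b i) (P i + (t (i + 1) - t i) *\<^sub>R v) \<and> mid (b i) \<bullet> v > 0 \<and> oct_label (b i) = w (i + 1)) \<and>
      f (t (i + 1)) = {P i + (t (i + 1) - t i) *\<^sub>R v, P i + (t (i + 1) - t i) *\<^sub>R v - 2 *\<^sub>R mid (b i)}"
    by metis
  have "P (i + 1) = P i + (t (i + 1) - t i) *\<^sub>R v - 2 *\<^sub>R mid (b i)" for i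
  proof -
    have "P (i + 1) \<noteq> P i + (t (i + 1) - t i) *\<^sub>R v"
    proof
      assume e: "P (i + 1) = P i + (t (i + 1) - t i) *\<^sub>R v"
      have "edge_pt (b i) (P (i + 1))" unfolding e using P[of i] by blast
      then have m: "mid (b i) \<bullet> P (i + 1) = ir * ir" by (simp add: edge_pt_def)
      have "edge_pt (a (i + 1)) (P (i + 1))" using P[of "i + 1"] by blast
      from edge_pt_unique[OF this m] have "b i mod 8 = a (i + 1) mod 8" .
      moreover have "b i < 8" "a (i + 1) < 8" "mid (b i) \<bullet> v > 0" "mid (a (i + 1)) \<bullet> v < 0" using P[of i] P[of "i + 1"] by blast+
      ultimately show False by simp
    qed
    moreover have "P (i + 1) \<in> f (t (i + 1))" using P[of "i + 1"] by blast
    moreover have "f (t (i + 1)) = {P i + (t (i + 1) - t i) *\<^sub>R v, P i + (t (i + 1) - t i) *\<^sub>R v - 2 *\<^sub>R mid (b i)}"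
      using P[of i] by blast
    ultimately show ?thesis by blast
  qed
  note step = this
  show ?thesis
  proof (rule that[of t P a b])
    show "strict_mono t" "range t = {u. \<exists>L. f u \<in> surface_side L}" by (fact t)+
    show "f (t i) \<in> surface_side (w i)" for i using t by simp
  qed (use P step in auto)
qed

section \<open>Transitions in the sector of directions from \<open>0\<close> to \<open>\<pi>/8\<close>\<close>

text \<open>An upper bound for the first diagram.  That a cutting sequence is admissible in the diagram of its own sector holds by definition, so an upper bound is enough to exclude the other diagrams.\<close>

definition diag0 :: "(letter \<times> letter) set" where
  "diag0 = {(A, D), (D, A), (D, B), (B, D), (B, C), (C, B), (C, C)}"

text \<open>The closed first sector: the directions with angle in \<open>[0, \<pi>/8]\<close>, as \<open>tan (\<pi>/8) = 1 / sr\<close>.\<close>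

definition cone0 :: "real^2 \<Rightarrow> bool" where
  "cone0 v \<longleftrightarrow> v $ 1 > 0 \<and> v $ 2 \<ge> 0 \<and> sr * v $ 2 \<le> v $ 1"

text \<open>A direction in the first sector is closest to the outer normal of side 2, so it leaves through one of the sides 0 to 3 and enters through one of the others.\<close>

lemma entering_sides:
  assumes "cone0 v" "i < 8"
  shows "mid i \<bullet> v < 0 \<Longrightarrow> i = 4 \<or> i = 5 \<or> i = 6 \<or> i = 7" "mid i \<bullet> v > 0 \<Longrightarrow> i = 0 \<or> i = 1 \<or> i = 2 \<or> i = 3"
proof -
  obtain x y where v: "v = pt x y" by (rule pt_cases)
  have "2 * y \<le> sr * y" using assms sr_bounds by (auto simp: cone0_def v intro!: mult_right_mono)
  then have xy: "x > 0" "y \<ge> 0" "x - y \<ge> 0" using assms by (auto simp: cone0_def v)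
  have m: "mid 0 \<bullet> v \<ge> 0" "mid 1 \<bullet> v \<ge> 0" "mid 2 \<bullet> v \<ge> 0" "mid 3 \<bullet> v \<ge> 0"
  proof -
    have "ir * y \<ge> 0" "ir * x \<ge> 0" "ll/2 * (x + y) \<ge> 0" "ll/2 * (x - y) \<ge> 0" using xy ir_pos hs_pos by auto
    moreover have "ll/2 * (x + y) = ll/2 * x + ll/2 * y" "ll/2 * (x - y) = ll/2 * x + - ll/2 * y" by algebra+
    ultimately show "mid 0 \<bullet> v \<ge> 0" "mid 1 \<bullet> v \<ge> 0" "mid 2 \<bullet> v \<ge> 0" "mid 3 \<bullet> v \<ge> 0"
      unfolding v mid_values by (simp_all only: pt_simps mult_zero_left add_0 add_0_right)
  qed
  have n: "mid 4 = - mid 0" "mid 5 = - mid 1" "mid 6 = - mid 2" "mid 7 = - mid 3" unfolding mid_values by (simp_all add: minus_divide_left)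
  show "mid i \<bullet> v < 0 \<Longrightarrow> i = 4 \<or> i = 5 \<or> i = 6 \<or> i = 7"
    using less_8[OF assms(2)] m by (elim disjE) auto
  show "mid i \<bullet> v > 0 \<Longrightarrow> i = 0 \<or> i = 1 \<or> i = 2 \<or> i = 3"
    using less_8[OF assms(2)] m unfolding n[symmetric] by (elim disjE) (auto simp: n)
qed

text \<open>A chord between two other sides would have to rise so far that, with slope at most \<open>1 / sr\<close>, its horizontal extent would not fit between them.\<close>

lemma chord_diag0:
  assumes v: "cone0 v" and T: "T > 0" and a: "a < 8" "edge_pt a p" "mid a \<bullet> v < 0"
    and b: "b < 8" "edge_pt b (p + T *\<^sub>R v)" "mid b \<bullet> v > 0"
  shows "(oct_label a, oct_label b) \<in> diag0"
proof -
  obtain x y where p: "p = pt x y" by (rule pt_cases)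
  obtain vx vy where vv: "v = pt vx vy" by (rule pt_cases)
  define dx dy where "dx = T * vx" and "dy = T * vy"
  have q: "p + T *\<^sub>R v = pt (x + dx) (y + dy)" by (simp add: p vv dx_def dy_def)
  have d: "dx > 0" "dy \<ge> 0" using v T by (auto simp: cone0_def vv dx_def dy_def)
  have s: "sr * dy \<le> dx" using v T mult_left_mono[of "sr * vy" vx T] by (simp add: cone0_def vv dx_def dy_def mult.left_commute)
  have sr: "sr > 0" using sr_bounds by simp
  have F1: "dx > 3 * ir + hs" if "dy > ll" using mult_strict_left_mono[OF that sr] s by (simp add: sr_hs sr_ir distrib_left)
  have F2: "dx > ll" if "dy > ir - hs" using mult_strict_left_mono[OF that sr] s by (simp add: sr_hs sr_ir right_diff_distrib)
  have F3: "dx > 2 * ir" if "dy > 2 * hs" using mult_strict_left_mono[OF that sr] s sr_hs by simp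
  have E: "edge_pt a (pt x y)" "edge_pt b (pt (x + dx) (y + dy))" using a b q p by auto
  have k: "a = 4 \<or> a = 5 \<or> a = 6 \<or> a = 7" "b = 0 \<or> b = 1 \<or> b = 2 \<or> b = 3"
    using entering_sides[OF v] a b by auto
  have bad40: "\<not> (a = 4 \<and> b = 0)"
  proof
    assume "a = 4 \<and> b = 0"
    then have e: "edge_pt 4 (pt x y)" "edge_pt 0 (pt (x + dx) (y + dy))" using E by auto
    note e = edge_coords(5)[OF e(1)] edge_coords(1)[OF e(2)] d hs_pos ir_bounds
    have "dy > ll" using e by linarith
    from F1[OF this] show False using e by linarith
  qed
  have bad41: "\<not> (a = 4 \<and> b = 1)"
  proof
    assume "a = 4 \<and> b = 1"
    then have e: "edge_pt 4 (pt x y)" "edge_pt 1 (pt (x + dx) (y + dy))" using E by auto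
    note e = edge_coords(5)[OF e(1)] edge_coords(2)[OF e(2)] d hs_pos ir_bounds
    have "dy > ll" using e by linarith
    from F1[OF this] show False using e by linarith
  qed
  have bad42: "\<not> (a = 4 \<and> b = 2)"
  proof
    assume "a = 4 \<and> b = 2"
    then have e: "edge_pt 4 (pt x y)" "edge_pt 2 (pt (x + dx) (y + dy))" using E by auto
    note e = edge_coords(5)[OF e(1)] edge_coords(3)[OF e(2)] d hs_pos ir_bounds
    have "dy > ir - hs" using e by linarith
    from F2[OF this] show False using e by linarith
  qed
  have bad50: "\<not> (a = 5 \<and> b = 0)"
  proof
    assume "a = 5 \<and> b = 0"
    then have e: "edge_pt 5 (pt x y)" "edge_pt 0 (pt (x + dx) (y + dy))" using E by auto
    note e = edge_coords(6)[OF e(1)] edge_coords(1)[OF e(2)] d hs_pos ir_bounds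
    have "dy > ll" using e by linarith
    from F1[OF this] show False using e by linarith
  qed
  have bad51: "\<not> (a = 5 \<and> b = 1)"
  proof
    assume "a = 5 \<and> b = 1"
    then have e: "edge_pt 5 (pt x y)" "edge_pt 1 (pt (x + dx) (y + dy))" using E by auto
    note e = edge_coords(6)[OF e(1)] edge_coords(2)[OF e(2)] d hs_pos ir_bounds
    have "dy > 2 * hs" using e by linarith
    from F3[OF this] show False using e by linarith
  qed
  have bad60: "\<not> (a = 6 \<and> b = 0)"
  proof
    assume "a = 6 \<and> b = 0"
    then have e: "edge_pt 6 (pt x y)" "edge_pt 0 (pt (x + dx) (y + dy))" using E by auto
    note e = edge_coords(7)[OF e(1)] edge_coords(1)[OF e(2)] d hs_pos ir_bounds
    have "dy > ir - hs" using e by linarith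
    from F2[OF this] show False using e by linarith
  qed
  have bad63: "\<not> (a = 6 \<and> b = 3)"
  proof
    assume "a = 6 \<and> b = 3"
    then have e: "edge_pt 6 (pt x y)" "edge_pt 3 (pt (x + dx) (y + dy))" using E by auto
    note e = edge_coords(7)[OF e(1)] edge_coords(4)[OF e(2)] d hs_pos ir_bounds
    show False using e by linarith
  qed
  have bad72: "\<not> (a = 7 \<and> b = 2)"
  proof
    assume "a = 7 \<and> b = 2"
    then have e: "edge_pt 7 (pt x y)" "edge_pt 2 (pt (x + dx) (y + dy))" using E by auto
    note e = edge_coords(8)[OF e(1)] edge_coords(3)[OF e(2)] d hs_pos ir_bounds
    show False using e by linarith
  qed
  have bad73: "\<not> (a = 7 \<and> b = 3)"
  proof
    assume "a = 7 \<and> b = 3"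
    then have e: "edge_pt 7 (pt x y)" "edge_pt 3 (pt (x + dx) (y + dy))" using E by auto
    note e = edge_coords(8)[OF e(1)] edge_coords(4)[OF e(2)] d hs_pos ir_bounds
    show False using e by linarith
  qed
  note bad = bad40 bad41 bad42 bad50 bad51 bad60 bad63 bad72 bad73
  show ?thesis using k bad by (elim disjE) (auto simp: oct_label_values oct_label_values(2)[unfolded One_nat_def] diag0_def)
qed

lemma cutting_diag0:
  assumes f: "traj v f" "cone0 v" and w: "cutting_sequence id f w"
  shows "(w i, w (i + 1)) \<in> diag0"
proof -
  obtain t P a b where t: "strict_mono (t :: int \<Rightarrow> real)"
    and 1: "\<And>i. P i \<in> f (t i) \<and> a i < 8 \<and> edge_pt (a i) (P i) \<and> mid (a i) \<bullet> v < 0 \<and> oct_label (a i) = w i"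
    and 2: "\<And>i. b i < 8 \<and> edge_pt (b i) (P i + (t (i + 1) - t i) *\<^sub>R v) \<and> mid (b i) \<bullet> v > 0 \<and> oct_label (b i) = w (i + 1)"
    by (rule cutting_chords[OF f(1) w]) blast
  have "t (i + 1) - t i > 0" using t by (simp add: strict_mono_less)
  from chord_diag0[OF f(2) this] show ?thesis using 1[of i] 2[of i] by metis
qed

lemma sector0_cone:
  assumes "0 \<le> y" "y \<le> pi / 8" "c > 0" shows "cone0 (c *\<^sub>R pt (cos y) (sin y))"
proof -
  have "sin (pi / 8 - y) \<ge> 0" by (rule sin_ge_zero) (use assms in auto)
  then have "sr * (hs * sin y) \<le> hs * cos y" using sr_hs by (simp add: sin_diff hs_def ir_def mult.assoc[symmetric])
  then have "hs * (sr * sin y) \<le> hs * cos y" by (simp add: mult.left_commute)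
  then have 1: "sr * sin y \<le> cos y" using hs_pos by simp
  have "cos y > 0" by (rule cos_gt_zero_pi) (use assms pi_gt_zero in linarith)+
  moreover have "sin y \<ge> 0" by (rule sin_ge_zero) (use assms pi_gt_zero in linarith)+
  ultimately show ?thesis using 1 assms mult_left_mono[OF 1, of c] by (simp add: cone0_def mult.left_commute)
qed

lemma diagram_diag0:
  assumes "j < 8" "(x, y) \<in> diagram j" shows "(letter_perm j x, letter_perm j y) \<in> diag0"
proof -
  obtain w i \<theta> \<tau> where w: "x = w i" "y = w (i + 1)" "\<theta> \<in> sector j" "linear_trajectory \<theta> \<tau>" "cutting_sequence id \<tau> w"
    using assms(2) unfolding diagram_def by blast
  obtain c where c: "c \<noteq> 0" "traj (c *\<^sub>R pt (cos \<theta>) (sin \<theta>)) \<tau>" using w(4) linear_trajectory_iff by blast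
  define z where "z = (if even j then \<theta> - j * pi / 8 else (real j + 1) * pi / 8 - \<theta>)"
  have z: "0 \<le> z" "z \<le> pi / 8" using w(3) by (auto simp: z_def sector_def field_simps)
  let ?f = "sym_map (nu j) \<circ> \<tau>"
  have "nu j *v (c *\<^sub>R pt (cos \<theta>) (sin \<theta>)) = c *\<^sub>R pt (cos z) (sin z)"
    using nu_direction[OF assms(1), of \<theta>] by (simp only: matrix_vector_mult_scaleR z_def Let_def)
  then have f: "traj (c *\<^sub>R pt (cos z) (sin z)) ?f" using aff_traj[OF sym_aff[OF nu_symmetry[OF assms(1)]] c(2)] by simp
  have reg: "?f t \<in> octagon_surface" "\<tau> t \<in> octagon_surface" for t using straight_regular[OF f, of t] straight_regular[OF c(2), of t] by auto
  have cw: "cutting_sequence id ?f (letter_perm j \<circ> w)" by (rule nu_cutting[OF assms(1) reg(2) w(5)])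
  show ?thesis
  proof (cases "c > 0")
    case True
    show ?thesis using cutting_diag0[OF f sector0_cone[OF z True] cw, of i] w by simp
  next
    case False
    have g: "traj ((- c) *\<^sub>R pt (cos z) (sin z)) (sym_map (- mat 1) \<circ> ?f)"
      using aff_traj[OF sym_aff[OF minus_symmetry] f] by (simp only: minus_vec scaleR_minus_left)
    have "- c > 0" using False c by simp
    from cutting_diag0[OF g sector0_cone[OF z this] minus_cutting[OF reg(1) cw], of i] show ?thesis using w by simp
  qed
qed

section \<open>The two horizontal cylinders\<close>

datatype cyl = Inner | Outer

text \<open>The point with coordinates \<open>(x, y)\<close> in the universal cover of a cylinder.  \<open>Inner\<close> repeats the middle rectangle of the octagon with period \<open>2 * ir\<close>; \<open>Outer\<close> alternates between the upper trapezoid and the lower one, which is glued to it along the slanted sides by the translation \<open>(ll, - ll)\<close>.\<close>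

fun K :: "cyl \<Rightarrow> real \<Rightarrow> real \<Rightarrow> surface_point" where
  "K Inner x y = dev {pt (2 * of_int n * ir) 0 | n :: int. True} (pt x y)"
| "K Outer x y = dev {pt (of_int n * ll) (if even n then 0 else - ll) | n :: int. True} (pt x y)"

fun lam :: "cyl \<Rightarrow> (real^2) set" where
  "lam Inner = {pt (2 * of_int n * ir) 0 | n :: int. True}"
| "lam Outer = {pt (of_int n * ll) (if even n then 0 else - ll) | n :: int. True}"

fun low :: "cyl \<Rightarrow> real" where "low Inner = - hs" | "low Outer = hs"
fun top :: "cyl \<Rightarrow> real" where "top Inner = hs" | "top Outer = ir"
fun per :: "cyl \<Rightarrow> real" where "per Inner = 2 * ir" | "per Outer = 2 * ll"

text \<open>The sides that cross a cylinder, unfolded: the horizontal coordinate at height \<open>y\<close> of the crossing side number \<open>j\<close>, which carries the label \<open>lab c j\<close>.\<close>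

fun line :: "cyl \<Rightarrow> int \<Rightarrow> real \<Rightarrow> real" where
  "line Inner j y = (2 * of_int j - 1) * ir"
| "line Outer j y = of_int j * ll + (if even j then y - ll else - y)"

fun lab :: "cyl \<Rightarrow> int \<Rightarrow> letter" where
  "lab Inner j = C" | "lab Outer j = (if even j then D else B)"

lemma K_dev: "K c x y = dev (lam c) (pt x y)" by (cases c) auto

lemma ll_pos: "ll > 0" using hs_pos ir_pos by simp

lemma loc_finite_lam: "loc_finite (lam c)"
proof -
  have fin: "finite {n :: int. \<bar>of_int n * k\<bar> \<le> R}" if "k > 0" for k R :: real
  proof -
    have "{n :: int. \<bar>of_int n * k\<bar> \<le> R} \<subseteq> {- \<lceil>R / k\<rceil> .. \<lceil>R / k\<rceil>}"
    proof
      fix n :: int assume "n \<in> {n. \<bar>of_int n * k\<bar> \<le> R}"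
      then have "\<bar>of_int n\<bar> \<le> R / k" using that by (simp add: abs_mult field_simps)
      then have "of_int \<bar>n\<bar> \<le> real_of_int \<lceil>R / k\<rceil>" by linarith
      then have "\<bar>n\<bar> \<le> \<lceil>R / k\<rceil>" by linarith
      then show "n \<in> {- \<lceil>R / k\<rceil> .. \<lceil>R / k\<rceil>}" by auto
    qed
    then show ?thesis by (rule finite_subset) simp
  qed
  have n: "\<bar>a\<bar> \<le> norm (pt a b)" for a b using component_le_norm_cart[of "pt a b" 1] by simp
  show ?thesis unfolding loc_finite_def
  proof
    fix R
    show "finite {q \<in> lam c. norm q \<le> R}"
    proof (cases c)
      case Inner
      have "{q \<in> lam c. norm q \<le> R} \<subseteq> (\<lambda>m. pt (2 * of_int m * ir) 0) ` {m :: int. \<bar>of_int m * (2 * ir)\<bar> \<le> R}"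
      proof
        fix q assume "q \<in> {q \<in> lam c. norm q \<le> R}"
        then obtain m :: int where m: "q = pt (2 * of_int m * ir) 0" "norm q \<le> R" using Inner by auto
        then have "\<bar>of_int m * (2 * ir)\<bar> \<le> R" using n[of "2 * of_int m * ir" 0] by (simp add: mult_ac)
        then show "q \<in> (\<lambda>m. pt (2 * of_int m * ir) 0) ` {m :: int. \<bar>of_int m * (2 * ir)\<bar> \<le> R}" using m(1) by blast
      qed
      then show ?thesis by (rule finite_subset) (use fin[of "2 * ir" R] ir_pos in simp)
    next
      case Outer
      have "{q \<in> lam c. norm q \<le> R} \<subseteq> (\<lambda>m. pt (of_int m * ll) (if even m then 0 else - ll)) ` {m :: int. \<bar>of_int m * ll\<bar> \<le> R}"
      proof
        fix q assume "q \<in> {q \<in> lam c. norm q \<le> R}"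
        then obtain m :: int where m: "q = pt (of_int m * ll) (if even m then 0 else - ll)" "norm q \<le> R" using Outer by auto
        then have "\<bar>of_int m * ll\<bar> \<le> R" using n[of "of_int m * ll" "if even m then 0 else - ll"] by simp
        then show "q \<in> (\<lambda>m. pt (of_int m * ll) (if even m then 0 else - ll)) ` {m :: int. \<bar>of_int m * ll\<bar> \<le> R}" using m(1) by blast
      qed
      then show ?thesis by (rule finite_subset) (use fin[OF ll_pos] in simp)
    qed
  qed
qed

lemma dev_iff: "p \<in> dev \<Lambda> P \<longleftrightarrow> (\<exists>q\<in>\<Lambda>. p = P + q) \<and> p \<in> octagon"
  by (auto simp: dev_def)

lemma K_Inner_iff: "p \<in> K Inner x y \<longleftrightarrow> (\<exists>n::int. p = pt (x + 2 * of_int n * ir) y \<and> p \<in> octagon)"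
proof -
  have "(\<exists>q\<in>{pt (2 * of_int n * ir) 0 | n :: int. True}. p = pt x y + q) \<longleftrightarrow> (\<exists>n::int. p = pt (x + 2 * of_int n * ir) y)"
    by auto
  then show ?thesis unfolding K.simps dev_iff by blast
qed

lemma K_Outer_iff:
  "p \<in> K Outer x y \<longleftrightarrow> (\<exists>n::int. p = pt (x + of_int n * ll) (if even n then y else y - ll) \<and> p \<in> octagon)"
proof -
  have "(\<exists>q\<in>{pt (of_int n * ll) (if even n then 0 else - ll) | n :: int. True}. p = pt x y + q) \<longleftrightarrow>
      (\<exists>n::int. p = pt x y + pt (of_int n * ll) (if even n then 0 else - ll))" by blast
  also have "\<dots> \<longleftrightarrow> (\<exists>n::int. p = pt (x + of_int n * ll) (if even n then y else y - ll))"
    by (intro ex_cong1) (simp add: algebra_simps)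
  finally show ?thesis unfolding K.simps dev_iff by blast
qed

lemma octagon_Inner: "- hs \<le> y \<Longrightarrow> y \<le> hs \<Longrightarrow> pt a y \<in> octagon \<longleftrightarrow> - ir \<le> a \<and> a \<le> ir"
  using hs_pos ir_bounds by (auto simp: octagon_pt)

lemma octagon_Outer: "hs \<le> y \<Longrightarrow> y \<le> ir \<Longrightarrow> pt a y \<in> octagon \<longleftrightarrow> - (ll - y) \<le> a \<and> a \<le> ll - y"
  "hs \<le> y \<Longrightarrow> y \<le> ir \<Longrightarrow> pt a (y - ll) \<in> octagon \<longleftrightarrow> - y \<le> a \<and> a \<le> y"
  using hs_pos ir_bounds by (auto simp: octagon_pt)

lemma normalize: "(P::real) > 0 \<Longrightarrow> \<exists>n::int. a \<le> x + of_int n * P \<and> x + of_int n * P < a + P"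
proof -
  assume P: "P > 0"
  obtain k :: int where "of_int k \<le> (x - a) / P" "(x - a) / P < of_int k + 1"
    by (rule that[of "\<lfloor>(x - a) / P\<rfloor>"]) linarith+
  then have "of_int k * P \<le> x - a" "x - a < (of_int k + 1) * P" using P by (simp_all add: pos_le_divide_eq pos_divide_less_eq)
  then show ?thesis by (intro exI[of _ "- k"]) (simp add: algebra_simps)
qed

lemma of_int_mono: "(k::int) \<le> n \<Longrightarrow> (P::real) > 0 \<Longrightarrow> of_int k * P \<le> of_int n * P" by simp

lemma K_period: "K c (x + of_int m * per c) y = K c x y"
proof (cases c)
  case Inner
  have "K Inner (x + of_int m * (2 * ir)) y \<subseteq> K Inner x y" for x and m :: int
  proof
    fix p assume "p \<in> K Inner (x + of_int m * (2 * ir)) y"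
    then obtain n :: int where "p = pt (x + of_int m * (2 * ir) + 2 * of_int n * ir) y" "p \<in> octagon" unfolding K_Inner_iff by blast
    then show "p \<in> K Inner x y" unfolding K_Inner_iff by (intro exI[of _ "m + n"]) (simp add: algebra_simps)
  qed
  from this[of x m] this[of "x + of_int m * (2 * ir)" "- m"] show ?thesis by (simp add: Inner del: K.simps)
next
  case Outer
  have "K Outer (x + of_int m * (2 * ll)) y \<subseteq> K Outer x y" for x and m :: int
  proof
    fix p assume "p \<in> K Outer (x + of_int m * (2 * ll)) y"
    then obtain n :: int where "p = pt (x + of_int m * (2 * ll) + of_int n * ll) (if even n then y else y - ll)" "p \<in> octagon" unfolding K_Outer_iff by blast
    then show "p \<in> K Outer x y" unfolding K_Outer_iff by (intro exI[of _ "2 * m + n"]) (simp add: algebra_simps)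
  qed
  from this[of x m] this[of "x + of_int m * (2 * ll)" "- m"] show ?thesis by (simp add: Outer del: K.simps)
qed

lemma line_period: "line Inner (j + m) y = line Inner j y + of_int m * per Inner" "line Outer (j + 2 * m) y = line Outer j y + of_int m * per Outer"
  by (simp_all add: algebra_simps)

lemma edge_coords_conv:
  "- hs < y \<Longrightarrow> y < hs \<Longrightarrow> edge_pt 2 (pt ir y)" "hs < y \<Longrightarrow> y < ir \<Longrightarrow> edge_pt 1 (pt (ll - y) y)"
  "hs < y \<Longrightarrow> y < ir \<Longrightarrow> edge_pt 7 (pt (y - ll) y)" "- hs < x \<Longrightarrow> x < hs \<Longrightarrow> edge_pt 0 (pt x ir)"
  unfolding edge_pt_def all8 using hs_pos ir_bounds
  by (simp_all add: mid_less_iff mid_le_iff mid_less_iff(2)[unfolded One_nat_def] mid_le_iff(10)[unfolded One_nat_def])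

text \<open>The cases for the outer cylinder are, in this order: inside the upper trapezoid, on side 1, inside the lower trapezoid, on side 7.  Both lemmas reduce a question about \<open>K\<close> to points of the octagon.\<close>

lemma Inner_cases:
  assumes y: "- hs < y" "y < hs"
  obtains n :: int where "- ir < x + of_int n * per Inner" "x + of_int n * per Inner < ir"
      "K Inner x y = {pt (x + of_int n * per Inner) y}" "oct_int (pt (x + of_int n * per Inner) y)"
  | n :: int where "x + of_int n * per Inner = ir" "K Inner x y = {pt ir y, pt ir y - 2 *\<^sub>R mid 2}" "edge_pt 2 (pt ir y)"
proof -
  have p: "2 * ir > 0" using ir_pos by simp
  obtain n0 :: int where n0: "- ir \<le> x + of_int n0 * (2 * ir)" "x + of_int n0 * (2 * ir) < - ir + 2 * ir" using normalize[OF p] by blast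
  define z where "z = x + of_int n0 * (2 * ir)"
  have z: "- ir \<le> z" "z < ir" using n0 by (auto simp: z_def)
  have Kz: "K Inner x y = K Inner z y" using K_period[of Inner x n0 y] by (simp add: z_def del: K.simps)
  have mem: "p \<in> K Inner z y \<longleftrightarrow> (\<exists>k::int. p = pt (z + 2 * of_int k * ir) y \<and> - ir \<le> z + 2 * of_int k * ir \<and> z + 2 * of_int k * ir \<le> ir)" for p
    unfolding K_Inner_iff using octagon_Inner[of y] y by auto
  have k: "k = 0 \<or> (k = 1 \<and> z = - ir)" if "- ir \<le> z + 2 * of_int k * ir" "z + 2 * of_int k * ir \<le> ir" for k :: int
  proof -
    have "k \<ge> 0"
    proof (rule ccontr)
      assume "\<not> k \<ge> 0" then have "of_int k * (2 * ir) \<le> - 1 * (2 * ir)" by (intro mult_right_mono) (use p in simp_all)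
      then show False using that z ir_pos by linarith
    qed
    moreover have "k \<le> 1"
    proof (rule ccontr)
      assume "\<not> k \<le> 1" then have "2 * (2 * ir) \<le> of_int k * (2 * ir)" by (intro mult_right_mono) (use p in simp_all)
      then show False using that z ir_pos by linarith
    qed
    ultimately have "k = 0 \<or> k = 1" by linarith
    moreover have "z = - ir" if "k = 1" using \<open>z + 2 * of_int k * ir \<le> ir\<close> that z by simp
    ultimately show ?thesis by blast
  qed
  show ?thesis
  proof (cases "z = - ir")
    case False
    have "K Inner z y = {pt z y}"
    proof
      show "K Inner z y \<subseteq> {pt z y}" using k False by (auto simp: mem simp del: K.simps)
      show "{pt z y} \<subseteq> K Inner z y" using z by (auto simp: mem simp del: K.simps intro!: exI[of _ 0])
    qed
    moreover have "oct_int (pt z y)" using z False y hs_pos ir_bounds by (auto simp: oct_int_pt)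
    ultimately show ?thesis using that(1)[of n0] z False Kz by (simp add: z_def del: K.simps)
  next
    case True
    have "K Inner z y = {pt ir y, pt (- ir) y}"
    proof
      show "K Inner z y \<subseteq> {pt ir y, pt (- ir) y}"
      proof
        fix p assume "p \<in> K Inner z y"
        then obtain k' :: int where k': "p = pt (z + 2 * of_int k' * ir) y" "- ir \<le> z + 2 * of_int k' * ir" "z + 2 * of_int k' * ir \<le> ir"
          unfolding mem by blast
        from k[OF k'(2,3)] show "p \<in> {pt ir y, pt (- ir) y}" using k'(1) True by auto
      qed
      have "pt ir y \<in> K Inner z y" unfolding mem using True ir_pos by (intro exI[of _ 1]) simp
      moreover have "pt (- ir) y \<in> K Inner z y" unfolding mem using True ir_pos by (intro exI[of _ 0]) simp
      ultimately show "{pt ir y, pt (- ir) y} \<subseteq> K Inner z y" by blast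
    qed
    moreover have "pt ir y - 2 *\<^sub>R mid 2 = pt (- ir) y" by (simp add: mid_values)
    moreover have "x + of_int (n0 + 1) * per Inner = ir" using True by (simp add: z_def algebra_simps)
    ultimately show ?thesis using that(2)[of "n0 + 1"] Kz edge_coords_conv(1)[OF y] by (simp del: K.simps)
  qed
qed

lemma Outer_cases:
  assumes y: "hs < y" "y < ir"
  obtains n :: int where "- (ll - y) < x + of_int n * per Outer" "x + of_int n * per Outer < ll - y"
      "K Outer x y = {pt (x + of_int n * per Outer) y}" "oct_int (pt (x + of_int n * per Outer) y)"
  | n :: int where "x + of_int n * per Outer = ll - y" "K Outer x y = {pt (ll - y) y, pt (ll - y) y - 2 *\<^sub>R mid 1}" "edge_pt 1 (pt (ll - y) y)"
  | n :: int where "ll - y < x + of_int n * per Outer" "x + of_int n * per Outer < ll + y"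
      "K Outer x y = {pt (x + of_int n * per Outer - ll) (y - ll)}" "oct_int (pt (x + of_int n * per Outer - ll) (y - ll))"
  | n :: int where "x + of_int n * per Outer = - (ll - y)" "K Outer x y = {pt (y - ll) y, pt (y - ll) y - 2 *\<^sub>R mid 7}" "edge_pt 7 (pt (y - ll) y)"
proof -
  note h = hs_pos ir_bounds
  have p: "2 * ll > 0" using ll_pos by simp
  obtain n0 :: int where n0: "- (ll - y) \<le> x + of_int n0 * (2 * ll)" "x + of_int n0 * (2 * ll) < - (ll - y) + 2 * ll" using normalize[OF p] by blast
  define z where "z = x + of_int n0 * (2 * ll)"
  have z: "- (ll - y) \<le> z" "z < ll + y" using n0 by (auto simp: z_def)
  have Kz: "K Outer x y = K Outer z y" using K_period[of Outer x n0 y] by (simp add: z_def del: K.simps)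
  have ze: "x + of_int n0 * per Outer = z" by (simp add: z_def)
  define ev where "ev k \<longleftrightarrow> even k \<and> - (ll - y) \<le> z + of_int k * ll \<and> z + of_int k * ll \<le> ll - y" for k :: int
  define od where "od k \<longleftrightarrow> odd k \<and> - y \<le> z + of_int k * ll \<and> z + of_int k * ll \<le> y" for k :: int
  have mem: "p \<in> K Outer z y \<longleftrightarrow> (\<exists>k. ev k \<and> p = pt (z + of_int k * ll) y) \<or> (\<exists>k. od k \<and> p = pt (z + of_int k * ll) (y - ll))" for p
  proof -
    have "p \<in> K Outer z y \<longleftrightarrow> (\<exists>k::int. (even k \<and> p = pt (z + of_int k * ll) y \<and> p \<in> octagon) \<or> (odd k \<and> p = pt (z + of_int k * ll) (y - ll) \<and> p \<in> octagon))"
      unfolding K_Outer_iff by (intro ex_cong1) auto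
    also have "\<dots> \<longleftrightarrow> (\<exists>k. (ev k \<and> p = pt (z + of_int k * ll) y) \<or> (od k \<and> p = pt (z + of_int k * ll) (y - ll)))"
      by (intro ex_cong1) (use octagon_Outer[of y] y in \<open>auto simp: ev_def od_def\<close>)
    finally show ?thesis by blast
  qed
  have lo: "z + of_int k * ll \<le> z - of_int m * ll" if "k \<le> - m" for k m :: int
    using of_int_mono[OF that ll_pos] by simp
  have hi: "z + of_int k * ll \<ge> z + of_int m * ll" if "k \<ge> m" for k m :: int
    using of_int_mono[OF that ll_pos] by simp
  have evk: "ev k \<longleftrightarrow> k = 0 \<and> z \<le> ll - y" for k
  proof
    assume e: "ev k"
    then have "\<not> k \<ge> 2" using hi[of 2 k] z h y by (auto simp: ev_def)
    moreover have "\<not> k \<le> - 2" using e lo[of k 2] z h y by (auto simp: ev_def)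
    moreover have "even k" using e by (simp add: ev_def)
    ultimately have "k = 0" by presburger
    then show "k = 0 \<and> z \<le> ll - y" using e by (simp add: ev_def)
  qed (use z in \<open>simp add: ev_def\<close>)
  have odk: "od k \<longleftrightarrow> (k = - 1 \<and> ll - y \<le> z) \<or> (k = 1 \<and> z = - (ll - y))" for k
  proof
    assume e: "od k"
    then have "\<not> k \<ge> 2" using hi[of 2 k] z h y by (auto simp: od_def)
    moreover have "\<not> k \<le> - 3" using e lo[of k 3] z h y by (auto simp: od_def)
    moreover have "odd k" using e by (simp add: od_def)
    ultimately have "k = - 1 \<or> k = 1" by presburger
    then show "(k = - 1 \<and> ll - y \<le> z) \<or> (k = 1 \<and> z = - (ll - y))" using e z by (auto simp: od_def)
  qed (use z h y in \<open>auto simp: od_def\<close>)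
  have Kset: "K Outer z y = {p. (z \<le> ll - y \<and> p = pt z y) \<or> (ll - y \<le> z \<and> p = pt (z - ll) (y - ll)) \<or> (z = - (ll - y) \<and> p = pt (z + ll) (y - ll))}"
    by (rule set_eqI) (auto simp: mem evk odk simp del: K.simps)
  consider "z = - (ll - y)" | "- (ll - y) < z" "z < ll - y" | "z = ll - y" | "ll - y < z" using z by linarith
  then show ?thesis
  proof cases
    case 1
    have "pt (y - ll) y - 2 *\<^sub>R mid 7 = pt y (y - ll)" by (simp add: mid_values diff_divide_distrib add_divide_distrib)
    moreover have "K Outer z y = {pt (y - ll) y, pt y (y - ll)}" unfolding Kset using 1 h y by auto
    ultimately show ?thesis using that(4)[of n0] 1 Kz ze edge_coords_conv(3)[OF y] by (simp del: K.simps)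
  next
    case 2
    have "K Outer z y = {pt z y}" unfolding Kset using 2 by auto
    moreover have "oct_int (pt z y)" using 2 h y by (auto simp: oct_int_pt)
    ultimately show ?thesis using that(1)[of n0] 2 Kz ze by (simp del: K.simps)
  next
    case 3
    have g: "2 * (c / 2) = c" for c :: real by simp
    have "pt (ll - y) y - 2 *\<^sub>R mid 1 = pt (- y) (y - ll)" unfolding mid_values(2) pt_simps g by simp
    moreover have "K Outer z y = {pt (ll - y) y, pt (- y) (y - ll)}" unfolding Kset using 3 h y by auto
    ultimately show ?thesis using that(2)[of n0] 3 Kz ze edge_coords_conv(2)[OF y] by (simp del: K.simps)
  next
    case 4
    have "K Outer z y = {pt (z - ll) (y - ll)}" unfolding Kset using 4 z h y by auto
    moreover have "oct_int (pt (z - ll) (y - ll))" using 4 z h y by (auto simp: oct_int_pt)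
    ultimately show ?thesis using that(3)[of n0] 4 z Kz ze by (simp del: K.simps)
  qed
qed

lemma K_regular: "low c < y \<Longrightarrow> y < top c \<Longrightarrow> K c x y \<in> regular"
proof (cases c)
  case Inner
  assume "low c < y" "y < top c"
  then have y: "- hs < y" "y < hs" using Inner by auto
  show ?thesis unfolding Inner
    by (rule Inner_cases[OF y, of x]) (simp_all only: int_regular edge_regular)
next
  case Outer
  assume "low c < y" "y < top c"
  then have y: "hs < y" "y < ir" using Outer by auto
  show ?thesis unfolding Outer
    by (rule Outer_cases[OF y, of x]) (simp_all only: int_regular edge_regular)
qed

lemma line_mono: assumes "low c \<le> y" "y \<le> top c" "i < j" shows "line c i y < line c j y"
proof -
  have step: "line c k y < line c (k + 1) y" for k
    using assms hs_pos ir_bounds by (cases c) (auto simp: algebra_simps)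
  have "line c i y < line c (i + 1 + int m) y" for m
  proof (induction m)
    case (Suc m)
    have "line c (i + 1 + int m) y < line c (i + 1 + int m + 1) y" by (rule step)
    then show ?case using Suc by (simp add: add.commute add.left_commute del: line.simps)
  qed (use step[of i] in simp)
  from this[of "nat (j - i - 1)"] assms(3) show ?thesis by simp
qed

lemma line_le_iff: "low c \<le> y \<Longrightarrow> y \<le> top c \<Longrightarrow> line c i y < line c j y \<longleftrightarrow> i < j"
  using line_mono[of c y i j] line_mono[of c y j i] by (metis less_irrefl not_less_iff_gr_or_eq order_less_trans)

lemma line_inj: "low c \<le> y \<Longrightarrow> y \<le> top c \<Longrightarrow> line c i y = line c j y \<longleftrightarrow> i = j"
  using line_mono[of c y i j] line_mono[of c y j i] by (metis less_irrefl not_less_iff_gr_or_eq)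

lemma line_minus: "- line c j y = line c (1 - j) y"
  by (cases c) (auto simp: algebra_simps)

lemma line_shift: "\<exists>m::int. \<forall>y. line c (j + m) y = line c j y + of_int n * per c \<and> lab c (j + m) = lab c j"
proof (cases c)
  case Inner then show ?thesis by (intro exI[of _ n]) (simp add: algebra_simps)
next
  case Outer then show ?thesis by (intro exI[of _ "2 * n"]) (simp add: algebra_simps)
qed

lemma K_side:
  assumes "low c < y" "y < top c"
  shows "K c x y \<in> surface_side L \<longleftrightarrow> (\<exists>j. x = line c j y \<and> L = lab c j)"
proof -
  \<comment> \<open>It suffices to treat a representative modulo the period.\<close>
  have shift: "(\<exists>j. x = line c j y \<and> L = lab c j) \<longleftrightarrow> (\<exists>j. x + of_int n * per c = line c j y \<and> L = lab c j)" for n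
  proof
    assume "\<exists>j. x = line c j y \<and> L = lab c j"
    then obtain j where "x = line c j y" "L = lab c j" by blast
    moreover obtain m :: int where "\<forall>y. line c (j + m) y = line c j y + of_int n * per c \<and> lab c (j + m) = lab c j" using line_shift by blast
    ultimately show "\<exists>j. x + of_int n * per c = line c j y \<and> L = lab c j" by (intro exI[of _ "j + m"]) auto
  next
    assume "\<exists>j. x + of_int n * per c = line c j y \<and> L = lab c j"
    then obtain j where "x + of_int n * per c = line c j y" "L = lab c j" by blast
    moreover obtain m :: int where "\<forall>y. line c (j + m) y = line c j y + of_int (- n) * per c \<and> lab c (j + m) = lab c j" using line_shift by blast
    ultimately show "\<exists>j. x = line c j y \<and> L = lab c j" by (intro exI[of _ "j + m"]) auto
  qed
  have yc: "low c \<le> y" "y \<le> top c" using assms by auto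
  have none: "\<not> (\<exists>j. z = line c j y \<and> L = lab c j)" if "line c k y < z" "z < line c (k + 1) y" for z k
    using that line_le_iff[OF yc, of k] line_le_iff[OF yc, of _ "k + 1"] by fastforce
  have one: "(\<exists>j. z = line c j y \<and> L = lab c j) \<longleftrightarrow> L = lab c k" if "z = line c k y" for z k
    using that line_inj[OF yc] by metis
  have edge: "{p, p - 2 *\<^sub>R mid i} \<in> surface_side L \<longleftrightarrow> L = oct_label i" if "edge_pt i p" for i p
    using edge_side[OF that] side_unique[OF edge_regular[OF that]] by blast
  show ?thesis
  proof (cases c)
    case Inner
    then have y: "- hs < y" "y < hs" using assms by auto
    show ?thesis
    proof (rule Inner_cases[OF y, of x])
      fix n :: int
      let ?z = "x + of_int n * per Inner"
      assume a: "- ir < ?z" "?z < ir" "K Inner x y = {pt ?z y}" "oct_int (pt ?z y)"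
      have "\<not> (\<exists>j. ?z = line c j y \<and> L = lab c j)" by (rule none[of 0]) (use a Inner in auto)
      then show ?thesis using int_side[OF a(4)] a(3) shift[of n] Inner by (metis (no_types))
    next
      fix n :: int
      let ?z = "x + of_int n * per Inner"
      assume a: "?z = ir" "K Inner x y = {pt ir y, pt ir y - 2 *\<^sub>R mid 2}" "edge_pt 2 (pt ir y)"
      have "(\<exists>j. ?z = line c j y \<and> L = lab c j) \<longleftrightarrow> L = lab c 1" by (rule one) (use a Inner in auto)
      then show ?thesis using edge[OF a(3)] a(2) shift[of n] Inner by (simp add: oct_label_values del: K.simps line.simps)
    qed
  next
    case Outer
    then have y: "hs < y" "y < ir" using assms by auto
    show ?thesis
    proof (rule Outer_cases[OF y, of x])
      fix n :: int
      let ?z = "x + of_int n * per Outer"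
      assume a: "- (ll - y) < ?z" "?z < ll - y" "K Outer x y = {pt ?z y}" "oct_int (pt ?z y)"
      have "\<not> (\<exists>j. ?z = line c j y \<and> L = lab c j)" by (rule none[of 0]) (use a Outer in auto)
      then show ?thesis using int_side[OF a(4)] a(3) shift[of n] Outer by (metis (no_types))
    next
      fix n :: int
      let ?z = "x + of_int n * per Outer"
      assume a: "?z = ll - y" "K Outer x y = {pt (ll - y) y, pt (ll - y) y - 2 *\<^sub>R mid 1}" "edge_pt 1 (pt (ll - y) y)"
      have "(\<exists>j. ?z = line c j y \<and> L = lab c j) \<longleftrightarrow> L = lab c 1" by (rule one) (use a Outer in auto)
      then show ?thesis using edge[OF a(3)] a(2) shift[of n] Outer oct_label_values(2) by (simp del: K.simps line.simps)
    next
      fix n :: int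
      let ?z = "x + of_int n * per Outer"
      assume a: "ll - y < ?z" "?z < ll + y" "K Outer x y = {pt (?z - ll) (y - ll)}" "oct_int (pt (?z - ll) (y - ll))"
      have "\<not> (\<exists>j. ?z = line c j y \<and> L = lab c j)" by (rule none[of 1]) (use a Outer in auto)
      then show ?thesis using int_side[OF a(4)] a(3) shift[of n] Outer by (metis (no_types))
    next
      fix n :: int
      let ?z = "x + of_int n * per Outer"
      assume a: "?z = - (ll - y)" "K Outer x y = {pt (y - ll) y, pt (y - ll) y - 2 *\<^sub>R mid 7}" "edge_pt 7 (pt (y - ll) y)"
      have "(\<exists>j. ?z = line c j y \<and> L = lab c j) \<longleftrightarrow> L = lab c 0" by (rule one) (use a Outer in auto)
      then show ?thesis using edge[OF a(3)] a(2) shift[of n] Outer by (simp add: oct_label_values del: K.simps line.simps)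
    qed
  qed
qed

section \<open>Closed horizontal trajectories and affine maps\<close>

declare K.simps [simp del] line.simps [simp del]

lemma low_top: "low c < top c" using hs_pos ir_bounds by (cases c) auto
lemma per_pos: "per c > 0" using ll_pos ir_pos by (cases c) auto
lemma per_ne: "per c = per c' \<Longrightarrow> c = c'" using hs_pos by (cases c; cases c') auto

text \<open>A point of the octagon determines its height, hence the cylinder, and the horizontal coordinate up to the period.\<close>

lemma K_meet:
  assumes m: "p \<in> K c x y" "p \<in> K c' x' y'" and y: "low c \<le> y" "y \<le> top c" and y': "low c' < y'" "y' < top c'"
  shows "c = c' \<and> y = y' \<and> (\<exists>n::int. x' = x + of_int n * per c)"
proof (cases c)
  case Inner
  obtain n :: int where n: "p = pt (x + 2 * of_int n * ir) y" using m(1) unfolding Inner K_Inner_iff by blast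
  show ?thesis
  proof (cases c')
    case I': Inner
    obtain n' :: int where n': "p = pt (x' + 2 * of_int n' * ir) y'" using m(2) unfolding I' K_Inner_iff by blast
    then have "y = y'" "x' = x + of_int (n - n') * per c" using n Inner by (simp_all add: algebra_simps)
    then show ?thesis using Inner I' by blast
  next
    case O': Outer
    obtain n' :: int where n': "p = pt (x' + of_int n' * ll) (if even n' then y' else y' - ll)" using m(2) unfolding O' K_Outer_iff by blast
    then have "y = y' \<or> y = y' - ll" using n by (auto split: if_splits)
    then show ?thesis using y y' Inner O' hs_pos by auto
  qed
next
  case Outer
  obtain n :: int where n: "p = pt (x + of_int n * ll) (if even n then y else y - ll)" using m(1) unfolding Outer K_Outer_iff by blast
  show ?thesis
  proof (cases c')
    case I': Inner
    obtain n' :: int where n': "p = pt (x' + 2 * of_int n' * ir) y'" using m(2) unfolding I' K_Inner_iff by blast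
    then have "y = y' \<or> y - ll = y'" using n by (auto split: if_splits)
    then show ?thesis using y y' Outer I' hs_pos by auto
  next
    case O': Outer
    obtain n' :: int where n': "p = pt (x' + of_int n' * ll) (if even n' then y' else y' - ll)" using m(2) unfolding O' K_Outer_iff by blast
    have xx: "x' = x + of_int (n - n') * ll" using n n' by (simp add: algebra_simps)
    have e: "(if even n then y else y - ll) = (if even n' then y' else y' - ll)" using n n' by simp
    have h: "hs \<le> y" "y \<le> ir" "hs < y'" "y' < ir" using y y' Outer O' by simp_all
    have par: "even n = even n'"
    proof (rule ccontr)
      assume "even n \<noteq> even n'"
      then have "y = y' - ll \<or> y - ll = y'" using e by (cases "even n") simp_all
      then show False using h hs_pos by linarith
    qed
    then have yy: "y = y'" using e by (cases "even n") simp_all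
    have "even (n - n')" using par by simp
    then obtain k where "n - n' = 2 * k" by (rule evenE)
    note this yy
    then show ?thesis using xx Outer O' by (intro conjI exI[of _ k]) simp_all
  qed
qed

lemma horizontal_traj: assumes "low c < y" "y < top c" shows "traj (pt k 0) (\<lambda>s. K c (x + k * s) y)"
proof -
  have e: "K c (x + k * s) y = dev (lam c) (pt x y + s *\<^sub>R pt k 0)" for s by (simp add: K_dev mult.commute)
  have "straight UNIV (pt k 0) (\<lambda>s. dev (lam c) (pt x y + s *\<^sub>R pt k 0))"
  proof (rule dev_straight[OF loc_finite_lam])
    show "dev (lam c) (pt x y + s *\<^sub>R pt k 0) \<in> octagon_surface" for s
      unfolding e[symmetric] using K_regular[OF assms] by simp
  qed
  then show ?thesis using K_regular[OF assms] unfolding traj_def e[symmetric] by simp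
qed

text \<open>Smallest positive return time of a path to its starting point.  Affine maps preserve it, as they are bijections, which makes it a substitute for the length of a closed trajectory.\<close>

definition minper :: "(real \<Rightarrow> surface_point) \<Rightarrow> real \<Rightarrow> bool" where
  "minper f P \<longleftrightarrow> P > 0 \<and> f P = f 0 \<and> (\<forall>s. 0 < s \<and> s < P \<longrightarrow> f s \<noteq> f 0)"

lemma minper_unique: "minper f P \<Longrightarrow> minper f Q \<Longrightarrow> P = Q"
  unfolding minper_def by (metis linorder_neqE_linordered_idom)

lemma minper_K:
  assumes y: "low c < y" "y < top c" and k: "k \<noteq> 0"
  shows "minper (\<lambda>s. K c (x + k * s) y) (per c / \<bar>k\<bar>)"
  unfolding minper_def
proof (intro conjI allI impI)
  show "per c / \<bar>k\<bar> > 0" using per_pos k by simp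
  have "k * (per c / \<bar>k\<bar>) = of_int (if k > 0 then 1 else - 1) * per c" using k by (auto simp: field_simps)
  then show "K c (x + k * (per c / \<bar>k\<bar>)) y = K c (x + k * 0) y"
    using K_period[of c x "if k > 0 then 1 else - 1" y] by simp
  fix s assume s: "0 < s \<and> s < per c / \<bar>k\<bar>"
  then have ks: "0 < \<bar>k * s\<bar>" "\<bar>k * s\<bar> < per c" using k by (auto simp: abs_mult field_simps)
  show "K c (x + k * s) y \<noteq> K c (x + k * 0) y"
  proof
    assume e: "K c (x + k * s) y = K c (x + k * 0) y"
    obtain p where "p \<in> K c x y" using K_regular[OF y] surface_nonempty by blast
    then obtain n :: int where n: "x + k * s = x + of_int n * per c"
      using K_meet[of p c x y c "x + k * s" y] e y by auto
    then have "\<bar>of_int n\<bar> * per c < 1 * per c" "n \<noteq> 0" using ks per_pos[of c] by (auto simp: abs_mult)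
    then have "\<bar>real_of_int n\<bar> < 1" "n \<noteq> 0" using per_pos[of c] by (simp_all add: mult_less_cancel_right_pos)
    then show False by linarith
  qed
qed

lemma vertex_pts: "pt hs ir \<in> singular_point" "pt (- hs) ir \<in> singular_point" "pt ir hs \<in> singular_point" "pt (- ir) hs \<in> singular_point"
  "pt hs (- ir) \<in> singular_point" "pt (- hs) (- ir) \<in> singular_point" "pt ir (- hs) \<in> singular_point" "pt (- ir) (- hs) \<in> singular_point"
  unfolding singular_point_eq oct_vertex_values[symmetric] by (rule rangeI)+

lemma regular_not_vertex: "x \<in> regular \<Longrightarrow> p \<in> x \<Longrightarrow> p \<notin> singular_point"
  using surface_eqI singular_surface by blast

text \<open>A horizontal path on the boundary between the cylinders runs into the singular point.\<close>

lemma horizontal_hit: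
  assumes f: "traj (pt k 0) f" and k: "k \<noteq> 0" and L: "finite \<Lambda>" and p: "pt x y \<in> f 0" "pt x y \<in> dev \<Lambda> (pt x y)" and x: "- m < x" "x < m"
    and d: "\<And>z. - m < z \<Longrightarrow> z < m \<Longrightarrow> dev \<Lambda> (pt z y) \<in> octagon_surface"
    and e: "dev \<Lambda> (pt m y) \<subseteq> singular_point" "dev \<Lambda> (pt (- m) y) \<subseteq> singular_point"
  shows False
proof -
  define z where "z = (if k > 0 then m else - m)"
  define b where "b = (z - x) / k"
  define a where "a = (- z - x) / k"
  have kb: "k * b = z - x" "k * a = - z - x" using k by (auto simp: b_def a_def)
  have ab: "a < 0" "0 < b" using k x by (auto simp: a_def b_def z_def divide_simps)
  have P: "pt x y + t *\<^sub>R pt k 0 = pt (x + k * t) y" for t by (simp add: mult.commute)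
  have int: "- m < x + k * t \<and> x + k * t < m" if t: "t \<in> {a<..<b}" for t
  proof (cases "k > 0")
    case True
    then have "k * a < k * t" "k * t < k * b" using t by auto
    then show ?thesis using kb True by (simp add: z_def)
  next
    case False
    then have "k * b < k * t" "k * t < k * a" using t k by (auto simp: mult_less_cancel_left)
    then show ?thesis using kb False by (simp add: z_def)
  qed
  have "f b \<inter> dev \<Lambda> (pt x y + b *\<^sub>R pt k 0) \<noteq> {}"
  proof (rule dev_path(3)[OF finite_loc_finite[OF L] traj_straight[OF f], where a = a and c = 0])
    show "dev \<Lambda> (pt x y + t *\<^sub>R pt k 0) \<in> octagon_surface" if "t \<in> {a<..<b}" for t
      unfolding P using int[OF that] d by blast
    show "0 \<in> {a<..<b}" using ab by simp
    show "f 0 \<inter> dev \<Lambda> (pt x y + 0 *\<^sub>R pt k 0) \<noteq> {}" unfolding P using p by auto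
  qed
  then obtain q where q: "q \<in> f b" "q \<in> dev \<Lambda> (pt z y)" unfolding P using kb by auto
  then have "q \<in> singular_point" using e by (auto simp: z_def split: if_splits)
  then show False using regular_not_vertex[OF straight_regular[OF f] q(1)] by blast
qed

text \<open>A horizontal trajectory that stays away from the singular point runs inside one of the two cylinders, as the boundaries of the cylinders are horizontal sides and diagonals, which end at vertices.\<close>

lemma horizontal_class:
  assumes f: "traj (pt k 0) f" and k: "k \<noteq> 0"
  obtains c x y where "low c < y" "y < top c" "f = (\<lambda>s. K c (x + k * s) y)"
proof -
  obtain p where p: "p \<in> f 0" using straight_regular[OF f] surface_nonempty by blast
  obtain x y where xy: "p = pt x y" by (rule pt_cases)
  have po: "pt x y \<in> octagon" using surface_class[of "f 0" p] straight_regular[OF f] p xy by auto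
  have O: "y \<le> ir" "x + y \<le> ll" "x \<le> ir" "x - y \<le> ll" "-ir \<le> y" "-ll \<le> x + y" "-ir \<le> x" "-ll \<le> x - y"
    using po unfolding octagon_pt by auto
  have nv: "p \<notin> singular_point" by (rule regular_not_vertex[OF straight_regular[OF f] p])
  have *: thesis if "low c < z" "z < top c" "p \<in> K c u z" for c u z
  proof -
    have g: "traj (pt k 0) (\<lambda>s. K c (u + k * s) z)" by (rule horizontal_traj[OF that(1,2)])
    have "f 0 = K c (u + k * 0) z"
      by (rule surface_eqI[of _ _ p]) (use straight_regular[OF f] K_regular[OF that(1,2)] p that(3) in auto)
    then have "f s = K c (u + k * s) z" for s by (rule traj_unique[OF f g])
    then show ?thesis using \<open>\<And>y c x. \<lbrakk>low c < y; y < top c; f = (\<lambda>s. K c (x + k * s) y)\<rbrakk> \<Longrightarrow> thesis\<close> that by blast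
  qed
  have level: False if y: "y = hs \<or> y = - hs"
  proof (rule horizontal_hit[OF f k, of "{0}" x y ir])
    show "pt x y \<in> f 0" using p xy by simp
    show "pt x y \<in> dev {0} (pt x y)" using po by (simp add: dev_0)
    have "x \<noteq> ir" "x \<noteq> - ir" using nv y vertex_pts unfolding xy by auto
    then show "- ir < x" "x < ir" using O by auto
    show "dev {0} (pt z y) \<in> octagon_surface" if "- ir < z" "z < ir" for z
    proof -
      have "oct_int (pt z y)" using that y hs_pos ir_bounds by (auto simp: oct_int_pt)
      then show ?thesis using int_regular oct_int_octagon by (auto simp: dev_0)
    qed
    show "dev {0} (pt ir y) \<subseteq> singular_point" "dev {0} (pt (- ir) y) \<subseteq> singular_point" using y vertex_pts by (auto simp: dev_0)
  qed simp
  have level2: False if y: "y = ir \<or> y = - ir"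
  proof (rule horizontal_hit[OF f k, of "{0, pt 0 (- 2 * y)}" x y hs])
    show "pt x y \<in> f 0" using p xy by simp
    show "pt x y \<in> dev {0, pt 0 (- 2 * y)} (pt x y)" using po by (simp add: dev_def)
    have "x \<noteq> hs" "x \<noteq> - hs" using nv y vertex_pts unfolding xy by auto
    then show "- hs < x" "x < hs" using O y by auto
    have dv: "dev {0, pt 0 (- 2 * y)} (pt z y) = {pt z ir, pt z (- ir)} \<inter> octagon" for z
      using y by (auto simp: dev_def)
    show "dev {0, pt 0 (- 2 * y)} (pt z y) \<in> octagon_surface" if "- hs < z" "z < hs" for z
    proof -
      have e: "edge_pt 0 (pt z ir)" by (rule edge_coords_conv(4)[OF that])
      have "{pt z ir, pt z (- ir)} = {pt z ir, pt z ir - 2 *\<^sub>R mid 0}" by (simp add: mid_values)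
      then have s: "{pt z ir, pt z (- ir)} \<in> octagon_surface" using edge_regular[OF e] by simp
      then have "{pt z ir, pt z (- ir)} \<subseteq> octagon" using surface_class by blast
      then show ?thesis unfolding dv using s by (simp add: inf.absorb1)
    qed
    show "dev {0, pt 0 (- 2 * y)} (pt hs y) \<subseteq> singular_point" "dev {0, pt 0 (- 2 * y)} (pt (- hs) y) \<subseteq> singular_point"
      unfolding dv using vertex_pts by auto
  qed simp
  consider "- hs < y" "y < hs" | "hs < y" "y < ir" | "- ir < y" "y < - hs" using level level2 O by fastforce
  then show thesis
  proof cases
    case 1
    have "p \<in> K Inner x y" unfolding K_Inner_iff xy using po by (intro exI[of _ 0]) simp
    then show ?thesis using *[of Inner y x] 1 by simp
  next
    case 2
    have "p \<in> K Outer x y" unfolding K_Outer_iff xy using po by (intro exI[of _ 0]) simp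
    then show ?thesis using *[of Outer y x] 2 by simp
  next
    case 3
    have "p \<in> K Outer (x + ll) (y + ll)" unfolding K_Outer_iff xy using po by (intro exI[of _ "- 1"]) simp
    then show ?thesis using *[of Outer "y + ll" "x + ll"] 3 by simp
  qed
qed

lemma minper_aff:
  assumes a: "aff \<Psi> M" and f: "\<And>t. f t \<in> octagon_surface" and m: "minper f P" shows "minper (\<Psi> \<circ> f) P"
proof -
  have "f s = f 0" if "\<Psi> (f s) = \<Psi> (f 0)" for s by (rule affD(3)[OF a f f that])
  then show ?thesis using m unfolding minper_def o_apply by metis
qed

lemma aff_horizontal_minper:
  assumes a: "aff \<Psi> M" and f: "traj v f" "minper f P" and M: "M *v v = pt l 0" "l \<noteq> 0"
  obtains c where "P = per c / \<bar>l\<bar>" "\<exists>x y. low c < y \<and> y < top c \<and> \<Psi> (f 0) = K c x y"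
proof -
  have g: "traj (pt l 0) (\<Psi> \<circ> f)" using aff_traj[OF a f(1)] M by simp
  obtain c x y where c: "low c < y" "y < top c" "\<Psi> \<circ> f = (\<lambda>s. K c (x + l * s) y)" by (rule horizontal_class[OF g M(2)])
  have m: "minper (\<Psi> \<circ> f) P" by (rule minper_aff[OF a _ f(2)]) (use straight_regular[OF f(1)] in auto)
  have "P = per c / \<bar>l\<bar>" using minper_unique[OF m] minper_K[OF c(1,2) M(2), of x] unfolding c(3) by blast
  moreover have "\<Psi> (f 0) = K c x y" using fun_cong[OF c(3), of 0] by simp
  ultimately show ?thesis using that c by blast
qed

text \<open>The map permutes the closed horizontal trajectories, and multiplies lengths by \<open>\<bar>l\<bar>\<close>.  A factor that takes the set of the two lengths \<open>2 * ir\<close> and \<open>2 * ll\<close> to itself has absolute value 1.\<close>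

lemma horizontal_scaling:
  assumes a: "aff \<Psi> M" and M: "M *v pt 1 0 = pt l 0" "l \<noteq> 0" shows "\<bar>l\<bar> = 1"
proof -
  have "\<exists>c'. per c = per c' / \<bar>l\<bar>" for c
  proof -
    have y: "low c < (low c + top c) / 2" "(low c + top c) / 2 < top c" using low_top[of c] by auto
    have "minper (\<lambda>s. K c (0 + 1 * s) ((low c + top c) / 2)) (per c / \<bar>1\<bar>)" by (rule minper_K[OF y]) simp
    then have m: "minper (\<lambda>s. K c (0 + 1 * s) ((low c + top c) / 2)) (per c)" by simp
    show ?thesis by (rule aff_horizontal_minper[OF a horizontal_traj[OF y] m M]) blast
  qed
  from this[of Inner] this[of Outer] obtain c1 c2 where c: "per c1 = 2 * ir * \<bar>l\<bar>" "per c2 = 2 * ll * \<bar>l\<bar>"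
    using M(2) by (auto simp: field_simps)
  have l: "\<bar>l\<bar> > 0" using M by simp
  show ?thesis
  proof (cases c1)
    case Inner then show ?thesis using c(1) ir_pos by simp
  next
    case O1: Outer
    show ?thesis
    proof (cases c2)
      case Inner
      define m where "m = \<bar>l\<bar>"
      have "2 * ll = 2 * ir * m" "2 * ir = 2 * ll * m" using c unfolding O1 Inner per.simps m_def by blast+
      moreover have "ir * m < ll * m" using l hs_pos by (simp add: m_def)
      ultimately have False using hs_pos unfolding distrib_right distrib_left by linarith
      then show ?thesis ..
    next
      case Outer then show ?thesis using c(2) ll_pos by simp
    qed
  qed
qed

text \<open>The closed trajectory through the midpoints of sides \<open>i\<close> and \<open>j\<close>: it consists of the segment from \<open>- mid j\<close> to \<open>mid i\<close> and the one from \<open>- mid i\<close> to \<open>mid j\<close>.\<close>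

definition zigzag :: "nat \<Rightarrow> nat \<Rightarrow> real \<Rightarrow> surface_point" where
  "zigzag i j s = (if even \<lfloor>s\<rfloor> then glue `` {frac s *\<^sub>R (mid i + mid j) - mid j} else glue `` {frac s *\<^sub>R (mid i + mid j) - mid i})"

lemma zigzag_shift: "zigzag i j (s + of_int m) = (if even m then zigzag i j s else zigzag j i s)"
  by (simp add: zigzag_def frac_def add.commute)

lemma mid_opposite: "mid ((i + 4) mod 8) = - mid i" by (simp add: mid_mod mid_4)

lemma zigzag_int:
  assumes ij: "i < 8" "j < 8" "i \<noteq> (j + 4) mod 8" and u: "0 < u" "u < 1"
  shows "oct_int (u *\<^sub>R (mid i + mid j) - mid j)"
  unfolding oct_int_def
proof (intro allI impI)
  fix k :: nat assume k: "k < 8"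
  let ?j = "(j + 4) mod 8"
  have le: "mid k \<bullet> mid i \<le> ir * ir" "mid k \<bullet> mid ?j \<le> ir * ir"
    using mid_inner_less[of _ k] mid_norm[of k] k ij(1) by (metis less_imp_le order_refl mod_less_divisor zero_less_numeral)+
  have lt: "mid k \<bullet> mid i < ir * ir \<or> mid k \<bullet> mid ?j < ir * ir"
    using mid_inner_less[of i k] mid_inner_less[of ?j k] k ij by (metis mod_less_divisor zero_less_numeral)
  have e: "mid k \<bullet> (u *\<^sub>R (mid i + mid j) - mid j) = u * (mid k \<bullet> mid i) + (1 - u) * (mid k \<bullet> mid ?j)"
    unfolding mid_opposite by (simp add: inner_add_right inner_diff_right algebra_simps)
  have "u * (mid k \<bullet> mid i) \<le> u * (ir * ir)" "(1 - u) * (mid k \<bullet> mid ?j) \<le> (1 - u) * (ir * ir)"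
    using le u by (auto intro!: mult_left_mono)
  moreover have "u * (mid k \<bullet> mid i) < u * (ir * ir) \<or> (1 - u) * (mid k \<bullet> mid ?j) < (1 - u) * (ir * ir)"
    using lt u by (auto simp: mult_less_cancel_left_pos)
  moreover have "u * (ir * ir) + (1 - u) * (ir * ir) = ir * ir" by (simp add: algebra_simps)
  ultimately show "mid k \<bullet> (u *\<^sub>R (mid i + mid j) - mid j) < ir * ir" unfolding e by linarith
qed

lemma mid_edge: assumes "i < 8" shows "edge_pt i (mid i)"
  unfolding edge_pt_def using mid_norm mid_inner_less[OF assms] assms by auto

lemma minus_mid_edge: "j < 8 \<Longrightarrow> edge_pt ((j + 4) mod 8) (- mid j)"
  using mid_edge[of "(j + 4) mod 8"] by (simp add: mid_opposite)

lemma zigzag_0: "j < 8 \<Longrightarrow> zigzag i j 0 = {- mid j, mid j}"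
  using class_edge[OF minus_mid_edge[of j]] by (simp add: zigzag_def mid_opposite scaleR_2)

lemma zigzag_open:
  assumes "i < 8" "j < 8" "i \<noteq> (j + 4) mod 8" "0 < u" "u < 1"
  shows "zigzag i j u = {u *\<^sub>R (mid i + mid j) - mid j}"
proof -
  have "\<lfloor>u\<rfloor> = 0" "frac u = u" using assms by (simp_all add: floor_eq_iff frac_eq)
  then show ?thesis using class_int[OF zigzag_int[OF assms]] by (simp add: zigzag_def)
qed

lemma zigzag_neg:
  assumes "i < 8" "j < 8" "j \<noteq> (i + 4) mod 8" "- 1 < u" "u < 0"
  shows "zigzag i j u = {u *\<^sub>R (mid i + mid j) + mid j}"
proof -
  have "zigzag i j u = zigzag j i (u + 1)" using zigzag_shift[of i j "u + 1" "- 1"] by simp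
  also have "\<dots> = {(u + 1) *\<^sub>R (mid j + mid i) - mid i}" using zigzag_open[of j i "u + 1"] assms by simp
  finally show ?thesis by (simp add: algebra_simps)
qed

lemma opposite_sym: "i < 8 \<Longrightarrow> j < 8 \<Longrightarrow> (i::nat) \<noteq> (j + 4) mod 8 \<Longrightarrow> j \<noteq> (i + 4) mod 8"
proof -
  assume "i < 8" "j < 8" "i \<noteq> (j + 4) mod 8"
  moreover have "\<forall>i<8. \<forall>j<8. (i::nat) \<noteq> (j + 4) mod 8 \<longrightarrow> j \<noteq> (i + 4) mod 8" unfolding all8 by simp
  ultimately show ?thesis by blast
qed

lemma zigzag_local:
  assumes ij: "i < 8" "j < 8" "i \<noteq> (j + 4) mod 8" and u: "0 \<le> u" "u < 1"
  shows "zigzag i j u \<in> regular \<and> (\<forall>\<^sub>F h in nhds 0. zigzag i j (u + h) = surface_plus (zigzag i j u) (h *\<^sub>R (mid i + mid j)))"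
proof (cases "u = 0")
  case False
  then have u: "0 < u" "u < 1" using u by auto
  have z: "zigzag i j u = {u *\<^sub>R (mid i + mid j) - mid j}" by (rule zigzag_open[OF ij u])
  have "zigzag i j (u + h) = surface_plus (zigzag i j u) (h *\<^sub>R (mid i + mid j))" if "\<bar>h\<bar> < min u (1 - u)" for h
  proof -
    have uh: "0 < u + h" "u + h < 1" using that by (auto simp: min_def split: if_splits)
    have "zigzag i j (u + h) = {(u + h) *\<^sub>R (mid i + mid j) - mid j}" by (rule zigzag_open[OF ij uh])
    moreover have "(u + h) *\<^sub>R (mid i + mid j) - mid j \<in> octagon" using zigzag_int[OF ij uh] oct_int_octagon by blast
    ultimately show ?thesis unfolding z surface_plus_def by (auto simp: algebra_simps)
  qed
  then show ?thesis using int_regular[OF zigzag_int[OF ij u]] z u unfolding small_ball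
    by (intro conjI exI[of _ "min u (1 - u)"]) auto
next
  case True
  have z: "zigzag i j 0 = {- mid j, mid j}" by (rule zigzag_0[OF ij(2)])
  have r: "{- mid j, mid j} \<in> regular" using edge_regular[OF minus_mid_edge[OF ij(2)]] by (simp add: mid_opposite scaleR_2)
  have pos: "mid j \<bullet> (mid i + mid j) > 0"
  proof -
    have "mid ((j + 4) mod 8) \<bullet> mid i < ir * ir" by (rule mid_inner_less) (use ij in auto)
    then show ?thesis by (simp add: mid_opposite inner_add_right mid_norm)
  qed
  have out: "mid j + h *\<^sub>R (mid i + mid j) \<notin> octagon" "- mid j - h *\<^sub>R (mid i + mid j) \<notin> octagon" if "h > 0" for h
  proof -
    have m: "mid j \<bullet> (mid j + h *\<^sub>R (mid i + mid j)) = ir * ir + h * (mid j \<bullet> (mid i + mid j))"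
      by (simp add: inner_add_right mid_norm)
    have hp: "h * (mid j \<bullet> (mid i + mid j)) > 0" using that pos by simp
    show "mid j + h *\<^sub>R (mid i + mid j) \<notin> octagon" using mid_le[of _ j] m hp by fastforce
    have "mid ((j+4) mod 8) \<bullet> (- mid j - h *\<^sub>R (mid i + mid j)) = mid j \<bullet> (mid j + h *\<^sub>R (mid i + mid j))"
      unfolding mid_opposite by (simp add: inner_add_right inner_diff_right algebra_simps)
    then show "- mid j - h *\<^sub>R (mid i + mid j) \<notin> octagon" using mid_le[of _ "(j + 4) mod 8"] m hp by fastforce
  qed
  have "zigzag i j h = surface_plus (zigzag i j 0) (h *\<^sub>R (mid i + mid j))" if h: "\<bar>h\<bar> < 1" for h
  proof -
    consider "h = 0" | "0 < h" "h < 1" | "- 1 < h" "h < 0" using h by linarith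
    then show ?thesis
    proof cases
      case 1
      have "{- mid j, mid j} \<subseteq> octagon" using r surface_class by blast
      then show ?thesis using 1 z by (auto simp: surface_plus_def)
    next
      case 2
      have "h *\<^sub>R (mid i + mid j) - mid j \<in> octagon" using zigzag_int[OF ij 2] oct_int_octagon by blast
      moreover have "zigzag i j h = {h *\<^sub>R (mid i + mid j) - mid j}" by (rule zigzag_open[OF ij 2])
      moreover have "- mid j + h *\<^sub>R (mid i + mid j) = h *\<^sub>R (mid i + mid j) - mid j" by simp
      ultimately show ?thesis using out(1)[OF 2(1)] unfolding z surface_plus_def by simp
    next
      case 3
      have n: "zigzag i j h = {h *\<^sub>R (mid i + mid j) + mid j}" by (rule zigzag_neg[OF ij(1,2) opposite_sym[OF ij] 3])
      have "(h + 1) *\<^sub>R (mid j + mid i) - mid i \<in> octagon"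
        using zigzag_int[OF ij(2,1) opposite_sym[OF ij], of "h + 1"] 3 oct_int_octagon by simp
      then have "mid j + h *\<^sub>R (mid i + mid j) \<in> octagon" by (simp add: algebra_simps)
      moreover have "- mid j + h *\<^sub>R (mid i + mid j) \<notin> octagon" using out(2)[of "- h"] 3 by simp
      ultimately show ?thesis unfolding n z surface_plus_def by (simp add: add.commute)
    qed
  qed
  then show ?thesis using r True z unfolding small_ball by (intro conjI exI[of _ 1]) auto
qed

lemma zigzag_traj:
  assumes ij: "i < 8" "j < 8" "i \<noteq> (j + 4) mod 8" shows "traj (mid i + mid j) (zigzag i j)"
proof -
  have "zigzag i j t \<in> regular \<and> (\<forall>\<^sub>F h in nhds 0. zigzag i j (t + h) = surface_plus (zigzag i j t) (h *\<^sub>R (mid i + mid j)))" for t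
  proof -
    have t: "t = frac t + of_int \<lfloor>t\<rfloor>" by (simp add: frac_def)
    have th: "t + h = (frac t + h) + of_int \<lfloor>t\<rfloor>" for h by (simp add: frac_def)
    have f: "0 \<le> frac t" "frac t < 1" by (simp_all add: frac_lt_1)
    show ?thesis
    proof (cases "even \<lfloor>t\<rfloor>")
      case True
      have "zigzag i j t = zigzag i j (frac t)" "\<And>h. zigzag i j (t + h) = zigzag i j (frac t + h)"
        using True by (subst t, simp only: zigzag_shift if_True) (simp only: th zigzag_shift True if_True)
      then show ?thesis using zigzag_local[OF ij f] by simp
    next
      case False
      have "zigzag i j t = zigzag j i (frac t)" "\<And>h. zigzag i j (t + h) = zigzag j i (frac t + h)"
        using False by (subst t, simp only: zigzag_shift if_False) (simp only: th zigzag_shift False if_False)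
      then show ?thesis using zigzag_local[OF ij(2,1) opposite_sym[OF ij] f] by (simp add: add.commute)
    qed
  qed
  then show ?thesis by (auto intro: trajI)
qed

lemma zigzag_minper:
  assumes ij: "i < 8" "j < 8" "i \<noteq> (j + 4) mod 8" "i \<noteq> j" shows "minper (zigzag i j) 2"
  unfolding minper_def
proof (intro conjI allI impI)
  show "zigzag i j 2 = zigzag i j 0" using zigzag_shift[of i j 0 2] by simp
  fix s :: real assume s: "0 < s \<and> s < 2"
  have z: "zigzag i j 0 = {- mid j, mid j}" by (rule zigzag_0[OF ij(2)])
  have int: "\<not> oct_int (mid j)" "\<not> oct_int (- mid j)"
    using edge_pt_inner[OF mid_edge[OF ij(2)]] edge_pt_inner[OF minus_mid_edge[OF ij(2)]] by blast+
  consider "s < 1" | "s = 1" | "s > 1" by linarith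
  then show "zigzag i j s \<noteq> zigzag i j 0"
  proof cases
    case 1
    then have "zigzag i j s = {s *\<^sub>R (mid i + mid j) - mid j}" "oct_int (s *\<^sub>R (mid i + mid j) - mid j)"
      using zigzag_open[OF ij(1-3)] zigzag_int[OF ij(1-3)] s by auto
    then show ?thesis using int z by (metis insertI1 insertE singletonD)
  next
    case 2
    have "zigzag i j 1 = zigzag j i 0" using zigzag_shift[of i j 0 1] by simp
    then have "zigzag i j 1 = {- mid i, mid i}" using zigzag_0[OF ij(1)] by simp
    moreover have "mid i \<noteq> mid j" using inj_onD[OF mid_inj, of i j] ij by auto
    moreover have "mid i \<noteq> - mid j"
      using inj_onD[OF mid_inj, of i "(j + 4) mod 8"] ij by (auto simp: mid_opposite)
    ultimately show ?thesis unfolding z 2 by auto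
  next
    case 3
    have "zigzag i j s = zigzag j i (s - 1)" using zigzag_shift[of i j "s - 1" 1] by simp
    moreover have "zigzag j i (s - 1) = {(s - 1) *\<^sub>R (mid j + mid i) - mid i}" "oct_int ((s - 1) *\<^sub>R (mid j + mid i) - mid i)"
      using zigzag_open[OF ij(2,1) opposite_sym[OF ij(1-3)], of "s - 1"] zigzag_int[OF ij(2,1) opposite_sym[OF ij(1-3)], of "s - 1"] s 3 by auto
    ultimately show ?thesis using int z by (metis insertI1 insertE singletonD)
  qed
qed simp

text \<open>The zigzags through the sides \<open>0, 3\<close> and through the sides \<open>1, 2\<close> are closed trajectories in the direction \<open>(sr, 1)\<close> with length ratio \<open>ll / (ir - hs) = sr\<close>.  Horizontal closed trajectories have length ratio \<open>1\<close> or \<open>ll / ir = sqrt 2\<close> or its inverse, so the direction cannot be mapped to the horizontal one.\<close>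

lemma no_swap:
  assumes a: "aff \<Psi> M" and M: "M *v pt sr 1 = pt l 0" "l \<noteq> 0" shows False
proof -
  have v1: "mid 0 + mid 3 = ((ir - hs) / 2) *\<^sub>R pt sr 1" unfolding mid_values pt_simps
    using sr_ir sr_hs by (simp add: algebra_simps diff_divide_distrib add_divide_distrib)
  have v2: "mid 1 + mid 2 = (ll / 2) *\<^sub>R pt sr 1" unfolding mid_values pt_simps
    using sr_ir sr_hs by (simp add: algebra_simps diff_divide_distrib add_divide_distrib)
  have m1: "M *v (mid 0 + mid 3) = pt ((ir - hs) / 2 * l) 0" "M *v (mid 1 + mid 2) = pt (ll / 2 * l) 0"
    unfolding v1 v2 matrix_vector_mult_scaleR M by simp_all
  have d: "ir - hs > 0" using ir_bounds hs_pos by simp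
  obtain c1 where c1: "2 = per c1 / \<bar>(ir - hs) / 2 * l\<bar>"
    by (rule aff_horizontal_minper[OF a zigzag_traj zigzag_minper m1(1)]) (use d M(2) in auto)
  obtain c2 where c2: "2 = per c2 / \<bar>ll / 2 * l\<bar>"
    by (rule aff_horizontal_minper[OF a zigzag_traj zigzag_minper m1(2)]) (use ll_pos M(2) in auto)
  have "\<bar>(ir - hs) / 2 * l\<bar> = (ir - hs) / 2 * \<bar>l\<bar>" "\<bar>ll / 2 * l\<bar> = ll / 2 * \<bar>l\<bar>"
    using d ll_pos by (simp_all only: abs_mult abs_of_pos half_gt_zero)
  then have "per c1 = 2 * ((ir - hs) / 2 * \<bar>l\<bar>)" "per c2 = 2 * (ll / 2 * \<bar>l\<bar>)"
  proof -
    have two: "p = 2 * q" if "2 = p / q" "q > 0" for p q :: real using that by (simp add: field_simps)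
    have q: "(ir - hs) / 2 * \<bar>l\<bar> > 0" "ll / 2 * \<bar>l\<bar> > 0" using d ll_pos M(2) by (auto intro!: mult_pos_pos)
    assume e: "\<bar>(ir - hs) / 2 * l\<bar> = (ir - hs) / 2 * \<bar>l\<bar>" "\<bar>ll / 2 * l\<bar> = ll / 2 * \<bar>l\<bar>"
    show "per c1 = 2 * ((ir - hs) / 2 * \<bar>l\<bar>)" "per c2 = 2 * (ll / 2 * \<bar>l\<bar>)"
      using two[OF c1[unfolded e] q(1)] two[OF c2[unfolded e] q(2)] .
  qed
  then have "per c1 = (ir - hs) * \<bar>l\<bar>" "per c2 = ll * \<bar>l\<bar>" by simp_all
  then have "per c1 * ll = per c2 * (ir - hs)" by simp
  moreover have "hs * hs > 0" "hs * ir > 0" using ir_pos hs_pos by simp_all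
  ultimately show False
    by (cases c1; cases c2; simp only: per.simps distrib_left distrib_right right_diff_distrib left_diff_distrib mult.assoc
        mult.commute[of ir hs]; linarith)
qed

section \<open>The action of \<open>gamma\<close> on the cylinders\<close>

text \<open>The point of the octagon at coordinates \<open>(x, low c)\<close> of the cylinder, for \<open>x\<close> between the lines \<open>j\<close> and \<open>j + 1\<close>; \<open>head\<close> is the same at the upper boundary.\<close>

fun foot :: "cyl \<Rightarrow> int \<Rightarrow> real \<Rightarrow> real^2" where
  "foot Inner j x = pt (x - of_int j * (2 * ir)) (- hs)"
| "foot Outer j x = (if even j then pt (x - of_int j * ll) hs else pt (x - of_int j * ll) (- ir))"

fun head :: "cyl \<Rightarrow> int \<Rightarrow> real \<Rightarrow> real^2" where
  "head Inner j x = pt (x - of_int j * (2 * ir)) hs"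
| "head Outer j x = (if even j then pt (x - of_int j * ll) ir else pt (x - of_int j * ll) (- hs))"

lemma line_ends:
  "line Inner j y = of_int j * (2 * ir) - ir" "line Inner (j + 1) y = of_int j * (2 * ir) + ir"
  "even j \<Longrightarrow> line Outer j hs = of_int j * ll - ir" "even j \<Longrightarrow> line Outer (j + 1) hs = of_int j * ll + ir"
  "odd j \<Longrightarrow> line Outer j hs = of_int j * ll - hs" "odd j \<Longrightarrow> line Outer (j + 1) hs = of_int j * ll + hs"
  "even j \<Longrightarrow> line Outer j ir = of_int j * ll - hs" "even j \<Longrightarrow> line Outer (j + 1) ir = of_int j * ll + hs"
  "odd j \<Longrightarrow> line Outer j ir = of_int j * ll - ir" "odd j \<Longrightarrow> line Outer (j + 1) ir = of_int j * ll + ir"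
  by (simp_all add: line.simps algebra_simps)

lemma Inner_end:
  assumes p: "p \<in> K Inner x y" and y: "y = hs \<or> y = - hs"
  shows "(\<exists>j. x = line Inner j y \<and> p \<in> singular_point) \<or> (\<exists>j. line Inner j y < x \<and> x < line Inner (j + 1) y \<and> p = pt (x - of_int j * (2 * ir)) y)"
proof -
  obtain n :: int where n: "p = pt (x + 2 * of_int n * ir) y" "p \<in> octagon" using p unfolding K_Inner_iff by blast
  define u where "u = x + 2 * of_int n * ir"
  have u: "- ir \<le> u" "u \<le> ir" using n octagon_Inner[of y u] y hs_pos by (auto simp: u_def)
  have x: "x = of_int (- n) * (2 * ir) + u" by (simp add: u_def)
  consider "u = - ir" | "u = ir" | "- ir < u" "u < ir" using u by linarith
  then show ?thesis
  proof cases
    case 1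
    have "x = line Inner (- n) y" unfolding line_ends x 1 by simp
    moreover have "p \<in> singular_point" using n(1) y vertex_pts unfolding u_def[symmetric] 1 by auto
    ultimately show ?thesis by blast
  next
    case 2
    have "x = line Inner (- n + 1) y" unfolding line_ends x 2 by (simp add: algebra_simps)
    moreover have "p \<in> singular_point" using n(1) y vertex_pts unfolding u_def[symmetric] 2 by auto
    ultimately show ?thesis by blast
  next
    case 3
    have "line Inner (- n) y < x" "x < line Inner (- n + 1) y" unfolding line_ends x using 3 by (simp_all add: algebra_simps)
    moreover have "p = pt (x - of_int (- n) * (2 * ir)) y" using n(1) by simp
    ultimately show ?thesis by blast
  qed
qed

lemma Outer_end:
  assumes p: "p \<in> K Outer x y" and y: "y = hs \<or> y = ir"
  shows "(\<exists>j. x = line Outer j y \<and> p \<in> singular_point) \<or>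
    (\<exists>j. line Outer j y < x \<and> x < line Outer (j + 1) y \<and> p = pt (x - of_int j * ll) (if even j then y else y - ll))"
proof -
  obtain n :: int where n: "p = pt (x + of_int n * ll) (if even n then y else y - ll)" "p \<in> octagon" using p unfolding K_Outer_iff by blast
  define u where "u = x + of_int n * ll"
  define m where "m = (if even n then ll - y else y)"
  have yb: "hs \<le> y" "y \<le> ir" using y hs_pos ir_bounds by auto
  have u: "- m \<le> u" "u \<le> m" using n octagon_Outer[OF yb, of u] by (auto simp: u_def m_def split: if_splits)
  have x: "x = of_int (- n) * ll + u" by (simp add: u_def)
  have le: "line Outer (- n) y = of_int (- n) * ll - m" "line Outer (- n + 1) y = of_int (- n) * ll + m"
    using y line_ends[of "- n"] unfolding m_def by (cases "even n"; auto)+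
  have v: "p \<in> singular_point" if "u = m \<or> u = - m"
    using that n(1) y vertex_pts unfolding u_def[symmetric] m_def by (cases "even n") auto
  consider "u = - m" | "u = m" | "- m < u" "u < m" using u by linarith
  then show ?thesis
  proof cases
    case 1
    have "x = line Outer (- n) y" unfolding le x 1 by simp
    then show ?thesis using v 1 by blast
  next
    case 2
    have "x = line Outer (- n + 1) y" unfolding le x 2 by simp
    then show ?thesis using v 2 by blast
  next
    case 3
    have "line Outer (- n) y < x" "x < line Outer (- n + 1) y" unfolding le x using 3 by simp_all
    moreover have "p = pt (x - of_int (- n) * ll) (if even (- n) then y else y - ll)" using n(1) by simp
    ultimately show ?thesis by blast
  qed
qed

lemma K_low:
  "p \<in> K c x (low c) \<Longrightarrow> (\<exists>j. x = line c j (low c) \<and> p \<in> singular_point) \<or>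
     (\<exists>j. line c j (low c) < x \<and> x < line c (j + 1) (low c) \<and> p = foot c j x)"
proof (cases c)
  case Inner
  assume "p \<in> K c x (low c)"
  then show ?thesis using Inner_end[of p x "- hs"] Inner by simp
next
  case Outer
  assume "p \<in> K c x (low c)"
  then have p: "p \<in> K Outer x hs" using Outer by simp
  have "pt (x - of_int j * ll) (if even j then hs else hs - ll) = foot Outer j x" for j by simp
  then show ?thesis using Outer_end[OF p] unfolding Outer by simp
qed

lemma K_top:
  "p \<in> K c x (top c) \<Longrightarrow> (\<exists>j. x = line c j (top c) \<and> p \<in> singular_point) \<or>
     (\<exists>j. line c j (top c) < x \<and> x < line c (j + 1) (top c) \<and> p = head c j x)"
proof (cases c)
  case Inner
  assume "p \<in> K c x (top c)"
  then show ?thesis using Inner_end[of p x hs] Inner by simp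
next
  case Outer
  assume "p \<in> K c x (top c)"
  then have p: "p \<in> K Outer x ir" using Outer by simp
  have "pt (x - of_int j * ll) (if even j then ir else ir - ll) = head Outer j x" for j by simp
  then show ?thesis using Outer_end[OF p] unfolding Outer by simp
qed

lemma line_strict: "y = low c \<or> y = top c \<Longrightarrow> line c i y < line c j y \<longleftrightarrow> i < j"
  using line_le_iff[of c y i j] low_top[of c] by auto

lemma K_vertex:
  "K c (line c j (low c)) (low c) \<subseteq> singular_point" "K c (line c j (top c)) (top c) \<subseteq> singular_point"
proof -
  show "K c (line c j (low c)) (low c) \<subseteq> singular_point"
  proof
    fix p assume p: "p \<in> K c (line c j (low c)) (low c)"
    have "\<not> (line c i (low c) < line c j (low c) \<and> line c j (low c) < line c (i + 1) (low c))" for i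
      using line_strict[of "low c" c] by auto
    then show "p \<in> singular_point" using K_low[OF p] by blast
  qed
  show "K c (line c j (top c)) (top c) \<subseteq> singular_point"
  proof
    fix p assume p: "p \<in> K c (line c j (top c)) (top c)"
    have "\<not> (line c i (top c) < line c j (top c) \<and> line c j (top c) < line c (i + 1) (top c))" for i
      using line_strict[of "top c" c] by auto
    then show "p \<in> singular_point" using K_top[OF p] by blast
  qed
qed

lemma foot_regular:
  assumes "line c j (low c) < x" "x < line c (j + 1) (low c)" shows "foot c j x \<notin> singular_point"
proof -
  have "oct_int (pt u hs)" "oct_int (pt u (- hs))" if "- ir < u" "u < ir" for u
    using that hs_pos ir_bounds by (auto simp: oct_int_pt)
  then have n: "pt u hs \<notin> singular_point" "pt u (- hs) \<notin> singular_point" if "- ir < u" "u < ir" for u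
    using that int_regular regular_not_vertex by (metis insertI1)+
  have n2: "pt u (- ir) \<notin> singular_point" if u: "- hs < u" "u < hs" for u
  proof -
    have "pt u (- ir) = pt u ir - 2 *\<^sub>R mid 0" by (simp add: mid_values)
    then show ?thesis using edge_regular[OF edge_coords_conv(4)[OF u]] regular_not_vertex by (metis insertI1 insertI2)
  qed
  show ?thesis
  proof (cases c)
    case Inner then show ?thesis using assms n(2)[of "x - of_int j * (2 * ir)"] line_ends(1,2)[of j] by simp
  next
    case Outer
    show ?thesis
    proof (cases "even j")
      case True then show ?thesis using Outer assms n(1)[of "x - of_int j * ll"] line_ends(3,4)[of j] by simp
    next
      case False then show ?thesis using Outer assms n2[of "x - of_int j * ll"] line_ends(5,6)[of j] by simp
    qed
  qed
qed

lemma finite_dev: "loc_finite \<Lambda> \<Longrightarrow> finite (dev \<Lambda> P)"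
proof -
  assume L: "loc_finite \<Lambda>"
  have "dev \<Lambda> P \<subseteq> (\<lambda>q. P + q) ` {q \<in> \<Lambda>. norm q \<le> 2 + norm P}"
  proof
    fix p assume "p \<in> dev \<Lambda> P"
    then obtain q where q: "q \<in> \<Lambda>" "p = P + q" "p \<in> octagon" by (auto simp: dev_def)
    have "norm q \<le> norm p + norm P" using norm_triangle_ineq4[of p P] q(2) by simp
    then show "p \<in> (\<lambda>q. P + q) ` {q \<in> \<Lambda>. norm q \<le> 2 + norm P}" using q bounded_octagon[OF q(3)] by auto
  qed
  then show ?thesis by (rule finite_subset) (use L in \<open>simp add: loc_finite_def\<close>)
qed

text \<open>If a developed path runs into the singular point, so does its image under an affine map.  The inverse map is
  defined near a regular limit point, so a regular limit of the image would come from a regular limit of the path.\<close>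

lemma aff_vertex_limit:
  assumes a: "aff \<Phi> M" and MN: "M ** N = mat 1" "N ** M = mat 1" and L: "loc_finite \<Lambda>" "loc_finite \<Lambda>'" and e: "e > 0"
    and f: "\<And>s. 0 < s \<Longrightarrow> s < e \<Longrightarrow> dev \<Lambda> (P + s *\<^sub>R v) \<in> regular"
      "\<And>s. 0 < s \<Longrightarrow> s < e \<Longrightarrow> \<Phi> (dev \<Lambda> (P + s *\<^sub>R v)) = dev \<Lambda>' (P' + s *\<^sub>R (M *v v))"
    and s: "dev \<Lambda> P \<subseteq> singular_point"
  shows "\<exists>q\<in>dev \<Lambda>' P'. q \<in> singular_point"
proof (rule ccontr)
  assume none: "\<not> (\<exists>q\<in>dev \<Lambda>' P'. q \<in> singular_point)"
  let ?I = "inv_into octagon_surface \<Phi>"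
  have aI: "aff ?I N" by (rule aff_inverse[OF a MN(1)])
  have b: "bij_betw \<Phi> octagon_surface octagon_surface" using a by (simp add: aff_def)
  have zr: "glue `` {q} \<in> regular" "q \<in> glue `` {q}" if "q \<in> dev \<Lambda>' P'" for q
  proof -
    have o: "q \<in> octagon" using that by (simp add: dev_def)
    show "q \<in> glue `` {q}" using equiv_class_self[OF equiv_glue o] .
    then show "glue `` {q} \<in> regular" using surfaceI[OF o] none that by auto
  qed
  have "\<forall>\<^sub>F u in nhds 0. \<forall>q\<in>dev \<Lambda>' P'. ?I (surface_plus (glue `` {q}) u) = surface_plus (?I (glue `` {q})) (N *v u) \<and> surface_plus (glue `` {q}) u \<in> regular"
    by (intro eventually_ball_finite[OF finite_dev[OF L(2)]] ballI eventually_conj affD(4)[OF aI] regular_plus zr(1))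
  then have 1: "\<forall>\<^sub>F s in nhds 0. \<forall>q\<in>dev \<Lambda>' P'. ?I (surface_plus (glue `` {q}) (s *\<^sub>R (M *v v))) = surface_plus (?I (glue `` {q})) (N *v (s *\<^sub>R (M *v v)))
      \<and> surface_plus (glue `` {q}) (s *\<^sub>R (M *v v)) \<in> regular" by (rule small_scale)
  have 2: "\<forall>\<^sub>F s in nhds 0. dev \<Lambda>' (P' + s *\<^sub>R (M *v v)) = surface_plus (dev \<Lambda>' P') (s *\<^sub>R (M *v v))"
    by (rule small_scale[OF dev_plus[OF L(2)]])
  have 3: "\<forall>\<^sub>F s in nhds 0. dev \<Lambda> (P + s *\<^sub>R v) = surface_plus (dev \<Lambda> P) (s *\<^sub>R v)"
    by (rule small_scale[OF dev_plus[OF L(1)]])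
  from ev_nhds_0_nonzero[OF eventually_conj[OF 1 eventually_conj[OF 2 3]]] obtain r where r: "r > 0"
    and R: "\<forall>s. \<bar>s\<bar> < r \<longrightarrow> (\<forall>q\<in>dev \<Lambda>' P'. ?I (surface_plus (glue `` {q}) (s *\<^sub>R (M *v v))) = surface_plus (?I (glue `` {q})) (N *v (s *\<^sub>R (M *v v)))
      \<and> surface_plus (glue `` {q}) (s *\<^sub>R (M *v v)) \<in> regular) \<and>
      dev \<Lambda>' (P' + s *\<^sub>R (M *v v)) = surface_plus (dev \<Lambda>' P') (s *\<^sub>R (M *v v)) \<and> dev \<Lambda> (P + s *\<^sub>R v) = surface_plus (dev \<Lambda> P) (s *\<^sub>R v)"
    by blast
  define s where "s = min (r / 2) (e / 2)"
  have s0: "0 < s" "s < e" "\<bar>s\<bar> < r" using r e by (auto simp: s_def min_def)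
  define x where "x = dev \<Lambda> (P + s *\<^sub>R v)"
  have x: "x \<in> regular" using f(1)[OF s0(1,2)] by (simp add: x_def)
  have Rs: "\<Phi> x = surface_plus (dev \<Lambda>' P') (s *\<^sub>R (M *v v))" "x = surface_plus (dev \<Lambda> P) (s *\<^sub>R v)"
    using R s0 f(2)[OF s0(1,2)] by (auto simp: x_def)
  have px: "\<Phi> x \<in> regular" by (rule aff_regular[OF a x])
  then obtain e0 where e0: "e0 \<in> \<Phi> x" using surface_nonempty by blast
  then obtain q where q: "q \<in> dev \<Lambda>' P'" "e0 = q + s *\<^sub>R (M *v v)" "e0 \<in> octagon" unfolding Rs(1) by (auto simp: surface_plus_def)
  have Rq: "?I (surface_plus (glue `` {q}) (s *\<^sub>R (M *v v))) = surface_plus (?I (glue `` {q})) (N *v (s *\<^sub>R (M *v v)))"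
      "surface_plus (glue `` {q}) (s *\<^sub>R (M *v v)) \<in> regular" using R s0(3) q(1) by blast+
  have "e0 \<in> surface_plus (glue `` {q}) (s *\<^sub>R (M *v v))" using q zr(2)[OF q(1)] by (auto simp: surface_plus_def)
  then have "\<Phi> x = surface_plus (glue `` {q}) (s *\<^sub>R (M *v v))" using surface_eqI[of "\<Phi> x" _ e0] px Rq(2) e0 by blast
  moreover have "?I (\<Phi> x) = x" using b x by (simp add: bij_betw_inv_into_left)
  moreover have "N *v (s *\<^sub>R (M *v v)) = s *\<^sub>R v" by (simp add: matrix_vector_mult_scaleR matrix_vector_mul_assoc MN)
  ultimately have x2: "x = surface_plus (?I (glue `` {q})) (s *\<^sub>R v)" using Rq(1) by simp
  obtain y where y: "y \<in> x" using x surface_nonempty by blast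
  then have "y - s *\<^sub>R v \<in> ?I (glue `` {q})" by (subst (asm) x2) (auto simp: surface_plus_def)
  moreover have "y - s *\<^sub>R v \<in> dev \<Lambda> P" using y by (subst (asm) Rs(2)) (auto simp: surface_plus_def)
  ultimately show False using s regular_not_vertex[OF aff_regular[OF aI zr(1)[OF q(1)]]] by blast
qed

lemma gamma_vec: "gamma *v pt x y = pt (- x + 2 * sr * y) y"
  unfolding gamma_def mat2_vec by (simp add: sr_def)

lemma gamma_gamma: "gamma ** gamma = mat 1"
  unfolding gamma_def mat2_mult mat2_1 by simp

text \<open>The cylinders have different periods, so they cannot be exchanged.\<close>

lemma gamma_image:
  assumes a: "aff \<Phi> gamma" and y: "low c < y" "y < top c"
  shows "\<exists>x' y'. low c < y' \<and> y' < top c \<and> \<Phi> (K c x y) = K c x' y'"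
proof -
  have m: "minper (\<lambda>s. K c (x + 1 * s) y) (per c)" using minper_K[OF y, of 1 x] by simp
  have g: "gamma *v pt 1 0 = pt (- 1) 0" by (simp add: gamma_vec)
  obtain c' where c': "per c = per c' / \<bar>- 1\<bar>" "\<exists>x' y'. low c' < y' \<and> y' < top c' \<and> \<Phi> (K c (x + 1 * 0) y) = K c' x' y'"
    by (rule aff_horizontal_minper[OF a horizontal_traj[OF y] m g]) simp
  then have "c' = c" using per_ne[of c c'] by simp
  then show ?thesis using c'(2) by simp
qed

text \<open>On the middle circle of the cylinder the image is determined by one point; from there, straight segments reach every other point of the cylinder.\<close>

lemma gamma_shear:
  assumes a: "aff \<Phi> gamma"
  shows "\<exists>d. \<forall>x y. low c < y \<longrightarrow> y < top c \<longrightarrow> \<Phi> (K c x y) = K c (d - x + 2 * sr * (y - low c)) y"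
proof -
  define m where "m = (low c + top c) / 2"
  have m: "low c < m" "m < top c" "top c - m = m - low c" using low_top[of c] by (auto simp: m_def field_simps)
  obtain x' y' where xy': "low c < y'" "y' < top c" "\<Phi> (K c 0 m) = K c x' y'" using gamma_image[OF a m(1,2)] by blast
  have Kd: "K c (u + s * p) (w + s * q) = dev (lam c) (pt u w + s *\<^sub>R pt p q)" for u w p q s by (simp add: K_dev)
  have Pv: "pt u w + s *\<^sub>R pt p q = pt (u + s * p) (w + s * q)" for u w p q s :: real by simp
  \<comment> \<open>A segment of the cylinder with a margin at both ends, and its image.\<close>
  have path: "\<exists>e>0. straight {- e..1 + e} (pt (- x + 2 * sr * (y - m)) (y - m)) (\<lambda>s. \<Phi> (K c (0 + s * x) (m + s * (y - m))))"
    if y: "low c < y" "y < top c" for x y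
  proof -
    define d where "d = min (y - low c) (top c - y)"
    define D where "D = top c - low c"
    have dD: "d > 0" "D > 0" "d \<le> y - low c" "d \<le> top c - y" using y low_top[of c] by (auto simp: d_def D_def)
    define e where "e = d / D"
    have e: "e > 0" using dD by (simp add: e_def)
    have dm: "\<bar>y - m\<bar> < D" "d \<le> m - low c" "d \<le> top c - m" using y m dD by (auto simp: D_def)
    have ed: "e * \<bar>y - m\<bar> < d"
    proof -
      have "e * \<bar>y - m\<bar> < e * D" using dm e by (intro mult_strict_left_mono)
      then show ?thesis using dD by (simp add: e_def)
    qed
    have strip: "low c < m + s * (y - m) \<and> m + s * (y - m) < top c" if s: "s \<in> {- e..1 + e}" for s
    proof -
      consider "s < 0" | "0 \<le> s" "s \<le> 1" | "s > 1" by linarith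
      then show ?thesis
      proof cases
        case 1
        have "\<bar>s * (y - m)\<bar> \<le> e * \<bar>y - m\<bar>" unfolding abs_mult using s 1 by (intro mult_right_mono) auto
        then show ?thesis using ed dm by linarith
      next
        case 2
        have "m + s * (y - m) = (1 - s) * m + s * y" by (simp add: algebra_simps)
        moreover have "(1 - s) * low c + s * low c < (1 - s) * m + s * y" "(1 - s) * m + s * y < (1 - s) * top c + s * top c"
          using 2 m y by (cases "s = 0"; auto intro!: add_le_less_mono mult_left_mono)+
        ultimately show ?thesis by (simp add: algebra_simps)
      next
        case 3
        have "\<bar>(s - 1) * (y - m)\<bar> \<le> e * \<bar>y - m\<bar>" unfolding abs_mult using s 3 by (intro mult_right_mono) auto
        moreover have "m + s * (y - m) = y + (s - 1) * (y - m)" by (simp add: algebra_simps)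
        ultimately show ?thesis using ed dD by linarith
      qed
    qed
    have reg: "K c (0 + s * x) (m + s * (y - m)) \<in> regular" if "s \<in> {- e..1 + e}" for s
      using K_regular strip[OF that] by blast
    have "straight {- e..1 + e} (pt x (y - m)) (\<lambda>s. K c (0 + s * x) (m + s * (y - m)))"
      unfolding Kd
    proof (rule dev_straight[OF loc_finite_lam])
      show "dev (lam c) (pt 0 m + s *\<^sub>R pt x (y - m)) \<in> octagon_surface" if "s \<in> {- e..1 + e}" for s
        using reg[OF that] unfolding Kd by simp
    qed
    from aff_straight[OF a this reg] show ?thesis using e by (auto simp: gamma_vec o_def)
  qed
  \<comment> \<open>The image cannot leave the cylinder, so heights are preserved.\<close>
  have inside: "low c < y' + (y - m) \<and> y' + (y - m) < top c" if y: "low c < y" "y < top c" for y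
  proof (rule ccontr)
    assume out: "\<not> (low c < y' + (y - m) \<and> y' + (y - m) < top c)"
    define k where "k = y - m"
    have k: "k \<noteq> 0" using out xy' by (auto simp: k_def)
    define z where "z = (if k > 0 then top c else low c)"
    define b where "b = (z - y') / k"
    have bk: "b * k = z - y'" using k by (simp add: b_def)
    have b: "0 < b" "b \<le> 1" using k out xy' by (auto simp: b_def z_def k_def[symmetric] divide_simps split: if_splits)
    obtain e where e: "e > 0" "straight {- e..1 + e} (pt (- 0 + 2 * sr * k) k) (\<lambda>s. \<Phi> (K c (0 + s * 0) (m + s * k)))"
      using path[OF y, of 0] unfolding k_def by blast
    define a0 where "a0 = - min e ((if k > 0 then y' - low c else top c - y') / \<bar>k\<bar>)"
    have a0: "a0 < 0" "- e \<le> a0" using e xy' k by (auto simp: a0_def)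
    have st: "low c < y' + s * k \<and> y' + s * k < top c" if s: "s \<in> {a0<..<b}" for s
    proof (cases "k > 0")
      case True
      have "s * k < b * k" using s True by simp
      moreover have "- ((y' - low c) / k) < s" using s True by (auto simp: a0_def min_def split: if_splits)
      then have "- (y' - low c) < s * k" using True by (simp add: field_simps)
      ultimately show ?thesis using bk True by (simp add: z_def)
    next
      case False
      then have kn: "k < 0" using k by simp
      have "b * k < s * k" using s kn by (simp add: mult_less_cancel_right)
      moreover have "- ((top c - y') / - k) < s" using s kn by (auto simp: a0_def min_def split: if_splits)
      then have "s * k < top c - y'" using kn by (simp add: field_simps)
      ultimately show ?thesis using bk False by (simp add: z_def)
    qed
    have meet: "\<Phi> (K c (0 + b * 0) (m + b * k)) \<inter> dev (lam c) (pt x' y' + b *\<^sub>R pt (- 0 + 2 * sr * k) k) \<noteq> {}"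
    proof (rule dev_path(3)[OF loc_finite_lam, where a = a0 and c = 0])
      show "straight {a0..b} (pt (- 0 + 2 * sr * k) k) (\<lambda>s. \<Phi> (K c (0 + s * 0) (m + s * k)))"
        by (rule straight_subset[OF e(2)]) (use a0 b e in auto)
      show "dev (lam c) (pt x' y' + s *\<^sub>R pt (- 0 + 2 * sr * k) k) \<in> octagon_surface" if "s \<in> {a0<..<b}" for s
        unfolding Kd[symmetric] using K_regular st[OF that] by blast
      show "0 \<in> {a0<..<b}" using a0 b by simp
      have "\<Phi> (K c 0 m) \<noteq> {}" unfolding xy'(3) using K_regular[OF xy'(1,2)] surface_nonempty by blast
      then show "\<Phi> (K c (0 + 0 * 0) (m + 0 * k)) \<inter> dev (lam c) (pt x' y' + 0 *\<^sub>R pt (- 0 + 2 * sr * k) k) \<noteq> {}"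
        unfolding Kd[symmetric] using xy'(3) by simp
    qed
    have mb: "low c < m + b * k" "m + b * k < top c"
    proof -
      have "m + b * k = (1 - b) * m + b * y" by (simp add: k_def algebra_simps)
      moreover have "(1 - b) * low c + b * low c < (1 - b) * m + b * y" "(1 - b) * m + b * y < (1 - b) * top c + b * top c"
        using b m y by (auto intro!: add_le_less_mono mult_left_mono)
      ultimately show "low c < m + b * k" "m + b * k < top c" by (simp_all add: algebra_simps)
    qed
    obtain x2 y2 where 2: "low c < y2" "y2 < top c" "\<Phi> (K c (0 + b * 0) (m + b * k)) = K c x2 y2" using gamma_image[OF a mb] by blast
    have yb: "y' + b * k = z" using bk by simp
    obtain p where "p \<in> K c x2 y2" "p \<in> K c (x' + b * (- 0 + 2 * sr * k)) z" using meet unfolding 2(3) Kd[symmetric] yb by blast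
    then have "z = y2" using K_meet[of p c _ z c x2 y2] 2 low_top[of c] by (auto simp: z_def)
    then show False using 2 by (auto simp: z_def split: if_splits)
  qed
  have ym: "y' = m"
  proof (rule ccontr)
    assume "y' \<noteq> m"
    then consider "y' > m" | "y' < m" by linarith
    then show False
    proof cases
      case 1 then show ?thesis using inside[of "top c - y' + m"] xy' m by simp
    next
      case 2 then show ?thesis using inside[of "low c - y' + m"] xy' m by simp
    qed
  qed
  have "\<Phi> (K c x y) = K c ((x' + 2 * sr * (low c - m)) - x + 2 * sr * (y - low c)) y" if y: "low c < y" "y < top c" for x y
  proof -
    obtain e where e: "e > 0" "straight {- e..1 + e} (pt (- x + 2 * sr * (y - m)) (y - m)) (\<lambda>s. \<Phi> (K c (0 + s * x) (m + s * (y - m))))"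
      using path[OF y, of x] by blast
    define b where "b = 1 + min e (min ((y - low c) / (\<bar>y - m\<bar> + 1)) ((top c - y) / (\<bar>y - m\<bar> + 1)))"
    define a0 where "a0 = - min e ((m - low c) / (\<bar>y - m\<bar> + 1))"
    have b: "1 < b" "b \<le> 1 + e" using e y by (auto simp: b_def)
    have a0: "a0 < 0" "- e \<le> a0" using e m by (auto simp: a0_def)
    have st: "low c < m + s * (y - m) \<and> m + s * (y - m) < top c" if s: "s \<in> {a0<..<b}" for s
    proof -
      have q: "\<bar>y - m\<bar> + 1 > 0" by linarith
      consider "s < 0" | "0 \<le> s" "s \<le> 1" | "s > 1" by linarith
      then show ?thesis
      proof cases
        case 1
        have "- s < (m - low c) / (\<bar>y - m\<bar> + 1)" using s by (auto simp: a0_def min_def split: if_splits)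
        then have "- s * (\<bar>y - m\<bar> + 1) < m - low c" using q by (simp add: pos_less_divide_eq)
        moreover have "\<bar>s * (y - m)\<bar> = - s * \<bar>y - m\<bar>" using 1 by (simp add: abs_mult)
        ultimately have "\<bar>s * (y - m)\<bar> < m - low c" using 1 by (simp add: algebra_simps)
        then show ?thesis using m by linarith
      next
        case 2
        have "m + s * (y - m) = (1 - s) * m + s * y" by (simp add: algebra_simps)
        moreover have "(1 - s) * low c + s * low c < (1 - s) * m + s * y" "(1 - s) * m + s * y < (1 - s) * top c + s * top c"
          using 2 m y by (cases "s = 0"; auto intro!: add_le_less_mono mult_left_mono)+
        ultimately show ?thesis by (simp add: algebra_simps)
      next
        case 3
        have "s - 1 < (y - low c) / (\<bar>y - m\<bar> + 1)" "s - 1 < (top c - y) / (\<bar>y - m\<bar> + 1)" using s by (auto simp: b_def)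
        then have l: "(s - 1) * (\<bar>y - m\<bar> + 1) < y - low c" "(s - 1) * (\<bar>y - m\<bar> + 1) < top c - y" using q by (simp_all add: pos_less_divide_eq)
        have "\<bar>(s - 1) * (y - m)\<bar> = (s - 1) * \<bar>y - m\<bar>" using 3 by (simp add: abs_mult)
        then have "\<bar>(s - 1) * (y - m)\<bar> < y - low c" "\<bar>(s - 1) * (y - m)\<bar> < top c - y" using l 3 by (simp_all add: algebra_simps)
        moreover have "m + s * (y - m) = y + (s - 1) * (y - m)" by (simp add: algebra_simps)
        ultimately show ?thesis by linarith
      qed
    qed
    have "\<Phi> (K c (0 + 1 * x) (m + 1 * (y - m))) = dev (lam c) (pt x' y' + 1 *\<^sub>R pt (- x + 2 * sr * (y - m)) (y - m))"
    proof (rule dev_path(1)[OF loc_finite_lam, where a = a0 and c = 0 and b = b])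
      show "straight {a0..b} (pt (- x + 2 * sr * (y - m)) (y - m)) (\<lambda>s. \<Phi> (K c (0 + s * x) (m + s * (y - m))))"
        by (rule straight_subset[OF e(2)]) (use a0 b in auto)
      show "dev (lam c) (pt x' y' + s *\<^sub>R pt (- x + 2 * sr * (y - m)) (y - m)) \<in> octagon_surface" if "s \<in> {a0<..<b}" for s
        unfolding Kd[symmetric] ym using K_regular st[OF that] by blast
      show "0 \<in> {a0<..<b}" "1 \<in> {a0<..<b}" using a0 b by simp_all
      have "\<Phi> (K c 0 m) \<noteq> {}" unfolding xy'(3) using K_regular[OF xy'(1,2)] surface_nonempty by blast
      then show "\<Phi> (K c (0 + 0 * x) (m + 0 * (y - m))) \<inter> dev (lam c) (pt x' y' + 0 *\<^sub>R pt (- x + 2 * sr * (y - m)) (y - m)) \<noteq> {}"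
        unfolding Kd[symmetric] using xy'(3) by simp
    qed
    then have A: "\<Phi> (K c x y) = K c (x' + 1 * (- x + 2 * sr * (y - m))) (y' + 1 * (y - m))" unfolding Kd[symmetric] by simp
    have B: "x' + 1 * (- x + 2 * sr * (y - m)) = (x' + 2 * sr * (low c - m)) - x + 2 * sr * (y - low c)" by (simp add: algebra_simps)
    have C: "y' + 1 * (y - m) = y" using ym by simp
    show ?thesis using A unfolding B C .
  qed
  then show ?thesis by blast
qed

text \<open>The shift \<open>d\<close> in the previous lemma is a multiple of the period because singular points on the lower boundary are mapped to singular points.  In the outer cylinder their spacing alternates between \<open>2 * ir\<close> and \<open>2 * hs\<close>, which excludes all other reflections.\<close>

lemma gamma_cylinder:
  assumes a: "aff \<Phi> gamma" and y: "low c < y" "y < top c"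
  shows "\<Phi> (K c x y) = K c (- (x - 2 * sr * (y - low c))) y"
proof -
  obtain d where d: "\<And>x y. low c < y \<Longrightarrow> y < top c \<Longrightarrow> \<Phi> (K c x y) = K c (d - x + 2 * sr * (y - low c)) y"
    using gamma_shear[OF a, of c] by blast
  \<comment> \<open>The singular points on the lower boundary of the cylinder are mapped to each other.\<close>
  have lines: "\<exists>k. d - line c j (low c) = line c k (low c)" for j
  proof -
    let ?X = "line c j (low c)" and ?D = "top c - low c"
    have Kd: "K c (u + s * p) (w + s * q) = dev (lam c) (pt u w + s *\<^sub>R pt p q)" for u w p q s by (simp add: K_dev)
    have "\<exists>q\<in>dev (lam c) (pt (d - ?X) (low c)). q \<in> singular_point"
    proof (rule aff_vertex_limit[OF a gamma_gamma gamma_gamma loc_finite_lam loc_finite_lam, where v = "pt 0 1"])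
      show "?D > 0" using low_top[of c] by simp
      fix s assume s: "0 < s" "s < ?D"
      then have st: "low c < low c + s * 1" "low c + s * 1 < top c" by auto
      show "dev (lam c) (pt ?X (low c) + s *\<^sub>R pt 0 1) \<in> regular" unfolding Kd[symmetric] by (rule K_regular[OF st])
      have e: "d - (?X + s * 0) + 2 * sr * (low c + s * 1 - low c) = d - ?X + s * (- 0 + 2 * sr * 1)" by simp
      show "\<Phi> (dev (lam c) (pt ?X (low c) + s *\<^sub>R pt 0 1)) = dev (lam c) (pt (d - ?X) (low c) + s *\<^sub>R (gamma *v pt 0 1))"
        unfolding gamma_vec Kd[symmetric] by (rule d[OF st, of "?X + s * 0", unfolded e])
    next
      show "dev (lam c) (pt ?X (low c)) \<subseteq> singular_point" using K_vertex(1)[of c j] by (simp add: K_dev)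
    qed
    then obtain q where q: "q \<in> K c (d - ?X) (low c)" "q \<in> singular_point" by (auto simp: K_dev)
    from K_low[OF q(1)] show ?thesis using q(2) foot_regular by blast
  qed
  have "\<exists>n::int. d = of_int n * per c"
  proof (cases c)
    case Inner
    obtain k where "d - line Inner 0 (low Inner) = line Inner k (low Inner)" using lines[of 0] Inner by blast
    then have "d = of_int (k - 1) * per Inner" by (simp add: line.simps algebra_simps)
    then show ?thesis using Inner by blast
  next
    case Outer
    obtain k0 where k0: "d - line Outer 0 hs = line Outer k0 hs" using lines[of 0] Outer by auto
    obtain k1 where k1: "d - line Outer 1 hs = line Outer k1 hs" using lines[of 1] Outer by auto
    have e0: "d + ir = line Outer k0 hs" "d - ir = line Outer k1 hs" using k0 k1 by (simp_all add: line.simps algebra_simps)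
    have small: False if "of_int m * ll = t" "0 < t" "t < ll" for m :: int and t
    proof -
      have "0 < of_int m * ll" "of_int m * ll < 1 * ll" using that by auto
      then have "(0::real) < of_int m" "(of_int m::real) < 1" using ll_pos by (auto simp: zero_less_mult_iff mult_less_cancel_right_pos)
      then have "0 < m" "m < 1" by simp_all
      then show False by simp
    qed
    show ?thesis
    proof (cases "even k0")
      case False
      have "d = of_int (k0 - 1) * ll" using e0(1) line_ends(5)[OF False] by (simp add: algebra_simps)
      moreover have "even (k0 - 1)" using False by simp
      then obtain m where "k0 - 1 = 2 * m" by (rule evenE)
      ultimately have "d = of_int m * per Outer" by simp
      then show ?thesis using Outer by blast
    next
      case True
      have d1: "d = of_int k0 * ll - 2 * ir" using e0(1) line_ends(3)[OF True] by simp
      show ?thesis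
      proof (cases "even k1")
        case e: True
        have "of_int (k0 - k1) * ll = 2 * ir" using e0(2) d1 line_ends(3)[OF e] by (simp add: algebra_simps)
        moreover have "even (k0 - k1)" using True e by simp
        then obtain m where "k0 - k1 = 2 * m" by (rule evenE)
        ultimately have "of_int m * ll = ir" by simp
        then show ?thesis using small[of m ir] ir_pos hs_pos by simp
      next
        case o: False
        have "of_int (3 - (k0 - k1)) * ll = 4 * hs" using e0(2) d1 line_ends(5)[OF o] by (simp add: algebra_simps)
        moreover have "even (3 - (k0 - k1))" using True o by presburger
        then obtain m where "3 - (k0 - k1) = 2 * m" by (rule evenE)
        ultimately have "of_int m * ll = 2 * hs" by simp
        then show ?thesis using small[of m "2 * hs"] ir_bounds hs_pos by simp
      qed
    qed
  qed
  then obtain n :: int where n: "d = of_int n * per c" by blast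
  have e: "d - x + 2 * sr * (y - low c) = - (x - 2 * sr * (y - low c)) + of_int n * per c" using n by simp
  show ?thesis unfolding d[OF y, of x] e by (rule K_period)
qed

section \<open>Crossing times in a cylinder\<close>

lemma region_unique:
  assumes "y = low c \<or> y = top c" "line c i y < x" "x < line c (i + 1) y" "line c j y < x" "x < line c (j + 1) y"
  shows "i = j"
proof -
  have "line c i y < line c (j + 1) y" "line c j y < line c (i + 1) y" using assms by linarith+
  then show ?thesis unfolding line_strict[OF assms(1)] by linarith
qed

lemma region_not_line:
  assumes "y = low c \<or> y = top c" "line c j y < line c i y" "line c i y < line c (j + 1) y" shows False
  using assms(2,3) unfolding line_strict[OF assms(1)] by linarith

text \<open>The relative time at which a path crosses the line \<open>j\<close>, if it starts at \<open>X\<close> on the lower boundary and moves by \<open>dx\<close> until it reaches the upper one.  The signed distance to the line is an affine function of time; \<open>hit\<close> is its zero.\<close>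

definition hit :: "cyl \<Rightarrow> real \<Rightarrow> real \<Rightarrow> int \<Rightarrow> real" where
  "hit c X dx j = (X - line c j (low c)) / ((X - line c j (low c)) - (X + dx - line c j (top c)))"

definition between :: "cyl \<Rightarrow> real \<Rightarrow> real \<Rightarrow> int \<Rightarrow> int \<Rightarrow> bool" where
  "between c X dx a b \<longleftrightarrow> line c a (low c) < X \<and> X < line c (a + 1) (low c) \<and>
     line c b (top c) < X + dx \<and> X + dx < line c (b + 1) (top c)"

lemma between_signs:
  assumes "between c X dx a b"
  shows "j \<le> a \<Longrightarrow> X - line c j (low c) > 0" "a < j \<Longrightarrow> X - line c j (low c) < 0"
    "j \<le> b \<Longrightarrow> X + dx - line c j (top c) > 0" "b < j \<Longrightarrow> X + dx - line c j (top c) < 0"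
proof -
  have m: "line c i y \<le> line c k y" if "i \<le> k" "y = low c \<or> y = top c" for i k y
    using line_strict[OF that(2), of i k] that(1) by (cases "i = k") auto
  show "j \<le> a \<Longrightarrow> X - line c j (low c) > 0" using m[of j a "low c"] assms by (auto simp: between_def)
  show "a < j \<Longrightarrow> X - line c j (low c) < 0" using m[of "a + 1" j "low c"] assms by (auto simp: between_def)
  show "j \<le> b \<Longrightarrow> X + dx - line c j (top c) > 0" using m[of j b "top c"] assms by (auto simp: between_def)
  show "b < j \<Longrightarrow> X + dx - line c j (top c) < 0" using m[of "b + 1" j "top c"] assms by (auto simp: between_def)
qed

lemma line_affine: "line c j ((1 - r) * low c + r * top c) = (1 - r) * line c j (low c) + r * line c j (top c)"
  by (cases c) (simp_all add: line.simps algebra_simps)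

lemma crossing_iff:
  assumes b: "between c X dx a b" and r: "0 < r" "r < 1"
  shows "X + r * dx = line c j ((1 - r) * low c + r * top c) \<longleftrightarrow> (a < j \<and> j \<le> b \<or> b < j \<and> j \<le> a) \<and> r = hit c X dx j"
proof -
  define p q where "p = X - line c j (low c)" and "q = X + dx - line c j (top c)"
  have e: "X + r * dx = line c j ((1 - r) * low c + r * top c) \<longleftrightarrow> (1 - r) * p + r * q = 0"
    unfolding line_affine p_def q_def by (auto simp: algebra_simps)
  note s = between_signs[OF b, of j, folded p_def q_def]
  have rt: "hit c X dx j = p / (p - q)" by (simp add: hit_def p_def q_def)
  consider "j \<le> a" "j \<le> b" | "a < j" "b < j" | "a < j" "j \<le> b" | "b < j" "j \<le> a" by linarith
  then show ?thesis
  proof cases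
    case 1
    then have "(1 - r) * p + r * q > 0" using s r by (intro add_pos_pos mult_pos_pos) auto
    then show ?thesis using 1 e by auto
  next
    case 2
    then have "(1 - r) * p + r * q < 0" using s r by (intro add_neg_neg mult_pos_neg) auto
    then show ?thesis using 2 e by auto
  next
    case 3
    then have "p - q < 0" using s by auto
    then have "r = p / (p - q) \<longleftrightarrow> r * (p - q) = p" by (auto simp: field_simps)
    then show ?thesis using 3 e rt by (auto simp: algebra_simps)
  next
    case 4
    then have "p - q > 0" using s by auto
    then have "r = p / (p - q) \<longleftrightarrow> r * (p - q) = p" by (auto simp: field_simps)
    then show ?thesis using 4 e rt by (auto simp: algebra_simps)
  qed
qed

lemma hit_range:
  assumes b: "between c X dx a b" and j: "a < j \<and> j \<le> b \<or> b < j \<and> j \<le> a"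
  shows "0 < hit c X dx j" "hit c X dx j < 1"
proof -
  define p q where "p = X - line c j (low c)" and "q = X + dx - line c j (top c)"
  note s = between_signs[OF b, of j, folded p_def q_def]
  have rt: "hit c X dx j = p / (p - q)" by (simp add: hit_def p_def q_def)
  have "0 < p / (p - q) \<and> p / (p - q) < 1"
    using j s by (elim disjE conjE) (auto simp: divide_simps)
  then show "0 < hit c X dx j" "hit c X dx j < 1" using rt by auto
qed

lemma hit_mono:
  assumes b: "between c X dx a b" and j: "a < j" "j < k" "k \<le> b"
  shows "hit c X dx j < hit c X dx k"
proof -
  define p q where "p = line c j (low c) - X" and "q = X + dx - line c j (top c)"
  define p' q' where "p' = line c k (low c) - X" and "q' = X + dx - line c k (top c)"
  have pq: "p > 0" "q > 0" "p' > 0" "q' > 0" using between_signs[OF b, of j] between_signs[OF b, of k] j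
    by (auto simp: p_def q_def p'_def q'_def)
  have lt: "p < p'" "q' < q" using line_strict[of "low c" c j k] line_strict[of "top c" c j k] j
    by (auto simp: p_def q_def p'_def q'_def)
  have "p * q' < p' * q" using lt pq by (intro mult_strict_mono) auto
  then have "p / (p + q) < p' / (p' + q')" using pq by (simp add: divide_simps algebra_simps)
  moreover have "hit c X dx j = (- p) / (- (p + q))" "hit c X dx k = (- p') / (- (p' + q'))"
    by (simp_all add: hit_def p_def q_def p'_def q'_def)
  ultimately show ?thesis unfolding minus_divide_divide by simp
qed

text \<open>The horizontal displacement by which \<open>gamma\<close> shears the cylinder: it shifts the lines by two.\<close>

definition shear :: "cyl \<Rightarrow> real" where "shear c = 2 * sr * (top c - low c)"

lemma line_shear: "line c (j - 2) y = line c j y - shear c"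
  using sr_hs sr_ir by (cases c) (simp_all add: line.simps shear_def algebra_simps)

lemma between_shear: "between c X dx a b \<Longrightarrow> between c X (dx - shear c) a (b - 2)"
  using line_shear[of c b "top c"] line_shear[of c "b + 1" "top c"] by (simp add: between_def algebra_simps)

section \<open>Passages through the cylinders\<close>

locale sector0_path =
  fixes f :: "real \<Rightarrow> surface_point" and vx vy :: real
  assumes f: "traj (pt vx vy) f" and vy: "vy > 0" and vx: "sr * vy < vx"
begin

definition dur :: "cyl \<Rightarrow> real" where "dur c = (top c - low c) / vy"

text \<open>From time \<open>T\<close> to time \<open>T + dur c\<close> the path climbs through the cylinder \<open>c\<close>, starting at the coordinate \<open>X\<close> between the lines \<open>a\<close> and \<open>a + 1\<close> and ending between the lines \<open>b\<close> and \<open>b + 1\<close>.  The first condition normalizes the coordinate, which is defined up to the period.\<close>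

definition pass :: "cyl \<Rightarrow> int \<Rightarrow> int \<Rightarrow> real \<Rightarrow> real \<Rightarrow> bool" where
  "pass c a b T X \<longleftrightarrow> (a = 0 \<or> a = 1 \<and> c = Outer) \<and> between c X (dur c * vx) a b \<and>
     (\<forall>s. 0 < s \<and> s < dur c \<longrightarrow> f (T + s) = K c (X + s * vx) (low c + s * vy)) \<and>
     foot c a X \<in> f T \<and> head c b (X + dur c * vx) \<in> f (T + dur c)"

lemma dur_pos: "dur c > 0" using low_top[of c] vy by (simp add: dur_def)

lemma dur_vy: "dur c * vy = top c - low c" using vy by (simp add: dur_def)

lemma Kd: "K c (u + s * vx) (w + s * vy) = dev (lam c) (pt u w + s *\<^sub>R pt vx vy)" by (simp add: K_dev)

lemma reg: "f t \<in> regular" by (rule straight_regular[OF f])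

lemma strip: "0 < s \<Longrightarrow> s < dur c \<Longrightarrow> low c < low c + s * vy \<and> low c + s * vy < top c"
  using vy mult_strict_right_mono[of s "dur c" vy] by (simp add: dur_vy)

lemma pass_norm:
  assumes "line c j (low c) < X" "X < line c (j + 1) (low c)"
  obtains n :: int and a where "a = 0 \<or> a = 1 \<and> c = Outer" "line c a (low c) < X + of_int n * per c" "X + of_int n * per c < line c (a + 1) (low c)"
proof (cases c)
  case Inner
  show ?thesis by (rule that[of 0 "- j"]) (use assms Inner in \<open>simp_all add: line.simps algebra_simps\<close>)
next
  case Outer
  define a where "a = j mod 2"
  have j: "j = a + 2 * (j div 2)" by (simp add: a_def)
  have a: "a = 0 \<or> a = 1" unfolding a_def by linarith
  have l: "line c (i + 2 * (j div 2)) y = line c i y + of_int (j div 2) * per c" for i y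
    using line_period(2)[of i "j div 2" y] Outer by simp
  have "line c j (low c) = line c a (low c) + of_int (j div 2) * per c" using l[of a "low c"] j by simp
  moreover have "line c (j + 1) (low c) = line c (a + 1) (low c) + of_int (j div 2) * per c"
    using l[of "a + 1" "low c"] j by (simp add: algebra_simps)
  ultimately show ?thesis using that[of a "- (j div 2)"] assms a Outer by simp
qed

text \<open>The straight line through a point of the open cylinder meets no singular point while it stays in the cylinder, and the path follows it to both boundaries.\<close>

lemma pass_through:
  assumes u: "f u \<inter> K c x y \<noteq> {}" and y: "low c < y" "y < top c"
  obtains a b X where "pass c a b (u - (y - low c) / vy) X"
proof -
  define T where "T = u - (y - low c) / vy"
  define X0 where "X0 = x - (u - T) * vx"
  have uT: "(u - T) * vy = y - low c" using vy by (simp add: T_def)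
  have uu: "T < u" "u < T + dur c" using y vy by (auto simp: T_def dur_def divide_strict_right_mono)
  have main: "(\<forall>s. 0 < s \<and> s < dur c \<longrightarrow> f (T + s) = K c (X + s * vx) (low c + s * vy)) \<and>
      f T \<inter> K c X (low c) \<noteq> {} \<and> f (T + dur c) \<inter> K c (X + dur c * vx) (top c) \<noteq> {}"
    if X: "X = X0 + of_int n * per c" for X and n :: int
  proof -
    define P where "P = pt X (low c) - T *\<^sub>R pt vx vy"
    have P: "P + t *\<^sub>R pt vx vy = pt X (low c) + (t - T) *\<^sub>R pt vx vy" for t by (simp add: P_def algebra_simps)
    have Pk: "dev (lam c) (P + t *\<^sub>R pt vx vy) = K c (X + (t - T) * vx) (low c + (t - T) * vy)" for t
      unfolding P Kd ..
    have cl: "dev (lam c) (P + t *\<^sub>R pt vx vy) \<in> octagon_surface" if "t \<in> {T<..<T + dur c}" for t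
    proof -
      have "0 < t - T" "t - T < dur c" using that by auto
      then show ?thesis unfolding Pk using K_regular strip by blast
    qed
    have um: "u \<in> {T<..<T + dur c}" using uu by simp
    have "K c (X + (u - T) * vx) (low c + (u - T) * vy) = K c x y"
      using K_period[of c x n y] unfolding X X0_def uT by (simp add: algebra_simps)
    then have meet: "f u \<inter> dev (lam c) (P + u *\<^sub>R pt vx vy) \<noteq> {}" unfolding Pk using u by simp
    note dx = dev_path[OF loc_finite_lam traj_straight[OF f] cl um meet]
    have 1: "f (T + s) = K c (X + s * vx) (low c + s * vy)" if "0 < s" "s < dur c" for s
      using dx(1)[of "T + s"] that unfolding Pk by simp
    have 2: "f T \<inter> K c X (low c) \<noteq> {}" using dx(2) unfolding Pk by simp
    have 3: "f (T + dur c) \<inter> K c (X + dur c * vx) (top c) \<noteq> {}" using dx(3) unfolding Pk by (simp add: dur_vy)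
    show ?thesis using 1 2 3 by blast
  qed
  obtain q0 where q0: "q0 \<in> f T" "q0 \<in> K c X0 (low c)" using main[of X0 0] by auto
  from K_low[OF q0(2)] regular_not_vertex[OF reg q0(1)] obtain j where j: "line c j (low c) < X0" "X0 < line c (j + 1) (low c)" by blast
  obtain n :: int and a where na: "a = 0 \<or> a = 1 \<and> c = Outer" "line c a (low c) < X0 + of_int n * per c" "X0 + of_int n * per c < line c (a + 1) (low c)"
    by (rule pass_norm[OF j])
  define X where "X = X0 + of_int n * per c"
  note M = main[OF X_def]
  obtain q where q: "q \<in> f T" "q \<in> K c X (low c)" using M by auto
  from K_low[OF q(2)] regular_not_vertex[OF reg q(1)] obtain i where i: "line c i (low c) < X" "X < line c (i + 1) (low c)" "q = foot c i X" by blast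
  have "i = a" by (rule region_unique[of "low c" c _ X]) (use i na in \<open>simp_all add: X_def\<close>)
  obtain e where e: "e \<in> f (T + dur c)" "e \<in> K c (X + dur c * vx) (top c)" using M by auto
  from K_top[OF e(2)] regular_not_vertex[OF reg e(1)] obtain b where b: "line c b (top c) < X + dur c * vx" "X + dur c * vx < line c (b + 1) (top c)" "e = head c b (X + dur c * vx)" by blast
  have "pass c a b T X"
    unfolding pass_def between_def using na[folded X_def] M b e(1) i(3) q(1) \<open>i = a\<close> by blast
  then show ?thesis using that[of a b X] by (simp add: T_def)
qed

lemma pass_unique:
  assumes p: "pass c a b T X" "pass c' a' b' T' X'" and u: "T < u" "u < T + dur c" "T' < u" "u < T' + dur c'"
  shows "c = c' \<and> a = a' \<and> b = b' \<and> T = T' \<and> X = X'"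
proof -
  have s: "0 < u - T" "u - T < dur c" "0 < u - T'" "u - T' < dur c'" using u by auto
  have "f (T + (u - T)) = K c (X + (u - T) * vx) (low c + (u - T) * vy)" "f (T' + (u - T')) = K c' (X' + (u - T') * vx) (low c' + (u - T') * vy)"
    using p s unfolding pass_def by blast+
  then have e: "f u = K c (X + (u - T) * vx) (low c + (u - T) * vy)" "f u = K c' (X' + (u - T') * vx) (low c' + (u - T') * vy)" by simp_all
  obtain q where q: "q \<in> f u" using reg surface_nonempty by blast
  have k: "c = c' \<and> low c + (u - T) * vy = low c' + (u - T') * vy \<and> (\<exists>n::int. X' + (u - T') * vx = X + (u - T) * vx + of_int n * per c)"
    by (rule K_meet[of q]) (use q e strip[OF s(1,2)] strip[OF s(3,4)] in auto)
  then have cT: "c = c'" "T = T'" using vy by auto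
  obtain n :: int where n: "X' = X + of_int n * per c" using k cT by auto
  have L: "line Outer 2 hs = line Outer 0 hs + per Outer" "line Inner 1 (- hs) = line Inner 0 (- hs) + per Inner" by (simp_all add: line.simps)
  have rng: "line c 0 (low c) < Z \<and> Z < line c 0 (low c) + per c" if "pass c a b T Z" for a b T Z
  proof -
    have a: "a = 0 \<or> a = 1 \<and> c = Outer" "line c a (low c) < Z" "Z < line c (a + 1) (low c)" using that by (auto simp: pass_def between_def)
    show ?thesis
    proof (cases c)
      case Inner then show ?thesis using a L by auto
    next
      case Outer
      have "line Outer 0 hs \<le> line Outer a hs" "line Outer (a + 1) hs \<le> line Outer 2 hs"
        using a(1) line_strict[of hs Outer 0 1] line_strict[of hs Outer 1 2] by auto
      then show ?thesis using a L Outer by auto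
    qed
  qed
  have "\<bar>of_int n * per c\<bar> < per c" using rng[OF p(1)] rng[of a' b' T' X'] p(2) cT n by auto
  then have "\<bar>of_int n\<bar> * per c < 1 * per c" using per_pos[of c] by (simp add: abs_mult)
  then have "n = 0" using per_pos[of c] by (simp add: mult_less_cancel_right_pos)
  then have X: "X = X'" using n by simp
  have "a = a'"
    by (rule region_unique[of "low c" c _ X]) (use p cT X in \<open>simp_all add: pass_def between_def\<close>)
  moreover have "b = b'"
    by (rule region_unique[of "top c" c _ "X + dur c * vx"]) (use p cT X in \<open>simp_all add: pass_def between_def\<close>)
  ultimately show ?thesis using cT X by blast
qed

lemma near_low:
  assumes q: "q \<in> f T" "q \<in> K c x (low c)"
  obtains a b X where "pass c a b T X"
proof -
  have nv: "q \<notin> singular_point" by (rule regular_not_vertex[OF reg q(1)])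
  then obtain j where j: "line c j (low c) < x" "x < line c (j + 1) (low c)" "q = foot c j x" using K_low[OF q(2)] by blast
  have one: "K c x (low c) = {q}"
  proof
    show "K c x (low c) \<subseteq> {q}"
    proof
      fix p assume "p \<in> K c x (low c)"
      from K_low[OF this] show "p \<in> {q}"
      proof (elim disjE exE conjE)
        fix i assume "x = line c i (low c)" then show ?thesis using region_not_line[of "low c" c j i] j by simp
      next
        fix i assume i: "line c i (low c) < x" "x < line c (i + 1) (low c)" "p = foot c i x"
        have "i = j" by (rule region_unique[of "low c" c _ x]) (use i j in simp_all)
        then show ?thesis using i j by simp
      qed
    qed
  qed (use q in simp)
  have "\<forall>\<^sub>F s in nhds 0. dev (lam c) (pt x (low c) + s *\<^sub>R pt vx vy) = surface_plus (dev (lam c) (pt x (low c))) (s *\<^sub>R pt vx vy)"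
    by (rule small_scale[OF dev_plus[OF loc_finite_lam]])
  then have "\<forall>\<^sub>F s in nhds 0. dev (lam c) (pt x (low c) + s *\<^sub>R pt vx vy) = surface_plus (dev (lam c) (pt x (low c))) (s *\<^sub>R pt vx vy) \<and>
      f (T + s) = surface_plus (f T) (s *\<^sub>R pt vx vy)"
    by (rule eventually_conj[OF _ trajD[OF f]])
  from ev_nhds_0_nonzero[OF this] obtain e where e: "e > 0" and E: "\<And>s. \<bar>s\<bar> < e \<Longrightarrow> dev (lam c) (pt x (low c) + s *\<^sub>R pt vx vy) = surface_plus (dev (lam c) (pt x (low c))) (s *\<^sub>R pt vx vy) \<and>
      f (T + s) = surface_plus (f T) (s *\<^sub>R pt vx vy)" by blast
  define s where "s = min (e / 2) (dur c / 2)"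
  have s: "0 < s" "\<bar>s\<bar> < e" "s < dur c" using e dur_pos[of c] by (auto simp: s_def min_def)
  have Ks: "K c (x + s * vx) (low c + s * vy) = surface_plus {q} (s *\<^sub>R pt vx vy)" unfolding Kd unfolding one[symmetric] K_dev by (rule conjunct1[OF E[OF s(2)]])
  have st: "low c < low c + s * vy" "low c + s * vy < top c" using strip[OF s(1,3)] by auto
  obtain p where p: "p \<in> K c (x + s * vx) (low c + s * vy)" using K_regular[OF st] surface_nonempty by blast
  then have "p \<in> f (T + s)" using E[OF s(2)] q(1) unfolding Ks by (auto simp: surface_plus_def)
  then have m: "f (T + s) \<inter> K c (x + s * vx) (low c + s * vy) \<noteq> {}" using p by blast
  obtain a b X where "pass c a b (T + s - (low c + s * vy - low c) / vy) X" by (rule pass_through[OF m st])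
  moreover have "T + s - (low c + s * vy - low c) / vy = T" using vy by simp
  ultimately show ?thesis using that by simp
qed

lemma near_top:
  assumes q: "q \<in> f T" "q \<in> K c x (top c)"
  obtains a b X where "pass c a b (T - dur c) X"
proof -
  have nv: "q \<notin> singular_point" by (rule regular_not_vertex[OF reg q(1)])
  then obtain j where j: "line c j (top c) < x" "x < line c (j + 1) (top c)" "q = head c j x" using K_top[OF q(2)] by blast
  have one: "K c x (top c) = {q}"
  proof
    show "K c x (top c) \<subseteq> {q}"
    proof
      fix p assume "p \<in> K c x (top c)"
      from K_top[OF this] show "p \<in> {q}"
      proof (elim disjE exE conjE)
        fix i assume "x = line c i (top c)" then show ?thesis using region_not_line[of "top c" c j i] j by simp
      next
        fix i assume i: "line c i (top c) < x" "x < line c (i + 1) (top c)" "p = head c i x"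
        have "i = j" by (rule region_unique[of "top c" c _ x]) (use i j in simp_all)
        then show ?thesis using i j by simp
      qed
    qed
  qed (use q in simp)
  have "\<forall>\<^sub>F s in nhds 0. dev (lam c) (pt x (top c) + s *\<^sub>R pt vx vy) = surface_plus (dev (lam c) (pt x (top c))) (s *\<^sub>R pt vx vy)"
    by (rule small_scale[OF dev_plus[OF loc_finite_lam]])
  then have "\<forall>\<^sub>F s in nhds 0. dev (lam c) (pt x (top c) + s *\<^sub>R pt vx vy) = surface_plus (dev (lam c) (pt x (top c))) (s *\<^sub>R pt vx vy) \<and>
      f (T + s) = surface_plus (f T) (s *\<^sub>R pt vx vy)"
    by (rule eventually_conj[OF _ trajD[OF f]])
  from ev_nhds_0_nonzero[OF this] obtain e where e: "e > 0" and E: "\<And>s. \<bar>s\<bar> < e \<Longrightarrow> dev (lam c) (pt x (top c) + s *\<^sub>R pt vx vy) = surface_plus (dev (lam c) (pt x (top c))) (s *\<^sub>R pt vx vy) \<and>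
      f (T + s) = surface_plus (f T) (s *\<^sub>R pt vx vy)" by blast
  define r where "r = min (e / 2) (dur c / 2)"
  define s where "s = - r"
  have r: "0 < r" "r < dur c" using e dur_pos[of c] by (auto simp: r_def min_def)
  have s: "\<bar>s\<bar> < e" using e dur_pos[of c] by (auto simp: s_def r_def min_def)
  have Ks: "K c (x + s * vx) (top c + s * vy) = surface_plus {q} (s *\<^sub>R pt vx vy)" unfolding Kd unfolding one[symmetric] K_dev by (rule conjunct1[OF E[OF s]])
  have "low c + (dur c - r) * vy = top c + s * vy" using dur_vy[of c] by (simp add: s_def algebra_simps)
  then have st: "low c < top c + s * vy" "top c + s * vy < top c" using strip[of "dur c - r" c] r by auto
  obtain p where p: "p \<in> K c (x + s * vx) (top c + s * vy)" using K_regular[OF st] surface_nonempty by blast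
  then have "p \<in> f (T + s)" using E[OF s] q(1) unfolding Ks by (auto simp: surface_plus_def)
  then have m: "f (T + s) \<inter> K c (x + s * vx) (top c + s * vy) \<noteq> {}" using p by blast
  obtain a b X where "pass c a b (T + s - (top c + s * vy - low c) / vy) X" by (rule pass_through[OF m st])
  moreover have "T + s - (top c + s * vy - low c) / vy = T - dur c" using vy by (simp add: dur_def field_simps)
  ultimately show ?thesis using that by simp
qed

end

section \<open>Crossings of a path and of its image under \<open>gamma\<close>\<close>

lemma edge_height:
  assumes "i < 8" "edge_pt i (pt u y)"
  shows "y = ir \<and> i = 0 \<or> y = - ir \<and> i = 4 \<or> - ir < y \<and> y < ir \<and> y \<noteq> hs \<and> y \<noteq> - hs"
proof -
  note h = hs_pos ir_bounds
  from less_8[OF assms(1)] show ?thesis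
  proof (elim disjE)
    assume i: "i = 0"
    note e = edge_coords(1)[OF assms(2)[unfolded i]]
    then show ?thesis using i by simp
  next
    assume i: "i = 1"
    note e = edge_coords(2)[OF assms(2)[unfolded i]]
    have "- ir < y" "y < ir" "y \<noteq> hs" "y \<noteq> - hs" using e h by linarith+
    then show ?thesis by simp
  next
    assume i: "i = 2"
    note e = edge_coords(3)[OF assms(2)[unfolded i]]
    have "- ir < y" "y < ir" "y \<noteq> hs" "y \<noteq> - hs" using e h by linarith+
    then show ?thesis by simp
  next
    assume i: "i = 3"
    note e = edge_coords(4)[OF assms(2)[unfolded i]]
    have "- ir < y" "y < ir" "y \<noteq> hs" "y \<noteq> - hs" using e h by linarith+
    then show ?thesis by simp
  next
    assume i: "i = 4"
    note e = edge_coords(5)[OF assms(2)[unfolded i]]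
    then show ?thesis using i by simp
  next
    assume i: "i = 5"
    note e = edge_coords(6)[OF assms(2)[unfolded i]]
    have "- ir < y" "y < ir" "y \<noteq> hs" "y \<noteq> - hs" using e h by linarith+
    then show ?thesis by simp
  next
    assume i: "i = 6"
    note e = edge_coords(7)[OF assms(2)[unfolded i]]
    have "- ir < y" "y < ir" "y \<noteq> hs" "y \<noteq> - hs" using e h by linarith+
    then show ?thesis by simp
  next
    assume i: "i = 7"
    note e = edge_coords(8)[OF assms(2)[unfolded i]]
    have "- ir < y" "y < ir" "y \<noteq> hs" "y \<noteq> - hs" using e h by linarith+
    then show ?thesis by simp
  qed
qed

lemma boundary_class:
  assumes x: "x \<in> regular" and p: "pt u y \<in> x" and y: "y = hs \<or> y = - hs"
  shows "x = {pt u y}" "x \<notin> surface_side L"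
proof -
  have o: "oct_int (pt u y) \<and> x = {pt u y}"
    using x p
  proof (cases rule: regular_cases)
    case (2 i)
    have False using edge_height[OF 2(1,2)] y hs_pos ir_bounds by linarith
    then show ?thesis ..
  qed auto
  then show "x = {pt u y}" by blast
  show "x \<notin> surface_side L" using o int_side by blast
qed

lemma A_class:
  assumes x: "x \<in> regular" and p: "pt u y \<in> x" and y: "y = ir \<or> y = - ir"
  shows "x = {pt u ir, pt u (- ir)}" "x \<in> surface_side A"
proof -
  obtain i where i: "i = 0 \<or> i = 4" "edge_pt i (pt u y)" "x = {pt u y, pt u y - 2 *\<^sub>R mid i}"
    using x p
  proof (cases rule: regular_cases)
    case 1
    then show ?thesis using y by (auto simp: oct_int_pt)
  next
    case (2 i)
    have "i = 0 \<or> i = 4" using edge_height[OF 2(1,2)] y by auto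
    then show ?thesis using that 2 by blast
  qed
  have "oct_label i = A" using i(1) oct_label_values by auto
  then show "x \<in> surface_side A" using edge_side[OF i(2)] i(3) by simp
  have "i = 0 \<and> y = ir \<or> i = 4 \<and> y = - ir" using i edge_coords(1)[of u y] edge_coords(5)[of u y] by auto
  then show "x = {pt u ir, pt u (- ir)}" using i(3) by (auto simp: mid_values)
qed

lemma side_A_class:
  assumes x: "x \<in> regular" "x \<in> surface_side A" obtains u where "x = {pt u ir, pt u (- ir)}"
proof -
  obtain p where p: "p \<in> x" using x surface_nonempty by blast
  obtain u y where uy: "p = pt u y" by (rule pt_cases)
  obtain i where i: "i < 8" "edge_pt i p" "oct_label i = A" by (rule regular_side[OF x(1) p x(2)])
  have "i = 0 \<or> i = 4" using less_8[OF i(1)] i(3) oct_label_values by (elim disjE) auto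
  then have "y = ir \<or> y = - ir" using i(2) edge_coords(1,5)[of u y] uy by auto
  then show ?thesis using that A_class(1)[OF x(1), of u y] p uy by blast
qed

lemma lab_flip: "lab c (1 - j) = lab c (j + 1)" by (cases c) auto

lemma line_next: "line c (a + 1) (top c) = line c a (low c) + shear c / 2"
  using sr_hs sr_ir by (cases c) (auto simp: line.simps shear_def algebra_simps)

text \<open>The crossings \<open>j\<close> whose letters are sandwiched, in a passage from line \<open>a\<close> to line \<open>b\<close>.  The image path runs from line \<open>a\<close> to line \<open>b - 2\<close>, and crosses the lines \<open>j - 1\<close> for these \<open>j\<close>: forwards if \<open>b > a + 2\<close>, not at all if \<open>b = a + 2\<close>, and one line backwards if \<open>b = a + 1\<close>.\<close>

definition kept :: "int \<Rightarrow> int \<Rightarrow> int \<Rightarrow> bool" where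
  "kept a b j \<longleftrightarrow> (a + 1 < j \<and> j < b) \<or> (j = a + 1 \<and> b = a + 1)"

context sector0_path begin

text \<open>At \<open>cross_time\<close> the path crosses the line \<open>j\<close>; at \<open>image_time\<close> its image under \<open>gamma\<close> crosses the mirror image of the line \<open>j - 1\<close>.\<close>

definition cross_time :: "cyl \<Rightarrow> real \<Rightarrow> real \<Rightarrow> int \<Rightarrow> real" where
  "cross_time c T X j = T + dur c * hit c X (dur c * vx) j"

definition image_time :: "cyl \<Rightarrow> real \<Rightarrow> real \<Rightarrow> int \<Rightarrow> real" where
  "image_time c T X j = T + dur c * hit c X (dur c * vx - shear c) (j - 1)"

text \<open>A path of slope less than \<open>1 / sr\<close> moves by more than half of \<open>shear c\<close>, and this distance takes line \<open>a\<close> at the bottom to line \<open>a + 1\<close> at the top.\<close>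

lemma pass_ab: "pass c a b T X \<Longrightarrow> a < b"
proof -
  assume p: "pass c a b T X"
  have d: "dur c * vx > shear c / 2"
  proof -
    have "dur c * (sr * vy) < dur c * vx" using vx dur_pos by (intro mult_strict_left_mono)
    moreover have "dur c * (sr * vy) = sr * (top c - low c)" using dur_vy[of c] by (simp add: mult.left_commute)
    ultimately show ?thesis by (simp add: shear_def)
  qed
  have "line c (a + 1) (top c) < line c (b + 1) (top c)"
    using p d line_next[of c a] by (auto simp: pass_def between_def)
  then show ?thesis using line_strict[of "top c" c] by simp
qed

lemma pass_side:
  assumes p: "pass c a b T X" and r: "0 < r" "r < 1"
  shows "f (T + dur c * r) \<in> surface_side L \<longleftrightarrow> (\<exists>j. a < j \<and> j \<le> b \<and> r = hit c X (dur c * vx) j \<and> L = lab c j)"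
proof -
  have b: "between c X (dur c * vx) a b" using p by (simp add: pass_def)
  have s: "0 < dur c * r" "dur c * r < dur c" using r dur_pos[of c] by auto
  have h: "low c + dur c * r * vy = (1 - r) * low c + r * top c"
    using dur_vy[of c] by (simp add: mult.commute mult.left_commute right_diff_distrib left_diff_distrib)
  have fe: "f (T + dur c * r) = K c (X + r * (dur c * vx)) ((1 - r) * low c + r * top c)"
    using p s unfolding pass_def h[symmetric] by (simp add: mult_ac)
  have "f (T + dur c * r) \<in> surface_side L \<longleftrightarrow> (\<exists>j. X + r * (dur c * vx) = line c j ((1 - r) * low c + r * top c) \<and> L = lab c j)"
    unfolding fe by (rule K_side) (use strip[OF s] h in auto)
  also have "\<dots> \<longleftrightarrow> (\<exists>j. a < j \<and> j \<le> b \<and> r = hit c X (dur c * vx) j \<and> L = lab c j)"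
    unfolding crossing_iff[OF b r] using pass_ab[OF p] by (intro ex_cong1) linarith
  finally show ?thesis .
qed

text \<open>In the coordinates of the cylinder the image is the path mirrored, with its displacement reduced by \<open>shear c\<close>, and the lines are symmetric under the reflection.\<close>

lemma pass_image_side:
  assumes p: "pass c a b T X" and r: "0 < r" "r < 1" and a: "aff \<Phi> gamma"
  shows "\<Phi> (f (T + dur c * r)) \<in> surface_side L \<longleftrightarrow>
    (\<exists>j. kept a b j \<and> r = hit c X (dur c * vx - shear c) (j - 1) \<and> L = lab c j)"
proof -
  let ?D = "dur c * vx - shear c"
  have b: "between c X ?D a (b - 2)" by (rule between_shear) (use p in \<open>simp add: pass_def\<close>)
  have s: "0 < dur c * r" "dur c * r < dur c" using r dur_pos[of c] by auto
  have h: "low c + dur c * r * vy = (1 - r) * low c + r * top c"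
    using dur_vy[of c] by (simp add: mult.commute mult.left_commute right_diff_distrib left_diff_distrib)
  have fe: "f (T + dur c * r) = K c (X + r * (dur c * vx)) ((1 - r) * low c + r * top c)"
    using p s unfolding pass_def h[symmetric] by (simp add: mult_ac)
  have st: "low c < (1 - r) * low c + r * top c" "(1 - r) * low c + r * top c < top c" using strip[OF s] h by auto
  have x: "- (X + r * (dur c * vx) - 2 * sr * ((1 - r) * low c + r * top c - low c)) = - (X + r * ?D)"
    by (simp add: shear_def algebra_simps)
  have "\<Phi> (f (T + dur c * r)) = K c (- (X + r * ?D)) ((1 - r) * low c + r * top c)"
    unfolding fe gamma_cylinder[OF a st] x ..
  then have "\<Phi> (f (T + dur c * r)) \<in> surface_side L \<longleftrightarrow> (\<exists>k. - (X + r * ?D) = line c k ((1 - r) * low c + r * top c) \<and> L = lab c k)"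
    using K_side[OF st] by simp
  also have "\<dots> \<longleftrightarrow> (\<exists>j. - (X + r * ?D) = line c (1 - (j - 1)) ((1 - r) * low c + r * top c) \<and> L = lab c (1 - (j - 1)))"
  proof
    assume "\<exists>k. - (X + r * ?D) = line c k ((1 - r) * low c + r * top c) \<and> L = lab c k"
    then obtain k where "- (X + r * ?D) = line c k ((1 - r) * low c + r * top c) \<and> L = lab c k" by blast
    then show "\<exists>j. - (X + r * ?D) = line c (1 - (j - 1)) ((1 - r) * low c + r * top c) \<and> L = lab c (1 - (j - 1))"
      by (intro exI[of _ "2 - k"]) simp
  qed blast
  also have "\<dots> \<longleftrightarrow> (\<exists>j. X + r * ?D = line c (j - 1) ((1 - r) * low c + r * top c) \<and> L = lab c j)"
    unfolding line_minus[symmetric] lab_flip neg_equal_iff_equal by simp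
  also have "\<dots> \<longleftrightarrow> (\<exists>j. kept a b j \<and> r = hit c X ?D (j - 1) \<and> L = lab c j)"
  proof (intro ex_cong1)
    fix j
    have "(a < j - 1 \<and> j - 1 \<le> b - 2 \<or> b - 2 < j - 1 \<and> j - 1 \<le> a) \<longleftrightarrow> kept a b j"
      using pass_ab[OF p] unfolding kept_def by linarith
    then show "(X + r * ?D = line c (j - 1) ((1 - r) * low c + r * top c) \<and> L = lab c j) \<longleftrightarrow> (kept a b j \<and> r = hit c X ?D (j - 1) \<and> L = lab c j)"
      unfolding crossing_iff[OF b r] by blast
  qed
  finally show ?thesis .
qed

lemma ratio:
  assumes "T < u" "u < T + dur c" obtains r where "0 < r" "r < 1" "u = T + dur c * r"
  by (rule that[of "(u - T) / dur c"]) (use assms dur_pos[of c] in auto)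

lemma cross_time_range: "pass c a b T X \<Longrightarrow> a < j \<Longrightarrow> j \<le> b \<Longrightarrow> T < cross_time c T X j \<and> cross_time c T X j < T + dur c \<and> f (cross_time c T X j) \<in> surface_side (lab c j)"
proof -
  assume p: "pass c a b T X" and j: "a < j" "j \<le> b"
  have h: "0 < hit c X (dur c * vx) j" "hit c X (dur c * vx) j < 1"
    using hit_range[of c X "dur c * vx" a b j] p j by (auto simp: pass_def)
  have "f (T + dur c * hit c X (dur c * vx) j) \<in> surface_side (lab c j)" unfolding pass_side[OF p h] using j by blast
  then show ?thesis using h dur_pos[of c] by (simp add: cross_time_def)
qed

lemma cross_time_iff:
  assumes p: "pass c a b T X" and u: "T < u" "u < T + dur c" "f u \<in> surface_side L"
  obtains j where "a < j" "j \<le> b" "u = cross_time c T X j" "L = lab c j"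
proof -
  obtain r where r: "0 < r" "r < 1" "u = T + dur c * r" by (rule ratio[OF u(1,2)])
  show ?thesis using u(3) that unfolding r(3) pass_side[OF p r(1,2)] cross_time_def by blast
qed

lemma image_time_range:
  assumes p: "pass c a b T X" and j: "kept a b j" and a: "aff \<Phi> gamma"
  shows "T < image_time c T X j \<and> image_time c T X j < T + dur c \<and> \<Phi> (f (image_time c T X j)) \<in> surface_side (lab c j)"
proof -
  have b: "between c X (dur c * vx - shear c) a (b - 2)" by (rule between_shear) (use p in \<open>simp add: pass_def\<close>)
  have jj: "a < j - 1 \<and> j - 1 \<le> b - 2 \<or> b - 2 < j - 1 \<and> j - 1 \<le> a" using j unfolding kept_def by linarith
  note h = hit_range[OF b jj]
  have "\<Phi> (f (T + dur c * hit c X (dur c * vx - shear c) (j - 1))) \<in> surface_side (lab c j)"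
    unfolding pass_image_side[OF p h a] using j by blast
  then show ?thesis using h dur_pos[of c] by (simp add: image_time_def)
qed

lemma image_time_iff:
  assumes p: "pass c a b T X" and u: "T < u" "u < T + dur c" "\<Phi> (f u) \<in> surface_side L" and a: "aff \<Phi> gamma"
  obtains j where "kept a b j" "u = image_time c T X j" "L = lab c j"
proof -
  obtain r where r: "0 < r" "r < 1" "u = T + dur c * r" by (rule ratio[OF u(1,2)])
  show ?thesis using u(3) that unfolding r(3) pass_image_side[OF p r(1,2) a] image_time_def by blast
qed

lemma cross_time_mono: "pass c a b T X \<Longrightarrow> a < j \<Longrightarrow> j < k \<Longrightarrow> k \<le> b \<Longrightarrow> cross_time c T X j < cross_time c T X k"
  using hit_mono[of c X "dur c * vx" a b j k] dur_pos[of c] by (simp add: cross_time_def pass_def)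

lemma cross_time_less_iff: "pass c a b T X \<Longrightarrow> a < j \<Longrightarrow> j \<le> b \<Longrightarrow> a < k \<Longrightarrow> k \<le> b \<Longrightarrow> cross_time c T X j < cross_time c T X k \<longleftrightarrow> j < k"
  using cross_time_mono[of c a b T X j k] cross_time_mono[of c a b T X k j] by (cases j k rule: linorder_cases) auto

lemma image_time_mono:
  assumes p: "pass c a b T X" and j: "kept a b j" "kept a b k" "j < k" shows "image_time c T X j < image_time c T X k"
proof -
  have b: "between c X (dur c * vx - shear c) a (b - 2)" by (rule between_shear) (use p in \<open>simp add: pass_def\<close>)
  have "a < j - 1" "j - 1 < k - 1" "k - 1 \<le> b - 2" using j unfolding kept_def by auto
  from hit_mono[OF b this] show ?thesis using dur_pos[of c] by (simp add: image_time_def)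
qed

lemma in_octagon: "p \<in> f t \<Longrightarrow> p \<in> octagon" using surface_class reg by blast

lemma position_cases:
  obtains c a b T X where "pass c a b T X" "T < u" "u < T + dur c"
  | x y where "pt x y \<in> f u" "y = hs \<or> y = - hs \<or> y = ir \<or> y = - ir"
proof -
  obtain p where p: "p \<in> f u" using reg surface_nonempty by blast
  obtain x y where xy: "p = pt x y" by (rule pt_cases)
  have o: "pt x y \<in> octagon" using in_octagon p xy by blast
  then have y: "- ir \<le> y" "y \<le> ir" by (simp_all add: octagon_pt)
  have go: thesis if v: "p \<in> K c z v" "low c < v" "v < top c" for c z v
  proof -
    obtain a b X where P: "pass c a b (u - (v - low c) / vy) X" by (rule pass_through[of u c z v]) (use v p in auto)
    have "(v - low c) / vy > 0" "(v - low c) / vy < dur c" using v vy by (simp_all add: dur_def divide_strict_right_mono)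
    then show ?thesis using \<open>\<And>c a b T X. \<lbrakk>pass c a b T X; T < u; u < T + dur c\<rbrakk> \<Longrightarrow> thesis\<close>[OF P] by simp
  qed
  consider "y = hs \<or> y = - hs \<or> y = ir \<or> y = - ir" | "- hs < y" "y < hs" | "hs < y" "y < ir" | "- ir < y" "y < - hs" using y by linarith
  then show ?thesis
  proof cases
    case 1 then show ?thesis using \<open>\<And>x y. \<lbrakk>pt x y \<in> f u; y = hs \<or> y = - hs \<or> y = ir \<or> y = - ir\<rbrakk> \<Longrightarrow> thesis\<close> p xy by blast
  next
    case 2
    have "p \<in> K Inner x y" unfolding K_Inner_iff xy using o by (intro exI[of _ 0]) simp
    then show ?thesis using go 2 by simp
  next
    case 3
    have "p \<in> K Outer x y" unfolding K_Outer_iff xy using o by (intro exI[of _ 0]) simp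
    then show ?thesis using go 3 by simp
  next
    case 4
    have "p \<in> K Outer (x + ll) (y + ll)" unfolding K_Outer_iff xy using o by (intro exI[of _ "- 1"]) simp
    then show ?thesis using go[of Outer "x + ll" "y + ll"] 4 by simp
  qed
qed

lemma start_U: assumes "pt u hs \<in> f T" obtains b X where "pass Outer 0 b T X"
proof -
  have "pt u hs \<in> K Outer u (low Outer)" unfolding K_Outer_iff using in_octagon[OF assms] by (intro exI[of _ 0]) simp
  from near_low[OF assms this] obtain a b X where P: "pass Outer a b T X" by blast
  have "foot Outer a X \<in> {pt u hs}" using P boundary_class(1)[OF reg assms] by (simp add: pass_def)
  then have "a = 0" using P hs_pos ir_bounds by (auto simp: pass_def)
  then show ?thesis using that P by blast
qed

lemma start_V: assumes "pt u (- hs) \<in> f T" obtains b X where "pass Inner 0 b T X"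
proof -
  have "pt u (- hs) \<in> K Inner u (low Inner)" unfolding K_Inner_iff using in_octagon[OF assms] by (intro exI[of _ 0]) simp
  from near_low[OF assms this] obtain a b X where P: "pass Inner a b T X" by blast
  then have "a = 0" by (auto simp: pass_def)
  then show ?thesis using that P by blast
qed

lemma start_A: assumes "f T \<in> surface_side A" obtains b X where "pass Outer 1 b T X"
proof -
  obtain u where u: "f T = {pt u ir, pt u (- ir)}" by (rule side_A_class[OF reg assms])
  then have m: "pt u (- ir) \<in> f T" by simp
  have "pt u (- ir) \<in> K Outer (u + ll) (low Outer)" unfolding K_Outer_iff using in_octagon[OF m] by (intro exI[of _ "- 1"]) simp
  from near_low[OF m this] obtain a b X where P: "pass Outer a b T X" by blast
  have "foot Outer a X \<in> {pt u ir, pt u (- ir)}" using P u by (simp add: pass_def)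
  then have "a \<noteq> 0" using hs_pos ir_bounds by auto
  then have "a = 1" using P by (auto simp: pass_def)
  then show ?thesis using that P by blast
qed

lemma end_U: assumes "pt u hs \<in> f T" obtains a b X where "pass Inner a b (T - dur Inner) X"
proof -
  have "pt u hs \<in> K Inner u (top Inner)" unfolding K_Inner_iff using in_octagon[OF assms] by (intro exI[of _ 0]) simp
  from near_top[OF assms this] show ?thesis using that by blast
qed

lemma end_V: assumes "pt u (- hs) \<in> f T" obtains a b X where "pass Outer a b (T - dur Outer) X" "odd b"
proof -
  have "pt u (- hs) \<in> K Outer (u + ll) (top Outer)" unfolding K_Outer_iff using in_octagon[OF assms] by (intro exI[of _ "- 1"]) simp
  from near_top[OF assms this] obtain a b X where P: "pass Outer a b (T - dur Outer) X" by blast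
  have "head Outer b (X + dur Outer * vx) \<in> {pt u (- hs)}" using P boundary_class(1)[OF reg assms] by (simp add: pass_def)
  then have "odd b" using hs_pos ir_bounds by (auto split: if_splits)
  then show ?thesis using that P by blast
qed

lemma end_A: assumes "f T \<in> surface_side A" obtains a b X where "pass Outer a b (T - dur Outer) X" "even b"
proof -
  obtain u where u: "f T = {pt u ir, pt u (- ir)}" by (rule side_A_class[OF reg assms])
  then have m: "pt u ir \<in> f T" by simp
  have "pt u ir \<in> K Outer u (top Outer)" unfolding K_Outer_iff using in_octagon[OF m] by (intro exI[of _ 0]) simp
  from near_top[OF m this] obtain a b X where P: "pass Outer a b (T - dur Outer) X" by blast
  have "head Outer b (X + dur Outer * vx) \<in> {pt u ir, pt u (- ir)}" using P u by (simp add: pass_def)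
  then have "even b" using hs_pos ir_bounds by (auto split: if_splits)
  then show ?thesis using that P by blast
qed

lemma pass_start:
  assumes p: "pass c a b T X"
  shows "c = Inner \<Longrightarrow> \<exists>u. pt u (- hs) \<in> f T" "c = Outer \<Longrightarrow> a = 0 \<Longrightarrow> \<exists>u. pt u hs \<in> f T"
    "c = Outer \<Longrightarrow> a \<noteq> 0 \<Longrightarrow> a = 1 \<and> f T \<in> surface_side A"
proof -
  have q: "foot c a X \<in> f T" "a = 0 \<or> a = 1 \<and> c = Outer" using p by (auto simp: pass_def)
  show "c = Inner \<Longrightarrow> \<exists>u. pt u (- hs) \<in> f T" "c = Outer \<Longrightarrow> a = 0 \<Longrightarrow> \<exists>u. pt u hs \<in> f T" using q by auto
  show "c = Outer \<Longrightarrow> a \<noteq> 0 \<Longrightarrow> a = 1 \<and> f T \<in> surface_side A" using q A_class(2)[OF reg] by auto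
qed

lemma pass_end:
  assumes p: "pass c a b T X"
  shows "c = Inner \<Longrightarrow> \<exists>u. pt u hs \<in> f (T + dur c)" "c = Outer \<Longrightarrow> odd b \<Longrightarrow> \<exists>u. pt u (- hs) \<in> f (T + dur c)"
    "c = Outer \<Longrightarrow> even b \<Longrightarrow> f (T + dur c) \<in> surface_side A"
proof -
  have q: "head c b (X + dur c * vx) \<in> f (T + dur c)" using p by (auto simp: pass_def)
  show "c = Inner \<Longrightarrow> \<exists>u. pt u hs \<in> f (T + dur c)" "c = Outer \<Longrightarrow> odd b \<Longrightarrow> \<exists>u. pt u (- hs) \<in> f (T + dur c)" using q by auto
  show "c = Outer \<Longrightarrow> even b \<Longrightarrow> f (T + dur c) \<in> surface_side A" using q A_class(2)[OF reg] by auto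
qed

lemma image_end:
  assumes p: "pass c a b T X" and a: "aff \<Phi> gamma"
  shows "head c (2 - b) (- (X + (dur c * vx - shear c))) \<in> \<Phi> (f (T + dur c))"
proof -
  define v' where "v' = pt (- vx + 2 * sr * vy) vy"
  have st: "straight {T..T + dur c} v' (\<Phi> \<circ> f)" using traj_straight[OF aff_traj[OF a f]] by (simp add: gamma_vec v'_def)
  define P where "P = pt (- X) (low c) - T *\<^sub>R v'"
  have Pk: "dev (lam c) (P + t *\<^sub>R v') = K c (- (X + (t - T) * vx - 2 * sr * ((t - T) * vy))) (low c + (t - T) * vy)" for t
  proof -
    have "P + t *\<^sub>R v' = pt (- X) (low c) + (t - T) *\<^sub>R v'" by (simp add: P_def algebra_simps)
    also have "\<dots> = pt (- (X + (t - T) * vx - 2 * sr * ((t - T) * vy))) (low c + (t - T) * vy)"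
      by (simp add: v'_def algebra_simps)
    finally show ?thesis by (simp add: K_dev)
  qed
  have img: "\<Phi> (f (T + s)) = K c (- (X + s * vx - 2 * sr * (s * vy))) (low c + s * vy)" if s: "0 < s" "s < dur c" for s
  proof -
    have "f (T + s) = K c (X + s * vx) (low c + s * vy)" using p s by (simp add: pass_def)
    moreover have "low c < low c + s * vy" "low c + s * vy < top c" using strip[OF s] by auto
    ultimately show ?thesis using gamma_cylinder[OF a, of c "low c + s * vy" "X + s * vx"] by simp
  qed
  let ?m = "T + dur c / 2"
  have m: "?m \<in> {T<..<T + dur c}" using dur_pos[of c] by simp
  have cl: "dev (lam c) (P + t *\<^sub>R v') \<in> octagon_surface" if "t \<in> {T<..<T + dur c}" for t
  proof -
    have "0 < t - T" "t - T < dur c" using that by auto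
    then show ?thesis unfolding Pk using K_regular strip by blast
  qed
  have "(\<Phi> \<circ> f) ?m = dev (lam c) (P + ?m *\<^sub>R v')" unfolding Pk using img[of "dur c / 2"] dur_pos[of c] by simp
  then have meet: "(\<Phi> \<circ> f) ?m \<inter> dev (lam c) (P + ?m *\<^sub>R v') \<noteq> {}" using cl[OF m] surface_nonempty by fastforce
  from dev_path(3)[OF loc_finite_lam st cl m meet] obtain q where q: "q \<in> \<Phi> (f (T + dur c))"
    "q \<in> K c (- (X + dur c * vx - 2 * sr * (dur c * vy))) (low c + dur c * vy)" unfolding Pk by auto
  have x: "- (X + dur c * vx - 2 * sr * (dur c * vy)) = - (X + (dur c * vx - shear c))" by (simp add: dur_vy shear_def)
  have y: "low c + dur c * vy = top c" by (simp add: dur_vy)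
  from K_top[OF q(2)[unfolded x y]] regular_not_vertex[OF aff_regular[OF a reg] q(1)]
  obtain j where j: "line c j (top c) < - (X + (dur c * vx - shear c))" "- (X + (dur c * vx - shear c)) < line c (j + 1) (top c)"
    "q = head c j (- (X + (dur c * vx - shear c)))" by blast
  have b: "between c X (dur c * vx - shear c) a (b - 2)" by (rule between_shear) (use p in \<open>simp add: pass_def\<close>)
  have "j = 2 - b"
  proof (rule region_unique[of "top c" c])
    show "line c (2 - b) (top c) < - (X + (dur c * vx - shear c))" "- (X + (dur c * vx - shear c)) < line c (2 - b + 1) (top c)"
      using b line_minus[of c "b - 1" "top c"] line_minus[of c "b - 2" "top c"] by (simp_all add: between_def)
  qed (use j in auto)
  then show ?thesis using j q by simp
qed

lemma image_end_side:
  assumes p: "pass c a b T X" and a: "aff \<Phi> gamma"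
  shows "c = Outer \<and> even b \<Longrightarrow> \<Phi> (f (T + dur c)) \<in> surface_side A" "\<not> (c = Outer \<and> even b) \<Longrightarrow> \<Phi> (f (T + dur c)) \<notin> surface_side L"
proof -
  note h = image_end[OF p a]
  have r: "\<Phi> (f (T + dur c)) \<in> regular" by (rule aff_regular[OF a reg])
  show "c = Outer \<and> even b \<Longrightarrow> \<Phi> (f (T + dur c)) \<in> surface_side A" using h A_class(2)[OF r] by auto
  show "\<not> (c = Outer \<and> even b) \<Longrightarrow> \<Phi> (f (T + dur c)) \<notin> surface_side L"
    using h boundary_class(2)[OF r, of _ hs] boundary_class(2)[OF r, of _ "- hs"] by (cases c) (auto split: if_splits)
qed

end

section \<open>Sandwiched letters\<close>

lemma int_enumeration:
  assumes up: "\<And>n. \<exists>i\<in>I. i > (n::int)" and down: "\<And>n. \<exists>i\<in>I. i < n"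
  shows "\<exists>e :: int \<Rightarrow> int. strict_mono e \<and> range e = I"
proof -
  obtain i0 where i0: "i0 \<in> I" using up by blast
  define U where "U = {n::nat. i0 + int n \<in> I}"
  define V where "V = {n::nat. i0 - int n \<in> I}"
  have inf: "infinite U" "infinite V"
  proof -
    show "infinite U" unfolding infinite_nat_iff_unbounded
    proof
      fix m
      obtain i where i: "i \<in> I" "i > i0 + int m" using up by blast
      then have "nat (i - i0) \<in> U" "m < nat (i - i0)" by (auto simp: U_def)
      then show "\<exists>n>m. n \<in> U" by blast
    qed
    show "infinite V" unfolding infinite_nat_iff_unbounded
    proof
      fix m
      obtain i where i: "i \<in> I" "i < i0 - int m" using down by blast
      then have "nat (i0 - i) \<in> V" "m < nat (i0 - i)" by (auto simp: V_def)
      then show "\<exists>n>m. n \<in> V" by blast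
    qed
  qed
  have z: "0 \<in> U" "0 \<in> V" using i0 by (auto simp: U_def V_def)
  have e0: "enumerate U 0 = 0" "enumerate V 0 = 0"
    using z by (simp_all add: enumerate_0 Least_eq_0)
  define e where "e k = (if k \<ge> 0 then i0 + int (enumerate U (nat k)) else i0 - int (enumerate V (nat (- k))))" for k
  have "strict_mono e"
  proof (rule strict_monoI)
    fix k l :: int assume kl: "k < l"
    consider "0 \<le> k" | "k < 0" "0 \<le> l" | "l < 0" using kl by linarith
    then show "e k < e l"
    proof cases
      case 1
      then have "nat k < nat l" using kl by simp
      from enumerate_mono[OF this inf(1)] show ?thesis using 1 kl by (simp add: e_def)
    next
      case 2
      then have "0 < nat (- k)" by simp
      from enumerate_mono[OF this inf(2)] show ?thesis using 2 e0 by (simp add: e_def)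
    next
      case 3
      then have "nat (- l) < nat (- k)" using kl by simp
      from enumerate_mono[OF this inf(2)] show ?thesis using 3 kl by (simp add: e_def)
    qed
  qed
  moreover have "range e = I"
  proof
    show "range e \<subseteq> I"
    proof
      fix i assume "i \<in> range e"
      then obtain k where k: "i = e k" by blast
      have U: "i0 + int (enumerate U n) \<in> I" for n using enumerate_in_set[OF inf(1)] by (simp add: U_def)
      have V: "i0 - int (enumerate V n) \<in> I" for n using enumerate_in_set[OF inf(2)] by (simp add: V_def)
      show "i \<in> I" unfolding k e_def by (cases "k \<ge> 0") (simp_all only: if_True if_False U V)
    qed
    show "I \<subseteq> range e"
    proof
      fix i assume i: "i \<in> I"
      show "i \<in> range e"
      proof (cases "i \<ge> i0")
        case True
        then have "nat (i - i0) \<in> U" using i by (simp add: U_def)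
        then obtain n where "enumerate U n = nat (i - i0)" using enumerate_Ex[OF inf(1), of "nat (i - i0)"] by blast
        then have "e (int n) = i" using True by (simp add: e_def)
        then show ?thesis by blast
      next
        case False
        then have "nat (i0 - i) \<in> V" using i by (simp add: V_def)
        then obtain n where n: "enumerate V n = nat (i0 - i)" using enumerate_Ex[OF inf(2), of "nat (i0 - i)"] by blast
        then have "n \<noteq> 0" using False e0 by (cases n) auto
        then have "e (- int n) = i" using False n by (simp add: e_def)
        then show ?thesis by blast
      qed
    qed
  qed
  ultimately show ?thesis by blast
qed

locale sector0_cutting = sector0_path +
  fixes w :: "int \<Rightarrow> letter" and t :: "int \<Rightarrow> real"
  assumes t: "strict_mono t" "range t = {u. \<exists>L. f u \<in> surface_side L}" and w: "\<And>i. f (t i) \<in> surface_side (w i)"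
begin

lemma index: "f u \<in> surface_side L \<Longrightarrow> \<exists>i. u = t i"
proof -
  assume "f u \<in> surface_side L"
  then have "u \<in> range t" unfolding t(2) by blast
  then show ?thesis by blast
qed

lemma letter: "f (t i) \<in> surface_side L \<Longrightarrow> w i = L"
  using side_unique[OF reg w] by blast

lemma t_less: "t i < t j \<longleftrightarrow> i < j" using t(1) by (simp add: strict_mono_less)

lemma next_letter:
  assumes u: "f u \<in> surface_side L" "t i < u" and n: "\<And>z L. t i < z \<Longrightarrow> z < u \<Longrightarrow> f z \<notin> surface_side L"
  shows "w (i + 1) = L"
proof -
  obtain k where k: "u = t k" using index[OF u(1)] by blast
  have "i < k" using u(2) k t_less by simp
  moreover have "\<not> i + 1 < k" using n[of "t (i + 1)" "w (i + 1)"] w[of "i + 1"] k t_less by auto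
  ultimately have "k = i + 1" by simp
  then show ?thesis using letter u(1) k by simp
qed

lemma prev_letter:
  assumes u: "f u \<in> surface_side L" "u < t i" and n: "\<And>z L. u < z \<Longrightarrow> z < t i \<Longrightarrow> f z \<notin> surface_side L"
  shows "w (i - 1) = L"
proof -
  obtain k where k: "u = t k" using index[OF u(1)] by blast
  have "k < i" using u(2) k t_less by simp
  moreover have "\<not> k < i - 1" using n[of "t (i - 1)" "w (i - 1)"] w[of "i - 1"] k t_less by auto
  ultimately have "k = i - 1" by simp
  then show ?thesis using letter u(1) k by simp
qed

lemma first_crossing:
  assumes p: "pass c a b T X" and i: "t i \<le> T" "\<And>z L. t i < z \<Longrightarrow> z < T \<Longrightarrow> f z \<notin> surface_side L" and T: "t i < T \<Longrightarrow> (\<And>L. f T \<notin> surface_side L)"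
  shows "w (i + 1) = lab c (a + 1)"
proof -
  have ab: "a < a + 1" "a + 1 \<le> b" using pass_ab[OF p] by auto
  note z = cross_time_range[OF p ab]
  show ?thesis
  proof (rule next_letter)
    show "f (cross_time c T X (a + 1)) \<in> surface_side (lab c (a + 1))" "t i < cross_time c T X (a + 1)" using z i by auto
    fix u L assume u: "t i < u" "u < cross_time c T X (a + 1)"
    show "f u \<notin> surface_side L"
    proof
      assume s: "f u \<in> surface_side L"
      consider "u < T" | "u = T" | "T < u" by linarith
      then show False
      proof cases
        case 3
        have "u < T + dur c" using u z by simp
        from cross_time_iff[OF p 3 this s] obtain j where j: "a < j" "j \<le> b" "u = cross_time c T X j" by metis
        then show False using cross_time_less_iff[OF p j(1,2) ab] u by simp
      qed (use i T u s in auto)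
    qed
  qed
qed

lemma last_crossing:
  assumes p: "pass c a b T X" and i: "T + dur c \<le> t i" "\<And>z L. T + dur c < z \<Longrightarrow> z < t i \<Longrightarrow> f z \<notin> surface_side L"
    and T: "T + dur c < t i \<Longrightarrow> (\<And>L. f (T + dur c) \<notin> surface_side L)"
  shows "w (i - 1) = lab c b"
proof -
  have ab: "a < b" "b \<le> b" using pass_ab[OF p] by auto
  note z = cross_time_range[OF p ab]
  show ?thesis
  proof (rule prev_letter)
    show "f (cross_time c T X b) \<in> surface_side (lab c b)" "cross_time c T X b < t i" using z i by auto
    fix u L assume u: "cross_time c T X b < u" "u < t i"
    show "f u \<notin> surface_side L"
    proof
      assume s: "f u \<in> surface_side L"
      consider "T + dur c < u" | "u = T + dur c" | "u < T + dur c" by linarith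
      then show False
      proof cases
        case 3
        have "T < u" using u z by simp
        from cross_time_iff[OF p this 3 s] obtain j where j: "a < j" "j \<le> b" "u = cross_time c T X j" by metis
        then show False using cross_time_less_iff[OF p ab j(1,2)] u by simp
      qed (use i T u s in auto)
    qed
  qed
qed

lemma nonside: "pt u hs \<in> f T \<Longrightarrow> f T \<notin> surface_side L" "pt u (- hs) \<in> f T \<Longrightarrow> f T \<notin> surface_side L"
  using boundary_class(2)[OF reg] by blast+

lemma next_in_pass:
  assumes p: "pass c a b T X" and j: "a < j" "j \<le> b" "t i = cross_time c T X j"
  shows "w (i + 1) = (if j < b then lab c (j + 1) else if c = Inner then B else if odd b then C else A)"
proof (cases "j < b")
  case True
  have j1: "a < j + 1" "j + 1 \<le> b" using j True by auto
  have "w (i + 1) = lab c (j + 1)"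
  proof (rule next_letter)
    show "f (cross_time c T X (j + 1)) \<in> surface_side (lab c (j + 1))" using cross_time_range[OF p j1] by blast
    show "t i < cross_time c T X (j + 1)" using cross_time_less_iff[OF p j(1,2) j1] j(3) by simp
    fix u L assume u: "t i < u" "u < cross_time c T X (j + 1)"
    show "f u \<notin> surface_side L"
    proof
      assume s: "f u \<in> surface_side L"
      have "T < u" "u < T + dur c" using u cross_time_range[OF p j(1,2)] cross_time_range[OF p j1] j(3) by auto
      from cross_time_iff[OF p this s] obtain k where k: "a < k" "k \<le> b" "u = cross_time c T X k" by metis
      then show False using u cross_time_less_iff[OF p j(1,2) k(1,2)] cross_time_less_iff[OF p k(1,2) j1] j(3) by simp
    qed
  qed
  then show ?thesis using True by simp
next
  case False
  then have jb: "j = b" using j by simp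
  have ti: "t i < T + dur c" using cross_time_range[OF p j(1,2)] j(3) by simp
  have free: "f z \<notin> surface_side L" if z: "t i < z" "z < T + dur c" for z L
  proof
    assume s: "f z \<in> surface_side L"
    have "T < z" using z cross_time_range[OF p j(1,2)] j(3) by simp
    from cross_time_iff[OF p this z(2) s] obtain k where k: "a < k" "k \<le> b" "z = cross_time c T X k" by metis
    then show False using z cross_time_less_iff[OF p j(1,2) k(1,2)] j(3) jb by simp
  qed
  have le: "t i \<le> T + dur c" using ti by simp
  show ?thesis
  proof (cases c)
    case Inner
    obtain u where u: "pt u hs \<in> f (T + dur c)" using pass_end(1)[OF p Inner] by blast
    obtain b' X' where p': "pass Outer 0 b' (T + dur c) X'" by (rule start_U[OF u])
    have "w (i + 1) = lab Outer (0 + 1)" by (rule first_crossing[OF p' le free nonside(1)[OF u]])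
    then show ?thesis using jb Inner by simp
  next
    case Outer
    show ?thesis
    proof (cases "odd b")
      case True
      obtain u where u: "pt u (- hs) \<in> f (T + dur c)" using pass_end(2)[OF p Outer True] by blast
      obtain b' X' where p': "pass Inner 0 b' (T + dur c) X'" by (rule start_V[OF u])
      have "w (i + 1) = lab Inner (0 + 1)" by (rule first_crossing[OF p' le free nonside(2)[OF u]])
      then show ?thesis using jb Outer True by simp
    next
      case e: False
      have "f (T + dur c) \<in> surface_side A" using pass_end(3)[OF p Outer] e by blast
      from next_letter[OF this ti free] show ?thesis using jb Outer e by simp
    qed
  qed
qed

lemma prev_in_pass:
  assumes p: "pass c a b T X" and j: "a < j" "j \<le> b" "t i = cross_time c T X j"
  shows "w (i - 1) = (if a + 1 < j then lab c (j - 1) else if c = Inner then B else if a = 0 then C else A)"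
proof (cases "a + 1 < j")
  case True
  have j1: "a < j - 1" "j - 1 \<le> b" using j True by auto
  have "w (i - 1) = lab c (j - 1)"
  proof (rule prev_letter)
    show "f (cross_time c T X (j - 1)) \<in> surface_side (lab c (j - 1))" using cross_time_range[OF p j1] by blast
    show "cross_time c T X (j - 1) < t i" using cross_time_less_iff[OF p j1 j(1,2)] j(3) by simp
    fix u L assume u: "cross_time c T X (j - 1) < u" "u < t i"
    show "f u \<notin> surface_side L"
    proof
      assume s: "f u \<in> surface_side L"
      have "T < u" "u < T + dur c" using u cross_time_range[OF p j(1,2)] cross_time_range[OF p j1] j(3) by auto
      from cross_time_iff[OF p this s] obtain k where k: "a < k" "k \<le> b" "u = cross_time c T X k" by metis
      then show False using u cross_time_less_iff[OF p j1 k(1,2)] cross_time_less_iff[OF p k(1,2) j(1,2)] j(3) by simp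
    qed
  qed
  then show ?thesis using True by simp
next
  case False
  then have ja: "j = a + 1" using j by simp
  have ti: "T < t i" using cross_time_range[OF p j(1,2)] j(3) by simp
  have free: "f z \<notin> surface_side L" if z: "T < z" "z < t i" for z L
  proof
    assume s: "f z \<in> surface_side L"
    have "z < T + dur c" using z cross_time_range[OF p j(1,2)] j(3) by simp
    from cross_time_iff[OF p z(1) this s] obtain k where k: "a < k" "k \<le> b" "z = cross_time c T X k" by metis
    then show False using z cross_time_less_iff[OF p k(1,2) j(1,2)] j(3) ja by simp
  qed
  have T: "T - dur d + dur d = T" for d by simp
  show ?thesis
  proof (cases c)
    case Inner
    obtain u where u: "pt u (- hs) \<in> f T" using pass_start(1)[OF p Inner] by blast
    obtain a' b' X' where p': "pass Outer a' b' (T - dur Outer) X'" "odd b'" by (rule end_V[OF u])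
    have "w (i - 1) = lab Outer b'" by (rule last_crossing[OF p'(1)]) (use T ti free nonside(2)[OF u] in auto)
    then show ?thesis using ja Inner p'(2) by simp
  next
    case Outer
    show ?thesis
    proof (cases "a = 0")
      case True
      obtain u where u: "pt u hs \<in> f T" using pass_start(2)[OF p Outer True] by blast
      obtain a' b' X' where p': "pass Inner a' b' (T - dur Inner) X'" by (rule end_U[OF u])
      have "w (i - 1) = lab Inner b'" by (rule last_crossing[OF p']) (use T ti free nonside(1)[OF u] in auto)
      then show ?thesis using ja Outer True by simp
    next
      case e: False
      have "f T \<in> surface_side A" using pass_start(3)[OF p Outer e] by blast
      from prev_letter[OF this ti free] show ?thesis using ja Outer e by simp
    qed
  qed
qed

text \<open>Inside a passage the labels alternate or are constantly \<open>C\<close>, so the letters away from its ends are sandwiched.  The first letter is preceded by \<open>B\<close> in the inner cylinder, and in the outer one by \<open>C\<close> or \<open>A\<close>, which do not occur inside; so at the ends sandwiching fails, unless the passage has a single letter.\<close>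

lemma sandwiched_kept:
  assumes p: "pass c a b T X" and j: "a < j" "j \<le> b" "t i = cross_time c T X j"
  shows "sandwiched w i \<longleftrightarrow> kept a b j"
proof -
  have a: "c = Outer \<Longrightarrow> a = 0 \<or> a = 1" using p by (auto simp: pass_def)
  consider "a + 1 < j" "j < b" | "a + 1 < j" "j = b" | "j = a + 1" "j < b" | "j = a + 1" "j = b" using j by linarith
  then show ?thesis
    unfolding sandwiched_def next_in_pass[OF p j] prev_in_pass[OF p j] kept_def
  proof cases
    case 4
    then show "((if a + 1 < j then lab c (j - 1) else if c = Inner then B else if a = 0 then C else A) =
       (if j < b then lab c (j + 1) else if c = Inner then B else if odd b then C else A)) = (a + 1 < j \<and> j < b \<or> j = a + 1 \<and> b = a + 1)"
      using a by (cases c) auto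
  qed (cases c; simp)+
qed

text \<open>A crossing of a side \<open>A\<close> separates two passages through the outer cylinder, the first of which ends and the second of which begins with the letter \<open>D\<close>.\<close>

lemma sandwiched_A: assumes "f (t i) \<in> surface_side A" shows "sandwiched w i"
proof -
  obtain b X where p: "pass Outer 1 b (t i) X" by (rule start_A[OF assms])
  have "w (i + 1) = lab Outer (1 + 1)" by (rule first_crossing[OF p]) auto
  moreover obtain a' b' X' where p': "pass Outer a' b' (t i - dur Outer) X'" "even b'" by (rule end_A[OF assms])
  have "w (i - 1) = lab Outer b'" by (rule last_crossing[OF p'(1)]) auto
  ultimately show ?thesis using p'(2) by (simp add: sandwiched_def)
qed

lemma Outer_has_sandwiched:
  assumes p: "pass Outer a b T X" shows "\<exists>i. T \<le> t i \<and> t i \<le> T + dur Outer \<and> sandwiched w i"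
proof -
  have ab: "a < b" by (rule pass_ab[OF p])
  have "\<exists>i. T \<le> t i \<and> t i \<le> T + dur Outer \<and> sandwiched w i" if "f z \<in> surface_side A" "T \<le> z" "z \<le> T + dur Outer" for z
  proof -
    from index[OF that(1)] obtain i where "z = t i" ..
    then show ?thesis using sandwiched_A that by blast
  qed
  note A = this
  have K: "\<exists>i. T \<le> t i \<and> t i \<le> T + dur Outer \<and> sandwiched w i" if j: "kept a b j" for j
  proof -
    have j': "a < j" "j \<le> b" using j by (auto simp: kept_def)
    have z: "T < cross_time Outer T X j" "cross_time Outer T X j < T + dur Outer" "f (cross_time Outer T X j) \<in> surface_side (lab Outer j)" using cross_time_range[OF p j'] by auto
    obtain i where "cross_time Outer T X j = t i" using index[OF z(3)] by blast
    then show ?thesis using sandwiched_kept[OF p j', of i] j z by (intro exI[of _ i]) simp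
  qed
  show ?thesis
  proof (cases "a = 0")
    case False
    then show ?thesis using A[of T] pass_start(3)[OF p] dur_pos[of Outer] by simp
  next
    case a: True
    show ?thesis
    proof (cases "even b")
      case True
      then show ?thesis using A[of "T + dur Outer"] pass_end(3)[OF p] dur_pos[of Outer] by simp
    next
      case False
      have "kept a b 1 \<or> kept a b 2"
      proof (cases "b = 1")
        case True then show ?thesis using a by (simp add: kept_def)
      next
        case False
        then have "b > 2" using ab a \<open>\<not> even b\<close> by presburger
        then show ?thesis using a by (simp add: kept_def)
      qed
      then show ?thesis using K by blast
    qed
  qed
qed

lemma boundary_future:
  assumes "pt x y \<in> f T" "y = hs \<or> y = - hs \<or> y = ir \<or> y = - ir" shows "\<exists>a b T' X. pass Outer a b T' X \<and> T \<le> T'"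
proof -
  have V: ?thesis if v: "pt x (- hs) \<in> f T" for x
  proof -
    obtain b X where p: "pass Inner 0 b T X" by (rule start_V[OF v])
    obtain u where u: "pt u hs \<in> f (T + dur Inner)" using pass_end(1)[OF p] by blast
    obtain b' X' where "pass Outer 0 b' (T + dur Inner) X'" by (rule start_U[OF u])
    then show ?thesis using dur_pos[of Inner] by (intro exI conjI) (assumption, simp)
  qed
  consider "y = hs" | "y = - hs" | "y = ir \<or> y = - ir" using assms(2) by blast
  then show ?thesis
  proof cases
    case 1
    obtain b X where "pass Outer 0 b T X" by (rule start_U[OF assms(1)[unfolded 1]])
    then show ?thesis by blast
  next
    case 2 then show ?thesis using V assms(1) by blast
  next
    case 3
    obtain b X where "pass Outer 1 b T X" by (rule start_A[OF A_class(2)[OF reg assms(1) 3]])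
    then show ?thesis by blast
  qed
qed

lemma boundary_past:
  assumes "pt x y \<in> f T" "y = hs \<or> y = - hs \<or> y = ir \<or> y = - ir" shows "\<exists>a b T' X. pass Outer a b T' X \<and> T' + dur Outer \<le> T"
proof -
  have V: "\<exists>a b T' X. pass Outer a b T' X \<and> T' + dur Outer \<le> z" if v: "pt x (- hs) \<in> f z" for x z
  proof -
    obtain a b X where p: "pass Outer a b (z - dur Outer) X" by (rule end_V[OF v])
    then show ?thesis by (intro exI conjI) (assumption, simp)
  qed
  consider "y = hs" | "y = - hs" | "y = ir \<or> y = - ir" using assms(2) by blast
  then show ?thesis
  proof cases
    case 1
    obtain a b X where p: "pass Inner a b (T - dur Inner) X" by (rule end_U[OF assms(1)[unfolded 1]])
    obtain u where u: "pt u (- hs) \<in> f (T - dur Inner)" using pass_start(1)[OF p] by blast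
    show ?thesis using V[OF u] dur_pos[of Inner] by (smt (verit, best))
  next
    case 2 then show ?thesis using V assms(1) by blast
  next
    case 3
    obtain a b X where "pass Outer a b (T - dur Outer) X" by (rule end_A[OF A_class(2)[OF reg assms(1) 3]])
    then show ?thesis by (intro exI conjI) (assumption, simp)
  qed
qed

lemma pass_end_boundary:
  assumes "pass c a b T X" obtains x y where "pt x y \<in> f (T + dur c)" "y = hs \<or> y = - hs \<or> y = ir \<or> y = - ir"
proof (cases c)
  case Inner
  then show ?thesis using pass_end(1)[OF assms] that by blast
next
  case Outer
  show ?thesis
  proof (cases "odd b")
    case True then show ?thesis using pass_end(2)[OF assms Outer] that by blast
  next
    case False
    then have "f (T + dur c) \<in> surface_side A" using pass_end(3)[OF assms Outer] by blast
    from side_A_class[OF reg this] show ?thesis using that by (metis insertI1)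
  qed
qed

lemma pass_start_boundary:
  assumes "pass c a b T X" obtains x y where "pt x y \<in> f T" "y = hs \<or> y = - hs \<or> y = ir \<or> y = - ir"
proof (cases c)
  case Inner
  then show ?thesis using pass_start(1)[OF assms] that by blast
next
  case Outer
  show ?thesis
  proof (cases "a = 0")
    case True then show ?thesis using pass_start(2)[OF assms Outer] that by blast
  next
    case False
    then have "f T \<in> surface_side A" using pass_start(3)[OF assms Outer] by blast
    from side_A_class[OF reg this] show ?thesis using that by (metis insertI1)
  qed
qed

lemma sandwiched_future: "\<exists>i>n. sandwiched w i"
proof -
  define u where "u = t n + 1"
  have "\<exists>a b T' X. pass Outer a b T' X \<and> u \<le> T'"
  proof (rule position_cases[of u])
    fix c a b T X assume p: "pass c a b T X" "T < u" "u < T + dur c"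
    obtain x y where "pt x y \<in> f (T + dur c)" "y = hs \<or> y = - hs \<or> y = ir \<or> y = - ir" by (rule pass_end_boundary[OF p(1)])
    from boundary_future[OF this] obtain a b T' X where "pass Outer a b T' X" "T + dur c \<le> T'" by blast
    then show ?thesis using p(3) by (intro exI conjI) (assumption, simp)
  next
    fix x y assume "pt x y \<in> f u" "y = hs \<or> y = - hs \<or> y = ir \<or> y = - ir"
    then show ?thesis by (rule boundary_future)
  qed
  then obtain a b T' X where p: "pass Outer a b T' X" "u \<le> T'" by blast
  obtain i where i: "T' \<le> t i" "sandwiched w i" using Outer_has_sandwiched[OF p(1)] by blast
  then have "t n < t i" using p(2) by (simp add: u_def)
  then show ?thesis using i t_less by blast
qed

lemma sandwiched_past: "\<exists>i<n. sandwiched w i"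
proof -
  define u where "u = t n - 1"
  have "\<exists>a b T' X. pass Outer a b T' X \<and> T' + dur Outer \<le> u"
  proof (rule position_cases[of u])
    fix c a b T X assume p: "pass c a b T X" "T < u" "u < T + dur c"
    obtain x y where "pt x y \<in> f T" "y = hs \<or> y = - hs \<or> y = ir \<or> y = - ir" by (rule pass_start_boundary[OF p(1)])
    from boundary_past[OF this] obtain a b T' X where "pass Outer a b T' X" "T' + dur Outer \<le> T" by blast
    then show ?thesis using p(2) by (intro exI conjI) (assumption, simp)
  next
    fix x y assume "pt x y \<in> f u" "y = hs \<or> y = - hs \<or> y = ir \<or> y = - ir"
    then show ?thesis by (rule boundary_past)
  qed
  then obtain a b T' X where p: "pass Outer a b T' X" "T' + dur Outer \<le> u" by blast
  obtain i where i: "t i \<le> T' + dur Outer" "sandwiched w i" using Outer_has_sandwiched[OF p(1)] by blast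
  then have "t i < t n" using p(2) by (simp add: u_def)
  then show ?thesis using i t_less by blast
qed

text \<open>The crossing time \<open>u\<close> of a sandwiched letter corresponds to the crossing time \<open>u'\<close> of the image path; crossings of \<open>A\<close> are boundary points of the outer cylinder, which the image path reaches at the same time.\<close>

definition corr :: "real \<Rightarrow> real \<Rightarrow> bool" where
  "corr u u' \<longleftrightarrow> (\<exists>c a b T X j. pass c a b T X \<and> kept a b j \<and> u = cross_time c T X j \<and> u' = image_time c T X j) \<or> (f u \<in> surface_side A \<and> u' = u)"

lemma kept_range: "kept a b j \<Longrightarrow> a < j \<and> j \<le> b" by (auto simp: kept_def)

lemma pass_no_A:
  assumes p: "pass c a b T X" and u: "T < u" "u < T + dur c" shows "f u \<notin> surface_side A"
proof
  assume "f u \<in> surface_side A"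
  from cross_time_iff[OF p u this] obtain j where "A = lab c j" by metis
  then show False by (cases c) (auto split: if_splits)
qed

lemma pass_order:
  assumes p: "pass c a b T X" "pass c' a' b' T' X'" and "T < u" "u < T + dur c" "T' < u'" "u' < T' + dur c'" "u < u'"
  shows "(c = c' \<and> a = a' \<and> b = b' \<and> T = T' \<and> X = X') \<or> T + dur c \<le> T'"
proof (rule ccontr)
  assume n: "\<not> ((c = c' \<and> a = a' \<and> b = b' \<and> T = T' \<and> X = X') \<or> T + dur c \<le> T')"
  define z where "z = (max T T' + min (T + dur c) (T' + dur c')) / 2"
  have "max T T' < min (T + dur c) (T' + dur c')" using n assms dur_pos[of c] dur_pos[of c'] by auto
  then have "max T T' < z" "z < min (T + dur c) (T' + dur c')" by (auto simp: z_def)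
  then have "T < z" "z < T + dur c" "T' < z" "z < T' + dur c'" by auto
  from pass_unique[OF p this] n show False by blast
qed

lemma corr_mono:
  assumes a: "aff \<Phi> gamma" and c: "corr u u'" "corr v v'" "u < v" shows "u' < v'"
proof -
  have pz: "T < cross_time c T X j \<and> cross_time c T X j < T + dur c \<and> T < image_time c T X j \<and> image_time c T X j < T + dur c"
    if "pass c a b T X" "kept a b j" for c a b T X j
    using cross_time_range[OF that(1)] kept_range[OF that(2)] image_time_range[OF that a] by blast
  from c(1) consider c1 a1 b1 T1 X1 j1 where "pass c1 a1 b1 T1 X1" "kept a1 b1 j1" "u = cross_time c1 T1 X1 j1" "u' = image_time c1 T1 X1 j1" | "f u \<in> surface_side A" "u' = u"
    unfolding corr_def by blast
  then show ?thesis
  proof cases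
    case p1: 1
    note z1 = pz[OF p1(1,2), folded p1(3,4)]
    from c(2) consider c2 a2 b2 T2 X2 j2 where "pass c2 a2 b2 T2 X2" "kept a2 b2 j2" "v = cross_time c2 T2 X2 j2" "v' = image_time c2 T2 X2 j2" | "f v \<in> surface_side A" "v' = v"
      unfolding corr_def by blast
    then show ?thesis
    proof cases
      case p2: 1
      note z2 = pz[OF p2(1,2), folded p2(3,4)]
      have "(c1 = c2 \<and> a1 = a2 \<and> b1 = b2 \<and> T1 = T2 \<and> X1 = X2) \<or> T1 + dur c1 \<le> T2"
        by (rule pass_order[OF p1(1) p2(1)]) (use z1 z2 c(3) in auto)
      then show ?thesis
      proof
        assume e: "c1 = c2 \<and> a1 = a2 \<and> b1 = b2 \<and> T1 = T2 \<and> X1 = X2"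
        have k: "kept a1 b1 j2" using p2(2) e by simp
        have "j1 < j2" using c(3) cross_time_less_iff[OF p1(1)] kept_range[OF p1(2)] kept_range[OF k] p1(3) p2(3) e by simp
        from image_time_mono[OF p1(1,2) k this] show ?thesis using p1(4) p2(4) e by simp
      next
        assume "T1 + dur c1 \<le> T2" then show ?thesis using z1 z2 by linarith
      qed
    next
      case 2
      have "\<not> (T1 < v \<and> v < T1 + dur c1)" using pass_no_A[OF p1(1)] 2 by blast
      then show ?thesis using z1 c(3) 2 by linarith
    qed
  next
    case A1: 2
    from c(2) consider c2 a2 b2 T2 X2 j2 where "pass c2 a2 b2 T2 X2" "kept a2 b2 j2" "v = cross_time c2 T2 X2 j2" "v' = image_time c2 T2 X2 j2" | "f v \<in> surface_side A" "v' = v"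
      unfolding corr_def by blast
    then show ?thesis
    proof cases
      case p2: 1
      note z2 = pz[OF p2(1,2), folded p2(3,4)]
      have "\<not> (T2 < u \<and> u < T2 + dur c2)" using pass_no_A[OF p2(1)] A1 by blast
      then show ?thesis using z2 c(3) A1 by linarith
    next
      case 2 then show ?thesis using A1 c(3) by simp
    qed
  qed
qed

lemma corr_unique:
  assumes a: "aff \<Phi> gamma" and c: "corr u u'" "corr u u''" shows "u' = u''"
proof -
  have pz: "T < cross_time c T X j \<and> cross_time c T X j < T + dur c" if "pass c a b T X" "kept a b j" for c a b T X j
    using cross_time_range[OF that(1)] kept_range[OF that(2)] by blast
  from c(1) consider c1 a1 b1 T1 X1 j1 where "pass c1 a1 b1 T1 X1" "kept a1 b1 j1" "u = cross_time c1 T1 X1 j1" "u' = image_time c1 T1 X1 j1" | "f u \<in> surface_side A" "u' = u"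
    unfolding corr_def by blast
  then show ?thesis
  proof cases
    case p1: 1
    note z1 = pz[OF p1(1,2), folded p1(3)]
    from c(2) consider c2 a2 b2 T2 X2 j2 where "pass c2 a2 b2 T2 X2" "kept a2 b2 j2" "u = cross_time c2 T2 X2 j2" "u'' = image_time c2 T2 X2 j2" | "f u \<in> surface_side A" "u'' = u"
      unfolding corr_def by blast
    then show ?thesis
    proof cases
      case p2: 1
      note z2 = pz[OF p2(1,2), folded p2(3)]
      have e: "c1 = c2 \<and> a1 = a2 \<and> b1 = b2 \<and> T1 = T2 \<and> X1 = X2"
        by (rule pass_unique[OF p1(1) p2(1), of u]) (use z1 z2 in auto)
      have k: "kept a1 b1 j2" using p2(2) e by simp
      have "\<not> j1 < j2" "\<not> j2 < j1"
        using cross_time_less_iff[OF p1(1)] kept_range[OF p1(2)] kept_range[OF k] p1(3) p2(3) e by (metis less_irrefl)+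
      then have "j1 = j2" by simp
      then show ?thesis using p1(4) p2(4) e by simp
    next
      case 2 then show ?thesis using pass_no_A[OF p1(1)] z1 by blast
    qed
  next
    case A1: 2
    from c(2) show ?thesis unfolding corr_def using A1 pz pass_no_A by blast
  qed
qed

lemma corr_exists:
  assumes a: "aff \<Phi> gamma" and i: "sandwiched w i" shows "\<exists>u'. corr (t i) u'"
proof (rule position_cases[of "t i"])
  fix c a b T X assume p: "pass c a b T X" "T < t i" "t i < T + dur c"
  obtain j where j: "a < j" "j \<le> b" "t i = cross_time c T X j" using cross_time_iff[OF p w] by metis
  then have "kept a b j" using sandwiched_kept[OF p(1) j] i by simp
  then show ?thesis unfolding corr_def using p(1) j(3) by blast
next
  fix x y assume b: "pt x y \<in> f (t i)" "y = hs \<or> y = - hs \<or> y = ir \<or> y = - ir"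
  then have "y = ir \<or> y = - ir" using nonside w by blast
  then have "f (t i) \<in> surface_side A" using A_class(2)[OF reg b(1)] by blast
  then show ?thesis unfolding corr_def by blast
qed

lemma corr_side:
  assumes a: "aff \<Phi> gamma" and c: "corr (t i) u'" shows "\<Phi> (f u') \<in> surface_side (w i)"
proof -
  from c consider c a b T X j where "pass c a b T X" "kept a b j" "t i = cross_time c T X j" "u' = image_time c T X j" | "f (t i) \<in> surface_side A" "u' = t i"
    unfolding corr_def by blast
  then show ?thesis
  proof cases
    case 1
    have "w i = lab c j" using cross_time_range[OF 1(1)] kept_range[OF 1(2)] 1(3) letter by metis
    then show ?thesis using image_time_range[OF 1(1,2) a] 1(4) by simp
  next
    case 2
    obtain a' b' X' where p': "pass Outer a' b' (t i - dur Outer) X'" "even b'" by (rule end_A[OF 2(1)])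
    have "\<Phi> (f (t i - dur Outer + dur Outer)) \<in> surface_side A" using image_end_side(1)[OF p'(1) a] p'(2) by blast
    then show ?thesis using letter[OF 2(1)] 2(2) by simp
  qed
qed

lemma corr_surj:
  assumes a: "aff \<Phi> gamma" and u': "\<Phi> (f u') \<in> surface_side L" shows "\<exists>i. sandwiched w i \<and> corr (t i) u'"
proof (rule position_cases[of u'])
  fix c a b T X assume p: "pass c a b T X" "T < u'" "u' < T + dur c"
  obtain j where j: "kept a b j" "u' = image_time c T X j" using image_time_iff[OF p u' assms(1)] by metis
  have j': "a < j" "j \<le> b" using kept_range[OF j(1)] by auto
  obtain i where i: "cross_time c T X j = t i" using index cross_time_range[OF p(1) j'] by blast
  have "sandwiched w i" using sandwiched_kept[OF p(1) j' i[symmetric]] j(1) by simp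
  moreover have "corr (t i) u'" unfolding corr_def using p(1) j i by metis
  ultimately show ?thesis by blast
next
  fix x y assume b: "pt x y \<in> f u'" "y = hs \<or> y = - hs \<or> y = ir \<or> y = - ir"
  have "y \<noteq> hs"
  proof
    assume y: "y = hs"
    obtain a' b' X' where p': "pass Inner a' b' (u' - dur Inner) X'" by (rule end_U[OF b(1)[unfolded y]])
    from image_end_side(2)[OF p' a, of L] show False using u' by simp
  qed
  moreover have "y \<noteq> - hs"
  proof
    assume y: "y = - hs"
    obtain a' b' X' where p': "pass Outer a' b' (u' - dur Outer) X'" "odd b'" by (rule end_V[OF b(1)[unfolded y]])
    from image_end_side(2)[OF p'(1) a, of L] show False using u' p'(2) by simp
  qed
  ultimately have "f u' \<in> surface_side A" using A_class(2)[OF reg b(1)] b(2) by blast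
  moreover obtain i where "u' = t i" using index[OF calculation] by blast
  ultimately show ?thesis unfolding corr_def using sandwiched_A by blast
qed

text \<open>The relation \<open>corr\<close> is an increasing bijection between the sandwiched crossings and the crossings of the image path, and preserves labels.\<close>

lemma derived_cutting:
  assumes a: "aff \<Phi> gamma" shows "cutting_sequence id (\<Phi> \<circ> f) (derived w)"
proof -
  define e where "e = (SOME e :: int \<Rightarrow> int. strict_mono e \<and> range e = {i. sandwiched w i})"
  have "\<exists>e :: int \<Rightarrow> int. strict_mono e \<and> range e = {i. sandwiched w i}"
    by (rule int_enumeration) (use sandwiched_future sandwiched_past in auto)
  then have e: "strict_mono e" "range e = {i. sandwiched w i}" unfolding e_def by (metis (mono_tags, lifting) someI_ex)+
  have s: "sandwiched w (e k)" for k using e(2) by auto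
  define \<phi> where "\<phi> i = (SOME u'. corr (t i) u')" for i
  have \<phi>: "corr (t i) (\<phi> i)" if "sandwiched w i" for i
    unfolding \<phi>_def by (rule someI_ex[OF corr_exists[OF a that]])
  show ?thesis unfolding cutting_id
  proof (intro exI[of _ "\<lambda>k. \<phi> (e k)"] conjI allI)
    show "strict_mono (\<lambda>k. \<phi> (e k))"
    proof (rule strict_monoI)
      fix k l :: int assume "k < l"
      then have "t (e k) < t (e l)" using e(1) t_less by (simp add: strict_mono_less)
      then show "\<phi> (e k) < \<phi> (e l)" by (rule corr_mono[OF a \<phi>[OF s] \<phi>[OF s]])
    qed
    show "(\<Phi> \<circ> f) (\<phi> (e k)) \<in> surface_side (derived w k)" for k
      using corr_side[OF a \<phi>[OF s]] by (simp add: derived_def e_def)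
    show "range (\<lambda>k. \<phi> (e k)) = {u. \<exists>L. (\<Phi> \<circ> f) u \<in> surface_side L}"
    proof
      show "range (\<lambda>k. \<phi> (e k)) \<subseteq> {u. \<exists>L. (\<Phi> \<circ> f) u \<in> surface_side L}" using corr_side[OF a \<phi>[OF s]] by auto
      show "{u. \<exists>L. (\<Phi> \<circ> f) u \<in> surface_side L} \<subseteq> range (\<lambda>k. \<phi> (e k))"
      proof
        fix u assume "u \<in> {u. \<exists>L. (\<Phi> \<circ> f) u \<in> surface_side L}"
        then obtain L where "\<Phi> (f u) \<in> surface_side L" by auto
        from corr_surj[OF a this] obtain i where i: "sandwiched w i" "corr (t i) u" by blast
        obtain k where k: "i = e k" using i(1) e(2) by blast
        have "\<phi> i = u" by (rule corr_unique[OF a \<phi>[OF i(1)] i(2)])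
        then show "u \<in> range (\<lambda>k. \<phi> (e k))" using k by auto
      qed
    qed
  qed
qed

end

lemma sector0_derived:
  assumes "traj (pt vx vy) f" "vy > 0" "sr * vy < vx" "cutting_sequence id f w" "aff \<Phi> gamma"
  shows "cutting_sequence id (\<Phi> \<circ> f) (derived w)"
proof -
  obtain t :: "int \<Rightarrow> real" where t: "strict_mono t" "range t = {u. \<exists>L. f u \<in> surface_side L}" "\<forall>i. f (t i) \<in> surface_side (w i)"
    using assms(4) unfolding cutting_id by blast
  interpret sector0_cutting f vx vy w t by unfold_locales (use assms t in auto)
  show ?thesis by (rule derived_cutting[OF assms(5)])
qed

section \<open>Words that lie in two diagrams\<close>

lemma edge_pt_bounds: assumes "i < 8" "edge_pt i p" shows "\<bar>p $ 1\<bar> \<le> ir" "\<bar>p $ 2\<bar> \<le> ir"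
proof -
  obtain x y where p: "p = pt x y" by (rule pt_cases)
  have "pt x y \<in> octagon" using edge_pt_octagon[OF assms(2)] p by simp
  then show "\<bar>p $ 1\<bar> \<le> ir" "\<bar>p $ 2\<bar> \<le> ir" unfolding octagon_iff all8 mid_le_iff p by auto
qed

lemma linear_unbounded:
  fixes c M :: real assumes "c \<noteq> 0" shows "\<exists>n::nat. \<bar>x - real n * c\<bar> > M"
proof -
  obtain n :: nat where "real n * \<bar>c\<bar> > M + \<bar>x\<bar>" using reals_Archimedean3[of "\<bar>c\<bar>"] assms by auto
  then have "\<bar>real n * c\<bar> > M + \<bar>x\<bar>" by (simp add: abs_mult)
  then have "\<bar>x - real n * c\<bar> > M" by arith
  then show ?thesis by blast
qed

locale heights =
  fixes vx vy :: real and f w and t :: "int \<Rightarrow> real" and P a b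
  assumes f: "traj (pt vx vy) f" and vy: "vy > 0" and vx: "sr * vy < vx"
    and w: "cutting_sequence id f w"
    and t: "strict_mono t" "\<And>i. f (t i) \<in> surface_side (w i)"
    and P: "\<And>i. P i \<in> f (t i) \<and> a i < 8 \<and> edge_pt (a i) (P i) \<and> mid (a i) \<bullet> pt vx vy < 0 \<and> oct_label (a i) = w i"
    and b: "\<And>i. b i < (8::nat) \<and> edge_pt (b i) (P i + (t (i + 1) - t i) *\<^sub>R pt vx vy) \<and> mid (b i) \<bullet> pt vx vy > 0 \<and> oct_label (b i) = w (i + 1)"
    and P_step: "\<And>i. P (i + 1) = P i + (t (i + 1) - t i) *\<^sub>R pt vx vy - 2 *\<^sub>R mid (b i)"
begin

lemma vx_pos: "vx > 0" "vx > vy" "vx > 2 * vy"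
proof -
  have "2 * vy < sr * vy" by (rule mult_strict_right_mono) (use sr_bounds vy in auto)
  then show "vx > 0" "vx > vy" "vx > 2 * vy" using vx vy by linarith+
qed

lemma cone: "cone0 (pt vx vy)" using vx vy vx_pos by (simp add: cone0_def)

lemma step: "(w i, w (i + 1)) \<in> diag0" by (rule cutting_diag0[OF f cone w])

text \<open>The loss of height at a crossing of a side with the given label.\<close>

definition G :: "letter \<Rightarrow> real" where
  "G L = (case L of A \<Rightarrow> 2 * ir * vx | B \<Rightarrow> ll * (vx - vy) | C \<Rightarrow> - 2 * ir * vy | D \<Rightarrow> - ll * (vx + vy))"

definition ht :: "real^2 \<Rightarrow> real" where "ht p = vx * p $ 2 - vy * p $ 1"

definition y :: "int \<Rightarrow> real" where "y i = ht (P i)"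

lemma exit_side: "b i = (case w (i + 1) of A \<Rightarrow> 0 | B \<Rightarrow> 1 | C \<Rightarrow> 2 | D \<Rightarrow> 3)"
proof -
  have l: "oct_label (b i) = w (i + 1)" and b8: "b i < 8" and m: "mid (b i) \<bullet> pt vx vy > 0" using b[of i] by auto
  show ?thesis
  proof -
    consider "b i = 0" | "b i = 1" | "b i = 2" | "b i = 3" using entering_sides(2)[OF cone b8 m] by argo
    then show ?thesis by cases (simp_all add: l[symmetric] oct_label_values del: One_nat_def)
  qed
qed

lemma entry_side: "a i = (case w i of A \<Rightarrow> 4 | B \<Rightarrow> 5 | C \<Rightarrow> 6 | D \<Rightarrow> 7)"
proof -
  have l: "oct_label (a i) = w i" and b8: "a i < 8" and m: "mid (a i) \<bullet> pt vx vy < 0" using P[of i] by auto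
  show ?thesis
  proof -
    consider "a i = 4" | "a i = 5" | "a i = 6" | "a i = 7" using entering_sides(1)[OF cone b8 m] by argo
    then show ?thesis by cases (simp_all add: l[symmetric] oct_label_values del: One_nat_def)
  qed
qed

lemma ht_line: "ht (p + s *\<^sub>R pt vx vy) = ht p" by (simp add: ht_def algebra_simps)

lemma y_exit: "y i = ht (P i + (t (i + 1) - t i) *\<^sub>R pt vx vy)" by (simp only: y_def ht_line)

text \<open>The height is constant along a chord, and the gluing at the end of the chord translates it by a fixed vector.\<close>

lemma y_step: "y (i + 1) = y i - G (w (i + 1))"
proof -
  have "y (i + 1) = ht (P i + (t (i + 1) - t i) *\<^sub>R pt vx vy) - ht (2 *\<^sub>R mid (b i))"
    unfolding y_def P_step by (simp add: ht_def algebra_simps)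
  moreover have "ht (2 *\<^sub>R mid (b i)) = G (w (i + 1))"
    unfolding exit_side G_def by (cases "w (i + 1)") (simp_all add: mid_values ht_def field_simps del: One_nat_def)
  ultimately show ?thesis by (simp add: y_exit)
qed

lemma y_bound: "\<bar>y i\<bar> \<le> ir * (vx + vy)"
proof -
  have e: "a i < 8" "edge_pt (a i) (P i)" using P[of i] by auto
  have "\<bar>vx * P i $ 2\<bar> \<le> vx * ir" "\<bar>vy * P i $ 1\<bar> \<le> vy * ir"
    using mult_left_mono[OF edge_pt_bounds(2)[OF e], of vx] mult_left_mono[OF edge_pt_bounds(1)[OF e], of vy] vx_pos vy
    by (simp_all add: abs_mult)
  then show ?thesis unfolding y_def ht_def by (simp add: algebra_simps)
qed

text \<open>The width, transverse to the direction, of the strip of all chords from \<open>D\<close> to \<open>B\<close>; also the loss of height in going once from \<open>D\<close> to \<open>A\<close> and back.\<close>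

definition W :: real where "W = (ir - hs) * (vx - sr * vy)"

lemma W_pos: "W > 0" unfolding W_def using vx ir_bounds hs_pos by simp

lemma sr_simps: "hs * (sr * x) = ir * x" "ir * (sr * x) = 2 * (ir * x) + hs * x"
  "sr * (hs * x) = ir * x" "sr * (ir * x) = 2 * (ir * x) + hs * x"
proof -
  have "hs * (sr * x) = (sr * hs) * x" "ir * (sr * x) = (sr * ir) * x" by simp_all
  then show *: "hs * (sr * x) = ir * x" "ir * (sr * x) = 2 * (ir * x) + hs * x" unfolding sr_hs sr_ir by (simp_all add: algebra_simps)
  show "sr * (hs * x) = ir * x" "sr * (ir * x) = 2 * (ir * x) + hs * x" using * by (simp_all only: mult.left_commute)
qed

lemma G_sums: "G A + G D = W" "G B + G C = sr * W" "G B + G D = - 2 * ll * vy" "G C + G C = - 4 * ir * vy"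
proof -
  have s: "sr * (sr * x) = 2 * (sr * x) + x" for x using sr_sq by (simp add: algebra_simps flip: mult.assoc)
  show "G A + G D = W" "G B + G C = sr * W" "G B + G D = - 2 * ll * vy" "G C + G C = - 4 * ir * vy"
    by (simp_all add: G_def W_def algebra_simps sr_simps s)
qed

text \<open>A word of period two repeats two letters, whose total loss of height is not zero, so the heights would be unbounded.\<close>

lemma no_period_2: "\<exists>i. w (i + 2) \<noteq> w i"
proof (rule ccontr)
  assume "\<not> ?thesis"
  then have p: "w (i + 2) = w i" for i by blast
  define c where "c = G (w 0) + G (w 1)"
  have pe: "w (2 * int n) = w 0" "w (2 * int n + 1) = w 1" for n
  proof (induction n)
    case (Suc n)
    have e: "2 * int (Suc n) = 2 * int n + 2" "2 * int n + 2 + 1 = 2 * int n + 1 + 2" by simp_all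
    show "w (2 * int (Suc n)) = w 0" "w (2 * int (Suc n) + 1) = w 1" by (simp_all only: e p Suc)
  qed simp_all
  have "y (2 * int n) = y 0 - real n * c" for n
  proof (induction n)
    case (Suc n)
    have e: "2 * int (Suc n) = 2 * int n + 1 + 1" by simp
    have "w (2 * int n + 1 + 1) = w 0" using pe(1)[of "Suc n"] unfolding e .
    then have "y (2 * int n + 1 + 1) = y (2 * int n) - G (w 1) - G (w 0)"
      by (simp only: y_step[of "2 * int n + 1"] y_step[of "2 * int n"] pe)
    then show ?case unfolding e Suc by (simp add: c_def algebra_simps)
  qed simp
  moreover have "c \<noteq> 0"
  proof -
    have pos: "W > 0" "sr * W > 0" "ll * vy > 0" "ir * vy > 0" using W_pos sr_bounds hs_pos ir_pos vy by simp_all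
    have c: "c = W \<or> c = sr * W \<or> c = - 2 * ll * vy \<or> c = - 4 * ir * vy"
      using step[of 0] G_sums unfolding c_def diag0_def by (auto simp: add.commute)
    have ne: "- 2 * ll * vy \<noteq> 0" "- 4 * ir * vy \<noteq> 0" "W \<noteq> 0" "sr * W \<noteq> 0" using pos hs_pos ir_pos by auto
    show ?thesis
    proof
      assume "c = 0"
      with c have "0 = W \<or> 0 = sr * W \<or> 0 = - 2 * ll * vy \<or> 0 = - 4 * ir * vy" by simp
      then show False using ne by argo
    qed
  qed
  ultimately show False using linear_unbounded[of c "ir * (vx + vy)" "y 0"] y_bound by (metis not_le)
qed

text \<open>The path cannot oscillate between \<open>X\<close> and \<open>Y\<close> forever, because each oscillation costs the height \<open>G X + G Y\<close>.\<close>

lemma bounce: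
  assumes s: "\<And>i. w i = Y \<Longrightarrow> w (i + 1) = X" "\<And>i. w i = X \<Longrightarrow> w (i + 1) = Y \<or> w (i + 1) = Z"
    and G: "G X + G Y > 0" and j: "w j = X"
  obtains n :: nat where "w (j + 2 * int n) = X" "w (j + 2 * int n + 1) = Z" "y (j + 2 * int n) = y j - real n * (G X + G Y)"
proof -
  have "\<exists>n :: nat. w (j + 2 * int n) = X \<and> w (j + 2 * int n + 1) = Z \<and> y (j + 2 * int n) = y j - real n * (G X + G Y)"
  proof (rule ccontr)
    assume N: "\<not> ?thesis"
    have "w (j + 2 * int n) = X \<and> y (j + 2 * int n) = y j - real n * (G X + G Y)" for n
    proof (induction n)
      case (Suc n)
      then have "w (j + 2 * int n + 1) \<noteq> Z" using N by blast
      then have Y: "w (j + 2 * int n + 1) = Y" using s(2) Suc by blast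
      then have X: "w (j + 2 * int n + 1 + 1) = X" by (rule s(1))
      have e: "j + 2 * int (Suc n) = j + 2 * int n + 1 + 1" by simp
      have "y (j + 2 * int n + 1 + 1) = y (j + 2 * int n) - G Y - G X" unfolding y_step X Y by simp
      then show ?case unfolding e using X Suc by (simp add: algebra_simps)
    qed (simp add: j)
    then show False using linear_unbounded[of "G X + G Y" "ir * (vx + vy)" "y j"] G y_bound by (metis less_irrefl not_le)
  qed
  then show ?thesis using that by blast
qed

text \<open>The heights of chords from \<open>D\<close> to \<open>B\<close> lie in \<open>(\<alpha>, \<alpha> + W)\<close>, those of chords from \<open>B\<close> to \<open>D\<close> in the opposite interval.\<close>

definition \<alpha> :: real where "\<alpha> = hs * vx + ir * vy"

lemma height_DB: assumes "w i = D" "w (i + 1) = B" shows "\<alpha> < y i" "y i < \<alpha> + W"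
proof -
  have ab: "a i = 7" "b i = 1" using entry_side[of i] exit_side[of i] assms by simp_all
  obtain x z where p: "P i = pt x z" by (rule pt_cases)
  obtain x' z' where q: "P i + (t (i + 1) - t i) *\<^sub>R pt vx vy = pt x' z'" by (rule pt_cases)
  have 1: "z = x + ll" "- ir < x" using P[of i] edge_coords(8)[of x z] unfolding ab p by auto
  have 2: "z' = ll - x'" "hs < x'" using b[of i] edge_coords(2)[of x' z'] unfolding ab q by auto
  have "(vx - vy) * x > (vx - vy) * (- ir)" by (rule mult_strict_left_mono) (use 1 vx_pos in auto)
  then show "\<alpha> < y i" unfolding y_def p ht_def 1 \<alpha>_def by (simp add: algebra_simps)
  have "(vx + vy) * x' > (vx + vy) * hs" by (rule mult_strict_left_mono) (use 2 vx_pos vy in auto)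
  then show "y i < \<alpha> + W" unfolding y_exit q ht_def 2 \<alpha>_def W_def by (simp add: algebra_simps sr_simps)
qed

lemma height_BD: assumes "w i = B" "w (i + 1) = D" shows "- \<alpha> - W < y i" "y i < - \<alpha>"
proof -
  have ab: "a i = 5" "b i = 3" using entry_side[of i] exit_side[of i] assms by simp_all
  obtain x z where p: "P i = pt x z" by (rule pt_cases)
  obtain x' z' where q: "P i + (t (i + 1) - t i) *\<^sub>R pt vx vy = pt x' z'" by (rule pt_cases)
  have 1: "z = - ll - x" "x < - hs" using P[of i] edge_coords(6)[of x z] unfolding ab p by auto
  have 2: "z' = x' - ll" "x' < ir" using b[of i] edge_coords(4)[of x' z'] unfolding ab q by auto
  have "(vx - vy) * x' < (vx - vy) * ir" by (rule mult_strict_left_mono) (use 2 vx_pos in auto)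
  then show "y i < - \<alpha>" unfolding y_exit q ht_def 2 \<alpha>_def by (simp add: algebra_simps)
  have "(vx + vy) * x < (vx + vy) * (- hs)" by (rule mult_strict_left_mono) (use 1 vx_pos vy in auto)
  then show "- \<alpha> - W < y i" unfolding y_def p ht_def 1 \<alpha>_def W_def by (simp add: algebra_simps sr_simps)
qed

definition position :: "int \<Rightarrow> real" where "position i = (y i - \<alpha>) / W"

definition \<delta> :: real where "\<delta> = 2 * ir * vy / W"

definition start :: "int \<Rightarrow> bool" where "start i \<longleftrightarrow> w i = D \<and> w (i + 1) = B"

lemma position_range: "start i \<Longrightarrow> 0 < position i" "start i \<Longrightarrow> position i < 1"
  using height_DB[of i] W_pos unfolding start_def position_def by (simp_all add: field_simps)

text \<open>Two chords from \<open>D\<close> to \<open>B\<close> at the same height are equal.\<close>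

lemma equal_position:
  assumes "start i" "start j" "i < j" "position i = position j" shows "\<exists>p>0. \<forall>s. f (s + p) = f s"
proof -
  have y: "y i = y j" using assms(4) W_pos by (simp add: position_def)
  have a: "a i = 7" "a j = 7" using entry_side assms(1,2) by (simp_all add: start_def)
  obtain x z where p: "P i = pt x z" by (rule pt_cases)
  obtain x' z' where q: "P j = pt x' z'" by (rule pt_cases)
  have 1: "z = x + ll" using P[of i] edge_coords(8)[of x z] unfolding a p by auto
  have 2: "z' = x' + ll" using P[of j] edge_coords(8)[of x' z'] unfolding a q by auto
  have "(vx - vy) * x = (vx - vy) * x'" using y unfolding y_def p q ht_def 1 2 by (simp add: algebra_simps)
  then have "P i = P j" using vx_pos by (simp add: p q 1 2)
  then have PP: "P i \<in> f (t i)" "P i \<in> f (t j)" using P[of i] P[of j] by auto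
  have reg: "f (t i) \<in> octagon_surface" "f (t j) \<in> octagon_surface" using straight_regular[OF f, of "t i"] straight_regular[OF f, of "t j"] by auto
  have e: "f (t i) = f (t j)" by (rule surface_eqI[OF reg PP])
  have tr: "traj (pt vx vy) (\<lambda>s. f (s + (t j - t i)))" by (rule traj_shift[OF f])
  have "f (s + (t j - t i)) = f s" for s by (rule traj_unique[OF tr f, of "t i"]) (simp add: e)
  moreover have "t j - t i > 0" using t(1) assms(3) by (simp add: strict_mono_less)
  ultimately show ?thesis by blast
qed

lemma fractional_dense:
  fixes \<rho> :: real assumes "\<rho> \<notin> \<rat>" "\<epsilon> > 0" obtains k :: nat and h :: int where "\<bar>real k * \<rho> - h - c\<bar> < \<epsilon>"
proof -
  obtain h k :: int where "k > 0" "\<bar>of_int k * \<rho> - of_int h - c\<bar> < \<epsilon>"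
    by (rule sequence_of_fractional_parts_is_dense[OF assms])
  then show ?thesis using that[of "nat k" h] by simp
qed

text \<open>Without \<open>C C\<close> the letters form a walk on the path \<open>A - D - B - C\<close> which is reflected at its ends.  Between a chord from \<open>D\<close> to \<open>B\<close> and the next one there are \<open>q\<close> visits to \<open>C\<close> and \<open>m\<close> visits to \<open>A\<close>.  Each visit to \<open>C\<close> costs \<open>sr * W > 2 * W\<close>, which is so much that \<open>q\<close> is always the same number \<open>Q\<close>.  In units of \<open>W\<close>, the position of the next chord is then \<open>sqrt 2 * \<beta>\<close> further, modulo integers, while adding \<open>\<beta>\<close> to a position never leaves the unit interval.  An irrational rotation would violate this by density; a rational one returns to its starting point.\<close>

lemma no_CC_periodic:
  assumes no: "\<And>i. \<not> (w i = C \<and> w (i + 1) = C)"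
  shows "\<exists>p>0. \<forall>s. f (s + p) = f s"
proof -
  have n: "w i = C \<Longrightarrow> w (i + 1) = B" "w i = B \<Longrightarrow> w (i + 1) = C \<or> w (i + 1) = D"
    "w i = A \<Longrightarrow> w (i + 1) = D" "w i = D \<Longrightarrow> w (i + 1) = A \<or> w (i + 1) = B" for i
    using step[of i] no[of i] by (auto simp: diag0_def)
  have GBC: "G B + G C > 0" "G D + G A > 0" using G_sums W_pos sr_bounds by (simp_all add: add.commute)
  have next_start: "\<exists>j>i. start j \<and> (\<exists>q m :: nat. position j = position i + (sqrt 2 * \<delta> - real q * sr * (sqrt 2 - 0) + real q * (sqrt 2 * sr - sr)) - real m
      \<and> 0 < position i + \<delta> - real q * sr \<and> position i + \<delta> - real q * sr < 1)" if i: "start i" for i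
  proof -
    have B: "w (i + 1) = B" using i by (simp add: start_def)
    obtain q where q: "w (i + 1 + 2 * int q) = B" "w (i + 1 + 2 * int q + 1) = D" "y (i + 1 + 2 * int q) = y (i + 1) - real q * (G B + G C)"
      by (rule bounce[OF n(1,2) GBC(1) B])
    define k where "k = i + 1 + 2 * int q"
    have k: "w k = B" "w (k + 1) = D" "y k = y i - G B - real q * (sr * W)" using q B y_step[of i] by (simp_all add: k_def G_sums)
    obtain m where m: "w (k + 1 + 2 * int m) = D" "w (k + 1 + 2 * int m + 1) = B" "y (k + 1 + 2 * int m) = y (k + 1) - real m * (G D + G A)"
      by (rule bounce[OF n(3,4) GBC(2) k(2)])
    define j where "j = k + 1 + 2 * int m"
    have GAD: "G D + G A = W" using G_sums(1) by simp
    have GD: "G D = - (2 * ll * vy) - G B" using G_sums(3) by (simp add: algebra_simps)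
    have "y j = y k - G D - real m * W" unfolding j_def m(3) y_step[of k] k(2) GAD by simp
    then have yj: "y j = y i + 2 * ll * vy - real q * (sr * W) - real m * W" unfolding k(3) GD by simp
    have "position j = position i + 2 * ll * vy / W - real q * sr - real m"
      unfolding position_def yj using W_pos by (simp add: field_simps)
    moreover have "2 * ll * vy / W = sqrt 2 * \<delta>" unfolding \<delta>_def sqrt2_ir[unfolded add.commute[of ir], symmetric] by simp
    ultimately have pj: "position j = position i + sqrt 2 * \<delta> - real q * sr - real m" by simp
    have al: "2 * \<alpha> - G B + W = 2 * ir * vy" by (simp add: \<alpha>_def G_def W_def algebra_simps sr_simps)
    have r: "- \<alpha> - W < y k" "y k < - \<alpha>" by (rule height_BD[OF k(1,2)])+
    have pk: "position i + \<delta> - real q * sr = (y k + \<alpha> + W) / W"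
      unfolding position_def \<delta>_def k(3) al[symmetric] using W_pos by (simp add: field_simps)
    have "0 < position i + \<delta> - real q * sr" "position i + \<delta> - real q * sr < 1" unfolding pk using r W_pos by simp_all
    moreover have "start j" using m by (simp add: start_def j_def)
    moreover have "i < j" by (simp add: j_def k_def)
    ultimately show ?thesis using pj by (intro exI[of _ j] conjI exI[of _ q] exI[of _ m]) (simp_all add: algebra_simps)
  qed
  have ex: "\<exists>i. start i"
  proof -
    have D: "\<exists>i. start i" if Di: "w i = D" for i
    proof -
      obtain m where "w (i + 2 * int m) = D" "w (i + 2 * int m + 1) = B" "y (i + 2 * int m) = y i - real m * (G D + G A)" by (rule bounce[OF n(3,4) GBC(2) Di])
      then show ?thesis unfolding start_def by blast
    qed
    have B: "\<exists>i. start i" if Bi: "w i = B" for i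
    proof -
      obtain m where "w (i + 2 * int m) = B" "w (i + 2 * int m + 1) = D" "y (i + 2 * int m) = y i - real m * (G B + G C)" by (rule bounce[OF n(1,2) GBC(1) Bi])
      then show ?thesis by (intro D)
    qed
    show ?thesis by (cases "w 0") (use n(1,3)[of 0] B D in blast)+
  qed
  obtain i0 where i0: "start i0" using ex by blast
  obtain Q :: nat where Q: "0 < position i0 + \<delta> - real Q * sr" "position i0 + \<delta> - real Q * sr < 1" using next_start[OF i0] by blast
  define \<beta> where "\<beta> = \<delta> - real Q * sr"
  have sr_sqrt: "sqrt 2 * sr - sr = 1" using sr_sq by (simp add: sr_def algebra_simps)
  have nxt: "\<exists>j>i. start j \<and> (\<exists>h::int. position j = position i + sqrt 2 * \<beta> + h) \<and> 0 < position i + \<beta> \<and> position i + \<beta> < 1" if i: "start i" for i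
  proof -
    obtain j q m where j: "j > i" "start j" "position j = position i + (sqrt 2 * \<delta> - real q * sr * (sqrt 2 - 0) + real q * (sqrt 2 * sr - sr)) - real m"
      and q: "0 < position i + \<delta> - real q * sr" "position i + \<delta> - real q * sr < 1" using next_start[OF i] by blast
    have "q = Q"
    proof (rule ccontr)
      assume "q \<noteq> Q"
      then have "1 \<le> \<bar>real q - real Q\<bar>" by linarith
      then have "sr * 1 \<le> sr * \<bar>real q - real Q\<bar>" by (rule mult_left_mono) (use sr_bounds in auto)
      then have "sr \<le> \<bar>sr * (real q - real Q)\<bar>" using sr_bounds by (simp only: abs_mult)
      then have "2 < \<bar>real q * sr - real Q * sr\<bar>" using sr_bounds by (simp add: algebra_simps)
      then show False using q Q position_range[OF i] position_range[OF i0] by linarith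
    qed
    then have "position j = position i + sqrt 2 * \<beta> + of_int (int Q - int m)" using j(3) unfolding sr_sqrt by (simp add: \<beta>_def algebra_simps)
    then show ?thesis using j(1,2) q \<open>q = Q\<close>
      by (intro exI[of _ j] conjI exI[of _ "int Q - int m"]) (simp_all only: \<beta>_def add_diff_eq)
  qed
  have "\<exists>g :: nat \<Rightarrow> int. g 0 = i0 \<and> (\<forall>n. start (g n) \<and> g (Suc n) > g n \<and> (\<exists>h::int. position (g (Suc n)) = position (g n) + sqrt 2 * \<beta> + h))"
  proof -
    have "\<exists>g. \<forall>n. (start (g n) \<and> (n = 0 \<longrightarrow> g n = i0)) \<and> (g (Suc n) > g n \<and> (\<exists>h::int. position (g (Suc n)) = position (g n) + sqrt 2 * \<beta> + h))"
      by (rule dependent_nat_choice) (use i0 nxt in blast)+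
    then show ?thesis by blast
  qed
  then obtain g where g: "g 0 = i0" "\<And>n. start (g n)" "\<And>n. g (Suc n) > g n" "\<And>n. \<exists>h::int. position (g (Suc n)) = position (g n) + sqrt 2 * \<beta> + h" by blast
  have mono: "strict_mono g" by (rule strict_mono_Suc_iff[THEN iffD2]) (use g(3) in blast)
  have orbit: "\<exists>h::int. position (g n) = position i0 + real n * (sqrt 2 * \<beta>) + h" for n
  proof (induction n)
    case 0 show ?case by (rule exI[of _ 0]) (simp add: g)
  next
    case (Suc n)
    then obtain h :: int where h: "position (g n) = position i0 + real n * (sqrt 2 * \<beta>) + h" by blast
    obtain h' :: int where h': "position (g (Suc n)) = position (g n) + sqrt 2 * \<beta> + h'" using g(4) by blast
    show ?case by (rule exI[of _ "h + h'"]) (simp add: h h' algebra_simps)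
  qed
  have gap: "0 < position (g n) + \<beta>" "position (g n) + \<beta> < 1" for n using nxt[OF g(2)] by blast+
  show ?thesis
  proof (cases "sqrt 2 * \<beta> \<in> \<rat>")
    case True
    then obtain u v :: int where uv: "v > 0" "sqrt 2 * \<beta> = u / v" by (rule Rats_cases')
    obtain h :: int where "position (g (nat v)) = position i0 + real (nat v) * (sqrt 2 * \<beta>) + h" using orbit by blast
    then have "position (g (nat v)) = position i0 + of_int (u + h)" using uv by simp
    moreover have "\<bar>position (g (nat v)) - position i0\<bar> < 1" using position_range[OF g(2)[of "nat v"]] position_range[OF i0] by linarith
    ultimately have "\<bar>real_of_int (u + h)\<bar> < 1" by simp
    then have "u + h = 0" by linarith
    then have "position (g 0) = position (g (nat v))" using \<open>position (g (nat v)) = position i0 + of_int (u + h)\<close> g(1) by simp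
    moreover have "g 0 < g (nat v)" using mono uv by (simp add: strict_mono_less)
    ultimately show ?thesis using equal_position[OF g(2) g(2)] by blast
  next
    case False
    then have "\<beta> \<noteq> 0" by auto
    \<comment> \<open>The middle of the part of the unit interval that \<open>\<beta>\<close> pushes out of it.\<close>
    define c where "c = (if \<beta> > 0 then 1 - \<beta> / 2 else - \<beta> / 2)"
    have b1: "\<bar>\<beta>\<bar> < 1" using gap[of 0] position_range[OF g(2)[of 0]] by linarith
    obtain n h where nh: "\<bar>real n * (sqrt 2 * \<beta>) - of_int h - (c - position i0)\<bar> < \<bar>\<beta>\<bar> / 2"
      by (rule fractional_dense[OF False, of "\<bar>\<beta>\<bar> / 2" "c - position i0"]) (use \<open>\<beta> \<noteq> 0\<close> in auto)
    obtain h' :: int where h': "position (g n) = position i0 + real n * (sqrt 2 * \<beta>) + h'" using orbit by blast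
    define e where "e = position (g n) - c - of_int (h + h')"
    have e: "\<bar>e\<bar> < \<bar>\<beta>\<bar> / 2" using nh h' by (simp add: e_def algebra_simps)
    have r: "0 < position (g n)" "position (g n) < 1" using position_range[OF g(2)] by blast+
    define x where "x = real_of_int (h + h')"
    have "- (\<bar>\<beta>\<bar> / 2) < position (g n) - c - x" "position (g n) - c - x < \<bar>\<beta>\<bar> / 2" using e unfolding e_def x_def by linarith+
    moreover have "c = 1 - \<bar>\<beta>\<bar> / 2 \<or> c = \<bar>\<beta>\<bar> / 2" unfolding c_def by simp
    ultimately have "- 1 < x" "x < 1" using r b1 by linarith+
    then have "h + h' = 0" unfolding x_def by linarith
    then have "position (g n) = c + e" by (simp add: e_def)
    then show ?thesis using e gap[of n] r \<open>\<beta> \<noteq> 0\<close> unfolding c_def by (simp split: if_splits)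
  qed
qed

end

lemma heights_exist:
  assumes "traj (pt vx vy) f" "vy > 0" "sr * vy < vx" "cutting_sequence id f w"
  obtains t P a b where "heights vx vy f w t P a b"
proof (rule cutting_chords[OF assms(1,4)])
  fix t :: "int \<Rightarrow> real" and P and a b :: "int \<Rightarrow> nat"
  assume h: "strict_mono t" "\<And>i. f (t i) \<in> surface_side (w i)"
    "\<And>i. P i \<in> f (t i) \<and> a i < 8 \<and> edge_pt (a i) (P i) \<and> mid (a i) \<bullet> pt vx vy < 0 \<and> oct_label (a i) = w i"
    "\<And>i. b i < 8 \<and> edge_pt (b i) (P i + (t (i + 1) - t i) *\<^sub>R pt vx vy) \<and> mid (b i) \<bullet> pt vx vy > 0 \<and> oct_label (b i) = w (i + 1)"
    "\<And>i. P (i + 1) = P i + (t (i + 1) - t i) *\<^sub>R pt vx vy - 2 *\<^sub>R mid (b i)"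
  show thesis by (rule that[OF heights.intro[OF assms(1-4) h]])
qed

text \<open>The period shifts the crossing times, hence their indices by a constant.\<close>

lemma periodic_cutting:
  assumes c: "cutting_sequence id f w" and reg: "\<And>s. f s \<in> regular" and p: "p > 0" "\<And>s. f (s + p) = f s"
  shows "periodic_word w"
proof -
  obtain t :: "int \<Rightarrow> real" where t: "strict_mono t" "range t = {u. \<exists>L. f u \<in> surface_side L}" "\<And>i. f (t i) \<in> surface_side (w i)"
    using c unfolding cutting_id by blast
  have ex: "\<exists>j. t j = u" if "f u \<in> surface_side L" for u L
  proof -
    have "u \<in> range t" unfolding t(2) using that by blast
    then show ?thesis by blast
  qed
  have "\<forall>i. \<exists>j. t j = t i + p"
  proof
    fix i have "f (t i + p) \<in> surface_side (w i)" using t(3) p(2) by simp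
    then show "\<exists>j. t j = t i + p" by (rule ex)
  qed
  then obtain \<sigma> where \<sigma>: "\<And>i. t (\<sigma> i) = t i + p" by metis
  have lt: "t i < t j \<longleftrightarrow> i < j" for i j using t(1) by (simp add: strict_mono_less)
  have m: "\<sigma> i < \<sigma> j \<longleftrightarrow> i < j" for i j unfolding lt[symmetric] \<sigma> by simp
  have suc: "\<sigma> (i + 1) = \<sigma> i + 1" for i
  proof -
    have "\<sigma> i < \<sigma> (i + 1)" using m by simp
    moreover have "\<not> \<sigma> i + 1 < \<sigma> (i + 1)"
    proof
      assume l: "\<sigma> i + 1 < \<sigma> (i + 1)"
      have "f (t (\<sigma> i + 1) - p) = f (t (\<sigma> i + 1))" using p(2)[of "t (\<sigma> i + 1) - p"] by simp
      then have "f (t (\<sigma> i + 1) - p) \<in> surface_side (w (\<sigma> i + 1))" using t(3) by simp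
      then obtain j where j: "t j = t (\<sigma> i + 1) - p" using ex by blast
      then have "t (\<sigma> j) = t (\<sigma> i + 1)" by (simp add: \<sigma>)
      then have "\<sigma> j = \<sigma> i + 1" using t(1) by (simp add: strict_mono_eq)
      then have "\<sigma> i < \<sigma> j" "\<sigma> j < \<sigma> (i + 1)" using l by auto
      then show False unfolding m by simp
    qed
    ultimately show ?thesis by simp
  qed
  have \<sigma>0: "\<sigma> i = \<sigma> 0 + i" for i
  proof (induction i rule: int_induct[where k = 0])
    case (step1 i) then show ?case using suc[of i] by simp
  next
    case (step2 i) then show ?case using suc[of "i - 1"] by simp
  qed simp
  have "t 0 < t (\<sigma> 0)" using p \<sigma> by simp
  then have "\<sigma> 0 > 0" unfolding lt .
  moreover have "w (i + \<sigma> 0) = w i" for i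
  proof (rule side_unique[OF reg])
    show "f (t (\<sigma> i)) \<in> surface_side (w (i + \<sigma> 0))" using t(3)[of "i + \<sigma> 0"] \<sigma>0[of i] by (simp add: add.commute)
    show "f (t (\<sigma> i)) \<in> surface_side (w i)" unfolding \<sigma> p(2) by (rule t(3))
  qed
  ultimately show ?thesis unfolding periodic_word_def by blast
qed

lemma all_letter: "(\<forall>x. Q x) \<longleftrightarrow> Q A \<and> Q B \<and> Q C \<and> Q D"
  by (metis letter.exhaust)

definition common :: "nat \<Rightarrow> nat \<Rightarrow> letter \<Rightarrow> letter \<Rightarrow> bool" where
  "common s j x y \<longleftrightarrow> (letter_perm s x, letter_perm s y) \<in> diag0 \<and> (letter_perm j x, letter_perm j y) \<in> diag0"

text \<open>A finite check.  The second alternative is for pairs of sectors such as 0 and 4, whose diagrams share a path through all four letters.\<close>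

lemma common_diagrams:
  assumes "s < 8" "j < 8" "s \<noteq> j"
  shows "(\<forall>x y z. common s j x y \<longrightarrow> common s j y z \<longrightarrow> x = z) \<or>
    (\<forall>x y. common s j x y \<longrightarrow> \<not> (letter_perm s x = C \<and> letter_perm s y = C))"
  using less_8[OF assms(1)] less_8[OF assms(2)] assms(3)
  by (elim disjE; simp add: all_letter common_def letter_perm_values diag0_def del: One_nat_def)

section \<open>The geodesic ray and the tessellation\<close>

declare transpose_matrix_vector [simp del]

definition eval_form :: "complex \<Rightarrow> real^2 \<Rightarrow> complex" where
  "eval_form z u = of_real (u $ 1) * z + of_real (u $ 2)"

text \<open>The product of two linear forms in \<open>(z, 1)\<close>, turned into a Hermitian form.  In the upper half-plane it vanishes on the geodesic between the real zeros of the two linear forms.\<close>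

definition form :: "complex \<Rightarrow> real^2 \<Rightarrow> real^2 \<Rightarrow> real" where
  "form z u v = Re (eval_form z u * cnj (eval_form z v))"

definition moebius :: "complex \<Rightarrow> real^2^2 \<Rightarrow> complex" where
  "moebius z M = eval_form z (column 1 M) / eval_form z (column 2 M)"

text \<open>Matrices of negative determinant act through the complex conjugate.\<close>

definition conj_by :: "real^2^2 \<Rightarrow> complex \<Rightarrow> complex" where
  "conj_by M z = (if det M > 0 then z else cnj z)"

lemma act_moebius: "act z M = moebius (conj_by M z) M"
  by (simp add: act_def moebius_def conj_by_def eval_form_def column_def Let_def)

lemma mult_vec_2: "(M *v u) $ 1 = M $ 1 $ 1 * u $ 1 + M $ 1 $ 2 * u $ 2" "(M *v u) $ 2 = M $ 2 $ 1 * u $ 1 + M $ 2 $ 2 * u $ 2"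
  for M :: "real^2^2" by (simp_all add: matrix_vector_mult_def sum_2)

lemma denominator: assumes "Im z \<noteq> 0" "det M \<noteq> 0" shows "eval_form z (column 2 M) \<noteq> 0"
proof
  assume "eval_form z (column 2 M) = 0"
  then have "Im (eval_form z (column 2 M)) = 0" "Re (eval_form z (column 2 M)) = 0" by simp_all
  then have "M $ 1 $ 2 = 0" "M $ 2 $ 2 = 0" using assms(1) by (auto simp: eval_form_def column_def)
  then show False using assms(2) by (simp add: det_2)
qed

lemma eval_moebius:
  assumes "Im z \<noteq> 0" "det M \<noteq> 0" shows "eval_form (moebius z M) u = eval_form z (M *v u) / eval_form z (column 2 M)"
  using denominator[OF assms] unfolding moebius_def
  by (simp add: eval_form_def mult_vec_2 column_def field_simps)

lemma Im_conj_by [simp]: "Im (conj_by M z) = 0 \<longleftrightarrow> Im z = 0" by (simp add: conj_by_def)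

text \<open>A Moebius transformation substitutes \<open>M\<close> into the linear forms, up to the common denominator.\<close>

lemma form_act:
  assumes "Im z \<noteq> 0" "det M \<noteq> 0" obtains r where "r > 0" "\<And>u v. form (act z M) u v = r * form z (M *v u) (M *v v)"
proof -
  define d where "d = eval_form (conj_by M z) (column 2 M)"
  have d: "d \<noteq> 0" unfolding d_def by (rule denominator) (use assms in simp_all)
  have c: "form (conj_by M z) u v = form z u v" for u v by (simp add: conj_by_def form_def eval_form_def)
  have "form (act z M) u v = (1 / (cmod d)\<^sup>2) * form z (M *v u) (M *v v)" for u v
  proof -
    have "eval_form (act z M) w = eval_form (conj_by M z) (M *v w) / d" for w
      unfolding act_moebius d_def by (rule eval_moebius) (use assms in simp_all)
    then have "form (act z M) u v = Re (eval_form (conj_by M z) (M *v u) * cnj (eval_form (conj_by M z) (M *v v)) / (d * cnj d))"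
      by (simp add: form_def)
    also have "\<dots> = form (conj_by M z) (M *v u) (M *v v) / (cmod d)\<^sup>2"
      unfolding form_def complex_norm_square[symmetric] by (metis Re_divide_of_real)
    finally show ?thesis by (simp add: c)
  qed
  moreover have "1 / (cmod d)\<^sup>2 > 0" using d by simp
  ultimately show ?thesis by (rule that[rotated])
qed

lemma act_half_plane: assumes "Im z > 0" "det M \<noteq> 0" shows "Im (act z M) > 0"
proof -
  define z' where "z' = conj_by M z"
  define d where "d = eval_form z' (column 2 M)"
  have "d \<noteq> 0" unfolding d_def z'_def by (rule denominator) (use assms in simp_all)
  then have p: "(Re d)\<^sup>2 + (Im d)\<^sup>2 > 0" by (simp add: complex_neq_0)
  have "Im (act z M) = (det M * Im z') / ((Re d)\<^sup>2 + (Im d)\<^sup>2)"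
    unfolding act_moebius moebius_def z'_def[symmetric] d_def Im_divide
    by (simp add: eval_form_def column_def det_2 algebra_simps)
  moreover have "det M * Im z' > 0" using assms unfolding z'_def conj_by_def by (cases "det M > 0") (simp_all add: mult_less_0_iff)
  ultimately show ?thesis using p by simp
qed

lemma column_mult: "column j (M ** N) = M *v column j N" for M N :: "real^2^2"
  by (simp add: column_def matrix_matrix_mult_def matrix_vector_mult_def vec_eq_iff)

lemma act_act: assumes "Im z > 0" "det M \<noteq> 0" "det N \<noteq> 0" shows "act (act z M) N = act z (M ** N)"
proof -
  define z' where "z' = conj_by M z"
  have m: "moebius (moebius x M) N = moebius x (M ** N)" if x: "Im x \<noteq> 0" for x
    unfolding moebius_def[of _ N] eval_moebius[OF x assms(2)] moebius_def[of x "M ** N"] column_mult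
    using denominator[OF x assms(2)] by simp
  have c: "cnj (moebius x M) = moebius (cnj x) M" for x by (simp add: moebius_def eval_form_def)
  have "conj_by N (moebius z' M) = moebius (conj_by N z') M" by (simp add: conj_by_def c)
  moreover have "conj_by N z' = conj_by (M ** N) z"
    using assms(2,3) by (auto simp: z'_def conj_by_def det_mul zero_less_mult_iff)
  moreover have "Im (conj_by N z') \<noteq> 0" using assms(1) by (simp add: z'_def)
  ultimately show ?thesis unfolding act_moebius z'_def[symmetric] using m by simp
qed

lemma act_1: "act z (mat 1) = z" unfolding mat2_1 by (simp add: act_def mat2_det)

lemma det_2_uminus: "det (- M) = det M" for M :: "real^2^2" by (simp add: det_2)

lemma act_uminus: "act z (- M) = act z M"
proof -
  have "- x / - y = x / y" for x y :: complex by simp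
  from this[of "of_real (M $ 1 $ 1) * z' + of_real (M $ 2 $ 1)" "of_real (M $ 1 $ 2) * z' + of_real (M $ 2 $ 2)" for z']
  show ?thesis by (simp add: act_def det_2_uminus Let_def)
qed

lemma act_set_act_set: "S \<subseteq> upper_half_plane \<Longrightarrow> det M \<noteq> 0 \<Longrightarrow> det N \<noteq> 0 \<Longrightarrow> act_set (act_set S M) N = act_set S (M ** N)"
  unfolding act_set_def image_image by (rule image_cong) (auto simp: upper_half_plane_def act_act)

lemma act_set_1: "act_set S (mat 1) = S" by (simp add: act_set_def act_1)

lemma act_set_uminus: "act_set S (- M) = act_set S M" by (simp add: act_set_def act_uminus)

lemma act_set_half_plane: "S \<subseteq> upper_half_plane \<Longrightarrow> det M \<noteq> 0 \<Longrightarrow> act_set S M \<subseteq> upper_half_plane"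
  by (auto simp: act_set_def upper_half_plane_def act_half_plane)

lemma act_set_cancel:
  assumes "S \<subseteq> upper_half_plane" "det M \<noteq> 0" "M ** N = mat 1" shows "act_set (act_set S M) N = S"
proof -
  have "det M * det N = 1" using assms(3) det_mul[of M N] by simp
  then have "det N \<noteq> 0" by auto
  then show ?thesis using act_set_act_set[OF assms(1,2)] assms(3) by (simp add: act_set_1)
qed

lemma ray_form:
  "\<exists>r>0. \<forall>u v. form (ray \<theta> t) u v = r * (exp (2 * t) * ((sin \<theta> * u $ 1 - cos \<theta> * u $ 2) * (sin \<theta> * v $ 1 - cos \<theta> * v $ 2))
    + (cos \<theta> * u $ 1 + sin \<theta> * u $ 2) * (cos \<theta> * v $ 1 + sin \<theta> * v $ 2))"
proof -
  have d: "det (mat2 (sin \<theta>) (- cos \<theta>) (cos \<theta>) (sin \<theta>)) \<noteq> 0" unfolding mat2_det by (simp add: power2_eq_square[symmetric] flip: power2_eq_square)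
  obtain r where r: "r > 0" "\<And>u v. form (ray \<theta> t) u v = r * form (\<i> * of_real (exp t)) (mat2 (sin \<theta>) (- cos \<theta>) (cos \<theta>) (sin \<theta>) *v u) (mat2 (sin \<theta>) (- cos \<theta>) (cos \<theta>) (sin \<theta>) *v v)"
    unfolding ray_def by (rule form_act[of "\<i> * of_real (exp t)" "mat2 (sin \<theta>) (- cos \<theta>) (cos \<theta>) (sin \<theta>)"]) (use d in auto)
  have e: "exp (2 * t) = exp t * exp t" by (simp flip: exp_add)
  show ?thesis by (intro exI[of _ r] conjI allI r(1), unfold r(2) e) (simp add: form_def eval_form_def mult_vec_2 e algebra_simps)
qed

lemma ray_half_plane: "Im (ray \<theta> t) > 0"
  unfolding ray_def by (rule act_half_plane) (simp_all add: mat2_det flip: power2_eq_square)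

definition cross2 :: "real^2 \<Rightarrow> real^2 \<Rightarrow> real" where "cross2 p q = p $ 1 * q $ 2 - p $ 2 * q $ 1"

lemma cross2_mult: "cross2 (M *v p) (M *v q) = det M * cross2 p q"
  by (simp add: cross2_def mult_vec_2 det_2 algebra_simps)

text \<open>Along the ray the form is proportional to \<open>exp (2 t) X + Y\<close>.  A zero at \<open>t2\<close> after a positive value forces \<open>X < 0\<close>.\<close>

lemma ray_crossing:
  assumes M: "det M \<noteq> 0" "N ** M = mat 1" and t: "t1 < t2"
    and 1: "form (act (ray \<theta> t1) M) u v > 0" and 2: "form (act (ray \<theta> t2) M) u v = 0"
  shows "cross2 (N *v pt (cos \<theta>) (sin \<theta>)) u * cross2 (N *v pt (cos \<theta>) (sin \<theta>)) v < 0"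
proof -
  define e where "e = pt (cos \<theta>) (sin \<theta>)"
  define X Y where "X = cross2 e (M *v u) * cross2 e (M *v v)" and "Y = (e \<bullet> (M *v u)) * (e \<bullet> (M *v v))"
  have pos: "\<exists>r>0. form (act (ray \<theta> t) M) u v = r * (exp (2 * t) * X + Y)" for t
  proof -
    obtain r where r: "r > 0" "\<And>u v. form (act (ray \<theta> t) M) u v = r * form (ray \<theta> t) (M *v u) (M *v v)"
      by (rule form_act[of "ray \<theta> t" M]) (use M ray_half_plane[of \<theta> t] in auto)
    obtain r' where r': "r' > 0" "\<forall>u v. form (ray \<theta> t) u v = r' * (exp (2 * t) * ((sin \<theta> * u $ 1 - cos \<theta> * u $ 2) * (sin \<theta> * v $ 1 - cos \<theta> * v $ 2))
      + (cos \<theta> * u $ 1 + sin \<theta> * u $ 2) * (cos \<theta> * v $ 1 + sin \<theta> * v $ 2))" using ray_form[of \<theta> t] by blast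
    have "X = (sin \<theta> * (M *v u) $ 1 - cos \<theta> * (M *v u) $ 2) * (sin \<theta> * (M *v v) $ 1 - cos \<theta> * (M *v v) $ 2)"
      unfolding X_def cross2_def e_def by (simp add: algebra_simps)
    moreover have "Y = (cos \<theta> * (M *v u) $ 1 + sin \<theta> * (M *v u) $ 2) * (cos \<theta> * (M *v v) $ 1 + sin \<theta> * (M *v v) $ 2)"
      unfolding Y_def e_def by (simp add: inner_vec_def sum_2)
    ultimately have "form (act (ray \<theta> t) M) u v = (r * r') * (exp (2 * t) * X + Y)" unfolding r(2) r'(2)[rule_format] by simp
    then show ?thesis using r(1) r'(1) by (intro exI[of _ "r * r'"]) simp
  qed
  have "exp (2 * t1) * X + Y > 0" using pos[of t1] 1 by (auto simp: zero_less_mult_iff)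
  moreover have "exp (2 * t2) * X + Y = 0" using pos[of t2] 2 by auto
  ultimately have "(exp (2 * t2) - exp (2 * t1)) * X < 0" by (simp add: algebra_simps)
  moreover have "exp (2 * t2) - exp (2 * t1) > 0" using t by simp
  ultimately have "X < 0" by (simp add: mult_less_0_iff)
  have "M ** N = mat 1" using M(2) matrix_left_right_inverse[of N M] by blast
  then have e: "M *v (N *v e) = e" by (simp add: matrix_vector_mul_assoc)
  have "cross2 e (M *v x) = det M * cross2 (N *v e) x" for x using cross2_mult[of M "N *v e" x] unfolding e .
  then have "X = (det M)\<^sup>2 * (cross2 (N *v e) u * cross2 (N *v e) v)" by (simp add: X_def power2_eq_square)
  then show ?thesis using \<open>X < 0\<close> M(1) unfolding e_def by (simp add: mult_less_0_iff not_less)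
qed

abbreviation e0 :: "real^2" where "e0 \<equiv> pt 1 0"
abbreviation e1 :: "real^2" where "e1 \<equiv> pt sr 1"

lemma edge_circle:
  "cmod (z - of_real ((1 - sqrt 2) / 2)) = (sqrt 2 - 1) / 2 \<longleftrightarrow> form z e0 e1 = 0"
  "cmod (z - of_real ((1 - sqrt 2) / 2)) \<ge> (sqrt 2 - 1) / 2 \<longleftrightarrow> form z e0 e1 \<ge> 0"
proof -
  define c where "c = (sqrt 2 - 1) / 2"
  have c: "c > 0" "sr * (2 * c) = 1" by (simp_all add: c_def sr_def algebra_simps)
  have f: "form z e0 e1 = sr * ((cmod (z - of_real (- c)))\<^sup>2 - c\<^sup>2)"
  proof -
    have "sr * (2 * c * x) = x" for x using c(2) by (simp flip: mult.assoc)
    then show ?thesis unfolding cmod_power2 by (simp add: form_def eval_form_def power2_eq_square algebra_simps)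
  qed
  have s: "sr > 0" using sr_bounds by simp
  have m: "(1 - sqrt 2) / 2 = - c" "(sqrt 2 - 1) / 2 = c" by (simp_all add: c_def field_simps)
  have "cmod (z - of_real (- c)) = c \<longleftrightarrow> (cmod (z - of_real (- c)))\<^sup>2 = c\<^sup>2" using c by (simp add: power2_eq_iff_nonneg)
  then show "cmod (z - of_real ((1 - sqrt 2) / 2)) = (sqrt 2 - 1) / 2 \<longleftrightarrow> form z e0 e1 = 0" unfolding m f using s by simp
  have "c \<le> cmod (z - of_real (- c)) \<longleftrightarrow> c\<^sup>2 \<le> (cmod (z - of_real (- c)))\<^sup>2" using c by (simp add: power_mono_iff)
  then show "cmod (z - of_real ((1 - sqrt 2) / 2)) \<ge> (sqrt 2 - 1) / 2 \<longleftrightarrow> form z e0 e1 \<ge> 0"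
    unfolding m f using s by (simp add: zero_le_mult_iff)
qed

lemma geodesic_form: "geodesic 0 (1 - sqrt 2) = {z. Im z > 0 \<and> form z e0 e1 = 0}"
  using edge_circle(1) by (auto simp: geodesic_def upper_half_plane_def)

lemma nu_inverse: "j < 8 \<Longrightarrow> transpose (nu j) ** nu j = mat 1" "j < 8 \<Longrightarrow> nu j ** transpose (nu j) = mat 1"
  using nu_orthogonal[of j] by (simp_all add: orthogonal_matrix_def)

lemma nu_det: "j < 8 \<Longrightarrow> \<bar>det (nu j)\<bar> = 1" using det_orthogonal_matrix[OF nu_orthogonal[of j]] by auto

lemma nu_det_nz: "j < 8 \<Longrightarrow> det (nu j) \<noteq> 0" using nu_det[of j] by auto

lemma nu_matrix_inv: assumes "j < 8" shows "matrix_inv (nu j) = transpose (nu j)"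
proof -
  have "nu j ** matrix_inv (nu j) = mat 1 \<and> matrix_inv (nu j) ** nu j = mat 1"
    unfolding matrix_inv_def by (rule someI[of _ "transpose (nu j)"]) (use nu_inverse[OF assms] in blast)
  then have "matrix_inv (nu j) ** nu j ** transpose (nu j) = transpose (nu j)" by simp
  then show ?thesis by (simp add: nu_inverse(2)[OF assms] flip: matrix_mul_assoc)
qed

lemma preimage_form:
  assumes j: "j < 8" and g: "\<And>r. r > 0 \<Longrightarrow> (\<And>x. Q (r * x) \<longleftrightarrow> Q x)"
  shows "act_set {z. Im z > 0 \<and> Q (form z e0 e1)} (nu j) = {z. Im z > 0 \<and> Q (form z (transpose (nu j) *v e0) (transpose (nu j) *v e1))}"
proof -
  note d = nu_det_nz[OF j]
  have d': "det (transpose (nu j)) \<noteq> 0" using d by (simp add: det_transpose)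
  have b: "nu j *v (transpose (nu j) *v x) = x" for x by (simp add: matrix_vector_mul_assoc nu_inverse[OF j])
  have i: "Q (form (act z (nu j)) (transpose (nu j) *v e0) (transpose (nu j) *v e1)) \<longleftrightarrow> Q (form z e0 e1)" if z: "Im z > 0" for z
  proof -
    obtain r where r: "r > 0" "\<And>u v. form (act z (nu j)) u v = r * form z (nu j *v u) (nu j *v v)"
      by (rule form_act[of z "nu j"]) (use z d in auto)
    show ?thesis unfolding r(2) b by (rule g[OF r(1)])
  qed
  show ?thesis (is "act_set ?S _ = ?R")
  proof (intro subset_antisym subsetI)
    fix z assume "z \<in> act_set ?S (nu j)"
    then obtain x where x: "Im x > 0" "Q (form x e0 e1)" "z = act x (nu j)" by (auto simp: act_set_def)
    then show "z \<in> ?R" using i[OF x(1)] act_half_plane[OF x(1) d] by simp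
  next
    fix z assume z: "z \<in> ?R"
    define x where "x = act z (transpose (nu j))"
    have x: "Im x > 0" "act x (nu j) = z" unfolding x_def using z act_half_plane[OF _ d'] act_act[OF _ d' d] nu_inverse[OF j] by (simp_all add: act_1)
    then have "Q (form x e0 e1)" using i[OF x(1)] z by simp
    then have xS: "x \<in> ?S" using x by simp
    show "z \<in> act_set ?S (nu j)" unfolding act_set_def by (rule image_eqI[where x = x], rule x(2)[symmetric], rule xS)
  qed
qed

lemma edge_form: "j < 8 \<Longrightarrow> edge j = {z. Im z > 0 \<and> form z (transpose (nu j) *v e0) (transpose (nu j) *v e1) = 0}"
  unfolding edge_def geodesic_form by (rule preimage_form) auto

lemma half_plane_form: assumes "j < 8"
  shows "edge_half_plane j = {z. Im z > 0 \<and> form z (transpose (nu j) *v e0) (transpose (nu j) *v e1) \<ge> 0}"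
proof -
  have "{z \<in> upper_half_plane. cmod (z - of_real ((1 - sqrt 2) / 2)) \<ge> (sqrt 2 - 1) / 2} = {z. Im z > 0 \<and> form z e0 e1 \<ge> 0}"
    using edge_circle(2) by (auto simp: upper_half_plane_def)
  then show ?thesis unfolding edge_half_plane_def by (simp only:) (rule preimage_form[OF assms], auto simp: zero_le_mult_iff)
qed

lemma edge_half: "edge j \<subseteq> upper_half_plane" if "j < 8" using edge_form[OF that] by (auto simp: upper_half_plane_def)

lemma edge_act_back: assumes "j < 8" shows "act_set (edge j) (transpose (nu j)) = edge 0"
proof -
  have g: "geodesic 0 (1 - sqrt 2) \<subseteq> upper_half_plane" by (auto simp: geodesic_def)
  have "edge 0 = geodesic 0 (1 - sqrt 2)" by (simp add: edge_def nu_values(1) mat2_1(1)[symmetric] act_set_1)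
  then show ?thesis using act_set_cancel[OF g nu_det_nz[OF assms] nu_inverse(2)[OF assms]] by (simp add: edge_def)
qed

text \<open>Up to sign the matrices \<open>nu j\<close> form the dihedral group of order 8.\<close>

lemma nu_mult: assumes ij: "i < 8" "j < 8"
  shows "\<exists>\<epsilon>\<in>{1, -1}. nu i ** nu j = \<epsilon> *\<^sub>R nu ((if even j then i + j else j + 8 - i) mod 8)"
proof -
  define c where "c = is2"
  define m where "m = (\<lambda>i j :: nat. (if even j then i + j else j + 8 - i) mod 8)"
  have c: "c * c = 1 / 2" by (simp add: c_def)
  note n = nu_values[folded c_def]
  have "\<forall>i<8. \<forall>j<8. nu i ** nu j = nu (m i j) \<or> nu i ** nu j = - nu (m i j)"
    unfolding all8
    apply (simp_all only: m_def)
    apply (intro conjI)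
    apply (simp_all only: n mat2_mult mat2_uminus)
    apply (simp_all add: n mat2_eq_iff mat2_uminus c del: One_nat_def flip: numeral_2_eq_2)
    done
  then have "nu i ** nu j = nu (m i j) \<or> nu i ** nu j = - nu (m i j)" using ij by blast
  then show ?thesis unfolding m_def by auto
qed

lemma octagon_half: "ideal_octagon \<subseteq> upper_half_plane"
proof -
  have "ideal_octagon \<subseteq> edge_half_plane 0" by (auto simp: ideal_octagon_def)
  then show ?thesis using half_plane_form[of 0] by (auto simp: upper_half_plane_def)
qed

lemma octagon_nu: assumes j: "j < 8" shows "act_set ideal_octagon (nu j) = ideal_octagon"
proof -
  have oct: "z \<in> ideal_octagon \<longleftrightarrow> Im z > 0 \<and> (\<forall>i<8. form z (transpose (nu i) *v e0) (transpose (nu i) *v e1) \<ge> 0)" for z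
  proof -
    have "z \<in> ideal_octagon \<longleftrightarrow> (\<forall>i<8. z \<in> edge_half_plane i)" by (auto simp: ideal_octagon_def)
    also have "\<dots> \<longleftrightarrow> (\<forall>i<8. Im z > 0 \<and> form z (transpose (nu i) *v e0) (transpose (nu i) *v e1) \<ge> 0)" using half_plane_form by blast
    also have "\<dots> \<longleftrightarrow> Im z > 0 \<and> (\<forall>i<8. form z (transpose (nu i) *v e0) (transpose (nu i) *v e1) \<ge> 0)"
      unfolding all8 by argo
    finally show ?thesis .
  qed
  have sub: "act_set ideal_octagon (nu j) \<subseteq> ideal_octagon" if j: "j < 8" for j
  proof
    fix z assume "z \<in> act_set ideal_octagon (nu j)"
    then obtain x where x: "x \<in> ideal_octagon" "z = act x (nu j)" by (auto simp: act_set_def)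
    have x': "Im x > 0" using x oct by blast
    note d = nu_det_nz[OF j]
    obtain r where r: "r > 0" "\<And>u v. form (act x (nu j)) u v = r * form x (nu j *v u) (nu j *v v)"
      by (rule form_act[of x "nu j"]) (use x' d in auto)
    have "form z (transpose (nu i) *v e0) (transpose (nu i) *v e1) \<ge> 0" if i: "i < 8" for i
    proof -
      define m where "m = (if even j then i + 8 - j else j + 8 - i) mod 8"
      have m: "m < 8" by (simp add: m_def)
      have "(if even j then m + j else j + 8 - m) mod 8 = i" unfolding m_def using less_8[OF i] less_8[OF j] by (elim disjE; simp)
      then obtain \<epsilon> where e: "\<epsilon> \<in> {1, -1}" "nu m ** nu j = \<epsilon> *\<^sub>R nu i" using nu_mult[OF m j] by metis
      have "transpose (nu j) ** transpose (nu m) = \<epsilon> *\<^sub>R transpose (nu i)"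
        unfolding matrix_transpose_mul[symmetric] e(2) by (simp add: transpose_def vec_eq_iff)
      then have "nu j ** (transpose (nu j) ** transpose (nu m)) = nu j ** (\<epsilon> *\<^sub>R transpose (nu i))" by simp
      then have "transpose (nu m) = nu j ** (\<epsilon> *\<^sub>R transpose (nu i))" by (simp add: matrix_mul_assoc nu_inverse[OF j])
      then have t: "nu j *v (transpose (nu i) *v u) = \<epsilon> *\<^sub>R (transpose (nu m) *v u)" for u
        using e(1) by (auto simp: matrix_vector_mul_assoc matrix_vector_mult_def matrix_matrix_mult_def vec_eq_iff sum_2 algebra_simps transpose_def)
      have "form x (\<epsilon> *\<^sub>R u) (\<epsilon> *\<^sub>R v) = form x u v" for u v using e(1) by (auto simp: form_def eval_form_def algebra_simps)
      then show ?thesis unfolding x(2) r(2) t using r(1) x(1) oct m by simp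
    qed
    then show "z \<in> ideal_octagon" using act_half_plane[OF x' d] x(2) oct by blast
  qed
  \<comment> \<open>The index of the inverse of \<open>nu j\<close> up to sign.\<close>
  define k where "k = (if even j then (8 - j) mod 8 else j)"
  have k: "k < 8" "(if even j then k + j else j + 8 - k) mod 8 = 0" unfolding k_def using less_8[OF j] by (elim disjE; simp)+
  obtain \<epsilon> where "\<epsilon> \<in> {1, -1 :: real}" "nu k ** nu j = \<epsilon> *\<^sub>R mat 1" using nu_mult[OF k(1) j] unfolding k(2) nu_values(1) mat2_1(1)[symmetric] by blast
  then have "nu k ** nu j = mat 1 \<or> nu k ** nu j = - mat 1" by auto
  then have "act_set ideal_octagon (nu k ** nu j) = ideal_octagon" using act_set_1 act_set_uminus by metis
  then have "act_set (act_set ideal_octagon (nu k)) (nu j) = ideal_octagon" using act_set_act_set[OF octagon_half nu_det_nz[OF k(1)] nu_det_nz[OF j]] by simp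
  then have "ideal_octagon \<subseteq> act_set ideal_octagon (nu j)" using image_mono[OF sub[OF k(1)], of "\<lambda>z. act z (nu j)"] by (simp only: act_set_def)
  then show ?thesis using sub[OF j] by blast
qed

lemma form_basis:
  "form z u v = ((u $ 1 - sr * u $ 2) * (v $ 1 - sr * v $ 2)) * form z e0 e0 + (u $ 2 * v $ 2) * form z e1 e1
     + ((u $ 1 - sr * u $ 2) * v $ 2 + u $ 2 * (v $ 1 - sr * v $ 2)) * form z e0 e1"
  by (simp add: form_def eval_form_def algebra_simps)

lemma edge_0_form: "z \<in> edge 0 \<longleftrightarrow> Im z > 0 \<and> form z e0 e1 = 0"
  using edge_form[of 0] by (simp add: nu_values(1) mat2_1(1)[symmetric])

lemma form_diag_pos: assumes "Im z > 0" shows "form z e0 e0 > 0" "form z e1 e1 > 0"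
proof -
  have "eval_form z e0 \<noteq> 0" "eval_form z e1 \<noteq> 0" using assms sr_bounds by (auto simp: eval_form_def complex_eq_iff)
  then show "form z e0 e0 > 0" "form z e1 e1 > 0" unfolding form_def complex_norm_square[symmetric] by simp_all
qed

text \<open>On \<open>edge 0\<close> the mixed term of the form vanishes, and for each side \<open>s\<close> the two remaining coefficients are non-negative and not both zero.\<close>

lemma edge_0_inside:
  assumes z: "z \<in> edge 0" and s: "s \<in> {1..7}" shows "form z (transpose (nu s) *v e0) (transpose (nu s) *v e1) > 0"
proof -
  have z: "Im z > 0" "form z e0 e1 = 0" using z edge_0_form by blast+
  define u v where "u = transpose (nu s) *v e0" and "v = transpose (nu s) *v e1"
  have s8: "s = 1 \<or> s = 2 \<or> s = 3 \<or> s = 4 \<or> s = 5 \<or> s = 6 \<or> s = 7" using s by auto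
  define c where "c = is2"
  define t where "t = sr"
  have "t * t = 2 * t + 1" unfolding t_def by (rule sr_sq)
  then have t: "t * t = 2 * t + 1" "t * (t * x) = 2 * (t * x) + x" "t > 2" for x
    using sr_bounds by (simp_all add: algebra_simps t_def flip: mult.assoc)
  have "c * c = 1 / 2" by (simp add: c_def)
  then have c: "c * c = 1 / 2" "c * (c * x) = x / 2" for x by (simp_all flip: mult.assoc)
  note n = nu_values[folded c_def]
  have "(u $ 1 - sr * u $ 2) * (v $ 1 - sr * v $ 2) \<ge> 0 \<and> u $ 2 * v $ 2 \<ge> 0 \<and>
    ((u $ 1 - sr * u $ 2) * (v $ 1 - sr * v $ 2) > 0 \<or> u $ 2 * v $ 2 > 0)"
    using s8 unfolding u_def v_def t_def[symmetric]
    by (elim disjE; hypsubst; unfold n mat2_transpose mat2_vec vector_2; insert t(3); simp add: algebra_simps c t(1,2) del: One_nat_def)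
  then show ?thesis unfolding u_def[symmetric] v_def[symmetric] form_basis[of z u v] z(2)
    using form_diag_pos[OF z(1)] by (auto intro: add_nonneg_pos add_pos_nonneg)
qed

text \<open>Stabilising the geodesic means permuting the directions \<open>e0\<close> and \<open>e1\<close> of its end points.  They cannot be exchanged by \<open>no_swap\<close>; if both are fixed, then \<open>e0\<close> is only multiplied by a sign, and by the determinant so is \<open>e1\<close>.\<close>

lemma edge_0_stabiliser:
  assumes a: "aff \<Phi> Q" and d: "\<bar>det Q\<bar> = 1" and s: "act_set (edge 0) Q = edge 0"
  shows "Q = mat 1 \<or> Q = - mat 1 \<or> Q = gamma \<or> Q = - gamma"
proof -
  define u v where "u = Q *v e0" and "v = Q *v e1"
  define c k where "c = (u $ 1 - sr * u $ 2) * (v $ 1 - sr * v $ 2)" and "k = u $ 2 * v $ 2"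
  have d0: "det Q \<noteq> 0" using d by auto
  have s0: "sr > 0" using sr_bounds by simp
  have eq: "c * (r / sr) + k * (1 - sr * r) = 0" if r: "0 < r" "sr * r < 1" for r
  proof -
    define h where "h = sqrt (r / sr - r\<^sup>2)"
    have "sr * r\<^sup>2 < r" using mult_strict_right_mono[OF r(2) r(1)] by (simp add: power2_eq_square)
    then have h: "h > 0" "h * h = r / sr - r\<^sup>2" using s0 by (simp_all add: h_def field_simps)
    define z where "z = Complex (- r) h"
    have z: "Im z > 0" "form z e0 e1 = 0" "form z e0 e0 = r / sr" "form z e1 e1 = 1 - sr * r"
    proof -
      have f: "form z e0 e0 = r * r + h * h" "form z e0 e1 = sr * (r * r + h * h) - r" "form z e1 e1 = sr * (sr * (r * r + h * h)) - 2 * (sr * r) + 1"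
        by (simp_all add: form_def eval_form_def z_def algebra_simps)
      have q: "r * r + h * h = r / sr" using h(2) by (simp add: power2_eq_square)
      show "Im z > 0" using h by (simp add: z_def)
      show "form z e0 e1 = 0" "form z e0 e0 = r / sr" "form z e1 e1 = 1 - sr * r" unfolding f q using s0 by simp_all
    qed
    have "z \<in> edge 0" using z edge_0_form by blast
    then have "act z Q \<in> edge 0" using s by (auto simp: act_set_def)
    then have "form (act z Q) e0 e1 = 0" using edge_0_form by blast
    moreover obtain r' where "r' > 0" "\<And>u v. form (act z Q) u v = r' * form z (Q *v u) (Q *v v)"
      by (rule form_act[of z Q]) (use z d0 in auto)
    ultimately have "form z u v = 0" by (simp add: u_def v_def)
    then show ?thesis unfolding form_basis[of z u v] z c_def k_def by simp
  qed
  \<comment> \<open>Two points of \<open>edge 0\<close> suffice to separate the coefficients.\<close>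
  have "c * (1 / (2 * sr) / sr) + k * (1 - sr * (1 / (2 * sr))) = 0" "c * (1 / (4 * sr) / sr) + k * (1 - sr * (1 / (4 * sr))) = 0"
    by (rule eq; use s0 in simp)+
  then have 0: "c / (2 * sr * sr) + k / 2 = 0" "c / (4 * sr * sr) + 3 * k / 4 = 0" using s0 by (simp_all add: field_simps)
  have "c / (2 * sr * sr) = 2 * (c / (4 * sr * sr))" by simp
  then have k0: "k = 0" using 0 by linarith
  then have c0: "c = 0" using 0(1) k0 s0 by simp
  obtain p q m n where Q: "Q = mat2 p q m n" by (rule mat2_cases)
  have u: "u = pt p m" and v: "v = pt (p * sr + q) (m * sr + n)" by (simp_all add: u_def v_def Q mat2_vec)
  have det: "\<bar>p * n - q * m\<bar> = 1" using d by (simp add: Q mat2_det)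
  have "m = 0"
  proof (rule ccontr)
    assume m: "m \<noteq> 0"
    then have "m * sr + n = 0" using k0 by (simp add: k_def u v)
    then have n: "n = - (m * sr)" by simp
    then have "p * n - q * m = - m * (p * sr + q)" by (simp add: algebra_simps)
    then have "p * sr + q \<noteq> 0" using det by auto
    moreover have "Q *v e1 = pt (p * sr + q) 0" using v n by (simp add: v_def)
    ultimately show False using no_swap[OF a] by blast
  qed
  then have pn: "\<bar>p\<bar> * \<bar>n\<bar> = 1" using det by (simp add: abs_mult)
  then have p0: "p \<noteq> 0" by auto
  have "Q *v e0 = pt p 0" using u \<open>m = 0\<close> by (simp add: u_def)
  then have p: "\<bar>p\<bar> = 1" by (rule horizontal_scaling[OF a _ p0])
  then have n: "\<bar>n\<bar> = 1" using pn by simp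
  have "p * (p * sr + q - sr * n) = 0" using c0 \<open>m = 0\<close> by (simp add: c_def u v)
  then have "p * sr + q - sr * n = 0" using p0 by (simp only: mult_eq_0_iff simp_thms)
  then have "q = sr * (n - p)" by (simp add: algebra_simps)
  moreover have "p = 1 \<or> p = -1" "n = 1 \<or> n = -1" using p n by (simp_all add: abs_if split: if_splits)
  ultimately show ?thesis unfolding Q \<open>m = 0\<close> gamma_def mat2_1 by (auto simp: mat2_eq_iff sr_def)
qed

lemma veech_aff: assumes "M \<in> veech_group" shows "(\<exists>\<Psi>. aff \<Psi> M) \<and> \<bar>det M\<bar> = 1"
proof -
  obtain \<Psi> where A: "affine_automorphism \<Psi> M" using assms by (auto simp: veech_group_def)
  then have "\<bar>det M\<bar> = 1" by (simp add: affine_automorphism_def)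
  then show ?thesis using affine_automorphism_aff[OF A] by blast
qed

lemma aff_id: "aff id (mat 1)" by (simp add: aff_def)

lemma inverse_matrix:
  fixes M :: "real^2^2" assumes "\<bar>det M\<bar> = 1" obtains N where "M ** N = mat 1" "N ** M = mat 1" "\<bar>det N\<bar> = 1"
proof -
  have "invertible M" using assms invertible_det_nz[of M] by auto
  then obtain N where N: "M ** N = mat 1" "N ** M = mat 1" unfolding invertible_def by blast
  have "det M * det N = 1" using N(1) det_mul[of M N] by simp
  then have "\<bar>det M\<bar> * \<bar>det N\<bar> = 1" by (simp flip: abs_mult)
  then show ?thesis using that[OF N] assms by simp
qed

lemma minus_mult: "(- M) ** N = - (M ** N)" "M ** (- N) = - (M ** N)" for M N :: "real^2^2"
  by (simp_all add: matrix_matrix_mult_def vec_eq_iff sum_negf)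

lemma aff_minus: "aff \<Phi> (- M) \<Longrightarrow> aff (sym_map (- mat 1) \<circ> \<Phi>) M"
  using aff_comp[OF sym_aff[OF minus_symmetry], of \<Phi> "- M"] by (simp add: minus_mult)

text \<open>The product \<open>v2 * (v1 - sr * v2)\<close> is positive exactly if \<open>v\<close> or \<open>- v\<close> lies in the open first sector.\<close>

lemma sign_change:
  assumes M: "\<bar>det M\<bar> = 1" and N: "N ** M = mat 1" and s: "s < 8" and t: "t1 < t2"
    and 1: "form (act (ray \<theta> t1) M) (transpose (nu s) *v e0) (transpose (nu s) *v e1) > 0"
    and 2: "act (ray \<theta> t2) M \<in> edge s"
    and v: "v = nu s *v (N *v pt (cos \<theta>) (sin \<theta>))"
  shows "v $ 2 * (v $ 1 - sr * v $ 2) > 0"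
proof -
  define y where "y = N *v pt (cos \<theta>) (sin \<theta>)"
  have "det M \<noteq> 0" using M by auto
  moreover have "form (act (ray \<theta> t2) M) (transpose (nu s) *v e0) (transpose (nu s) *v e1) = 0" using 2 edge_form[OF s] by simp
  ultimately have n: "cross2 y (transpose (nu s) *v e0) * cross2 y (transpose (nu s) *v e1) < 0"
    unfolding y_def using ray_crossing[OF _ N t 1] by simp
  have b: "nu s *v (transpose (nu s) *v x) = x" for x by (simp add: matrix_vector_mul_assoc nu_inverse[OF s])
  have c: "cross2 v x = det (nu s) * cross2 y (transpose (nu s) *v x)" for x
    using cross2_mult[of "nu s" y "transpose (nu s) *v x"] unfolding b v y_def by simp
  have d: "det (nu s) * det (nu s) = 1" using nu_det[OF s] by (metis abs_mult_self_eq mult_1)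
  have "cross2 v e0 * cross2 v e1 = (det (nu s) * det (nu s)) * (cross2 y (transpose (nu s) *v e0) * cross2 y (transpose (nu s) *v e1))"
    unfolding c by simp
  then have "cross2 v e0 * cross2 v e1 < 0" unfolding d using n by simp
  then show ?thesis by (simp add: cross2_def algebra_simps)
qed

text \<open>Let \<open>M\<close> and \<open>M'\<close> move two adjacent tiles to the ideal octagon, such that their common side becomes \<open>edge s\<close> and \<open>edge 0\<close>.  Then \<open>nu s * M\<^sup>-\<^sup>1 * M'\<close> stabilises \<open>edge 0\<close> but not the ideal octagon, so it is \<open>\<plusminus> gamma\<close>.\<close>

lemma tile_transition:
  assumes P: "P \<subseteq> upper_half_plane" "P' \<subseteq> upper_half_plane" "P' \<noteq> P" and E: "E \<subseteq> upper_half_plane" and s: "s < 8"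
    and M: "\<exists>\<Psi>. aff \<Psi> M" "\<bar>det M\<bar> = 1" "act_set P M = ideal_octagon" "act_set E M = edge s"
    and M': "\<exists>\<Psi>. aff \<Psi> M'" "\<bar>det M'\<bar> = 1" "act_set P' M' = ideal_octagon" "act_set E M' = edge 0"
  shows "M' = M ** (matrix_inv (nu s) ** gamma) \<or> M' = - (M ** (matrix_inv (nu s) ** gamma))" "\<exists>\<Phi>. aff \<Phi> gamma"
proof -
  obtain N where N: "M ** N = mat 1" "N ** M = mat 1" "\<bar>det N\<bar> = 1" by (rule inverse_matrix[OF M(2)])
  obtain N' where N': "M' ** N' = mat 1" "N' ** M' = mat 1" "\<bar>det N'\<bar> = 1" by (rule inverse_matrix[OF M'(2)])
  obtain \<Psi> \<Psi>' where \<Psi>: "aff \<Psi> M" "aff \<Psi>' M'" using M(1) M'(1) by blast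
  define Q where "Q = nu s ** (N ** M')"
  have aQ: "aff (sym_map (nu s) \<circ> (inv_into octagon_surface \<Psi> \<circ> \<Psi>')) Q" unfolding Q_def
    by (rule aff_comp[OF sym_aff[OF nu_symmetry[OF s]] aff_comp[OF aff_inverse[OF \<Psi>(1) N(1)] \<Psi>(2)]])
  have dQ: "\<bar>det Q\<bar> = 1" by (simp add: Q_def det_mul abs_mult nu_det[OF s] N M')
  have d: "det M \<noteq> 0" "det M' \<noteq> 0" "det N \<noteq> 0" "det (N ** M') \<noteq> 0" using M(2) M'(2) N(3) by (auto simp: det_mul)
  have through: "act_set S Q = act_set (act_set (act_set S (nu s)) N) M'" if S: "S \<subseteq> upper_half_plane" for S
    unfolding Q_def act_set_act_set[OF S nu_det_nz[OF s] d(4), symmetric]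
      act_set_act_set[OF act_set_half_plane[OF S nu_det_nz[OF s]] d(3,2), symmetric] ..
  have "act_set (edge 0) (nu s) = edge s"
    using act_set_cancel[OF edge_half[OF s] _ nu_inverse(1)[OF s]] nu_det_nz[OF s] unfolding edge_act_back[OF s] by (simp add: det_transpose)
  moreover have "act_set (edge s) N = E" using act_set_cancel[OF E d(1) N(1)] unfolding M(4) .
  ultimately have sQ: "act_set (edge 0) Q = edge 0" using through[OF edge_half[of 0]] M'(4) by simp
  have "act_set ideal_octagon N = P" using act_set_cancel[OF P(1) d(1) N(1)] unfolding M(3) .
  then have oQ: "act_set ideal_octagon Q = act_set P M'" unfolding through[OF octagon_half] octagon_nu[OF s] by simp
  have "act_set ideal_octagon Q \<noteq> ideal_octagon"
  proof
    assume "act_set ideal_octagon Q = ideal_octagon"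
    then have "act_set P M' = act_set P' M'" using oQ M'(3) by simp
    then have "act_set (act_set P M') N' = act_set (act_set P' M') N'" by simp
    then show False using act_set_cancel[OF P(1) d(2) N'(1)] act_set_cancel[OF P(2) d(2) N'(1)] P(3) by simp
  qed
  then have "Q \<noteq> mat 1" "Q \<noteq> - mat 1" using act_set_1[of ideal_octagon] act_set_uminus[of ideal_octagon "mat 1"] by auto
  then have Q: "Q = gamma \<or> Q = - gamma" using edge_0_stabiliser[OF aQ dQ sQ] by simp
  have "matrix_inv (nu s) ** Q = N ** M'" unfolding Q_def nu_matrix_inv[OF s] by (simp add: matrix_mul_assoc nu_inverse[OF s])
  then have "M ** (matrix_inv (nu s) ** Q) = M'" by (simp add: matrix_mul_assoc N)
  then show "M' = M ** (matrix_inv (nu s) ** gamma) \<or> M' = - (M ** (matrix_inv (nu s) ** gamma))"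
    using Q by (auto simp: minus_mult)
  show "\<exists>\<Phi>. aff \<Phi> gamma" using Q aQ aff_minus[of _ gamma] by auto
qed

lemma normalized_cutting:
  assumes "normalized_cutting_sequence \<theta> s"
  shows "s l < 8" "\<exists>\<Phi>. aff \<Phi> gamma"
    "\<And>N v. N ** nu_prod s l = mat 1 \<Longrightarrow> v = nu (s l) *v (N *v pt (cos \<theta>) (sin \<theta>)) \<Longrightarrow> v $ 2 * (v $ 1 - sr * v $ 2) > 0"
proof -
  obtain T P E where H: "0 < T 0" "strict_mono T" "P 0 = ideal_octagon" "\<forall>l. P l \<in> tiles" "\<forall>l. P (Suc l) \<noteq> P l"
     "\<forall>l. E l \<in> tile_sides (P l) \<inter> tile_sides (P (Suc l)) \<and> ray \<theta> (T l) \<in> E l"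
     "\<forall>t\<in>{0..T 0}. ray \<theta> t \<in> P 0" "\<forall>l. \<forall>t\<in>{T l..T (Suc l)}. ray \<theta> t \<in> P (Suc l)"
     "s 0 \<in> {0..7}" "E 0 = edge (s 0)"
     "\<forall>l. s (Suc l) \<in> {1..7} \<and> (\<exists>M\<in>veech_group. act_set (P (Suc l)) M = ideal_octagon \<and>
              act_set (E l) M = edge 0 \<and> act_set (E (Suc l)) M = edge (s (Suc l)))"
    using assms unfolding normalized_cutting_sequence_def by (elim exE conjE) (rule that)
  note T = H(1,2) and P = H(3) spec[OF H(4)] spec[OF H(5)]
  have E: "E l \<in> tile_sides (P l)" "ray \<theta> (T l) \<in> E l" for l using spec[OF H(6), of l] by (simp_all only: Int_iff)
  note s = H(9,10) conjunct1[OF spec[OF H(11)]]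
  note M = conjunct2[OF spec[OF H(11)]]
  define M' where "M' l = (SOME M. M \<in> veech_group \<and> act_set (P (Suc l)) M = ideal_octagon \<and> act_set (E l) M = edge 0 \<and> act_set (E (Suc l)) M = edge (s (Suc l)))" for l
  have ch: "M' l \<in> veech_group \<and> act_set (P (Suc l)) (M' l) = ideal_octagon \<and> act_set (E l) (M' l) = edge 0 \<and> act_set (E (Suc l)) (M' l) = edge (s (Suc l))" for l
    unfolding M'_def by (rule someI_ex) (use M[of l] in \<open>simp only: Bex_def\<close>)
  have M': "M' l \<in> veech_group" "act_set (P (Suc l)) (M' l) = ideal_octagon"
    "act_set (E l) (M' l) = edge 0" "act_set (E (Suc l)) (M' l) = edge (s (Suc l))" for l using ch[of l] by simp_all
  \<comment> \<open>The matrix for the initial tile is the identity; its leaving side is \<open>edge (s 0)\<close>.\<close>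
  define M where "M l = (case l of 0 \<Rightarrow> mat 1 | Suc m \<Rightarrow> M' m)" for l
  have s8: "s l < 8" for l using s(1) s(3)[of "l - 1"] by (cases l) auto
  then show "s l < 8" .
  have a: "\<exists>\<Psi>. aff \<Psi> (M l)" "\<bar>det (M l)\<bar> = 1" for l using veech_aff[OF M'(1)] aff_id by (cases l; auto simp: M_def)+
  have MP: "act_set (P l) (M l) = ideal_octagon" for l using M'(2) P(1) by (cases l) (simp_all add: M_def act_set_1)
  have ME: "act_set (E l) (M l) = edge (s l)" for l using M'(4) s(2) by (cases l) (simp_all add: M_def act_set_1)
  have ME0: "act_set (E l) (M (Suc l)) = edge 0" for l using M'(3) by (simp add: M_def)
  have dV: "det R \<noteq> 0" if "R \<in> veech_group" for R using veech_aff[OF that] by auto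
  have PH: "P l \<subseteq> upper_half_plane" for l
  proof -
    obtain R where "P l = act_set ideal_octagon R" "R \<in> veech_group" using P(2)[of l] by (auto simp: tiles_def)
    then show ?thesis using act_set_half_plane[OF octagon_half dV] by simp
  qed
  have EH: "E l \<subseteq> upper_half_plane" for l
  proof -
    obtain i R where "E l = act_set (edge i) R" "i < 8" "R \<in> veech_group" using E(1)[of l] by (auto simp: tile_sides_def)
    then show ?thesis using act_set_half_plane[OF edge_half dV] by simp
  qed
  note tr = tile_transition[OF PH PH P(3) EH s8 a(1) a(2) MP ME a(1) a(2) MP ME0]
  show "\<exists>\<Phi>. aff \<Phi> gamma" by (rule tr(2))
  have prod: "M l = nu_prod s l \<or> M l = - nu_prod s l" for l
  proof (induction l)
    case (Suc l)
    then show ?case using tr(1)[of l] by (auto simp: minus_mult)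
  qed (simp add: M_def)
  fix N v assume N: "N ** nu_prod s l = mat 1" and v: "v = nu (s l) *v (N *v pt (cos \<theta>) (sin \<theta>))"
  have out: "act (ray \<theta> (T l)) (M l) \<in> edge (s l)" using E(2)[of l] unfolding ME[symmetric] act_set_def by blast
  have pos: "\<exists>t < T l. form (act (ray \<theta> t) (M l)) (transpose (nu (s l)) *v e0) (transpose (nu (s l)) *v e1) > 0"
  proof (cases l)
    case 0
    have "form (act (ray \<theta> 0) (M l)) u v = u \<bullet> v" for u v
      by (simp add: 0 M_def act_1 ray_0 form_def eval_form_def inner_vec_def sum_2)
    moreover have "(transpose (nu (s l)) *v e0) \<bullet> (transpose (nu (s l)) *v e1) = e0 \<bullet> (nu (s l) *v (transpose (nu (s l)) *v e1))"
      unfolding transpose_matrix_vector[of "nu (s l)" e0] by (rule dot_lmul_matrix)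
    moreover have "\<dots> = sr" by (simp add: matrix_vector_mul_assoc nu_inverse[OF s8])
    ultimately show ?thesis using T(1) 0 sr_bounds by (intro exI[of _ 0]) simp
  next
    case (Suc m)
    have "act (ray \<theta> (T m)) (M l) \<in> act_set (E m) (M (Suc m))" unfolding act_set_def Suc by (rule imageI[OF E(2)])
    then have "act (ray \<theta> (T m)) (M l) \<in> edge 0" unfolding ME0 .
    from edge_0_inside[OF this] have "form (act (ray \<theta> (T m)) (M l)) (transpose (nu (s l)) *v e0) (transpose (nu (s l)) *v e1) > 0"
      using s(3) Suc by simp
    moreover have "T m < T l" using T(2) Suc by (simp add: strict_mono_less)
    ultimately show ?thesis by blast
  qed
  then obtain t where t: "t < T l" "form (act (ray \<theta> t) (M l)) (transpose (nu (s l)) *v e0) (transpose (nu (s l)) *v e1) > 0" by blast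
  from prod[of l] show "v $ 2 * (v $ 1 - sr * v $ 2) > 0"
  proof
    assume "M l = nu_prod s l"
    then have "N ** M l = mat 1" using N by simp
    from sign_change[OF a(2) this s8 t(1,2) out v] show ?thesis .
  next
    assume "M l = - nu_prod s l"
    then have "(- N) ** M l = mat 1" using N by (simp add: minus_mult)
    moreover have "- v = nu (s l) *v ((- N) *v pt (cos \<theta>) (sin \<theta>))"
      unfolding v by (simp add: matrix_vector_mult_def vec_eq_iff sum_negf)
    ultimately have "(- v) $ 2 * ((- v) $ 1 - sr * (- v) $ 2) > 0" by (rule sign_change[OF a(2) _ s8 t(1,2) out])
    then show ?thesis by (simp add: algebra_simps)
  qed
qed

section \<open>Renormalization\<close>

lemma first_sector_polar:
  assumes v: "vy > 0" "sr * vy < vx" obtains c y where "c > 0" "0 \<le> y" "y \<le> pi / 8" "pt vx vy = c *\<^sub>R pt (cos y) (sin y)"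
proof -
  define y where "y = arctan (vy / vx)"
  have "sr * vy > 0" using v sr_bounds by simp
  then have vx: "vx > 0" using v by simp
  then have q: "vy / vx > 0" using v by simp
  have "vy * (sr * hs) < vx * hs" using mult_strict_right_mono[OF v(2) hs_pos] by (simp add: algebra_simps)
  then have "vy / vx \<le> hs / ir" unfolding sr_hs using vx ir_pos by (simp add: field_simps)
  moreover have "tan (pi / 8) = hs / ir" by (simp add: tan_def hs_def ir_def)
  ultimately have "y \<le> arctan (tan (pi / 8))" unfolding y_def using arctan_monotone' by simp
  moreover have "arctan (tan (pi / 8)) = pi / 8" by (rule arctan_tan) (use pi_gt_zero in linarith)+
  moreover have "0 \<le> y" using q by (simp add: y_def)
  moreover have c: "cos y > 0" unfolding y_def by (rule cos_gt_zero_pi[OF arctan_lbound arctan_ubound])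
  then have "sin y = (vy / vx) * cos y" using tan_arctan[of "vy / vx"] unfolding y_def[symmetric] tan_def by (simp add: field_simps)
  then have "pt vx vy = (vx / cos y) *\<^sub>R pt (cos y) (sin y)" using c vx by simp
  moreover have "vx / cos y > 0" using c vx by simp
  ultimately show ?thesis using that by simp
qed

lemma sector_direction:
  assumes s: "s < 8" and v: "nu s *v u = pt vx vy" "vy > 0" "sr * vy < vx"
  obtains c x where "c > 0" "x \<in> sector s" "u = c *\<^sub>R pt (cos x) (sin x)"
proof -
  obtain c y where y: "c > 0" "0 \<le> y" "y \<le> pi / 8" "pt vx vy = c *\<^sub>R pt (cos y) (sin y)" by (rule first_sector_polar[OF v(2,3)])
  define x where "x = (if even s then y + s * pi / 8 else (s + 1) * pi / 8 - y)"
  have x: "x \<in> sector s" using y by (auto simp: x_def sector_def field_simps)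
  have e: "(if even s then x - real s * pi / 8 else (real s + 1) * pi / 8 - x) = y" by (simp add: x_def)
  have "nu s *v pt (cos x) (sin x) = pt (cos y) (sin y)" using nu_direction[OF s, of x] by (simp only: Let_def e)
  then have "nu s *v u = nu s *v (c *\<^sub>R pt (cos x) (sin x))" unfolding v(1) y(4) by (simp only: matrix_vector_mult_scaleR)
  then have "transpose (nu s) *v (nu s *v u) = transpose (nu s) *v (nu s *v (c *\<^sub>R pt (cos x) (sin x)))" by simp
  then show ?thesis using that[OF y(1) x] by (simp only: matrix_vector_mul_assoc nu_inverse[OF s] matrix_vector_mul_lid)
qed

lemma sym_minus_minus: "sym_map (- mat 1) (sym_map (- mat 1) x) = x"
  unfolding sym_map_def image_image minus_vec by simp

text \<open>By \<open>common_diagrams\<close>, a word in two diagrams either has period two, which contradicts \<open>no_period_2\<close>, or has no \<open>C C\<close> in normal form, which makes the trajectory periodic.\<close>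

lemma unique_diagram:
  assumes f: "traj (pt vx vy) f" "vy > 0" "sr * vy < vx" and w: "cutting_sequence id f (letter_perm s \<circ> w)"
    and ap: "\<not> (\<exists>p>0. \<forall>t. f (t + p) = f t)" and j: "s < 8" "j < 8" "s \<noteq> j"
    and ad: "admissible s w" "admissible j w"
  shows False
proof -
  obtain t P a b where "heights vx vy f (letter_perm s \<circ> w) t P a b" by (rule heights_exist[OF f w])
  then interpret heights vx vy f "letter_perm s \<circ> w" t P a b .
  have c: "common s j (w i) (w (i + 1))" for i
    using diagram_diag0[OF j(1)] diagram_diag0[OF j(2)] ad unfolding admissible_def common_def by blast
  from common_diagrams[OF j] show False
  proof
    assume *: "\<forall>x y z. common s j x y \<longrightarrow> common s j y z \<longrightarrow> x = z"
    have "w (i + 2) = w i" for i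
    proof -
      have "common s j (w (i + 1)) (w (i + 2))" using c[of "i + 1"] by (simp add: add.assoc)
      then show ?thesis using * c[of i] by metis
    qed
    then show False using no_period_2 by simp
  next
    assume *: "\<forall>x y. common s j x y \<longrightarrow> \<not> (letter_perm s x = C \<and> letter_perm s y = C)"
    have "\<not> ((letter_perm s \<circ> w) i = C \<and> (letter_perm s \<circ> w) (i + 1) = C)" for i using * c[of i] by simp
    then show False using no_CC_periodic ap by blast
  qed
qed

text \<open>The velocity of the normalized trajectory may point into the opposite of the first sector.  The symmetry \<open>- 1\<close> repairs this without changing labels; conjugating \<open>\<Phi>\<close> by it does not change the derivative.\<close>

lemma renormalize:
  assumes h: "traj u h" "cutting_sequence id h w" and s: "s < 8" and v: "(nu s *v u) $ 2 * ((nu s *v u) $ 1 - sr * (nu s *v u) $ 2) > 0"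
    and ap: "\<not> (\<exists>p>0. \<forall>t. h (t + p) = h t)" and \<Phi>: "aff \<Phi> gamma"
  shows "cutting_sequence id (\<Phi> \<circ> (sym_map (nu s) \<circ> h)) (derived (normal_form w))"
proof -
  define g where "g = sym_map (nu s) \<circ> h"
  define n where "n = letter_perm s \<circ> w"
  note sy = nu_symmetry[OF s]
  have hS: "h t \<in> octagon_surface" for t using straight_regular[OF h(1), of t] by blast
  have gS: "g t \<in> octagon_surface" for t unfolding g_def o_def by (rule sym_surface[OF sy hS])
  have g: "traj (nu s *v u) g" unfolding g_def by (rule aff_traj[OF sym_aff[OF sy] h(1)])
  have n: "cutting_sequence id g n" unfolding g_def n_def by (rule nu_cutting[OF s hS h(2)])
  have gap: "\<not> (\<exists>p>0. \<forall>t. g (t + p) = g t)"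
  proof
    assume "\<exists>p>0. \<forall>t. g (t + p) = g t"
    then obtain p where p: "p > 0" "\<And>t. g (t + p) = g t" by blast
    have "h (t + p) = h t" for t using affD(3)[OF sym_aff[OF sy] hS hS] p(2)[of t] by (simp add: g_def)
    then show False using ap p(1) by blast
  qed
  obtain vx vy where uv: "nu s *v u = pt vx vy" by (rule pt_cases)
  have sgn: "vy * (vx - sr * vy) > 0" using v unfolding uv by simp
  define m :: "real^2^2" where "m = - mat 1"
  obtain g' \<Phi>' vx' vy' c x where g': "traj (pt vx' vy') g'" "vy' > 0" "sr * vy' < vx'" "cutting_sequence id g' n"
    "\<not> (\<exists>p>0. \<forall>t. g' (t + p) = g' t)" "aff \<Phi>' gamma"
    "\<And>w. cutting_sequence id (\<Phi>' \<circ> g') w \<Longrightarrow> cutting_sequence id (\<Phi> \<circ> g) w"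
    and x: "x \<in> sector s" "c \<noteq> 0" "u = c *\<^sub>R pt (cos x) (sin x)"
  proof (cases "vy > 0")
    case True
    then have vx: "sr * vy < vx" using sgn by (simp add: zero_less_mult_iff)
    obtain c x where "c > 0" "x \<in> sector s" "u = c *\<^sub>R pt (cos x) (sin x)" by (rule sector_direction[OF s uv True vx])
    then show ?thesis using that[of vx vy g \<Phi> x c] g[unfolded uv] True vx n gap \<Phi> by simp
  next
    case False
    then have vy: "- vy > 0" and vx: "sr * (- vy) < - vx" using sgn by (auto simp: zero_less_mult_iff)
    have "nu s *v (- u) = pt (- vx) (- vy)" using uv matrix_vector_mult_scaleR[of "nu s" "-1" u] by simp
    then obtain c x where cx: "c > 0" "x \<in> sector s" "- u = c *\<^sub>R pt (cos x) (sin x)" by (rule sector_direction[OF s _ vy vx])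
    have "- (- u) = (- c) *\<^sub>R pt (cos x) (sin x)" unfolding cx(3) by (rule scaleR_minus_left[symmetric])
    then have u: "u = (- c) *\<^sub>R pt (cos x) (sin x)" by (simp only: minus_minus)
    note am = sym_aff[OF minus_symmetry]
    define g' where "g' = sym_map m \<circ> g"
    have t: "traj (pt (- vx) (- vy)) g'" using aff_traj[OF am g] unfolding g'_def m_def uv minus_vec by simp
    have cg: "cutting_sequence id g' n" unfolding g'_def m_def by (rule minus_cutting[OF gS n])
    have pg: "\<not> (\<exists>p>0. \<forall>t. g' (t + p) = g' t)"
    proof
      assume "\<exists>p>0. \<forall>t. g' (t + p) = g' t"
      then obtain p where p: "p > 0" "\<And>t. g' (t + p) = g' t" by blast
      have "g (t + p) = g t" for t using affD(3)[OF am gS gS] p(2)[of t] by (simp add: g'_def m_def)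
      then show False using gap p(1) by blast
    qed
    have "aff (sym_map m \<circ> (\<Phi> \<circ> sym_map m)) (m ** (gamma ** m))" unfolding m_def by (rule aff_comp[OF am aff_comp[OF \<Phi> am]])
    then have ap: "aff (sym_map m \<circ> (\<Phi> \<circ> sym_map m)) gamma" by (simp add: m_def minus_mult)
    have "cutting_sequence id (\<Phi> \<circ> g) w" if c: "cutting_sequence id ((sym_map m \<circ> (\<Phi> \<circ> sym_map m)) \<circ> g') w" for w
    proof -
      have e: "(sym_map m \<circ> (\<Phi> \<circ> sym_map m)) \<circ> g' = sym_map m \<circ> (\<Phi> \<circ> g)" by (simp add: fun_eq_iff g'_def m_def sym_minus_minus)
      have S: "(sym_map m \<circ> (\<Phi> \<circ> g)) t \<in> octagon_surface" for t
        unfolding o_def m_def by (rule sym_surface[OF minus_symmetry affD(1)[OF \<Phi> gS]])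
      have "cutting_sequence id (sym_map (- mat 1) \<circ> (sym_map m \<circ> (\<Phi> \<circ> g))) w" by (rule minus_cutting[OF S c[unfolded e]])
      moreover have "sym_map (- mat 1) \<circ> (sym_map m \<circ> (\<Phi> \<circ> g)) = \<Phi> \<circ> g" by (simp add: fun_eq_iff m_def sym_minus_minus)
      ultimately show ?thesis by simp
    qed
    then show ?thesis using that[OF t vy vx cg pg ap _ cx(2) _ u] cx(1) by simp
  qed
  have lt: "linear_trajectory x h" unfolding linear_trajectory_iff using x h(1) by blast
  have ad: "admissible s w" unfolding admissible_def diagram_def using lt x(1) h(2) by blast
  have "(THE j. j < 8 \<and> admissible j w) = s"
  proof (rule the_equality)
    fix j assume j: "j < 8 \<and> admissible j w"
    show "j = s"
    proof (rule ccontr)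
      assume "j \<noteq> s"
      then show False using unique_diagram[OF g'(1-3) g'(4)[unfolded n_def] g'(5) s _ _ ad, of j] j by simp
    qed
  qed (use s ad in simp)
  then have "normal_form w = n" by (simp add: normal_form_def n_def)
  then show ?thesis using g'(7)[OF sector0_derived[OF g'(1-4,6)]] by (simp add: g_def)
qed

lemma nu_prod_inverse: assumes "\<And>i. s i < 8" shows "\<exists>N. N ** nu_prod s k = mat 1 \<and> nu_prod s k ** N = mat 1"
proof (induction k)
  case 0 show ?case by (rule exI[of _ "mat 1"]) simp
next
  case (Suc k)
  then obtain N where N: "N ** nu_prod s k = mat 1" "nu_prod s k ** N = mat 1" by blast
  have "(gamma ** (nu (s k) ** N)) ** nu_prod s (Suc k) = gamma ** (nu (s k) ** (N ** nu_prod s k) ** (transpose (nu (s k)) ** gamma))"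
    by (simp add: nu_matrix_inv[OF assms] matrix_mul_assoc)
  also have "\<dots> = gamma ** ((nu (s k) ** transpose (nu (s k))) ** gamma)" by (simp add: N matrix_mul_assoc)
  also have "\<dots> = mat 1" by (simp add: nu_inverse(2)[OF assms] gamma_gamma)
  finally show ?case using matrix_left_right_inverse by blast
qed

lemma inv_comp:
  assumes "aff \<Psi> M" "\<And>t. \<tau> t \<in> octagon_surface"
  shows "(inv_into octagon_surface \<Psi> \<circ> \<tau>) t \<in> octagon_surface" "\<Psi> ((inv_into octagon_surface \<Psi> \<circ> \<tau>) t) = \<tau> t"
proof -
  obtain x where "x \<in> octagon_surface" "\<tau> t = \<Psi> x" using affD(5)[OF assms] by blast
  then have "\<tau> t \<in> \<Psi> ` octagon_surface" by blast
  then show "(inv_into octagon_surface \<Psi> \<circ> \<tau>) t \<in> octagon_surface" "\<Psi> ((inv_into octagon_surface \<Psi> \<circ> \<tau>) t) = \<tau> t"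
    by (simp_all add: inv_into_into f_inv_into_f)
qed

text \<open>The octagons of two consecutive steps differ by \<open>nu (s k)\<close> and a map \<open>\<Phi>\<close> with derivative \<open>gamma\<close>: for given \<open>\<Psi>\<close> at step \<open>k + 1\<close>, the map \<open>\<Psi> \<circ> \<Phi>\<^sup>-\<^sup>1 \<circ> nu (s k)\<close> has the derivative required at step \<open>k\<close>.  At the first step \<open>\<Phi>\<close> is chosen as \<open>nu (s 0) \<circ> \<Psi>\<close> instead, so that the previous trajectory is \<open>\<tau>\<close> itself.\<close>

lemma renormalized_cutting:
  assumes \<tau>: "traj (c *\<^sub>R pt (cos \<theta>) (sin \<theta>)) \<tau>" "c \<noteq> 0" "cutting_sequence id \<tau> w" and ap: "\<not> (\<exists>p>0. \<forall>t. \<tau> (t + p) = \<tau> t)"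
    and s: "normalized_cutting_sequence \<theta> s" and \<Psi>: "aff \<Psi> (nu_prod s (Suc k))"
  shows "cutting_sequence id (inv_into octagon_surface \<Psi> \<circ> \<tau>) (renormalized (Suc k) w)"
  using \<Psi>
proof (induction k arbitrary: \<Psi>)
  have \<tau>S: "\<tau> t \<in> octagon_surface" for t using straight_regular[OF \<tau>(1), of t] by blast
  note s8 = normalized_cutting(1)[OF s]
  have inv: "matrix_inv (nu (s k)) = transpose (nu (s k))" for k by (rule nu_matrix_inv[OF s8])
  have step: "cutting_sequence id (inv_into octagon_surface \<Psi> \<circ> \<tau>) (renormalized (Suc k) w)"
    if \<Psi>: "aff \<Psi> (nu_prod s (Suc k))" and \<Phi>: "aff \<Phi> gamma" and X: "aff X (nu_prod s k)"
      and h: "h = inv_into octagon_surface X \<circ> \<tau>" "cutting_sequence id h (renormalized k w)"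
      and e: "\<And>t. \<Phi> ((inv_into octagon_surface \<Psi> \<circ> \<tau>) t) = sym_map (nu (s k)) (h t)" for \<Psi> \<Phi> X h k
  proof -
    obtain N where N: "N ** nu_prod s k = mat 1" "nu_prod s k ** N = mat 1" using nu_prod_inverse[of s k, OF s8] by blast
    define y where "y = pt (cos \<theta>) (sin \<theta>)"
    have tr: "traj (N *v (c *\<^sub>R y)) h" unfolding h(1) y_def by (rule aff_traj[OF aff_inverse[OF X N(2)] \<tau>(1)])
    define v where "v = nu (s k) *v (N *v y)"
    have "v $ 2 * (v $ 1 - sr * v $ 2) > 0" by (rule normalized_cutting(3)[OF s N(1)]) (simp add: v_def y_def)
    moreover have cv: "nu (s k) *v (N *v (c *\<^sub>R y)) = c *\<^sub>R v" by (simp only: v_def matrix_vector_mult_scaleR)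
    moreover have "c * c > 0" using \<tau>(2) by (simp add: zero_less_mult_iff) arith
    ultimately have sg: "(nu (s k) *v (N *v (c *\<^sub>R y))) $ 2 * ((nu (s k) *v (N *v (c *\<^sub>R y))) $ 1 - sr * (nu (s k) *v (N *v (c *\<^sub>R y))) $ 2) > 0"
      unfolding cv using mult_pos_pos[of "c * c" "v $ 2 * (v $ 1 - sr * v $ 2)"] by (simp add: algebra_simps)
    note XT = inv_comp[where \<tau> = \<tau>, OF X \<tau>S, folded h(1)]
    have hap: "\<not> (\<exists>p>0. \<forall>t. h (t + p) = h t)"
    proof
      assume "\<exists>p>0. \<forall>t. h (t + p) = h t"
      then obtain p where p: "p > 0" "\<And>t. h (t + p) = h t" by blast
      have "\<tau> (t + p) = \<tau> t" for t using XT(2)[of "t + p"] XT(2)[of t] p(2)[of t] by simp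
      then show False using ap p(1) by blast
    qed
    have \<Phi>i: "aff (inv_into octagon_surface \<Phi>) gamma" by (rule aff_inverse[OF \<Phi> gamma_gamma])
    have "cutting_sequence id (inv_into octagon_surface \<Phi> \<circ> (sym_map (nu (s k)) \<circ> h)) (derived (normal_form (renormalized k w)))"
      by (rule renormalize[OF tr h(2) s8 sg hap \<Phi>i])
    moreover have "inv_into octagon_surface \<Phi> \<circ> (sym_map (nu (s k)) \<circ> h) = inv_into octagon_surface \<Psi> \<circ> \<tau>"
    proof
      fix t
      have "inj_on \<Phi> octagon_surface" using affD(3)[OF \<Phi>] by (rule inj_onI)
      from inv_into_f_f[OF this inv_comp(1)[where \<tau> = \<tau>, OF \<Psi> \<tau>S, of t]]
      show "(inv_into octagon_surface \<Phi> \<circ> (sym_map (nu (s k)) \<circ> h)) t = (inv_into octagon_surface \<Psi> \<circ> \<tau>) t" unfolding e by simp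
    qed
    ultimately show ?thesis by simp
  qed
  {
    case 0
    have id: "inv_into octagon_surface id (\<tau> t) = \<tau> t" for t using inv_into_f_f[of id octagon_surface "\<tau> t"] \<tau>S by simp
    have "aff (sym_map (nu (s 0)) \<circ> \<Psi>) (nu (s 0) ** nu_prod s (Suc 0))" by (rule aff_comp[OF sym_aff[OF nu_symmetry[OF s8]] 0])
    then have \<Phi>: "aff (sym_map (nu (s 0)) \<circ> \<Psi>) gamma" by (simp add: inv matrix_mul_assoc nu_inverse[OF s8])
    have X: "aff id (nu_prod s 0)" using aff_id by simp
    have "inv_into octagon_surface id \<circ> \<tau> = \<tau>" using id by auto
    then have cut: "cutting_sequence id (inv_into octagon_surface id \<circ> \<tau>) (renormalized 0 w)" using \<tau>(3) by simp
    show ?case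
    proof (rule step[OF 0 \<Phi> X refl cut])
      fix t show "(sym_map (nu (s 0)) \<circ> \<Psi>) ((inv_into octagon_surface \<Psi> \<circ> \<tau>) t) = sym_map (nu (s 0)) ((inv_into octagon_surface id \<circ> \<tau>) t)"
        using inv_comp(2)[where \<tau> = \<tau>, OF 0 \<tau>S, of t] id[of t] by simp
    qed
  next
    case (Suc k)
    obtain \<Phi> where \<Phi>: "aff \<Phi> gamma" using normalized_cutting(2)[OF s] by blast
    have \<Phi>i: "aff (inv_into octagon_surface \<Phi>) gamma" by (rule aff_inverse[OF \<Phi> gamma_gamma])
    define X where "X = \<Psi> \<circ> (inv_into octagon_surface \<Phi> \<circ> sym_map (nu (s (Suc k))))"
    note sy = sym_aff[OF nu_symmetry[OF s8]]
    have "aff X (nu_prod s (Suc (Suc k)) ** (gamma ** nu (s (Suc k))))" unfolding X_def by (rule aff_comp[OF Suc.prems aff_comp[OF \<Phi>i sy]])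
    moreover have "nu_prod s (Suc (Suc k)) ** (gamma ** nu (s (Suc k))) = nu_prod s (Suc k) ** (transpose (nu (s (Suc k))) ** (gamma ** gamma) ** nu (s (Suc k)))"
      unfolding nu_prod.simps(2)[of s "Suc k"] inv by (simp only: matrix_mul_assoc)
    moreover have "\<dots> = nu_prod s (Suc k)" unfolding gamma_gamma by (simp only: matrix_mul_rid nu_inverse[OF s8])
    ultimately have X: "aff X (nu_prod s (Suc k))" by simp
    define h where "h = inv_into octagon_surface X \<circ> \<tau>"
    show ?case
    proof (rule step[OF Suc.prems \<Phi> X h_def])
      show "cutting_sequence id h (renormalized (Suc k) w)" unfolding h_def by (rule Suc.IH[OF X])
      fix t
      define x where "x = sym_map (nu (s (Suc k))) (h t)"
      have hS: "h t \<in> octagon_surface" unfolding h_def by (rule inv_comp(1)[where \<tau> = \<tau>, OF X \<tau>S])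
      have x: "x \<in> octagon_surface" unfolding x_def by (rule affD(1)[OF sy hS])
      have "X (h t) = \<tau> t" unfolding h_def by (rule inv_comp(2)[where \<tau> = \<tau>, OF X \<tau>S])
      then have "\<Psi> (inv_into octagon_surface \<Phi> x) = \<Psi> ((inv_into octagon_surface \<Psi> \<circ> \<tau>) t)"
        using inv_comp(2)[where \<tau> = \<tau>, OF Suc.prems \<tau>S, of t] by (simp add: X_def x_def)
      then have "inv_into octagon_surface \<Phi> x = (inv_into octagon_surface \<Psi> \<circ> \<tau>) t"
        by (rule affD(3)[OF Suc.prems affD(1)[OF \<Phi>i x] inv_comp(1)[where \<tau> = \<tau>, OF Suc.prems \<tau>S]])
      then show "\<Phi> ((inv_into octagon_surface \<Psi> \<circ> \<tau>) t) = sym_map (nu (s (Suc k))) (h t)"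
        using inv_comp(2)[OF \<Phi>, of "\<lambda>_. x"] x by (simp add: x_def)
    qed
  }
qed

theorem proposition3p12:
  fixes \<theta> :: real and \<tau> :: "real \<Rightarrow> surface_point" and w :: "int \<Rightarrow> letter"
    and s :: "nat \<Rightarrow> nat" and k :: nat and \<Psi> :: "surface_point \<Rightarrow> surface_point"
  assumes "0 \<le> \<theta>" and "\<theta> < pi"
    and "linear_trajectory \<theta> \<tau>"
    and "cutting_sequence id \<tau> w"
    and "\<not> periodic_word w"
    and "normalized_cutting_sequence \<theta> s"
    and "k \<ge> 1"
    and "affine_automorphism \<Psi> (nu_prod s k)"
  shows "cutting_sequence \<Psi> \<tau> (renormalized k w)"
proof -
  obtain c where c: "c \<noteq> 0" "traj (c *\<^sub>R pt (cos \<theta>) (sin \<theta>)) \<tau>" using assms(3) linear_trajectory_iff by blast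
  have reg: "\<tau> t \<in> regular" for t by (rule straight_regular[OF c(2)])
  have ap: "\<not> (\<exists>p>0. \<forall>t. \<tau> (t + p) = \<tau> t)" using periodic_cutting[OF assms(4) reg] assms(5) by blast
  have a: "aff \<Psi> (nu_prod s k)" by (rule affine_automorphism_aff[OF assms(8)])
  obtain l where l: "k = Suc l" using assms(7) by (cases k) auto
  have "cutting_sequence id (inv_into octagon_surface \<Psi> \<circ> \<tau>) (renormalized k w)"
    using renormalized_cutting[OF c(2,1) assms(4) ap assms(6)] a unfolding l by blast
  then show ?thesis using aff_cutting[OF a, of \<tau>] reg by blast
qed

end
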